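(* Let $\mathcal{C}$ be a reduced curve in $\mathbb{P}^2$ such that $c_{\mathcal{T}_{\mathcal{C}}}(t) = (at-1)(bt-1)$ with $a,b \in \mathbb{Z}_{>0}$, $a \leq b$. Let $C_0 \subset \mathbb{P}^2$ be a smooth conic with $C_0 \notin \mathrm{Irr}(\mathcal{C})$ and let $k := |\mathcal{C} \cap C_0| + \epsilon(\mathcal{C}\cup C_0,\mathcal{C})$. Then: (1) If $k=2m$ is even, then $m \leq a$ or $m \geq b$. Moreover: (a) if $m=a$ or $m=b$, then $\mathcal{C}$ is free with exponents $(a,b)$; (b) if $m<a$, then $\mathcal{C}$ is not free; (c) if $m>b$, both possibilities, free and non free, occur (i.e. among the pairs $(\mathcal{C},C_0)$ consisting of a reduced curve $\mathcal{C}\subset\mathbb{P}^2$ with $c_{\mathcal{T}_{\mathcal{C}}}(t) = (at-1)(bt-1)$ for some $a,b \in \mathbb{Z}_{>0}$, $a \leq b$, and a smooth conic $C_0 \subset \mathbb{P}^2$ with $C_0 \notin \mathrm{Irr}(\mathcal{C})$, such that $k = |\mathcal{C} \cap C_0| + \epsilon(\mathcal{C}\cup C_0,\mathcal{C}) = 2m$ and $m>b$, there are some with $\mathcal{C}$ free and some with $\mathcal{C}$ not free). (2) If $k=2m+1$ is odd, then $m \leq a$ or $m \geq b$. Moreover: (a) if $m=a$, then necessarily $m=b$ and $\mathcal{C}$ is free with exponents $(a,a)$; (b) if $m=b$, then $\mathcal{C}$ is free with exponents $(a,b)$; (c) if $m<a$, then $\mathcal{C}$ is not free; (d) if $m>b$,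 both possibilities, free and non free, occur (i.e. among the pairs $(\mathcal{C},C_0)$ consisting of a reduced curve $\mathcal{C}\subset\mathbb{P}^2$ with $c_{\mathcal{T}_{\mathcal{C}}}(t) = (at-1)(bt-1)$ for some $a,b \in \mathbb{Z}_{>0}$, $a \leq b$, and a smooth conic $C_0 \subset \mathbb{P}^2$ with $C_0 \notin \mathrm{Irr}(\mathcal{C})$, such that $k = |\mathcal{C} \cap C_0| + \epsilon(\mathcal{C}\cup C_0,\mathcal{C}) = 2m+1$ and $m>b$, there are some with $\mathcal{C}$ free and some with $\mathcal{C}$ not free).
   Context: $\mathbb{P}^2$ is the complex projective plane and $S=\mathbb{C}[x,y,z]$. For a reduced curve $\mathcal{C}\subset\mathbb{P}^2$ with defining homogeneous polynomial $f_{\mathcal{C}}\in S$, let $D_0(\mathcal{C})=\{\theta\in \mathrm{Der}(S) : \theta(f_{\mathcal{C}})=0\}$, a graded $S$-module, where a derivation $\theta = \theta_1\partial_x+\theta_2\partial_y+\theta_3\partial_z$ has degree $d$ if the $\theta_i$ are homogeneous of degree $d$. Let $\mathcal{T}_{\mathcal{C}}$ be the sheafification of $D_0(\mathcal{C})$; it is a rank 2 vector bundle on $\mathbb{P}^2$. Its Chern polynomial is $c_{\mathcal{T}_{\mathcal{C}}}(t)=1+c_1(\mathcal{T}_{\mathcal{C}})t+c_2(\mathcal{T}_{\mathcal{C}})t^2$, with $c_1,c_2$ the Chern numbers. The curve $\mathcal{C}$ is free if $D_0(\mathcal{C})$ is a free $S$-module (equivalently $\mathcal{T}_{\mathcal{C}}$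 splits as a direct sum of line bundles); it is free with exponents $(a,b)$ if $D_0(\mathcal{C})\cong S(-a)\oplus S(-b)$, i.e. $\mathcal{T}_{\mathcal{C}}\cong\mathcal{O}_{\mathbb{P}^2}(-a)\oplus\mathcal{O}_{\mathbb{P}^2}(-b)$. $\mathrm{Irr}(\mathcal{C})$ is the set of irreducible components of $\mathcal{C}$. $|X\cap Y|$ is the number of points of the set $X\cap Y$ (without multiplicity). For $p\in\mathcal{C}$, $\mu_p(\mathcal{C})$ and $\tau_p(\mathcal{C})$ are the Milnor and Tjurina numbers of $\mathcal{C}$ at $p$ (both zero if $p$ is a smooth point of $\mathcal{C}$), and $\epsilon_p(\mathcal{C}):=\mu_p(\mathcal{C})-\tau_p(\mathcal{C})$. For reduced curves $\mathcal{C}_1,\mathcal{C}_2$ with no common irreducible component, $\epsilon(\mathcal{C}_1\cup\mathcal{C}_2,\mathcal{C}_1):=\sum_{p\in\mathcal{C}_1\cap\mathcal{C}_2}\left[\epsilon_p(\mathcal{C}_1\cup\mathcal{C}_2)-\epsilon_p(\mathcal{C}_1)\right]$. *)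

theory Defs
  imports
    "HOL-Computational_Algebra.Computational_Algebra"
    "HOL-Computational_Algebra.Field_as_Ring"
    "Jordan_Normal_Form.Matrix"
begin

section \<open>The ring \<open>S = \<complex>[x, y, z]\<close>\<close>

text \<open>
  \<open>S\<close> is realised as \<open>\<complex>[x][y][z]\<close>: the coefficient of \<open>x\<^sup>i y\<^sup>j z\<^sup>k\<close> in \<open>f\<close> is
  \<open>coeff (coeff (coeff f k) j) i\<close>.
\<close>

type_synonym poly3 = "complex poly poly poly"

definition homogeneous :: "int \<Rightarrow> poly3 \<Rightarrow> bool" where
  "homogeneous d f \<longleftrightarrow>
     (\<forall>i j k. coeff (coeff (coeff f k) j) i \<noteq> 0 \<longrightarrow> int i + int j + int k = d)"

definition dx :: "poly3 \<Rightarrow> poly3" where "dx f = map_poly (map_poly pderiv) f"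
definition dy :: "poly3 \<Rightarrow> poly3" where "dy f = map_poly pderiv f"
definition dz :: "poly3 \<Rightarrow> poly3" where "dz f = pderiv f"

text \<open>
  \<open>subst3 h f a b c\<close> is the value of \<open>f\<close> at \<open>(x, y, z) = (a, b, c)\<close> in a \<open>\<complex>\<close>-algebra with
  structure map \<open>h\<close>.
\<close>

definition subst3 :: "(complex \<Rightarrow> 'a::comm_ring_1) \<Rightarrow> poly3 \<Rightarrow> 'a \<Rightarrow> 'a \<Rightarrow> 'a \<Rightarrow> 'a" where
  "subst3 h f a b c =
     poly (map_poly (\<lambda>q. poly (map_poly (\<lambda>r. poly (map_poly h r) a) q) b) f) c"

abbreviation eval3 :: "poly3 \<Rightarrow> complex \<Rightarrow> complex \<Rightarrow> complex \<Rightarrow> complex" where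
  "eval3 \<equiv> subst3 (\<lambda>c. c)"


section \<open>Plane projective curves\<close>

type_synonym vec3 = "complex \<times> complex \<times> complex"

definition proj_rel :: "(vec3 \<times> vec3) set" where
  "proj_rel = {((x, y, z), (x', y', z')) | x y z x' y' z'.
     (x, y, z) \<noteq> (0, 0, 0) \<and> (\<exists>c. c \<noteq> 0 \<and> x' = c * x \<and> y' = c * y \<and> z' = c * z)}"

definition P2 :: "vec3 set set" where
  "P2 = (UNIV - {(0, 0, 0)}) // proj_rel"

text \<open>
  A reduced curve is represented by a defining polynomial, which is unique up to a nonzero
  scalar; the union of two curves without common component is represented by the product.
\<close>

definition reduced_curve :: "poly3 \<Rightarrow> bool" where
  "reduced_curve f \<longleftrightarrow> (\<exists>d>0. homogeneous d f) \<and> squarefree f"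

definition points :: "poly3 \<Rightarrow> vec3 set set" where
  "points f = {p \<in> P2. \<forall>(x, y, z) \<in> p. eval3 f x y z = 0}"

definition smooth_conic :: "poly3 \<Rightarrow> bool" where
  "smooth_conic q \<longleftrightarrow> q \<noteq> 0 \<and> homogeneous 2 q \<and>
     (\<forall>x y z. (x, y, z) \<noteq> (0, 0, 0) \<and> eval3 q x y z = 0 \<longrightarrow>
        eval3 (dx q) x y z \<noteq> 0 \<or> eval3 (dy q) x y z \<noteq> 0 \<or> eval3 (dz q) x y z \<noteq> 0)"

text \<open>All defining polynomials of the irreducible components, hence closed under nonzero scalars.\<close>

definition Irr :: "poly3 \<Rightarrow> poly3 set" where
  "Irr f = {g. irreducible g \<and> g dvd f}"


section \<open>Milnor and Tjurina numbers\<close>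

text \<open>
  \<open>\<complex>{u, v}\<close> as a subring of \<open>\<complex>[[u]][[v]]\<close>; the coefficient of \<open>u\<^sup>i v\<^sup>j\<close> in \<open>F\<close> is
  \<open>fps_nth (fps_nth F j) i\<close>.
\<close>

type_synonym fps2 = "complex fps fps"

definition conv :: "fps2 set" where
  "conv = {F. \<exists>C R. R > 0 \<and> (\<forall>i j. norm (fps_nth (fps_nth F j) i) \<le> C * R ^ (i + j))}"

definition const2 :: "complex \<Rightarrow> fps2" where "const2 c = fps_const (fps_const c)"
definition U :: fps2 where "U = fps_const fps_X"
definition V :: fps2 where "V = fps_X"

definition du :: "fps2 \<Rightarrow> fps2" where "du F = Abs_fps (\<lambda>n. fps_deriv (fps_nth F n))"
definition dv :: "fps2 \<Rightarrow> fps2" where "dv F = fps_deriv F"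

text \<open>
  The germ at \<open>p\<close> of a local equation of the curve, in the affine coordinates \<open>(u, v)\<close> centred
  at \<open>p\<close> of a standard chart containing \<open>p\<close> (it does not depend on the representative chosen).
\<close>

definition germ :: "poly3 \<Rightarrow> vec3 set \<Rightarrow> fps2" where
  "germ f p = (case SOME w. w \<in> p of (x, y, z) \<Rightarrow>
     if z \<noteq> 0 then subst3 const2 f (const2 (x / z) + U) (const2 (y / z) + V) 1
     else if y \<noteq> 0 then subst3 const2 f (const2 (x / y) + U) 1 V
     else subst3 const2 f 1 U V)"

text \<open>
  \<open>B\<close> is mapped injectively onto a basis of the quotient space \<open>E / W\<close>;
  \<open>quot_dim E W\<close> is the dimension of \<open>E / W\<close> whenever this is finite, as it is for the
  algebras of isolated singularities.
\<close>

definition quot_basis :: "fps2 set \<Rightarrow> fps2 set \<Rightarrow> fps2 set \<Rightarrow> bool" where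
  "quot_basis E W B \<longleftrightarrow> finite B \<and> B \<subseteq> E \<and>
     (\<forall>F\<in>E. \<exists>!c. (\<forall>b. b \<notin> B \<longrightarrow> c b = 0) \<and> F - (\<Sum>b\<in>B. const2 (c b) * b) \<in> W)"

definition quot_dim :: "fps2 set \<Rightarrow> fps2 set \<Rightarrow> nat" where
  "quot_dim E W = (THE n. \<exists>B. quot_basis E W B \<and> card B = n)"

definition milnor :: "poly3 \<Rightarrow> vec3 set \<Rightarrow> nat" where
  "milnor f p = (let g = germ f p in
     quot_dim conv {a * du g + b * dv g | a b. a \<in> conv \<and> b \<in> conv})"

definition tjurina :: "poly3 \<Rightarrow> vec3 set \<Rightarrow> nat" where
  "tjurina f p = (let g = germ f p in
     quot_dim conv {a * du g + b * dv g + c * g | a b c. a \<in> conv \<and> b \<in> conv \<and> c \<in> conv})"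

definition eps :: "poly3 \<Rightarrow> vec3 set \<Rightarrow> int" where
  "eps f p = int (milnor f p) - int (tjurina f p)"

text \<open>\<open>eps_union f g\<close> is \<open>\<epsilon>(\<C>\<^sub>1 \<union> \<C>\<^sub>2, \<C>\<^sub>1)\<close> for \<open>\<C>\<^sub>1: f = 0\<close> and \<open>\<C>\<^sub>2: g = 0\<close>.\<close>

definition eps_union :: "poly3 \<Rightarrow> poly3 \<Rightarrow> int" where
  "eps_union f g = (\<Sum>p \<in> points f \<inter> points g. eps (f * g) p - eps f p)"

definition k_number :: "poly3 \<Rightarrow> poly3 \<Rightarrow> int" where
  "k_number f q = int (card (points f \<inter> points q)) + eps_union f q"


section \<open>The module of derivations\<close>

text \<open>The derivation \<open>\<theta>\<^sub>1 \<partial>\<^sub>x + \<theta>\<^sub>2 \<partial>\<^sub>y + \<theta>\<^sub>3 \<partial>\<^sub>z\<close> is represented by its coefficient vector.\<close>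

definition D0 :: "poly3 \<Rightarrow> poly3 vec set" where
  "D0 f = {\<theta> \<in> carrier_vec 3.
     vec_index \<theta> 0 * dx f + vec_index \<theta> 1 * dy f + vec_index \<theta> 2 * dz f = 0}"

text \<open>
  A matrix defines a degree-preserving map \<open>\<Oplus>\<^sub>j S(-es\<^sub>j) \<rightarrow> \<Oplus>\<^sub>i S(-ds\<^sub>i)\<close>.
\<close>

definition graded_map :: "int list \<Rightarrow> int list \<Rightarrow> poly3 mat \<Rightarrow> bool" where
  "graded_map es ds A \<longleftrightarrow> A \<in> carrier_mat (length ds) (length es) \<and>
     (\<forall>i<length ds. \<forall>j<length es. homogeneous (es ! j - ds ! i) (A $$ (i, j)))"

definition free_curve :: "poly3 \<Rightarrow> bool" where
  "free_curve f \<longleftrightarrow> (\<exists>n. \<exists>A \<in> carrier_mat 3 n.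
     bij_betw (\<lambda>w. A *\<^sub>v w) (carrier_vec n) (D0 f))"

definition free_with_exponents :: "poly3 \<Rightarrow> int \<Rightarrow> int \<Rightarrow> bool" where
  "free_with_exponents f a b \<longleftrightarrow> (\<exists>A. graded_map [a, b] [0, 0, 0] A \<and>
     bij_betw (\<lambda>w. A *\<^sub>v w) (carrier_vec 2) (D0 f))"


section \<open>Chern polynomials\<close>

text \<open>
  \<open>has_chern_poly ds M c\<close>: the sheaf on \<open>\<P>\<^sup>2\<close> associated with the graded submodule
  \<open>M \<subseteq> \<Oplus>\<^sub>i S(-ds\<^sub>i)\<close> has Chern polynomial \<open>c \<in> \<int>[t]/(t\<^sup>3)\<close>. It is computed along a finite graded
  free resolution of \<open>M\<close> from the two defining properties of Chern classes: \<open>1 - e t\<close> is the Chern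
  polynomial of the line bundle \<open>\<O>(-e)\<close>, the sheaf associated with \<open>S(-e)\<close>, and in the second
  rule the Whitney formula is applied to \<open>0 \<rightarrow> ker A \<rightarrow> \<Oplus>\<^sub>j S(-es\<^sub>j) \<rightarrow> im A \<rightarrow> 0\<close>. Every finitely
  generated \<open>M\<close> has such a resolution, and \<open>c\<close> does not depend on it.
\<close>

inductive has_chern_poly :: "int list \<Rightarrow> poly3 vec set \<Rightarrow> int poly \<Rightarrow> bool" where
  zero: "has_chern_poly ds {0\<^sub>v (length ds)} 1"
| step: "has_chern_poly ds ((\<lambda>w. A *\<^sub>v w) ` carrier_vec (length es)) c"
    if "graded_map es ds A"
      and "has_chern_poly es {w \<in> carrier_vec (length es). A *\<^sub>v w = 0\<^sub>v (length ds)} c'"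
      and "degree c \<le> 2"
      and "[:0, 0, 0, 1:] dvd (c * c' - (\<Prod>e\<leftarrow>es. [:1, - e:]))"

text \<open>\<open>D0 f\<close> is a graded submodule of \<open>S\<^sup>3\<close>, graded by polynomial degree of the coefficients.\<close>

definition curve_chern_poly :: "poly3 \<Rightarrow> int poly \<Rightarrow> bool" where
  "curve_chern_poly f c \<longleftrightarrow> has_chern_poly [0, 0, 0] (D0 f) c"

definition admissible :: "poly3 \<Rightarrow> poly3 \<Rightarrow> int \<Rightarrow> int \<Rightarrow> bool" where
  "admissible f q a b \<longleftrightarrow>
     reduced_curve f \<and> 0 < a \<and> a \<le> b \<and> curve_chern_poly f ([:-1, a:] * [:-1, b:]) \<and>
     smooth_conic q \<and> q \<notin> Irr f"

end

(*
  Parametrise the conic by t. At a point p of C and C0 the contribution to k is i - r, where i is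
  the intersection number of C and C0 at p and r is the minimal order along the conic of theta(q),
  theta ranging over the local logarithmic derivations of C: with Puiseux branches one gets
  mu(f q) = mu(f) + 2 i - 1 and tau(f q) = tau(f) + i + r.

  Hence a global theta in D0 of degree n restricts to the conic as follows: theta(q) is divisible
  by a polynomial of degree 2 d - k, and if theta(q) vanishes on the conic, the tangent field
  induced by theta is divisible by a polynomial of degree k. If this field vanishes too, theta is a
  multiple of q. So the Hilbert function h of D0 satisfies
    h n - h (n - 2) <= max 0 (2 n + 3 - (2 d - k)) + max 0 (2 n + 1 - k).
  Summing up and comparing with the Hilbert polynomial, which the Chern polynomial determines,
  gives the dichotomy for m. In the boundary cases the bound forces the minimal degree of a
  nonzero s in D0 to be a, and the ideal of all g with g grad f = s x theta for some theta in D0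
  contains all forms of large degree. By exactness of the Koszul complex it is then the unit ideal,
  so Saito's criterion applies. If k < 2 a, all theta of degree at most b are tangent to the conic;
  for free C this would make every derivation tangent, which fails for the Koszul derivations.

  The examples are members of the family of quintics
    kappa x^5 + gamma x^2 y^3 + y^4 (alpha y + z),
  free exactly for nonzero gamma, together with the conic z^2 = x y.
*)
theory Submission
 imports Defs "Jordan_Normal_Form.Char_Poly" "HOL-Library.Function_Algebras"
begin

section \<open>Codimensions of subspaces\<close>

text \<open>The Milnor and Tjurina numbers are taken over convergent series, whereas Puiseux roots
  and orders along branches are handled over formal ones. The local work is therefore formal, and a
  Nakayama argument carries finite codimensions back to convergent series. Dimensions of quotients
  are expressed by coordinate functions with a prescribed kernel, so that no quotient spaces are
  formed.

  The two terms of the Hilbert bound are coupled: the forced zeros of theta(q) and those of the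
  tangent field number 2 d together, and d = a + b + 1. Hence the summed bound is symmetric under k
  -> 2 (a + b) - k. Both the rank 2 and the relation a + b = d - 1 come from squeezing the Hilbert
  polynomial between this bound and 3 dim S_n - dim S_(n + d - 1).

  The bound compares degrees n and n - 2, so it is summed over one parity class, and the sums are
  y^2 / 8 rounded down. The loss in rounding depends on y modulo 4; for odd k a suitable parity of n
  gains the extra 1 that distinguishes case (2) from case (1).\<close>

definition subsp :: "(complex => 'v::ab_group_add => 'v) => 'v set => bool" where
 "subsp sc E \<longleftrightarrow> vector_space sc \<and> 0 \<in> E \<and> (\<forall>x\<in>E. \<forall>y\<in>E. x + y \<in> E) \<and> (\<forall>c. \<forall>x\<in>E. sc c x \<in> E)"

definition lin_on :: "(complex => 'v::ab_group_add => 'v) => (complex => 'w::ab_group_add => 'w) =>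
  'v set => ('v => 'w) => bool" where
 "lin_on sc sc' E T \<longleftrightarrow> (\<forall>x\<in>E. \<forall>y\<in>E. T (x + y) = T x + T y) \<and> (\<forall>c. \<forall>x\<in>E. T (sc c x) = sc' c (T x))"

text \<open>Linear functionals indexed by \<open>I\<close> that together identify
  \<open>E / W\<close> with the functions on \<open>I\<close>. Coordinate vectors are extended by 0
  outside \<open>I\<close>, so that equality of vectors is equality of functions and index sets can
  be changed freely.\<close>

definition coord_on :: "(complex => 'v::ab_group_add => 'v) => 'v set => 'v set => 'i set =>
  ('v => 'i => complex) => bool" where
 "coord_on sc E W I fi \<longleftrightarrow>
   (\<forall>x\<in>E. \<forall>y\<in>E. \<forall>i. fi (x + y) i = fi x i + fi y i) \<and>
   (\<forall>c. \<forall>x\<in>E. \<forall>i. fi (sc c x) i = c * fi x i) \<and>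
   (\<forall>x\<in>E. (\<forall>i\<in>I. fi x i = 0) \<longleftrightarrow> x \<in> W) \<and>
   (\<forall>x\<in>E. \<forall>i. i \<notin> I \<longrightarrow> fi x i = 0) \<and>
   (\<forall>g. (\<forall>i. i \<notin> I \<longrightarrow> g i = 0) \<longrightarrow> (\<exists>x\<in>E. fi x = g))"

text \<open>\<open>codim sc E W n\<close>: the space \<open>E / W\<close> has dimension \<open>n\<close>.\<close>

definition codim :: "(complex => 'v::ab_group_add => 'v) => 'v set => 'v set => nat => bool" where
 "codim sc E W n \<longleftrightarrow> (\<exists>fi. coord_on sc E W {..<n} fi)"

lemma subspD:
 assumes "subsp sc E"
 shows "0 \<in> E" "x \<in> E ==> y \<in> E ==> x + y \<in> E" "x \<in> E ==> sc c x \<in> E"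
  "x \<in> E ==> - x \<in> E" "x \<in> E ==> y \<in> E ==> x - y \<in> E"
proof -
 show "0 \<in> E" "x \<in> E ==> y \<in> E ==> x + y \<in> E" "x \<in> E ==> sc c x \<in> E" for x y c
  using assms by (auto simp: subsp_def)
 interpret vector_space sc using assms by (simp add: subsp_def)
 show m: "x \<in> E ==> - x \<in> E" for x
  using assms scale_minus_left[of 1 x] unfolding subsp_def by (metis scale_one)
 show "x \<in> E ==> y \<in> E ==> x - y \<in> E"
  using m[of y] assms by (auto simp: subsp_def)
qed

lemma subsp_sum:
 assumes "subsp sc E" "\<And>i. i \<in> I ==> f i \<in> E"
 shows "sum f I \<in> E"
 using assms(2) by (induction I rule: infinite_finite_induct) (auto simp: subspD[OF assms(1)])

lemma coord_onD:
 assumes "coord_on sc E W I fi" "subsp sc E" "x \<in> E"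
 shows "y \<in> E ==> fi (x + y) i = fi x i + fi y i" "fi (sc c x) i = c * fi x i"
  "y \<in> E ==> fi (x - y) i = fi x i - fi y i"
  "(\<forall>i\<in>I. fi x i = 0) \<longleftrightarrow> x \<in> W" "(\<forall>i. fi x i = 0) \<longleftrightarrow> x \<in> W" "i \<notin> I ==> fi x i = 0" "x \<in> W ==> fi x i = 0"
proof -
 have 1: "fi (x + y) i = fi x i + fi y i" if "x \<in> E" "y \<in> E" for x y i
  using assms that by (auto simp: coord_on_def)
 thus "y \<in> E ==> fi (x + y) i = fi x i + fi y i" using assms by auto
 show "fi (sc c x) i = c * fi x i" using assms by (auto simp: coord_on_def)
 show "(\<forall>i\<in>I. fi x i = 0) \<longleftrightarrow> x \<in> W" using assms by (auto simp: coord_on_def)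
 thus 2: "(\<forall>i. fi x i = 0) \<longleftrightarrow> x \<in> W" using assms unfolding coord_on_def by blast
 show "i \<notin> I ==> fi x i = 0" using assms by (auto simp: coord_on_def)
 show "x \<in> W ==> fi x i = 0" using 2 by auto
 show "fi (x - y) i = fi x i - fi y i" if "y \<in> E"
  using 1[of "x - y" y i] assms that subspD[OF assms(2)] by auto
qed

lemma coord_on_surj:
 assumes "coord_on sc E W I fi" "\<And>i. i \<notin> I ==> g i = 0"
 obtains x where "x \<in> E" "fi x = g"
 using assms unfolding coord_on_def by blast

lemma coord_on_sum:
 assumes "coord_on sc E W I fi" "subsp sc E" "finite J" "\<And>j. j \<in> J ==> b j \<in> E"
 shows "fi (\<Sum>j\<in>J. sc (c j) (b j)) i = (\<Sum>j\<in>J. c j * fi (b j) i)"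
 using assms(3,4)
proof (induction J rule: finite_induct)
 case empty
 have "fi (0 + 0) i = fi 0 i + fi 0 i"
  using coord_onD(1)[OF assms(1,2) subspD(1)[OF assms(2)] subspD(1)[OF assms(2)]] .
 thus ?case by simp
next
 case (insert j J)
 have "sc (c j) (b j) \<in> E" "(\<Sum>j\<in>J. sc (c j) (b j)) \<in> E"
  using insert.prems subspD[OF assms(2)] by (auto intro!: subsp_sum[OF assms(2)])
 thus ?case using insert coord_onD[OF assms(1,2)] by simp
qed

lemma codim_index:
 assumes "coord_on sc E W I fi" "finite I"
 shows "codim sc E W (card I)"
proof -
 obtain h where h: "bij_betw h {..<card I} I"
  using ex_bij_betw_nat_finite[OF assms(2)] by (auto simp: atLeast0LessThan)
 define h' where "h' = inv_into {..<card I} h"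
 have h': "i \<in> I ==> h' i < card I \<and> h (h' i) = i" for i
  using h unfolding h'_def bij_betw_def by (metis f_inv_into_f inv_into_into lessThan_iff)
 have hh: "n < card I ==> h n \<in> I \<and> h' (h n) = n" for n
  using h unfolding h'_def by (metis bij_betw_def imageI inv_into_f_f lessThan_iff)
 define py where "py x n = (if n < card I then fi x (h n) else 0)" for x n
 have "coord_on sc E W {..<card I} py"
  unfolding coord_on_def
 proof (intro conjI ballI allI impI)
  fix x assume "x \<in> E"
  thus "(\<forall>i\<in>{..<card I}. py x i = 0) = (x \<in> W)"
   using assms(1) h' hh unfolding coord_on_def py_def by (metis lessThan_iff)
 next
  fix g :: "nat => complex" assume g: "\<forall>i. i \<notin> {..<card I} \<longrightarrow> g i = 0"
  obtain x where "x \<in> E" "fi x = (\<lambda>i. if i \<in> I then g (h' i) else 0)"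
   by (rule coord_on_surj[OF assms(1), of "\<lambda>i. if i \<in> I then g (h' i) else 0"]) auto
  thus "\<exists>x\<in>E. py x = g"
   using g hh by (intro bexI[of _ x]) (auto simp: py_def)
 qed (use assms(1) in "auto simp: py_def coord_on_def")
 thus ?thesis unfolding codim_def by blast
qed

text \<open>\<open>T\<close> induces an isomorphism of \<open>E / W\<close> onto
  \<open>E' / W'\<close>; this is the form in which exact sequences are used below, often with
  \<open>T\<close> a multiplication. Coordinates are pulled back along \<open>T\<close> in one
  direction, and along a choice of preimages modulo \<open>W'\<close> in the other.\<close>

lemma codim_map:
 assumes E: "subsp sc E" "subsp sc' E'" "subsp sc' W'"
  and T: "lin_on sc sc' E T" "T ` E \<subseteq> E'" and W: "\<And>x. x \<in> E ==> T x \<in> W' \<longleftrightarrow> x \<in> W"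
  and sur: "\<And>y. y \<in> E' ==> \<exists>x\<in>E. y - T x \<in> W'" and "W' \<subseteq> E'"
 shows "codim sc E W n \<longleftrightarrow> codim sc' E' W' n"
proof
 note s = subspD[OF E(1)] and s' = subspD[OF E(2)] and w' = subspD[OF E(3)]
 have Tadd: "T (x + y) = T x + T y" and Tsc: "T (sc c x) = sc' c (T x)" if "x \<in> E" "y \<in> E" for x y c
  using T that by (auto simp: lin_on_def)
 have Tdiff: "T (x - y) = T x - T y" if "x \<in> E" "y \<in> E" for x y
  using Tadd[of "x - y" y] that s by (auto simp: algebra_simps)
 {
  assume "codim sc' E' W' n"
  then obtain fi where fi: "coord_on sc' E' W' {..<n} fi" by (auto simp: codim_def)
  note c = coord_onD[OF fi E(2)]
  have "coord_on sc E W {..<n} (\<lambda>x. fi (T x))"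
   unfolding coord_on_def
  proof (intro conjI ballI allI impI)
   fix x assume "x \<in> E"
   thus "(\<forall>i\<in>{..<n}. fi (T x) i = 0) = (x \<in> W)" using c(4)[of "T x"] W T(2) by blast
  next
   fix g :: "nat => complex" assume "\<forall>i. i \<notin> {..<n} \<longrightarrow> g i = 0"
   then obtain y where y: "y \<in> E'" "fi y = g" using coord_on_surj[OF fi] by metis
   obtain x where x: "x \<in> E" "y - T x \<in> W'" using sur y by blast
   have "fi (T x) i = fi y i" for i
    using c(3)[of y "T x" i] c(7)[of "y - T x" i] x y T(2) s' by (auto simp: image_subset_iff)
   thus "\<exists>x\<in>E. fi (T x) = g" using x y by (intro bexI[of _ x]) auto
  qed (use c T in "auto simp: Tadd Tsc image_subset_iff")
  thus "codim sc E W n" unfolding codim_def by blast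
 }
 {
  assume "codim sc E W n"
  then obtain fi where fi: "coord_on sc E W {..<n} fi" by (auto simp: codim_def)
  note c = coord_onD[OF fi E(1)]
  have wd: "fi x = fi x'" if "x \<in> E" "x' \<in> E" "y - T x \<in> W'" "y - T x' \<in> W'" for x x' y
  proof -
   have "y - T x - (y - T x') = T (x' - x)" using Tdiff[OF that(2,1)] by simp
   hence "T (x' - x) \<in> W'" using w'(5)[OF that(3,4)] by metis
   hence "x' - x \<in> W" using W[OF s(5)[OF that(2,1)]] by metis
   hence "fi x' i - fi x i = 0" for i
    using c(3)[OF that(2,1), of i] c(7)[OF s(5)[OF that(2,1)], of i] by simp
   thus ?thesis by auto
  qed
  define r where "r y = (SOME x. x \<in> E \<and> y - T x \<in> W')" for y
  have r: "r y \<in> E \<and> y - T (r y) \<in> W'" if "y \<in> E'" for y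
  proof -
   have "\<exists>x. x \<in> E \<and> y - T x \<in> W'" using sur[OF that] by blast
   thus ?thesis unfolding r_def by (rule someI_ex)
  qed
  note r1 = r[THEN conjunct1] and r2 = r[THEN conjunct2]
  have rT: "fi (r (T x)) = fi x" if "x \<in> E" for x
  proof -
   have "T x \<in> E'" using T(2) that by blast
   thus ?thesis using wd[OF r1 that r2, of "T x"] w'(1) by simp
  qed
  have "coord_on sc' E' W' {..<n} (\<lambda>y. fi (r y))"
   unfolding coord_on_def
  proof (intro conjI ballI allI impI)
   fix x y i assume xy: "x \<in> E'" "y \<in> E'"
   have "x + y - T (r x + r y) \<in> W'"
    using w'(2)[OF r2[OF xy(1)] r2[OF xy(2)]] Tadd[OF r1[OF xy(1)] r1[OF xy(2)]] by (simp add: algebra_simps)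
   hence "fi (r (x + y)) = fi (r x + r y)"
    using wd[OF r1[OF s'(2)[OF xy]] s(2)[OF r1[OF xy(1)] r1[OF xy(2)]] r2[OF s'(2)[OF xy]]] by blast
   thus "fi (r (x + y)) i = fi (r x) i + fi (r y) i"
    using c(1)[OF r1[OF xy(1)] r1[OF xy(2)]] by simp
  next
   fix a x i assume x: "x \<in> E'"
   interpret vector_space sc' using E by (auto simp: subsp_def)
   have "sc' a x - T (sc a (r x)) \<in> W'"
    using w'(3)[OF r2[OF x], of a] Tsc[OF r1[OF x] s(1)] by (simp add: scale_right_diff_distrib)
   hence "fi (r (sc' a x)) = fi (sc a (r x))"
    using wd[OF r1[OF s'(3)[OF x]] s(3)[OF r1[OF x]] r2[OF s'(3)[OF x]]] by blast
   thus "fi (r (sc' a x)) i = a * fi (r x) i" using c(2)[OF r1[OF x]] by simp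
  next
   fix y assume y: "y \<in> E'"
   have "(\<forall>i\<in>{..<n}. fi (r y) i = 0) \<longleftrightarrow> r y \<in> W" by (rule c(4)[OF r1[OF y]])
   also have "\<dots> \<longleftrightarrow> T (r y) \<in> W'" using W[OF r1[OF y]] by simp
   also have "\<dots> \<longleftrightarrow> y \<in> W'"
    using w'(2)[OF r2[OF y], of "T (r y)"] w'(5)[OF _ r2[OF y], of y] by auto
   finally show "(\<forall>i\<in>{..<n}. fi (r y) i = 0) = (y \<in> W')" .
  next
   fix g :: "nat => complex" assume "\<forall>i. i \<notin> {..<n} \<longrightarrow> g i = 0"
   then obtain x where x: "x \<in> E" "fi x = g" using coord_on_surj[OF fi] by metis
   thus "\<exists>x\<in>E'. fi (r x) = g" using rT T by (intro bexI[of _ "T x"]) auto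
  qed (use c(6)[OF r1] in auto)
  thus "codim sc' E' W' n" unfolding codim_def by blast
 }
qed

lemma codim_self: "subsp sc E ==> codim sc E E 0"
 unfolding codim_def by (rule exI[of _ "\<lambda>_ _. 0"]) (auto simp: coord_on_def subsp_def)

lemma codim_0_iff: "subsp sc E ==> codim sc E W 0 \<longleftrightarrow> E \<subseteq> W"
proof
 assume s: "subsp sc E"
 show "E \<subseteq> W" if "codim sc E W 0" using that unfolding codim_def coord_on_def by auto
 show "codim sc E W 0" if "E \<subseteq> W"
  unfolding codim_def by (rule exI[of _ "\<lambda>_ _. 0"]) (use s that in "auto simp: coord_on_def subsp_def")
qed

lemma coord_on_unit_vectors:
 assumes "coord_on sc E W I fi"
 obtains b where "\<And>i. i \<in> I ==> b i \<in> E" "\<And>i j. i \<in> I ==> fi (b i) j = (if i = j then 1 else 0)"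
proof -
 have "\<forall>i. \<exists>x. i \<in> I \<longrightarrow> x \<in> E \<and> fi x = (\<lambda>j. if i = j then 1 else 0)"
 proof (intro allI)
  fix i
  have "i \<in> I ==> \<exists>x\<in>E. fi x = (\<lambda>j. if i = j then 1 else 0)"
   using assms unfolding coord_on_def by auto
  thus "\<exists>x. i \<in> I \<longrightarrow> x \<in> E \<and> fi x = (\<lambda>j. if i = j then 1 else 0)" by blast
 qed
 then obtain b where "\<forall>i. i \<in> I \<longrightarrow> b i \<in> E \<and> fi (b i) = (\<lambda>j. if i = j then 1 else 0)" by metis
 thus thesis by (intro that[of b]) auto
qed

lemma codim_add:
 assumes E: "subsp sc W" "subsp sc E" "subsp sc G" "W \<subseteq> E" "E \<subseteq> G"
  and "codim sc E W n" "codim sc G E m"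
 shows "codim sc G W (n + m)"
proof -
 obtain fi where fi: "coord_on sc E W {..<n} fi" using assms by (auto simp: codim_def)
 obtain py where py: "coord_on sc G E {..<m} py" using assms by (auto simp: codim_def)
 note c = coord_onD[OF fi E(2)] and d = coord_onD[OF py E(3)]
 obtain b where b: "\<And>i. i < m ==> b i \<in> G" "\<And>i j. i < m ==> py (b i) j = (if i = j then 1 else 0)"
  using coord_on_unit_vectors[OF py] by auto
 interpret vector_space sc using E by (auto simp: subsp_def)
 \<comment> \<open>\<open>s\<close> is a linear section of \<open>G -> G / E\<close> built from
   lifts of the unit vectors; the first \<open>n\<close> coordinates of \<open>x\<close> will be
   those of the component \<open>x - s x\<close> in \<open>E\<close>.\<close>
 define s where "s x = (\<Sum>i<m. sc (py x i) (b i))" for x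
 have sG: "s x \<in> G" for x unfolding s_def by (intro subsp_sum[OF E(3)] subspD(3)[OF E(3)] b) auto
 have ps: "py (s x) j = (if j < m then py x j else 0)" for x j
 proof -
  have "py (s x) j = (\<Sum>i<m. py x i * py (b i) j)"
   unfolding s_def by (rule coord_on_sum[OF py E(3)]) (auto simp: b)
  also have "\<dots> = (\<Sum>i<m. if i = j then py x i else 0)" by (rule sum.cong) (auto simp: b)
  finally show ?thesis by auto
 qed
 have xs: "x - s x \<in> E" if "x \<in> G" for x
  using d(4)[of "x - s x"] subspD(5)[OF E(3) that sG] d(3)[OF that sG] ps by auto
 have sadd: "s (x + y) = s x + s y" if "x \<in> G" "y \<in> G" for x y
  using d(1)[OF that] by (simp add: s_def scale_left_distrib sum.distrib)
 have ssc: "s (sc a x) = sc a (s x)" if "x \<in> G" for x a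
  using d(2)[OF that] by (simp add: s_def scale_sum_right)
 define cx where "cx x j = (if j < n then fi (x - s x) j else if j < n + m then py x (j - n) else 0)" for x j
 have s0: "s x = 0" if "x \<in> E" for x using d(7)[of x] that E by (auto simp: s_def)
 have "coord_on sc G W {..<n+m} cx"
  unfolding coord_on_def
 proof (intro conjI ballI allI impI)
  fix x y i assume xy: "x \<in> G" "y \<in> G"
  have "x + y - s (x + y) = (x - s x) + (y - s y)" using xy by (simp add: sadd)
  hence "fi (x + y - s (x + y)) j = fi (x - s x) j + fi (y - s y) j" for j
   using c(1)[OF xs xs, OF xy] by (simp only:)
  thus "cx (x + y) i = cx x i + cx y i" using d(1)[OF xy] by (simp add: cx_def)
 next
  fix a x i assume x: "x \<in> G"
  have "sc a x - s (sc a x) = sc a (x - s x)" using x by (simp add: ssc scale_right_diff_distrib)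
  thus "cx (sc a x) i = a * cx x i"
   using c(2)[OF xs, OF x] d(2)[OF x] by (auto simp: cx_def)
 next
  fix x assume x: "x \<in> G"
  show "(\<forall>i\<in>{..<n+m}. cx x i = 0) = (x \<in> W)"
  proof
   assume z: "\<forall>i\<in>{..<n+m}. cx x i = 0"
   have "py x i = 0" if "i < m" for i using z[rule_format, of "n + i"] that by (auto simp: cx_def)
   hence "x \<in> E" using d(4)[OF x] by auto
   moreover have "fi x i = 0" if "i < n" for i
    using z[rule_format, of i] that s0[OF \<open>x \<in> E\<close>] by (simp add: cx_def)
   ultimately show "x \<in> W" using c(4)[of x] by auto
  next
   assume "x \<in> W"
   hence "x \<in> E" using E by auto
   thus "\<forall>i\<in>{..<n+m}. cx x i = 0" using c(7)[of x] d(7)[OF x] s0 \<open>x \<in> W\<close> by (auto simp: cx_def)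
  qed
 next
  fix g :: "nat => complex" assume g: "\<forall>i. i \<notin> {..<n+m} \<longrightarrow> g i = 0"
  obtain y where y: "y \<in> G" "py y = (\<lambda>i. if i < m then g (n + i) else 0)"
   by (rule coord_on_surj[OF py, of "\<lambda>i. if i < m then g (n + i) else 0"]) auto
  obtain x where x: "x \<in> E" "fi x = (\<lambda>i. if i < n then g i - fi (y - s y) i else 0)"
   by (rule coord_on_surj[OF fi, of "\<lambda>i. if i < n then g i - fi (y - s y) i else 0"]) auto
  have xG: "x \<in> G" using x E by auto
  have p: "py (x + y) i = py y i" for i using d(1)[OF xG y(1)] d(7)[OF xG x(1)] by simp
  have "x + y - s (x + y) = x + (y - s y)" using sadd[OF xG y(1)] s0[OF x(1)] by simp
  hence q: "fi (x + y - s (x + y)) i = fi x i + fi (y - s y) i" for i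
   using c(1)[OF x(1) xs[OF y(1)]] by (simp only:)
  have "cx (x + y) i = g i" for i using g x y p q by (auto simp: cx_def)
  thus "\<exists>x\<in>G. cx x = g" using subspD(2)[OF E(3) xG y(1)] by blast
 qed (auto simp: cx_def)
 thus ?thesis unfolding codim_def by blast
qed

text \<open>Dropping the last coordinate cuts out a hyperplane \<open>G'\<close> containing
  \<open>W\<close>, in which \<open>W\<close> has codimension one less. This is the induction step
  for splitting codimensions and for their uniqueness.\<close>

lemma coord_hyperplane:
 assumes fi: "coord_on sc G W {..<Suc l} fi" and s: "subsp sc G" "subsp sc W" "W \<subseteq> G"
 defines "G' \<equiv> {x \<in> G. fi x l = 0}"
 shows "subsp sc G'" "W \<subseteq> G'" "codim sc G' W l" "\<exists>z\<in>G. fi z l ~= 0"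
  "subsp sc H ==> H \<subseteq> G ==> y \<in> H ==> fi y l ~= 0 ==> codim sc H (H \<inter> G') 1"
proof -
 note c = coord_onD[OF fi s(1)] and sG = subspD[OF s(1)]
 show "subsp sc G'" using s(1) c subspD(1)[OF s(2)] by (auto simp: subsp_def G'_def)
 show "W \<subseteq> G'" using c s(3) by (auto simp: G'_def)
 have "coord_on sc G' W {..<l} (\<lambda>x. (fi x)(l := 0))"
  unfolding coord_on_def
 proof (intro conjI ballI allI impI)
  fix x assume "x \<in> G'"
  thus "(\<forall>i\<in>{..<l}. ((fi x)(l := 0)) i = 0) = (x \<in> W)"
   using c(4)[of x] by (auto simp: G'_def less_Suc_eq)
 next
  fix x i assume "x \<in> G'" "i \<notin> {..<l}"
  thus "((fi x)(l := 0)) i = 0" using c(6)[of x i] by (auto simp: G'_def)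
 next
  fix g :: "nat => complex" assume g: "\<forall>i. i \<notin> {..<l} \<longrightarrow> g i = 0"
  hence "i \<notin> {..<Suc l} ==> g i = 0" for i by auto
  then obtain x where "x \<in> G" "fi x = g" using coord_on_surj[OF fi] by metis
  thus "\<exists>x\<in>G'. (fi x)(l := 0) = g" using g by (intro bexI[of _ x]) (auto simp: G'_def)
 qed (use c in "auto simp: G'_def")
 thus "codim sc G' W l" by (auto simp: codim_def)
 show "\<exists>z\<in>G. fi z l ~= 0" by (rule coord_on_surj[OF fi, of "\<lambda>i. if i = l then 1 else 0"]) (auto intro!: bexI)
 assume H: "subsp sc H" "H \<subseteq> G" and y: "y \<in> H" "fi y l ~= 0"
 have "coord_on sc H (H \<inter> G') {0::nat} (\<lambda>x i. if i = 0 then fi x l else 0)"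
  unfolding coord_on_def
 proof (intro conjI ballI allI impI)
  fix g :: "nat => complex" assume g: "\<forall>i. i \<notin> {0} \<longrightarrow> g i = 0"
  have "sc (g 0 / fi y l) y \<in> H" using subspD(3)[OF H(1) y(1)] .
  moreover have "fi (sc (g 0 / fi y l) y) l = g 0" using c(2)[of y] y H by auto
  ultimately show "\<exists>x\<in>H. (\<lambda>i. if i = 0 then fi x l else 0) = g" using g by (intro bexI) auto
 qed (use c(1,2)[OF subsetD[OF H(2)]] H in "auto simp: subset_iff G'_def")
 from codim_index[OF this] show "codim sc H (H \<inter> G') 1" by simp
qed

text \<open>Induction on the codimension, cutting \<open>G\<close> by a hyperplane \<open>G'\<close>
  through \<open>W\<close>. Either \<open>E\<close> lies in \<open>G'\<close>, and the step is spent
  between \<open>E\<close> and \<open>G\<close>; or \<open>E + G' = G\<close>, so that the step is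
  spent inside \<open>E\<close> and \<open>G / E\<close> is unchanged.\<close>

lemma codim_split:
 assumes "codim sc G W l" "subsp sc W" "subsp sc E" "subsp sc G" "W \<subseteq> E" "E \<subseteq> G"
 shows "\<exists>n m. n + m = l \<and> codim sc E W n \<and> codim sc G E m"
 using assms
proof (induction l arbitrary: G E)
 case 0
 hence "G \<subseteq> W" using codim_0_iff by blast
 thus ?case using 0 codim_0_iff by (metis add.right_neutral subset_trans)
next
 case (Suc l)
 note EE = Suc.prems(2-6)
 have WG: "W \<subseteq> G" using EE by auto
 interpret vector_space sc using EE by (simp add: subsp_def)
 obtain fi where fi: "coord_on sc G W {..<Suc l} fi" using Suc by (auto simp: codim_def)
 note c = coord_onD[OF fi EE(3)]
 note sG = subspD[OF EE(3)] and sE = subspD[OF EE(2)]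
 define G' where "G' = {x\<in>G. fi x l = 0}"
 note hyp = coord_hyperplane[OF fi EE(3,1) WG, folded G'_def]
 define E' where "E' = E \<inter> G'"
 have E': "subsp sc E'" using hyp(1) EE(2) by (auto simp: subsp_def E'_def)
 have W: "W \<subseteq> E'" "E' \<subseteq> G'" "E' \<subseteq> E" "G' \<subseteq> G" using hyp(2) EE by (auto simp: E'_def G'_def)
 from Suc.IH[OF hyp(3) EE(1) E' hyp(1) W(1,2)] obtain n m where nm: "n + m = l" "codim sc E' W n" "codim sc G' E' m"
  by auto
 show ?case
 proof (cases "E \<subseteq> G'")
  case True
  hence [simp]: "E' = E" by (auto simp: E'_def)
  have "G \<inter> G' = G'" using W by blast
  hence "codim sc G G' 1" using hyp(4) hyp(5)[OF EE(3) subset_refl] by auto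
  hence "codim sc G E (m + 1)" by (intro codim_add[OF EE(2) hyp(1) EE(3)]) (use nm True W in auto)
  thus ?thesis using nm by (intro exI[of _ n] exI[of _ "m + 1"]) auto
 next
  case False
  then obtain y where y: "y \<in> E" "fi y l ~= 0" using EE by (auto simp: G'_def)
  have "codim sc E E' 1" using hyp(5)[OF EE(2) EE(5) y] by (simp add: E'_def)
  hence 1: "codim sc E W (n + 1)" by (intro codim_add[OF EE(1) E' EE(2) W(1,3)]) (use nm in auto)
  have "codim sc G' E' m \<longleftrightarrow> codim sc G E m"
  proof (rule codim_map[where T = "\<lambda>x. x"])
   fix x assume x: "x \<in> G"
   let ?a = "sc (fi x l / fi y l) y"
   have "?a \<in> E" by (rule sE(3)[OF y(1)])
   moreover have "?a \<in> G" "y \<in> G" using \<open>?a \<in> E\<close> y EE(5) by auto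
   hence "x - ?a \<in> G'"
    using sG(5)[OF x, of ?a] y(2) c(3)[OF x, of ?a] c(2)[of y] by (auto simp: G'_def)
   ultimately show "\<exists>u\<in>G'. x - u \<in> E" by (intro bexI[of _ "x - ?a"]) auto
  qed (use EE hyp(1) W in "auto simp: lin_on_def E'_def")
  thus ?thesis using nm 1 by (intro exI[of _ "n + 1"] exI[of _ m]) auto
 qed
qed

lemma codim_1_unique:
 assumes "codim sc G E 1" "codim sc G E j" "subsp sc G" "subsp sc E" "E \<subseteq> G"
 shows "j = 1"
proof (rule ccontr)
 assume "j ~= 1"
 obtain fi where fi: "coord_on sc G E {..<1::nat} fi" using assms(1) unfolding codim_def by blast
 obtain py where py: "coord_on sc G E {..<j} py" using assms(2) unfolding codim_def by blast
 note c = coord_onD[OF fi assms(3)] and d = coord_onD[OF py assms(3)]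
 note s = subspD[OF assms(3)]
 obtain b where b: "\<And>i. i < j ==> b i \<in> G" "\<And>i l. i < j ==> py (b i) l = (if i = l then 1 else 0)"
  using coord_on_unit_vectors[OF py] by auto
 obtain a where a: "a \<in> G" "fi a 0 = 1"
  by (rule coord_on_surj[OF fi, of "\<lambda>i. if i = 0 then 1 else 0"]) auto
 show False
 proof (cases "j = 0")
  case True
  hence "a \<in> E" using d(4)[OF a(1)] by auto
  thus False using c(7)[OF a(1)] a by auto
 next
  case False
  hence j: "0 < j" "1 < j" using \<open>j ~= 1\<close> by auto
  note b0 = b(1)[OF j(1)] and b1 = b(1)[OF j(2)]
  let ?x = "sc (fi (b 1) 0) (b 0) - sc (fi (b 0) 0) (b 1)"
  have sb: "sc u (b 0) \<in> G" "sc u (b 1) \<in> G" for u using s(3)[OF b0] s(3)[OF b1] by auto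
  have x: "?x \<in> G" by (intro s(5) sb)
  have "fi ?x 0 = 0" using c(3)[OF sb(1) sb(2)] c(2)[OF b0] c(2)[OF b1] by simp
  hence "?x \<in> E" using c(4)[OF x] by auto
  hence z: "py ?x i = 0" for i using d(7)[OF x] by auto
  have "py ?x 0 = fi (b 1) 0"
   using d(3)[OF sb(1) sb(2)] d(2)[OF b0] d(2)[OF b1] b(2)[OF j(1)] b(2)[OF j(2)] by simp
  hence "fi (b 1) 0 = 0" using z[of 0] by simp
  hence "b 1 \<in> E" using c(4)[OF b1] by auto
  thus False using d(7)[OF b1, of 1] b(2)[OF j(2)] by auto
 qed
qed

lemma codim_unique:
 assumes "codim sc G W n" "codim sc G W m" "subsp sc G" "subsp sc W" "W \<subseteq> G"
 shows "n = m"
 using assms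
proof (induction n arbitrary: m G)
 case 0
 hence "G \<subseteq> W" using codim_0_iff by blast
 obtain py where py: "coord_on sc G W {..<m} py" using 0 by (auto simp: codim_def)
 show ?case
 proof (cases m)
  case (Suc k)
  then obtain b where b: "b \<in> G" "py b 0 = 1" using coord_on_unit_vectors[OF py] by (metis lessThan_iff zero_less_Suc)
  thus ?thesis using coord_onD(7)[OF py 0(3), of b 0] \<open>G \<subseteq> W\<close> by auto
 qed auto
next
 case (Suc l)
 obtain fi where fi: "coord_on sc G W {..<Suc l} fi" using Suc by (auto simp: codim_def)
 define G' where "G' = {x\<in>G. fi x l = 0}"
 note hyp = coord_hyperplane[OF fi Suc.prems(3-5), folded G'_def]
 have W: "G' \<subseteq> G" "G \<inter> G' = G'" by (auto simp: G'_def)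
 hence 2: "codim sc G G' 1" using hyp(4) hyp(5)[OF Suc.prems(3) subset_refl] by auto
 obtain n' m' where nm: "n' + m' = m" "codim sc G' W n'" "codim sc G G' m'"
  using codim_split[OF Suc.prems(2,4) hyp(1) Suc.prems(3) hyp(2) W(1)] by blast
 have "m' = 1" using codim_1_unique[OF 2 nm(3) Suc.prems(3) hyp(1) W(1)] .
 moreover have "l = n'" using Suc.IH[OF hyp(3) nm(2) hyp(1) Suc.prems(4) hyp(2)] .
 ultimately show ?case using nm by simp
qed

text \<open>The image of \<open>T\<close>, enlarged by \<open>W'\<close>, is an intermediate space
  \<open>M\<close>, and \<open>E / W\<close> is isomorphic to \<open>M / W'\<close>.\<close>

lemma codim_inj:
 assumes E: "subsp sc E" "subsp sc' E'" "subsp sc' W'" "W' \<subseteq> E'"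
  and T: "lin_on sc sc' E T" "T ` E \<subseteq> E'" and W: "\<And>x. x \<in> E ==> T x \<in> W' \<longleftrightarrow> x \<in> W"
  and n: "codim sc' E' W' n"
 shows "\<exists>m\<le>n. codim sc E W m"
proof -
 note s = subspD[OF E(1)] and s' = subspD[OF E(2)] and w' = subspD[OF E(3)]
 have Tadd: "T (x + y) = T x + T y" and Tsc: "T (sc c x) = sc' c (T x)" if "x \<in> E" "y \<in> E" for x y c
  using T that by (auto simp: lin_on_def)
 interpret vector_space sc' using E by (auto simp: subsp_def)
 interpret v: vector_space sc using E by (auto simp: subsp_def)
 define M where "M = {T x + y | x y. x \<in> E \<and> y \<in> W'}"
 have T0: "T 0 = 0" using Tadd[of 0 0] s by simp
 have M: "subsp sc' M"
  unfolding subsp_def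
 proof (intro conjI ballI allI)
  have "0 = T 0 + 0" using T0 by simp
  thus "0 \<in> M" unfolding M_def using s(1) w'(1) by blast
 next
  fix a b assume "a \<in> M" "b \<in> M"
  then obtain x y x' y' where *: "x \<in> E" "y \<in> W'" "a = T x + y" "x' \<in> E" "y' \<in> W'" "b = T x' + y'" by (auto simp: M_def)
  hence "a + b = T (x + x') + (y + y')" by (simp add: Tadd)
  thus "a + b \<in> M" unfolding M_def using s(2)[OF *(1,4)] w'(2)[OF *(2,5)] by blast
 next
  fix c a assume "a \<in> M"
  then obtain x y where *: "x \<in> E" "y \<in> W'" "a = T x + y" by (auto simp: M_def)
  hence "sc' c a = T (sc c x) + sc' c y" using Tsc[OF *(1) s(1)] by (simp add: scale_right_distrib)
  thus "sc' c a \<in> M" unfolding M_def using s(3)[OF *(1)] w'(3)[OF *(2)] by blast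
 qed (use E in "auto simp: subsp_def")
 have WM: "W' \<subseteq> M" using s(1) T0 by (force simp: M_def)
 have ME: "M \<subseteq> E'" using T(2) E(4) s'(2) by (auto simp: M_def)
 obtain k l where kl: "k + l = n" "codim sc' M W' k" using codim_split[OF n E(3) M E(2) WM ME] by blast
 have "codim sc E W k \<longleftrightarrow> codim sc' M W' k"
 proof (rule codim_map[OF E(1) M E(3) T(1)])
  show "T ` E \<subseteq> M"
  proof
   fix z assume "z \<in> T ` E"
   then obtain x where "x \<in> E" "z = T x + 0" by auto
   thus "z \<in> M" unfolding M_def using w'(1) by blast
  qed
  fix y assume "y \<in> M"
  then obtain x u where "x \<in> E" "u \<in> W'" "y = T x + u" by (auto simp: M_def)
  thus "\<exists>x\<in>E. y - T x \<in> W'" by (intro bexI[of _ x]) auto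
 qed (use W WM in auto)
 thus ?thesis using kl by (intro exI[of _ k]) auto
qed

lemma codim_mono:
 assumes "codim sc G W n" "codim sc E W m" "subsp sc W" "subsp sc E" "subsp sc G" "W \<subseteq> E" "E \<subseteq> G"
 shows "m \<le> n" "m = n ==> E = G"
proof -
 obtain n' m' where nm: "n' + m' = n" "codim sc E W n'" "codim sc G E m'"
  using codim_split[OF assms(1,3,4,5,6,7)] by blast
 have "n' = m" using codim_unique[OF nm(2) assms(2) assms(4,3,6)] .
 thus "m \<le> n" using nm by simp
 show "E = G" if "m = n"
 proof -
  have "m' = 0" using nm \<open>n' = m\<close> that by simp
  thus ?thesis using codim_0_iff[OF assms(5), of E] nm(3) assms(7) by blast
 qed
qed

section \<open>Substitution, derivations and grading\<close>

abbreviation cc :: "complex => poly3" where "cc c \<equiv> [:[:[:c:]:]:]"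
abbreviation xx :: poly3 where "xx \<equiv> [:[:[:0, 1:]:]:]"
abbreviation yy :: poly3 where "yy \<equiv> [:[:0, 1:]:]"
abbreviation zz :: poly3 where "zz \<equiv> [:0, 1:]"

abbreviation c3 :: "poly3 => nat => nat => nat => complex" where
 "c3 F i j k \<equiv> coeff (coeff (coeff F k) j) i"

lemma c3_eqI: "(\<And>i j k. c3 F i j k = c3 G i j k) ==> F = G"
 by (intro poly_eqI)

text \<open>Lets identities between homomorphisms or derivations be checked on generators,
  regardless of the nesting of the three polynomial rings.\<close>

lemma poly3_induct [case_names const x y z add mult]:
 assumes c: "\<And>c. P (cc c)" and x: "P xx" and y: "P yy" and z: "P zz"
  and add: "\<And>F G. P F ==> P G ==> P (F + G)" and mult: "\<And>F G. P F ==> P G ==> P (F * G)"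
 shows "P F"
proof -
 have 0: "P 0" using c[of 0] by simp
 have 1: "P [:[:r:]:]" for r
 proof (induction r)
  case (pCons a p)
  have "[:[:pCons a p:]:] = cc a + xx * [:[:p:]:]" by simp
  thus ?case using add[OF c mult[OF x pCons.IH]] by metis
 qed (use 0 in simp)
 have 2: "P [:q:]" for q
 proof (induction q)
  case (pCons a p)
  have "[:pCons a p:] = [:[:a:]:] + yy * [:p:]" by simp
  thus ?case using add[OF 1 mult[OF y pCons.IH]] by metis
 qed (use 0 in simp)
 show ?thesis
 proof (induction F)
  case (pCons a p)
  have "pCons a p = [:a:] + zz * p" by simp
  thus ?case using add[OF 2 mult[OF z pCons.IH]] by metis
 qed (use 0 in simp)
qed

lemma map_poly_pCons0: "f 0 = 0 ==> map_poly f (pCons a p) = pCons (f a) (map_poly f p)"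
 by (rule poly_eqI) (simp add: coeff_map_poly coeff_pCons split: nat.splits)

lemma comm_ring_homI:
 assumes "h 1 = 1" "\<And>x y. h (x + y) = h x + h y" "\<And>x y. h (x * y) = h x * h y"
 shows "comm_ring_hom h"
proof -
 have "h 0 = 0" using assms(2)[of 0 0] by simp
 thus ?thesis by unfold_locales (use assms in auto)
qed

lemma comm_ring_hom_id: "comm_ring_hom (\<lambda>x. x)"
 by (rule comm_ring_homI) auto

lemma comm_ring_hom_comp: "comm_ring_hom f ==> comm_ring_hom g ==> comm_ring_hom (\<lambda>x. f (g x))"
proof -
 assume "comm_ring_hom f" "comm_ring_hom g"
 then interpret f: comm_ring_hom f + g: comm_ring_hom g .
 show ?thesis by (rule comm_ring_homI) (auto simp: f.hom_add f.hom_mult g.hom_add g.hom_mult)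
qed

lemma comm_ring_hom_poly_eval:
 fixes h :: "'a::comm_ring_1 => 'b::comm_ring_1"
 assumes "comm_ring_hom h"
 shows "comm_ring_hom (\<lambda>p. poly (map_poly h p) a)"
proof -
 interpret h: comm_ring_hom h by fact
 interpret m: map_poly_comm_ring_hom h by unfold_locales
 show ?thesis by (rule comm_ring_homI) (auto simp: m.hom_add m.hom_mult)
qed

lemma subst3_hom:
 assumes "comm_ring_hom h"
 shows "comm_ring_hom (\<lambda>F. subst3 h F a b c)"
 unfolding subst3_def by (intro comm_ring_hom_poly_eval assms)

lemma subst3_gens:
 assumes "comm_ring_hom h"
 shows "subst3 h (cc r) a b c = h r" "subst3 h xx a b c = a" "subst3 h yy a b c = b" "subst3 h zz a b c = c"
proof -
 interpret h: comm_ring_hom h by fact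
 show "subst3 h (cc r) a b c = h r" "subst3 h xx a b c = a" "subst3 h yy a b c = b" "subst3 h zz a b c = c"
  by (simp_all add: subst3_def map_poly_pCons0)
qed

lemma hom3_eqI:
 assumes "comm_ring_hom Ph" "comm_ring_hom Ps" "\<And>c. Ph (cc c) = Ps (cc c)"
  "Ph xx = Ps xx" "Ph yy = Ps yy" "Ph zz = Ps zz"
 shows "Ph F = Ps F"
proof -
 interpret f: comm_ring_hom Ph by fact
 interpret g: comm_ring_hom Ps by fact
 show ?thesis by (induction F rule: poly3_induct) (use assms in "auto simp: f.hom_add f.hom_mult g.hom_add g.hom_mult")
qed

lemma hom_subst3:
 assumes "comm_ring_hom Ph" "comm_ring_hom h"
 shows "Ph (subst3 h F a b c) = subst3 (\<lambda>r. Ph (h r)) F (Ph a) (Ph b) (Ph c)"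
 by (rule hom3_eqI[OF comm_ring_hom_comp[OF assms(1) subst3_hom[OF assms(2)]] subst3_hom[OF comm_ring_hom_comp[OF assms]]])
  (simp_all only: subst3_gens[OF assms(2)] subst3_gens[OF comm_ring_hom_comp[OF assms]])

section \<open>Derivations of commutative rings and the chain rule\<close>

definition is_deriv :: "('a::comm_ring_1 => 'a) => bool" where
 "is_deriv D \<longleftrightarrow> (\<forall>x y. D (x + y) = D x + D y) \<and> (\<forall>x y. D (x * y) = D x * y + x * D y)"

lemma is_derivD:
 assumes "is_deriv D"
 shows "D (x + y) = D x + D y" "D (x * y) = D x * y + x * D y" "D 0 = 0" "D 1 = 0"
  "D (- x) = - D x" "D (x - y) = D x - D y" "D (sum f A) = (\<Sum>i\<in>A. D (f i))"
proof -
 show a: "D (x + y) = D x + D y" and m: "D (x * y) = D x * y + x * D y" for x y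
  using assms by (auto simp: is_deriv_def)
 show 0: "D 0 = 0" using a[of 0 0] by simp
 show "D 1 = 0" using m[of 1 1] by simp
 show n: "D (- x) = - D x" for x using a[of x "- x"] 0 by (simp add: eq_neg_iff_add_eq_0 add.commute)
 show "D (x - y) = D x - D y" using a[of x "- y"] n by simp
 show "D (sum f A) = (\<Sum>i\<in>A. D (f i))" by (induction A rule: infinite_finite_induct) (auto simp: 0 a)
qed

lemma is_deriv_pderiv: "is_deriv (pderiv :: 'a::idom poly => 'a poly)"
 by (auto simp: is_deriv_def pderiv_add pderiv_mult)

lemma is_deriv_map_poly:
 assumes "is_deriv D"
 shows "is_deriv (map_poly D)"
 unfolding is_deriv_def
proof (intro conjI allI)
 note d = is_derivD[OF assms]
 show "map_poly D (x + y) = map_poly D x + map_poly D y" for x y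
  by (rule poly_eqI) (simp add: coeff_map_poly d)
 show "map_poly D (x * y) = map_poly D x * y + x * map_poly D y" for x y
  by (rule poly_eqI) (simp add: coeff_map_poly d coeff_mult sum.distrib)
qed

lemma is_deriv_d: "is_deriv dx" "is_deriv dy" "is_deriv dz"
 unfolding dx_def[abs_def] dy_def[abs_def] dz_def[abs_def]
 by (intro is_deriv_map_poly is_deriv_pderiv)+

lemma d_gens [simp]:
 "dx (cc c) = 0" "dx xx = 1" "dx yy = 0" "dx zz = 0"
 "dy (cc c) = 0" "dy xx = 0" "dy yy = 1" "dy zz = 0"
 "dz (cc c) = 0" "dz xx = 0" "dz yy = 0" "dz zz = 1"
 by (simp_all add: dx_def dy_def dz_def map_poly_pCons0 pderiv_pCons one_pCons)

lemma chain_rule: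
 assumes "comm_ring_hom Ph" "is_deriv de" "\<And>c. de (Ph (cc c)) = 0"
 shows "de (Ph F) = Ph (dx F) * de (Ph xx) + Ph (dy F) * de (Ph yy) + Ph (dz F) * de (Ph zz)"
proof -
 interpret f: comm_ring_hom Ph by fact
 note d = is_derivD[OF assms(2)] is_derivD[OF is_deriv_d(1)] is_derivD[OF is_deriv_d(2)] is_derivD[OF is_deriv_d(3)]
 show ?thesis
 proof (induction F rule: poly3_induct)
  case (mult F G)
  show ?case by (simp only: f.hom_add f.hom_mult d mult.IH) (simp add: algebra_simps)
 next
  case (add F G)
  show ?case by (simp only: f.hom_add f.hom_mult d add.IH) (simp add: algebra_simps)
 qed (simp_all only: d_gens f.hom_zero f.hom_one assms(3), simp_all)
qed

lemma c3_d:
 "c3 (dx F) i j k = of_nat (Suc i) * c3 F (Suc i) j k"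
 "c3 (dy F) i j k = of_nat (Suc j) * c3 F i (Suc j) k"
 "c3 (dz F) i j k = of_nat (Suc k) * c3 F i j (Suc k)"
 by (simp_all add: dx_def dy_def dz_def coeff_map_poly coeff_pderiv of_nat_poly)

subsection \<open>Homogeneous components\<close>

text \<open>The substitution (x, y, z) -> (s x, s y, s z), with s the variable of the outer
  polynomial ring; the coefficient of s^n is the homogeneous component of degree n. As a ring
  homomorphism it turns homogeneous polynomials into monomials in s, where degrees can be read
  off.\<close>

definition graded :: "poly3 => poly3 poly" where
 "graded F = subst3 (\<lambda>c. [:cc c:]) F [:0, xx:] [:0, yy:] [:0, zz:]"

abbreviation hcomp :: "nat => poly3 => poly3" where "hcomp n F \<equiv> coeff (graded F) n"

lemma hom_cc: "comm_ring_hom (\<lambda>c. [:cc c:])" "comm_ring_hom cc"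
 by (auto intro!: comm_ring_homI simp: one_pCons)

lemma graded_hom: "comm_ring_hom graded"
 unfolding graded_def[abs_def] by (intro subst3_hom hom_cc)

lemma graded_gens [simp]: "graded (cc c) = [:cc c:]" "graded xx = [:0, xx:]" "graded yy = [:0, yy:]" "graded zz = [:0, zz:]"
 unfolding graded_def by (simp_all only: subst3_gens[OF hom_cc(1)])

interpretation graded: comm_ring_hom graded by (rule graded_hom)

lemma graded_at_1: "poly (graded F) 1 = F"
proof -
 have "comm_ring_hom (\<lambda>p. poly p (1::poly3))" by (rule comm_ring_homI) auto
 from hom3_eqI[OF comm_ring_hom_comp[OF this graded_hom] comm_ring_hom_id] show ?thesis by simp
qed

lemma comp_step:
 "hcomp n (pCons a p) = hcomp n [:a:] + (case n of 0 => 0 | Suc m => zz * hcomp m p)"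
 "hcomp n [:pCons b q:] = hcomp n [:[:b:]:] + (case n of 0 => 0 | Suc m => yy * hcomp m [:q:])"
 "hcomp n [:[:pCons c r:]:] = hcomp n (cc c) + (case n of 0 => 0 | Suc m => xx * hcomp m [:[:r:]:])"
proof -
 have "graded (pCons a p) = graded ([:a:] + zz * p)" by simp
 thus "hcomp n (pCons a p) = hcomp n [:a:] + (case n of 0 => 0 | Suc m => zz * hcomp m p)"
  by (simp only: graded.hom_add graded.hom_mult graded_gens) (simp split: nat.splits)
 have "graded [:pCons b q:] = graded ([:[:b:]:] + yy * [:q:])" by simp
 thus "hcomp n [:pCons b q:] = hcomp n [:[:b:]:] + (case n of 0 => 0 | Suc m => yy * hcomp m [:q:])"
  by (simp only: graded.hom_add graded.hom_mult graded_gens) (simp split: nat.splits)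
 have "graded [:[:pCons c r:]:] = graded (cc c + xx * [:[:r:]:])" by simp
 thus "hcomp n [:[:pCons c r:]:] = hcomp n (cc c) + (case n of 0 => 0 | Suc m => xx * hcomp m [:[:r:]:])"
  by (simp only: graded.hom_add graded.hom_mult graded_gens) (simp split: nat.splits)
qed

lemma c3_comp: "c3 (hcomp n F) i j k = (if i + j + k = n then c3 F i j k else 0)"
proof -
 have 1: "c3 (hcomp n [:[:r:]:]) i j k = (if i + j + k = n then c3 [:[:r:]:] i j k else 0)" for r n i j k
 proof (induction r arbitrary: n i j k)
  case (pCons c r)
  show ?case unfolding comp_step(3)[where n = n and c = c and r = r]
   by (cases n; cases i; cases j; cases k; simp add: pCons.IH)
 qed auto
 have 2: "c3 (hcomp n [:q:]) i j k = (if i + j + k = n then c3 [:q:] i j k else 0)" for q n i j k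
 proof (induction q arbitrary: n i j k)
  case (pCons c r)
  show ?case unfolding comp_step(2)[where n = n and b = c and q = r]
   by (cases n; cases j; cases k; simp add: pCons.IH 1)
 qed auto
 show ?thesis
 proof (induction F arbitrary: n i j k)
  case (pCons c r)
  show ?case unfolding comp_step(1)[where n = n and a = c and p = r]
   by (cases n; cases k; simp add: pCons.IH 2)
 qed auto
qed

lemma homogeneous_neg: "n < 0 ==> homogeneous n F ==> F = 0"
 by (rule c3_eqI) (force simp: homogeneous_def)

lemma homogeneous_0 [simp]: "homogeneous n 0"
 by (simp add: homogeneous_def)

lemma homogeneous_comp: "homogeneous (int n) (hcomp n F)"
 by (auto simp: homogeneous_def c3_comp)

lemma comp_homogeneous: "homogeneous (int n) F ==> hcomp m F = (if m = n then F else 0)"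
 by (rule c3_eqI) (fastforce simp: homogeneous_def c3_comp)

lemma homogeneous_iff: "homogeneous (int n) F \<longleftrightarrow> graded F = monom F n"
proof
 assume "homogeneous (int n) F"
 thus "graded F = monom F n" by (intro poly_eqI) (auto simp: comp_homogeneous)
next
 assume "graded F = monom F n"
 thus "homogeneous (int n) F" using homogeneous_comp[of n F] by simp
qed

lemma homogeneous_comp_iff: "homogeneous n F \<longleftrightarrow> (\<forall>m. int m ~= n \<longrightarrow> hcomp m F = 0)"
proof
 assume h: "homogeneous n F"
 show "\<forall>m. int m ~= n \<longrightarrow> hcomp m F = 0"
 proof (intro allI impI)
  fix m assume "int m ~= n"
  thus "hcomp m F = 0" using h by (intro c3_eqI) (fastforce simp: homogeneous_def c3_comp)
 qed
next
 assume h: "\<forall>m. int m ~= n \<longrightarrow> hcomp m F = 0"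
 show "homogeneous n F" unfolding homogeneous_def
 proof (intro allI impI)
  fix i j k assume nz: "c3 F i j k ~= 0"
  have "c3 (hcomp (i + j + k) F) i j k ~= 0" using nz by (simp add: c3_comp)
  thus "int i + int j + int k = n" using h by (metis coeff_0 of_nat_add)
 qed
qed

lemma homogeneous_add: "homogeneous n F ==> homogeneous n G ==> homogeneous n (F + G)"
 by (simp add: homogeneous_comp_iff graded.hom_add)

lemma homogeneous_diff: "homogeneous n F ==> homogeneous n G ==> homogeneous n (F - G)"
 by (simp add: homogeneous_def)(metis diff_zero diff_self)

lemma homogeneous_minus [simp]: "homogeneous n (- F) \<longleftrightarrow> homogeneous n F"
 by (simp add: homogeneous_def)

lemma homogeneous_mult:
 assumes "homogeneous n F" "homogeneous m G"
 shows "homogeneous (n + m) (F * G)"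
proof (cases "n < 0 \<or> m < 0")
 case True
 hence "F = 0 \<or> G = 0" using assms homogeneous_neg by blast
 thus ?thesis by auto
next
 case False
 then obtain a b where [simp]: "n = int a" "m = int b" by (metis int_nat_eq linorder_not_less)
 have "graded (F * G) = monom (F * G) (a + b)"
  using assms by (simp add: homogeneous_iff graded.hom_mult mult_monom)
 hence "homogeneous (int (a + b)) (F * G)" by (simp only: homogeneous_iff)
 thus ?thesis by simp
qed

lemma homogeneous_gens [simp]: "homogeneous 0 (cc c)" "homogeneous 1 xx" "homogeneous 1 yy" "homogeneous 1 zz"
 by (auto simp: homogeneous_def coeff_pCons split: nat.splits)

lemma homogeneous_sum: "(\<And>i. i \<in> I ==> homogeneous n (f i)) ==> homogeneous n (sum f I)"
 by (induction I rule: infinite_finite_induct) (auto intro: homogeneous_add)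

lemma homogeneous_d:
 assumes "homogeneous n F"
 shows "homogeneous (n - 1) (dx F)" "homogeneous (n - 1) (dy F)" "homogeneous (n - 1) (dz F)"
 using assms unfolding homogeneous_def c3_d by fastforce+

lemma homogeneous_unique: "homogeneous n F ==> homogeneous m F ==> F ~= 0 ==> n = m"
 unfolding homogeneous_def by (metis c3_eqI coeff_0)

lemma homogeneous_const: "homogeneous 0 F ==> \<exists>c. F = cc c"
proof
 assume "homogeneous 0 F"
 thus "F = cc (c3 F 0 0 0)"
  by (intro c3_eqI) (force simp: homogeneous_def coeff_pCons split: nat.splits)
qed

lemma subst3_scale:
 assumes "comm_ring_hom h" "homogeneous (int n) F"
 shows "subst3 h F (t * a) (t * b) (t * c) = t ^ n * subst3 h F a b c"
proof -
 let ?Ps = "\<lambda>p. poly (map_poly (\<lambda>G. subst3 h G a b c) p) t"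
 have Ps: "comm_ring_hom ?Ps" by (intro comm_ring_hom_poly_eval subst3_hom assms)
 interpret s: comm_ring_hom "\<lambda>G. subst3 h G a b c" by (intro subst3_hom assms)
 have "subst3 h F (t * a) (t * b) (t * c) = ?Ps (graded F)"
  by (rule hom3_eqI[OF subst3_hom[OF assms(1)] comm_ring_hom_comp[OF Ps graded_hom]])
   (simp_all add: subst3_gens[OF assms(1)] map_poly_pCons0 s.hom_zero)
 also have "graded F = monom F n" using assms by (simp add: homogeneous_iff)
 finally show ?thesis by (simp add: poly_monom)
qed

lemma euler:
 assumes "homogeneous (int n) F"
 shows "xx * dx F + yy * dy F + zz * dz F = of_nat n * F"
proof -
 \<comment> \<open>Differentiate \<open>graded F = monom F n\<close> in the scaling variable and
   evaluate at 1.\<close>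
 have "pderiv (graded F) = graded (dx F) * pderiv (graded xx) + graded (dy F) * pderiv (graded yy) + graded (dz F) * pderiv (graded zz)"
  by (rule chain_rule[OF graded_hom is_deriv_pderiv]) (simp add: pderiv_pCons)
 hence "poly (pderiv (graded F)) 1 = dx F * xx + dy F * yy + dz F * zz"
  by (simp add: graded_at_1 pderiv_pCons)
 moreover have "poly (pderiv (graded F)) 1 = of_nat n * F"
  using assms by (simp add: homogeneous_iff pderiv_monom poly_monom)
 ultimately show ?thesis by simp
qed

definition tdeg :: "poly3 => nat" where "tdeg F = degree (graded F)"

lemma graded_eq_0_iff [simp]: "graded F = 0 \<longleftrightarrow> F = 0"
 using graded_at_1[of F] by (metis graded.hom_zero poly_0)

lemma tdeg_mult: "F ~= 0 ==> G ~= 0 ==> tdeg (F * G) = tdeg F + tdeg G"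
 by (simp add: tdeg_def graded.hom_mult degree_mult_eq)

lemma tdeg_homogeneous: "homogeneous (int n) F ==> F ~= 0 ==> tdeg F = n"
 by (simp add: tdeg_def homogeneous_iff degree_monom_eq)

lemma comp_d: "hcomp n (dx F) = dx (hcomp (Suc n) F)" "hcomp n (dy F) = dy (hcomp (Suc n) F)" "hcomp n (dz F) = dz (hcomp (Suc n) F)"
 by (auto intro!: c3_eqI simp: c3_comp c3_d)

lemma tdeg_d:
 assumes "D \<in> {dx, dy, dz}" "D F ~= 0"
 shows "tdeg (D F) < tdeg F"
proof -
 have *: "hcomp n (D F) = D (hcomp (Suc n) F)" for n using assms comp_d by auto
 have D0: "D 0 = 0" using assms is_derivD(3) is_deriv_d by auto
 have "hcomp (tdeg (D F)) (D F) ~= 0" unfolding tdeg_def using assms by simp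
 hence "hcomp (Suc (tdeg (D F))) F ~= 0" using * D0 by metis
 thus ?thesis unfolding tdeg_def using le_degree by (metis Suc_le_lessD)
qed

lemma tdeg_0: "tdeg F = 0 ==> \<exists>c. F = cc c"
proof -
 assume "tdeg F = 0"
 then obtain G where G: "graded F = [:G:]" unfolding tdeg_def by (metis degree_eq_zeroE)
 hence "F = G" using graded_at_1[of F] by simp
 thus ?thesis using homogeneous_const[of F] homogeneous_iff[of 0 F] G by (simp add: monom_0)
qed

no_notation vec_index (infixl "$" 100)

section \<open>Evaluating power series in two variables on formal curves\<close>

text \<open>\<open>ev a b F\<close> is \<open>F(a, b)\<close>; it makes sense when \<open>a\<close> and \<open>b\<close> have no constant term.\<close>

definition ev :: "complex fps => complex fps => fps2 => complex fps" where
 "ev a b F = Abs_fps (\<lambda>n. \<Sum>k\<le>n. fps_nth ((fps_nth F k oo a) * b ^ k) n)"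

lemma fps_mult_power_nth_0: "b $ 0 = 0 ==> n < k ==> (c * b ^ k) $ n = (0::complex)"
 by (simp add: fps_mult_nth startsby_zero_power_prefix)

lemma ev_nth:
 assumes "b $ 0 = 0" "n \<le> M"
 shows "ev a b F $ n = (\<Sum>k\<le>M. (fps_nth F k oo a) * b ^ k) $ n"
proof -
 have "(\<Sum>k\<le>n. ((F $ k oo a) * b ^ k) $ n) = (\<Sum>k\<le>M. ((F $ k oo a) * b ^ k) $ n)"
  by (rule sum.mono_neutral_left) (use assms in "auto simp: fps_mult_power_nth_0")
 thus ?thesis by (simp add: ev_def fps_sum_nth)
qed

lemma fps_mult_nth_cong:
 assumes "\<And>m. m \<le> n ==> f $ m = f' $ m" "\<And>m. m \<le> n ==> g $ m = g' $ m"
 shows "(f * g) $ n = (f' * g') $ n"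
 unfolding fps_mult_nth by (rule sum.cong) (use assms in auto)

text \<open>As \<open>b\<close> has no constant term, only finitely many terms contribute to the
  coefficient n, and products of terms i and j with i + j > n vanish there. This turns the square of
  summation into a triangle, which is the Cauchy product.\<close>

lemma ev_hom:
 assumes "a $ 0 = 0" "b $ 0 = 0"
 shows "comm_ring_hom (ev a b)"
proof (rule comm_ring_homI)
 show "ev a b 1 = 1"
 proof (rule fps_ext)
  fix n
  have "(\<Sum>k\<le>n. ((1::fps2) $ k oo a) * b ^ k) = (\<Sum>k\<in>{0}. ((1::fps2) $ k oo a) * b ^ k)"
   by (rule sum.mono_neutral_right) auto
  thus "ev a b 1 $ n = 1 $ n" using ev_nth[OF assms(2), of n n a 1] by simp
 qed
 show "ev a b (F + G) = ev a b F + ev a b G" for F G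
  by (rule fps_ext) (simp add: ev_def fps_compose_add_distrib sum.distrib distrib_right)
 show "ev a b (F * G) = ev a b F * ev a b G" for F G
 proof (rule fps_ext)
  fix n
  define A where "A i = (F $ i oo a) * b ^ i" for i
  define B where "B i = (G $ i oo a) * b ^ i" for i
  define f where "f i j = (A i * B j) $ n" for i j
  have fz: "f i j = 0" if "i + j > n" for i j
  proof -
   have "A i * B j = (F $ i oo a) * (G $ j oo a) * b ^ (i + j)" by (simp add: A_def B_def power_add algebra_simps)
   thus ?thesis unfolding f_def using fps_mult_power_nth_0[OF assms(2) that] by simp
  qed
  have "(ev a b F * ev a b G) $ n = ((\<Sum>i\<le>n. A i) * (\<Sum>j\<le>n. B j)) $ n"
   unfolding A_def B_def by (rule fps_mult_nth_cong) (auto intro: ev_nth[OF assms(2)])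
  also have "\<dots> = (\<Sum>i\<le>n. \<Sum>j\<le>n. f i j)" by (simp add: sum_product fps_sum_nth f_def)
  also have "\<dots> = (\<Sum>(i, j)\<in>{..n} \<times> {..n}. f i j)" by (rule sum.cartesian_product)
  also have "\<dots> = (\<Sum>(i, j)\<in>{(i, j). i + j \<le> n}. f i j)"
   by (rule sum.mono_neutral_right) (use fz in "force+")
  also have "\<dots> = (\<Sum>k\<le>n. \<Sum>i\<le>k. f i (k - i))" by (rule sum.triangle_reindex_eq)
  also have "\<dots> = (\<Sum>k\<le>n. (((F * G) $ k oo a) * b ^ k) $ n)"
  proof (rule sum.cong[OF refl])
   fix k assume "k \<in> {..n}"
   have "((F * G) $ k oo a) * b ^ k = (\<Sum>i\<le>k. A i * B (k - i))"
    unfolding fps_mult_nth fps_compose_sum_distrib sum_distrib_right atMost_atLeast0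
   proof (rule sum.cong[OF refl])
    fix i assume "i \<in> {0..k}"
    hence "b ^ k = b ^ i * b ^ (k - i)" by (simp flip: power_add)
    thus "((F $ i * G $ (k - i)) oo a) * b ^ k = A i * B (k - i)"
     by (simp add: A_def B_def fps_compose_mult_distrib[OF assms(1)] algebra_simps)
   qed
   thus "(\<Sum>i\<le>k. f i (k - i)) = (((F * G) $ k oo a) * b ^ k) $ n" by (simp add: f_def fps_sum_nth)
  qed
  also have "\<dots> = ev a b (F * G) $ n" by (simp add: ev_def)
  finally show "ev a b (F * G) $ n = (ev a b F * ev a b G) $ n" by simp
 qed
qed

lemma ev_const: "ev a b (fps_const g) = g oo a"
proof (rule fps_ext)
 fix n
 have "(\<Sum>k\<le>n. ((fps_const g $ k oo a) * b ^ k) $ n) = (\<Sum>k\<in>{0}. ((fps_const g $ k oo a) * b ^ k) $ n)"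
  by (rule sum.mono_neutral_right) auto
 thus "ev a b (fps_const g) $ n = (g oo a) $ n" by (simp add: ev_def)
qed

lemma ev_nth_0: "ev a b F $ 0 = F $ 0 $ 0"
 by (simp add: ev_def)

lemma ev_V: "b $ 0 = 0 ==> ev a b V = b"
proof (rule fps_ext)
 fix n assume b: "b $ 0 = 0"
 have "(\<Sum>k\<le>n. ((fps_X $ k oo a) * b ^ k) $ n) = (\<Sum>k\<in>{1} \<inter> {..n}. (((fps_X :: fps2) $ k oo a) * b ^ k) $ n)"
  by (rule sum.mono_neutral_right) (auto simp: fps_X_def)
 also have "\<dots> = b $ n" using b by (cases n) auto
 finally show "ev a b V $ n = b $ n" by (simp add: ev_def V_def)
qed

lemma ev_U: "a $ 0 = 0 ==> ev a b U = a"
 by (simp add: U_def ev_const)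

lemma ev_const2: "ev a b (const2 c) = fps_const c"
 by (simp add: const2_def ev_const)

lemma fps_shift_decomp: "F = fps_const (F $ 0) + fps_X * fps_shift (Suc 0) F" for F :: "'a::comm_ring_1 fps"
 by (rule fps_ext) (auto simp: fps_X_mult_nth)

lemma ev_shift:
 assumes "a $ 0 = 0" "b $ 0 = 0"
 shows "ev a b F = (F $ 0 oo a) + b * ev a b (fps_shift (Suc 0) F)"
proof -
 interpret e: comm_ring_hom "ev a b" by (rule ev_hom[OF assms])
 have "ev a b F = ev a b (fps_const (F $ 0) + V * fps_shift (Suc 0) F)" using fps_shift_decomp[of F] by (simp add: V_def)
 thus ?thesis by (simp add: e.hom_add e.hom_mult ev_const ev_V assms)
qed

text \<open>Modulo \<open>V ^ Suc n\<close> a series is a polynomial in \<open>V\<close> over the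
  series in u, and multiples of that power do not reach the coefficient n of the image. Continuity
  is thus automatic.\<close>

lemma ev_unique:
 assumes "comm_ring_hom Ps" "\<And>g. Ps (fps_const g) = g oo a" "Ps V $ 0 = 0" "a $ 0 = 0"
 shows "Ps F = ev a (Ps V) F"
proof (rule fps_ext)
 fix n
 interpret p: comm_ring_hom Ps by fact
 have *: "\<exists>R. F = (\<Sum>k\<le>n. fps_const (F $ k) * V ^ k) + V ^ Suc n * R"
 proof
  show "F = (\<Sum>k\<le>n. fps_const (F $ k) * V ^ k) + V ^ Suc n * fps_shift (Suc n) F"
  proof (rule fps_ext)
   fix m
   have "(\<Sum>k\<le>n. (fps_const (F $ k) * V ^ k) $ m) = (\<Sum>k\<in>{m} \<inter> {..n}. (fps_const (F $ k) * V ^ k) $ m)"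
    by (rule sum.mono_neutral_right) (auto simp: V_def)
   thus "F $ m = ((\<Sum>k\<le>n. fps_const (F $ k) * V ^ k) + V ^ Suc n * fps_shift (Suc n) F) $ m"
    by (auto simp: fps_sum_nth V_def fps_X_power_mult_nth simp del: power_Suc)
  qed
 qed
 then obtain R where R: "F = (\<Sum>k\<le>n. fps_const (F $ k) * V ^ k) + V ^ Suc n * R" by blast
 have "Ps F = (\<Sum>k\<le>n. (F $ k oo a) * Ps V ^ k) + Ps R * Ps V ^ Suc n"
  by (subst R) (simp add: p.hom_add p.hom_mult p.hom_power p.hom_sum assms mult.commute)
 thus "Ps F $ n = ev a (Ps V) F $ n"
  using ev_nth[OF assms(3), of n n a F] fps_mult_power_nth_0[OF assms(3), of n "Suc n" "Ps R"] by simp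
qed

lemma ev_compose:
 assumes "a $ 0 = 0" "b $ 0 = 0" "c $ 0 = 0"
 shows "ev a b F oo c = ev (a oo c) (b oo c) F"
proof -
 interpret e: comm_ring_hom "ev a b" by (rule ev_hom[OF assms(1,2)])
 have 1: "comm_ring_hom (\<lambda>F. ev a b F oo c)"
  by (rule comm_ring_homI) (simp_all add: e.hom_add e.hom_mult fps_compose_add_distrib fps_compose_mult_distrib assms)
 have "ev a b F oo c = ev (a oo c) (ev a b V oo c) F"
  by (rule ev_unique[OF 1]) (simp_all add: ev_const ev_V assms fps_compose_assoc)
 thus ?thesis by (simp add: ev_V assms)
qed

lemma ev_chain_rule:
 assumes "a $ 0 = 0" "b $ 0 = 0"
 shows "fps_deriv (ev a b F) = ev a b (du F) * fps_deriv a + ev a b (dv F) * fps_deriv b"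
proof (rule fps_ext)
 fix n
 define A where "A k = (F $ k oo a)" for k
 define D where "D k = fps_deriv (F $ k) oo a" for k
 have dA: "fps_deriv (A k) = D k * fps_deriv a" for k by (simp add: A_def D_def fps_compose_deriv assms)
 have "fps_deriv (ev a b F) $ n = of_nat (Suc n) * (\<Sum>k\<le>Suc n. A k * b ^ k) $ Suc n"
  using ev_nth[OF assms(2), of "Suc n" "Suc n" a F] by (simp add: A_def)
 also have "\<dots> = fps_deriv (\<Sum>k\<le>Suc n. A k * b ^ k) $ n" by (simp only: fps_deriv_nth Suc_eq_plus1)
 also have "fps_deriv (\<Sum>k\<le>Suc n. A k * b ^ k) =
   (\<Sum>k\<le>Suc n. D k * b ^ k) * fps_deriv a + (\<Sum>k\<le>Suc n. A k * fps_deriv (b ^ k))"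
  by (simp only: fps_deriv_sum fps_deriv_mult dA sum.distrib sum_distrib_right) (simp add: algebra_simps)
 also have "(\<Sum>k\<le>Suc n. A k * fps_deriv (b ^ k)) = (\<Sum>k\<le>n. (dv F $ k oo a) * b ^ k) * fps_deriv b"
 proof -
  have "A (Suc k) * fps_deriv (b ^ Suc k) = (dv F $ k oo a) * b ^ k * fps_deriv b" for k
  proof -
   have "dv F $ k = fps_const (of_nat (Suc k)) * F $ Suc k"
    unfolding dv_def fps_deriv_nth fps_of_nat by simp
   hence "dv F $ k oo a = fps_const (of_nat (Suc k)) * A (Suc k)"
    by (simp only: A_def fps_compose_mult_distrib[OF assms(1)] fps_const_compose)
   moreover have "fps_deriv (b ^ Suc k) = fps_const (of_nat (Suc k)) * fps_deriv b * b ^ k"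
    by (simp only: fps_deriv_power diff_Suc_1)
   ultimately show ?thesis by (simp only: mult_ac)
  qed
  thus ?thesis unfolding sum.atMost_Suc_shift sum_distrib_right by simp
 qed
 also have "((\<Sum>k\<le>Suc n. D k * b ^ k) * fps_deriv a + (\<Sum>k\<le>n. (dv F $ k oo a) * b ^ k) * fps_deriv b) $ n =
   (ev a b (du F) * fps_deriv a + ev a b (dv F) * fps_deriv b) $ n"
 proof -
  have "((\<Sum>k\<le>Suc n. D k * b ^ k) * fps_deriv a) $ n = (ev a b (du F) * fps_deriv a) $ n"
   by (rule fps_mult_nth_cong) (auto simp: ev_nth[OF assms(2), of _ "Suc n"] D_def du_def simp del: sum.atMost_Suc)
  moreover have "((\<Sum>k\<le>n. (dv F $ k oo a) * b ^ k) * fps_deriv b) $ n = (ev a b (dv F) * fps_deriv b) $ n"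
   by (rule fps_mult_nth_cong) (auto simp: ev_nth[OF assms(2), of _ n])
  ultimately show ?thesis by simp
 qed
 finally show "fps_deriv (ev a b F) $ n = (ev a b (du F) * fps_deriv a + ev a b (dv F) * fps_deriv b) $ n" .
qed

subsection \<open>Division by \<open>v - b(u)\<close>\<close>

definition lin :: "complex fps => fps2" where "lin b = V - fps_const b"

lemma ev_lin: "b $ 0 = 0 ==> c $ 0 = 0 ==> a $ 0 = 0 ==> ev a c (lin b) = c - (b oo a)"
proof -
 assume *: "b $ 0 = 0" "c $ 0 = 0" "a $ 0 = 0"
 interpret e: comm_ring_hom "ev a c" by (rule ev_hom) (use * in auto)
 show ?thesis by (simp add: lin_def e.hom_minus ev_V ev_const *)
qed

text \<open>Synthetic division: the coefficient l of the quotient of F by v - b(u) is the sum over k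
  > l of \<open>F $ k\<close> times b^(k - l - 1), which makes sense because b has no constant
  term.\<close>

definition lquot :: "complex fps => fps2 => fps2" where
 "lquot b F = Abs_fps (\<lambda>l. ev fps_X b (fps_shift (Suc l) F))"

lemma lin_division:
 assumes "b $ 0 = 0"
 shows "F = lin b * lquot b F + fps_const (ev fps_X b F)"
proof (rule fps_ext)
 fix n
 have X: "(fps_X :: complex fps) $ 0 = 0" by simp
 show "F $ n = (lin b * lquot b F + fps_const (ev fps_X b F)) $ n"
 proof (cases n)
  case 0
  thus ?thesis using ev_shift[OF X assms, of F] by (simp add: lin_def lquot_def V_def algebra_simps)
 next
  case (Suc l)
  have "(lin b * lquot b F) $ Suc l = lquot b F $ l - b * lquot b F $ Suc l"
   by (simp add: lin_def V_def algebra_simps fps_X_mult_nth)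
  also have "fps_shift (Suc 0) (fps_shift (Suc l) F) = fps_shift (Suc (Suc l)) F" by (rule fps_ext) simp
  hence "lquot b F $ l - b * lquot b F $ Suc l = F $ Suc l"
   using ev_shift[OF X assms, of "fps_shift (Suc l) F"] by (simp add: lquot_def)
  finally show ?thesis using Suc by simp
 qed
qed

lemma lin_dvd_iff:
 assumes "b $ 0 = 0"
 shows "lin b dvd F \<longleftrightarrow> ev fps_X b F = 0"
proof
 interpret e: comm_ring_hom "ev fps_X b" by (rule ev_hom) (use assms in auto)
 show "ev fps_X b F = 0" if "lin b dvd F" using that assms by (auto simp: e.hom_mult ev_lin)
 show "lin b dvd F" if "ev fps_X b F = 0" using lin_division[OF assms, of F] that by (metis add.right_neutral dvd_triv_left fps_const_0_eq_0)
qed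

subsection \<open>Formal implicit functions\<close>

text \<open>Newton iteration with the fixed slope \<open>G $ 1\<close>. The map \<open>T\<close>
  raises by one the order to which two approximations agree, because 1 minus the normalised
  difference quotient has no constant term. The solution is read off diagonally from the
  iterates.\<close>

lemma implicit_function:
 fixes G :: fps2
 assumes "G $ 0 $ 0 = 0" "G $ 1 $ 0 ~= 0"
 obtains b where "b $ 0 = 0" "ev fps_X b G = 0"
proof -
 have X: "(fps_X :: complex fps) $ 0 = 0" by simp
 define T where "T b = b - inverse (G $ 1) * ev fps_X b G" for b
 have T0: "T b $ 0 = 0" if "b $ 0 = 0" for b using that assms by (simp add: T_def ev_nth_0)
 have contr: "T b $ n = T b' $ n" if "b $ 0 = 0" "b' $ 0 = 0" "\<And>i. i < n ==> b $ i = b' $ i" for b b' n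
 proof -
  interpret e: comm_ring_hom "ev fps_X b" by (rule ev_hom) (use that in auto)
  have "ev fps_X b G - ev fps_X b' G = (b - b') * ev fps_X b (lquot b' G)"
   by (subst lin_division[OF that(2), of G]) (use that in "simp add: e.hom_add e.hom_mult ev_lin ev_const")
  moreover have "T b - T b' = (b - b') - inverse (G $ 1) * (ev fps_X b G - ev fps_X b' G)"
   unfolding T_def by (simp add: algebra_simps)
  ultimately have "T b - T b' = (b - b') - inverse (G $ 1) * ((b - b') * ev fps_X b (lquot b' G))"
   by (simp only:)
  hence *: "T b - T b' = (b - b') * (1 - inverse (G $ 1) * ev fps_X b (lquot b' G))"
   by (simp add: algebra_simps)
  have "(1 - inverse (G $ 1) * ev fps_X b (lquot b' G)) $ 0 = 0"
   using assms by (simp add: ev_nth_0 lquot_def)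
  hence "(T b - T b') $ n = 0" unfolding * fps_mult_nth
   by (intro sum.neutral) (use that in "auto simp: le_less")
  thus ?thesis by simp
 qed
 define B where "B n = (T ^^ n) 0" for n
 have B0: "B n $ 0 = 0" for n by (induction n) (auto simp: B_def T0)
 have BS: "B (Suc n) = T (B n)" for n by (simp add: B_def)
 have stab: "i \<le> n ==> B (Suc n) $ i = B n $ i" for n i
 proof (induction n arbitrary: i)
  case (Suc n)
  show ?case unfolding BS[of "Suc n"] BS[of n]
   by (rule contr) (use B0 Suc in "auto simp flip: BS")
 qed (use B0 in auto)
 have stab': "i \<le> n ==> B n $ i = B i $ i" for n i
  by (induction n rule: nat_induct) (auto simp: stab le_Suc_eq)
 define b where "b = Abs_fps (\<lambda>i. B i $ i)"
 have b0: "b $ 0 = 0" by (simp add: b_def B0)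
 have "T b $ n = b $ n" for n
 proof -
  have "T b $ n = T (B n) $ n" by (rule contr) (use b0 B0 stab'[of _ n] in "simp_all add: b_def")
  also have "\<dots> = B (Suc n) $ n" by (simp add: BS)
  also have "\<dots> = b $ n" by (simp add: b_def stab)
  finally show ?thesis .
 qed
 hence "T b = b" by (intro fps_ext)
 hence "inverse (G $ 1) * ev fps_X b G = 0" by (simp add: T_def)
 moreover have "inverse (G $ 1) ~= 0" using assms by (metis fps_inverse_eq_0_iff)
 ultimately have "ev fps_X b G = 0" by simp
 thus thesis using that b0 by blast
qed

subsection \<open>Taylor expansion\<close>

definition hasse :: "nat => fps2 => fps2" where
 "hasse l F = Abs_fps (\<lambda>k. of_nat ((k + l) choose l) * F $ (k + l))"

definition taylor :: "complex fps => fps2 => fps2" where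
 "taylor c F = Abs_fps (\<lambda>l. ev fps_X c (hasse l F))"

lemma fps_mult_two_powers_nth_0:
 fixes b c :: "complex fps"
 assumes "b $ 0 = 0" "c $ 0 = 0" "n < k + l"
 shows "(g * (b ^ k * c ^ l)) $ n = 0"
proof -
 have b: "b = fps_X * fps_shift 1 b" and c: "c = fps_X * fps_shift 1 c"
  using fps_shift_decomp[of b] fps_shift_decomp[of c] assms by auto
 have "b ^ k = fps_X ^ k * fps_shift 1 b ^ k" by (subst b) (rule power_mult_distrib)
 moreover have "c ^ l = fps_X ^ l * fps_shift 1 c ^ l" by (subst c) (rule power_mult_distrib)
 ultimately have "g * (b ^ k * c ^ l) = fps_X ^ (k + l) * (g * fps_shift 1 b ^ k * fps_shift 1 c ^ l)"
  by (simp only: power_add mult_ac)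
 thus ?thesis using assms(3) by (simp only: fps_X_power_mult_nth if_True)
qed

lemma taylor_ev:
 assumes "a $ 0 = 0" "c $ 0 = 0" "y $ 0 = 0"
 shows "ev a y (taylor c F) = ev a ((c oo a) + y) F"
proof (rule fps_ext)
 fix n
 define c' where "c' = c oo a"
 define G where "G m = F $ m oo a" for m
 have c'0: "c' $ 0 = 0" using assms by (simp add: c'_def)
 define f where "f l k = (of_nat ((k + l) choose l) * G (k + l) * (c' ^ k * y ^ l)) $ n" for l k
 have tc: "taylor c F $ l oo a = ev a c' (hasse l F)" for l
  using ev_compose[OF _ assms(2) assms(1), of fps_X "hasse l F"] assms(1) by (simp add: taylor_def c'_def)
 have hc: "hasse l F $ k oo a = of_nat ((k + l) choose l) * G (k + l)" for l k
  by (simp add: hasse_def G_def fps_compose_mult_distrib assms(1))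
 have "ev a y (taylor c F) $ n = (\<Sum>l\<le>n. (ev a c' (hasse l F) * y ^ l) $ n)"
  by (simp add: ev_def[of a y] tc)
 also have "\<dots> = (\<Sum>l\<le>n. \<Sum>k\<le>n. f l k)"
 proof (rule sum.cong[OF refl])
  fix l
  have "(ev a c' (hasse l F) * y ^ l) $ n = ((\<Sum>k\<le>n. (hasse l F $ k oo a) * c' ^ k) * y ^ l) $ n"
   by (rule fps_mult_nth_cong) (auto intro: ev_nth[OF c'0])
  thus "(ev a c' (hasse l F) * y ^ l) $ n = (\<Sum>k\<le>n. f l k)"
   by (simp add: hc sum_distrib_right fps_sum_nth f_def mult.assoc)
 qed
 also have "\<dots> = (\<Sum>(l, k)\<in>{..n} \<times> {..n}. f l k)" by (rule sum.cartesian_product)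
 also have "\<dots> = (\<Sum>(l, k)\<in>{(l, k). l + k \<le> n}. f l k)"
 proof (rule sum.mono_neutral_right)
  show "\<forall>i\<in>{..n} \<times> {..n} - {(l, k). l + k \<le> n}. (case i of (l, k) => f l k) = 0"
  proof
   fix x assume x: "x \<in> {..n} \<times> {..n} - {(l, k). l + k \<le> n}"
   obtain l k where [simp]: "x = (l, k)" by (cases x)
   have "n < k + l" using x by auto
   hence "f l k = 0" unfolding f_def by (rule fps_mult_two_powers_nth_0[OF c'0 assms(3)])
   thus "(case x of (l, k) => f l k) = 0" by simp
  qed
 qed auto
 also have "\<dots> = (\<Sum>m\<le>n. \<Sum>l\<le>m. f l (m - l))" by (rule sum.triangle_reindex_eq)
 also have "\<dots> = (\<Sum>m\<le>n. (G m * (c' + y) ^ m) $ n)"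
 proof (rule sum.cong[OF refl])
  fix m
  have "G m * (y + c') ^ m = (\<Sum>l\<le>m. of_nat (m choose l) * G m * (c' ^ (m - l) * y ^ l))"
   unfolding binomial_ring sum_distrib_left by (simp only: mult_ac)
  thus "(\<Sum>l\<le>m. f l (m - l)) = (G m * (c' + y) ^ m) $ n"
   by (simp add: f_def fps_sum_nth add.commute)
 qed
 also have "\<dots> = ev a ((c oo a) + y) F $ n" by (simp add: ev_def G_def c'_def)
 finally show "ev a y (taylor c F) $ n = ev a ((c oo a) + y) F $ n" .
qed

lemma ev_rescale:
 assumes "a $ 0 = 0"
 shows "ev a ((e oo a) * y) F = ev a y (Abs_fps (\<lambda>l. e ^ l * F $ l))"
 by (simp add: ev_def fps_compose_mult_distrib assms fps_compose_power algebra_simps)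

definition lift_pow :: "nat => fps2 => fps2" where
 "lift_pow N F = Abs_fps (\<lambda>k. F $ k oo fps_X ^ N)"

lemma fps_X_power_compose_power: "(fps_X :: complex fps) ^ N oo fps_X ^ M = fps_X ^ (M * N)" if "M > 0"
 using that fps_compose_power[of "fps_X ^ M" fps_X N, symmetric] by (simp add: power_mult del: fps_compose_power)

lemma ev_lift_pow:
 assumes "M > 0" "N > 0"
 shows "ev (fps_X ^ M) b (lift_pow N F) = ev (fps_X ^ (M * N)) b F"
proof -
 have "(F $ k oo fps_X ^ N) oo fps_X ^ M = F $ k oo fps_X ^ (M * N)" for k
  using fps_compose_assoc[of "fps_X ^ M" "fps_X ^ N" "F $ k"] assms by (simp add: fps_X_power_compose_power)
 thus ?thesis by (simp add: ev_def lift_pow_def)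
qed

subsection \<open>Puiseux parametrisations\<close>

text \<open>Newton-Puiseux by induction on the order n of G(0, v), directly for power series in v. A
  shift removes the coefficient of v^(n-1), and a weighted blow-up along an edge of the Newton
  polygon follows. The edge polynomial then cannot be an n-th power of a linear form, so at any of
  its roots the order drops.\<close>

lemma puiseux_root:
 fixes G :: fps2
 assumes "\<And>j. j < n ==> G $ j $ 0 = 0" "G $ n $ 0 ~= 0" "n \<ge> 1"
 shows "\<exists>N>0. \<exists>b. b $ 0 = 0 \<and> ev (fps_X ^ N) b G = 0"
 using assms
proof (induction n arbitrary: G rule: less_induct)
 case (less n)
 have X: "(fps_X :: complex fps) $ 0 = 0" by simp
 show ?case
 proof (cases "n = 1")
  case True
  then obtain b where "b $ 0 = 0" "ev fps_X b G = 0" using implicit_function[of G] less.prems by auto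
  thus ?thesis by (intro exI[of _ 1]) auto
 next
  case False
  hence n: "n \<ge> 2" using less.prems by simp
  have "hasse (n - 1) G $ 0 $ 0 = 0" using less.prems(1)[of "n - 1"] n by (simp add: hasse_def)
  moreover have "hasse (n - 1) G $ 1 $ 0 = of_nat n * G $ n $ 0"
  proof -
   have "(1 + (n - 1)) choose (n - 1) = n" using n by (metis One_nat_def Suc_leD binomial_Suc_n le_add_diff_inverse numeral_2_eq_2 plus_1_eq_Suc)
   moreover have "1 + (n - 1) = n" using n by simp
   ultimately have "hasse (n - 1) G $ 1 = of_nat n * G $ n" unfolding hasse_def by simp
   thus ?thesis by simp
  qed
  hence "hasse (n - 1) G $ 1 $ 0 ~= 0" using less.prems by simp
  \<comment> \<open>Tschirnhaus shift: the coefficient of v^(n-1) after moving the origin to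
    \<open>ta\<close> is the Hasse derivative of order n - 1 along \<open>ta\<close>, which
    vanishes.\<close>
  ultimately obtain ta where ta: "ta $ 0 = 0" "ev fps_X ta (hasse (n - 1) G) = 0" using implicit_function by blast
  define G' where "G' = taylor ta G"
  have G'0: "G' $ j $ 0 = G $ j $ 0" for j by (simp add: G'_def taylor_def ev_nth_0 hasse_def)
  have G'n: "G' $ (n - 1) = 0" using ta by (simp add: G'_def taylor_def)
  have bk: "\<exists>N>0. \<exists>b. b $ 0 = 0 \<and> ev (fps_X ^ N) b G = 0" if "N > 0" "b $ 0 = 0" "ev (fps_X ^ N) b G' = 0" for N b
  proof -
   have "ev (fps_X ^ N) ((ta oo fps_X ^ N) + b) G = 0"
    using taylor_ev[of "fps_X ^ N" ta b G] that ta by (simp add: G'_def)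
   thus ?thesis using that ta by (intro exI[of _ N] conjI exI[of _ "(ta oo fps_X ^ N) + b"]) auto
  qed
  show ?thesis
  proof (cases "G' $ 0 = 0")
   case True
   hence "ev fps_X 0 G' = 0" using ev_shift[OF X, of 0 G'] by simp
   thus ?thesis using bk[of 1 0] by simp
  next
   case False
   define J where "J = {j. j < n \<and> G' $ j ~= 0}"
   have "0 \<in> J" using False n by (simp add: J_def)
   hence J: "finite J" "J ~= {}" by (auto simp: J_def)
   \<comment> \<open>The smallest slope of the Newton polygon seen from the vertex (n, 0). It equals
     p / N, not necessarily in lowest terms; substituting u -> u^N and v -> u^p v makes every term
     divisible by u^(p n).\<close>
   define w where "w j = real (subdegree (G' $ j)) / real (n - j)" for j
   define j0 where "j0 = arg_min_on w J"
   have j0: "j0 \<in> J" "\<And>j. j \<in> J ==> w j0 \<le> w j"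
    using arg_min_if_finite[OF J, of w] by (auto simp: j0_def)
   define p where "p = subdegree (G' $ j0)"
   define N where "N = n - j0"
   have N: "N > 0" using j0 by (auto simp: N_def J_def)
   have p: "p > 0" using j0 G'0[of j0] less.prems(1)[of j0] unfolding p_def J_def
    by (metis (mono_tags, lifting) mem_Collect_eq nth_subdegree_nonzero not_gr_zero)
   have slope: "p * (n - j) \<le> subdegree (G' $ j) * N" if "j \<in> J" for j
   proof -
    have "n - j > 0" using that by (auto simp: J_def)
    hence "real p * real (n - j) \<le> real (subdegree (G' $ j)) * real N"
     using j0(2)[OF that] N by (simp add: w_def p_def N_def divide_simps)
    thus ?thesis by (metis of_nat_le_iff of_nat_mult)
   qed
   have sdc: "subdegree (g oo fps_X ^ N) = subdegree g * N" for g :: "complex fps"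
    using N by simp
   \<comment> \<open>The coefficient of v^j after that substitution and division by u^(p n); the
     case distinction keeps the exponents of u nonnegative.\<close>
   define h where "h j = (if j \<le> n then fps_shift (p * (n - j)) (G' $ j oo fps_X ^ N)
     else (G' $ j oo fps_X ^ N) * fps_X ^ (p * (j - n)))" for j
   have hj: "fps_X ^ (p * n) * h j = (G' $ j oo fps_X ^ N) * fps_X ^ (p * j)" for j
   proof (cases "j \<le> n")
    case True
    have "fps_shift (p * (n - j)) (G' $ j oo fps_X ^ N) * fps_X ^ (p * (n - j)) = G' $ j oo fps_X ^ N"
    proof (cases "j \<in> J")
     case True
     thus ?thesis using slope[OF True] by (intro fps_shift_times_fps_X_power) (simp add: sdc)
    next
     case False
     thus ?thesis using \<open>j \<le> n\<close> by (cases "j = n") (auto simp: J_def)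
    qed
    moreover have "(fps_X :: complex fps) ^ (p * n) = fps_X ^ (p * (n - j)) * fps_X ^ (p * j)"
     using True by (simp flip: power_add distrib_left)
    hence "fps_X ^ (p * n) * h j = (fps_shift (p * (n - j)) (G' $ j oo fps_X ^ N) * fps_X ^ (p * (n - j))) * fps_X ^ (p * j)"
     using True by (simp only: h_def if_True mult_ac)
    ultimately show ?thesis by (simp only:)
   next
    case False
    hence "(fps_X :: complex fps) ^ (p * j) = fps_X ^ (p * (j - n)) * fps_X ^ (p * n)"
     by (simp flip: power_add distrib_left)
    thus ?thesis using False by (simp only: h_def if_False mult_ac)
   qed
   have hn: "h n $ 0 ~= 0" using less.prems G'0 by (simp add: h_def)
   have hn1: "h (n - 1) $ 0 = 0" using G'n by (simp add: h_def)
   have hgt: "h j $ 0 = 0" if "j > n" for j using that p by (simp add: h_def)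
   have hj0: "h j0 $ 0 ~= 0"
   proof -
    have "G' $ j0 oo fps_X ^ N ~= 0" using j0 N by (auto simp: J_def fps_compose_eq_0_iff)
    hence "(G' $ j0 oo fps_X ^ N) $ (subdegree (G' $ j0 oo fps_X ^ N)) ~= 0" by (rule nth_subdegree_nonzero)
    hence "(G' $ j0 oo fps_X ^ N) $ (p * N) ~= 0" unfolding sdc p_def .
    thus ?thesis using j0 by (simp add: h_def N_def J_def)
   qed
   \<comment> \<open>The edge polynomial, of degree n. Its coefficient n - 1 is zero by the
     Tschirnhaus shift, its coefficient \<open>j0\<close> is not.\<close>
   define ka where "ka = (\<Sum>j\<le>n. monom (h j $ 0) j)"
   have cka: "coeff ka j = (if j \<le> n then h j $ 0 else 0)" for j by (simp add: ka_def coeff_sum)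
   have "degree ka ~= 0" using le_degree[of ka n] hn n by (simp add: cka)
   hence "\<not> constant (poly ka)" by (simp add: constant_degree)
   then obtain ze where "poly ka ze = 0" using fundamental_theorem_of_algebra by blast
   hence ze: "(\<Sum>k\<le>n. h k $ 0 * ze ^ k) = 0" by (simp add: ka_def poly_sum poly_monom)
   \<comment> \<open>The Taylor coefficients of the edge polynomial at its root \<open>ze\<close>;
     the multiplicity of this root will be \<open>n'\<close>.\<close>
   define lam where "lam l = (\<Sum>k\<le>n. of_nat ((k + l) choose l) * h (k + l) $ 0 * ze ^ k)" for l
   have lamn: "lam n = h n $ 0"
   proof -
    have "lam n = (\<Sum>k\<in>{0}. of_nat ((k + n) choose n) * h (k + n) $ 0 * ze ^ k)"
     unfolding lam_def by (rule sum.mono_neutral_right) (auto simp: hgt)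
    thus ?thesis by simp
   qed
   define n' where "n' = (LEAST l. lam l ~= 0)"
   have n'1: "lam n' ~= 0" unfolding n'_def by (rule LeastI[of _ n]) (simp add: lamn hn)
   have n'2: "lam l = 0" if "l < n'" for l using not_less_Least[of l "\<lambda>l. lam l ~= 0"] that by (auto simp: n'_def)
   have "lam 0 = 0" using ze by (simp add: lam_def)
   hence n'pos: "n' \<ge> 1" using n'1 by (cases n') auto
   have "n' \<le> n" unfolding n'_def by (rule Least_le) (simp add: lamn hn)
   moreover have "n' ~= n"
   proof
    \<comment> \<open>A root of multiplicity n would make the edge polynomial a multiple of (v -
      ze)^n. The missing coefficient n - 1 forces ze = 0, and then the coefficient \<open>j0\<close>
      would vanish.\<close>
    assume eq: "n' = n"
    have "lam (n - 1) = (\<Sum>k\<in>{0, 1}. of_nat ((k + (n - 1)) choose (n - 1)) * h (k + (n - 1)) $ 0 * ze ^ k)"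
     unfolding lam_def by (rule sum.mono_neutral_right) (use n in "auto intro!: hgt")
    also have "\<dots> = of_nat ((1 + (n - 1)) choose (n - 1)) * h n $ 0 * ze" using hn1 n by simp
    finally have "of_nat ((1 + (n - 1)) choose (n - 1)) * h n $ 0 * ze = 0" using n'2[of "n - 1"] eq n by simp
    moreover have "(1 + (n - 1)) choose (n - 1) ~= 0" by simp
    ultimately have z: "ze = 0" using hn by (metis mult_eq_0_iff of_nat_eq_0_iff)
    have "lam j0 = (\<Sum>k\<in>{0}. of_nat ((k + j0) choose j0) * h (k + j0) $ 0 * ze ^ k)"
     unfolding lam_def z by (rule sum.mono_neutral_right) auto
    hence "lam j0 = h j0 $ 0" by simp
    thus False using n'2[of j0] j0 eq hj0 by (auto simp: J_def)
   qed
   ultimately have n'n: "n' < n" by simp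
   define c where "c = fps_const ze * fps_X ^ p"
   have c0: "c $ 0 = 0" using p by (simp add: c_def)
   define L where "L = lift_pow N G'"
   define t where "t l = taylor c L $ l" for l
   have tl: "(fps_X ^ (p * l) * t l) $ i = (fps_X ^ (p * n) * (\<Sum>k\<le>p * n. fps_const (of_nat ((k + l) choose l) * ze ^ k) * h (k + l))) $ i"
    if "i \<le> p * n" for l i
   proof -
    have "(fps_X ^ (p * l) * t l) $ i = (fps_X ^ (p * l) * (\<Sum>k\<le>p * n. (hasse l L $ k oo fps_X) * c ^ k)) $ i"
     unfolding t_def taylor_def fps_nth_Abs_fps by (rule fps_mult_nth_cong[OF refl], rule ev_nth[OF c0]) (use that in linarith)
    also have "fps_X ^ (p * l) * (\<Sum>k\<le>p * n. (hasse l L $ k oo fps_X) * c ^ k) =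
      (\<Sum>k\<le>p * n. fps_X ^ (p * n) * (fps_const (of_nat ((k + l) choose l) * ze ^ k) * h (k + l)))"
     unfolding sum_distrib_left
    proof (rule sum.cong[OF refl])
     fix k
     have 1: "hasse l L $ k = fps_const (of_nat ((k + l) choose l)) * (G' $ (k + l) oo fps_X ^ N)"
      by (simp add: hasse_def L_def lift_pow_def flip: fps_of_nat)
     have 2: "c ^ k = fps_const (ze ^ k) * fps_X ^ (p * k)"
      by (simp add: c_def power_mult_distrib power_mult)
     have "fps_X ^ (p * l) * ((hasse l L $ k oo fps_X) * c ^ k) =
      fps_const (of_nat ((k + l) choose l)) * fps_const (ze ^ k) * ((G' $ (k + l) oo fps_X ^ N) * fps_X ^ (p * (k + l)))"
      unfolding 2 by (simp add: 1 power_add distrib_left)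
     also have "\<dots> = fps_const (of_nat ((k + l) choose l) * ze ^ k) * (fps_X ^ (p * n) * h (k + l))"
      by (simp only: hj fps_const_mult)
     finally show "fps_X ^ (p * l) * ((hasse l L $ k oo fps_X) * c ^ k) =
      fps_X ^ (p * n) * (fps_const (of_nat ((k + l) choose l) * ze ^ k) * h (k + l))" by simp
    qed
    finally show ?thesis by (simp add: sum_distrib_left)
   qed
   \<comment> \<open>The coefficients of the blown-up series, recentred at \<open>ze\<close> and
     divided by u^(p n). At u = 0 the order in v is n' < n, so the induction hypothesis
     applies.\<close>
   define K where "K l = fps_shift (p * n) (fps_X ^ (p * l) * t l)" for l
   have K: "fps_X ^ (p * n) * K l = fps_X ^ (p * l) * t l" for l
   proof -
    have "fps_X ^ (p * l) * t l = 0 \<or> p * n \<le> subdegree (fps_X ^ (p * l) * t l)"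
    proof (cases "fps_X ^ (p * l) * t l = 0")
     case False
     have "(fps_X ^ (p * l) * t l) $ i = 0" if "i < p * n" for i
      unfolding tl[OF less_imp_le[OF that]] by (simp only: fps_X_power_mult_nth that if_True)
     thus ?thesis using False by (intro disjI2 subdegree_geI) blast+
    qed simp
    thus ?thesis unfolding K_def by (metis fps_shift_times_fps_X_power fps_shift_zero mult.commute mult_zero_left)
   qed
   have K0: "K l $ 0 = lam l" for l
   proof -
    have "K l $ 0 = (\<Sum>k\<le>p * n. of_nat ((k + l) choose l) * h (k + l) $ 0 * ze ^ k)"
     unfolding K_def fps_shift_nth using tl[of "p * n" l] by (simp add: fps_X_power_mult_nth fps_sum_nth mult_ac)
    also have "\<dots> = lam l" unfolding lam_def
     by (rule sum.mono_neutral_right) (use p in "auto simp: hgt")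
    finally show ?thesis .
   qed
   have "\<exists>N>0. \<exists>b. b $ 0 = 0 \<and> ev (fps_X ^ N) b (Abs_fps K) = 0"
    by (rule less.IH[OF n'n]) (use n'1 n'2 n'pos K0 in auto)
   then obtain M y where M: "M > 0" "y $ 0 = 0" "ev (fps_X ^ M) y (Abs_fps K) = 0" by blast
   let ?a = "(fps_X :: complex fps) ^ M"
   have a0: "?a $ 0 = 0" using M by simp
   interpret e: comm_ring_hom "ev ?a y" by (rule ev_hom[OF a0 M(2)])
   have ep: "(fps_X ^ p oo ?a) * y = fps_X ^ (M * p) * y" using M by (simp add: fps_X_power_compose_power)
   have y'0: "((fps_X ^ p oo ?a) * y) $ 0 = 0" using M by simp
   have "ev ?a ((c oo ?a) + (fps_X ^ p oo ?a) * y) L = ev ?a ((fps_X ^ p oo ?a) * y) (taylor c L)"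
    using taylor_ev[OF a0 c0 y'0] by simp
   also have "\<dots> = ev ?a y (Abs_fps (\<lambda>l. (fps_X ^ p) ^ l * taylor c L $ l))" by (rule ev_rescale[OF a0])
   also have "Abs_fps (\<lambda>l. (fps_X ^ p) ^ l * taylor c L $ l) = fps_const (fps_X ^ (p * n)) * Abs_fps K"
    by (rule fps_ext) (simp add: K flip: t_def power_mult)
   also have "ev ?a y \<dots> = 0" by (simp add: e.hom_mult M)
   finally have "ev (fps_X ^ (M * N)) ((c oo ?a) + (fps_X ^ p oo ?a) * y) G' = 0"
    unfolding L_def using ev_lift_pow[OF M(1) N] by simp
   thus ?thesis using bk[of "M * N" "(c oo ?a) + (fps_X ^ p oo ?a) * y"] M N c0 y'0 by simp
  qed
 qed
qed

section \<open>Intersection numbers of formal germs\<close>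

definition sc1 :: "complex => complex fps => complex fps" where "sc1 c x = fps_const c * x"
definition sc2 :: "complex => fps2 => fps2" where "sc2 c F = const2 c * F"

lemma const2_simps [simp]: "const2 (a + b) = const2 a + const2 b" "const2 (a * b) = const2 a * const2 b" "const2 1 = 1" "const2 0 = 0"
 by (simp_all add: const2_def)

lemma vector_space_sc1: "vector_space sc1"
 by unfold_locales (simp_all add: sc1_def algebra_simps flip: fps_const_add fps_const_mult)

lemma vector_space_sc2: "vector_space sc2"
 by unfold_locales (simp_all add: sc2_def algebra_simps)

lemma subsp_UNIV: "subsp sc1 UNIV" "subsp sc2 UNIV"
 by (auto simp: subsp_def vector_space_sc1 vector_space_sc2)

definition is_ideal :: "'a::comm_ring_1 set => bool" where
 "is_ideal W \<longleftrightarrow> 0 \<in> W \<and> (\<forall>x\<in>W. \<forall>y\<in>W. x + y \<in> W) \<and> (\<forall>x\<in>W. \<forall>r. r * x \<in> W)"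

lemma is_idealD:
 assumes "is_ideal W"
 shows "0 \<in> W" "x \<in> W ==> y \<in> W ==> x + y \<in> W" "x \<in> W ==> r * x \<in> W" "x \<in> W ==> x * r \<in> W"
  "x \<in> W ==> - x \<in> W" "x \<in> W ==> y \<in> W ==> x - y \<in> W"
proof -
 show a: "0 \<in> W" "x \<in> W ==> y \<in> W ==> x + y \<in> W" and m: "x \<in> W ==> r * x \<in> W" for x y r
  using assms by (auto simp: is_ideal_def)
 show "x \<in> W ==> x * r \<in> W" using m[of x r] by (simp add: mult.commute)
 show n: "x \<in> W ==> - x \<in> W" for x using m[of x "-1"] by simp
 show "x \<in> W ==> y \<in> W ==> x - y \<in> W" using a(2)[of x "- y"] n[of y] by simp
qed

lemma ideal_subsp: "is_ideal W ==> subsp sc2 W"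
 using is_idealD[of W] by (auto simp: subsp_def vector_space_sc2 sc2_def)

definition idl2 :: "fps2 => fps2 => fps2 set" where
 "idl2 a b = {x * a + y * b | x y. True}"

definition idl3 :: "fps2 => fps2 => fps2 => fps2 set" where
 "idl3 a b c = {x * a + y * b + z * c | x y z. True}"

lemma idl3_ideal: "is_ideal (idl3 a b c)"
 unfolding is_ideal_def
proof (intro conjI ballI allI)
 have "0 = 0 * a + 0 * b + 0 * c" by simp
 thus "0 \<in> idl3 a b c" unfolding idl3_def by blast
next
 fix x y assume "x \<in> idl3 a b c" "y \<in> idl3 a b c"
 then obtain p q r p' q' r' where "x = p * a + q * b + r * c" "y = p' * a + q' * b + r' * c" unfolding idl3_def by blast
 hence "x + y = (p + p') * a + (q + q') * b + (r + r') * c" by (simp add: algebra_simps)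
 thus "x + y \<in> idl3 a b c" unfolding idl3_def by blast
next
 fix x s assume "x \<in> idl3 a b c"
 then obtain p q r where "x = p * a + q * b + r * c" unfolding idl3_def by blast
 hence "s * x = (s * p) * a + (s * q) * b + (s * r) * c" by (simp add: algebra_simps)
 thus "s * x \<in> idl3 a b c" unfolding idl3_def by blast
qed

lemma idl2_idl3: "idl2 a b = idl3 a b 0"
 by (auto simp: idl2_def idl3_def)

lemma idl2_ideal: "is_ideal (idl2 a b)"
 by (simp add: idl2_idl3 idl3_ideal)

lemma idl_gens: "a \<in> idl3 a b c" "b \<in> idl3 a b c" "c \<in> idl3 a b c" "a \<in> idl2 a b" "b \<in> idl2 a b"
proof -
 have "a = 1 * a + 0 * b + 0 * c" "b = 0 * a + 1 * b + 0 * c" "c = 0 * a + 0 * b + 1 * c"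
  "a = 1 * a + 0 * b" "b = 0 * a + 1 * b" by auto
 thus "a \<in> idl3 a b c" "b \<in> idl3 a b c" "c \<in> idl3 a b c" "a \<in> idl2 a b" "b \<in> idl2 a b"
  unfolding idl3_def idl2_def by blast+
qed

lemma idl3_subset: "is_ideal W ==> a \<in> W ==> b \<in> W ==> c \<in> W ==> idl3 a b c \<subseteq> W"
 unfolding idl3_def by (auto intro!: is_idealD(2,3))

lemma idl2_subset: "is_ideal W ==> a \<in> W ==> b \<in> W ==> idl2 a b \<subseteq> W"
 unfolding idl2_idl3 by (intro idl3_subset is_idealD)

lemma idl2_commute: "idl2 a b = idl2 b a"
 by (intro subset_antisym idl2_subset idl2_ideal idl_gens)

abbreviation cdim :: "fps2 set => nat => bool" where "cdim W n \<equiv> codim sc2 UNIV W n"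

lemma cdim_unique: "cdim W n ==> cdim W m ==> is_ideal W ==> n = m"
 using codim_unique[of sc2 UNIV W n m] subsp_UNIV(2) ideal_subsp by blast

lemma lin_on_mult: "lin_on sc2 sc2 UNIV (\<lambda>x. a * x)"
 by (auto simp: lin_on_def sc2_def algebra_simps)

text \<open>The exact sequence 0 -> R/(b, H) -> R/(a b, H) -> R/(a, H) -> 0, where R is the ring of
  series in two variables and the first map is multiplication by \<open>a\<close>. It is injective
  because \<open>H\<close> is a nonzerodivisor modulo \<open>a\<close>.\<close>

lemma cdim_mult:
 assumes nzd: "\<And>x. a dvd x * H ==> a dvd x" and "a ~= 0"
  and "cdim (idl2 a H) n" "cdim (idl2 b H) m"
 shows "cdim (idl2 (a * b) H) (n + m)"
proof -
 have sub: "idl2 (a * b) H \<subseteq> idl2 a H"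
  by (intro idl2_subset idl2_ideal idl_gens) (auto intro!: is_idealD(4)[OF idl2_ideal] idl_gens)
 have "codim sc2 UNIV (idl2 b H) m \<longleftrightarrow> codim sc2 (idl2 a H) (idl2 (a * b) H) m"
 proof (rule codim_map[where T = "\<lambda>x. a * x"])
  show "(\<lambda>x. a * x) ` UNIV \<subseteq> idl2 a H" using is_idealD(4)[OF idl2_ideal idl_gens(4)] by blast
  fix x
  show "a * x \<in> idl2 (a * b) H \<longleftrightarrow> x \<in> idl2 b H"
  proof
   assume "a * x \<in> idl2 (a * b) H"
   then obtain u v where uv: "a * x = u * (a * b) + v * H" by (auto simp: idl2_def)
   have "v * H = a * (x - u * b)" using uv by (simp add: algebra_simps)
   hence "a dvd v * H" by simp
   hence "a dvd v" by (rule nzd)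
   then obtain w where w: "v = a * w" by (rule dvdE)
   hence "a * x = a * (u * b + w * H)" using uv by (simp add: algebra_simps)
   hence "x = u * b + w * H" using \<open>a ~= 0\<close> by simp
   thus "x \<in> idl2 b H" by (auto simp: idl2_def)
  next
   assume "x \<in> idl2 b H"
   then obtain u v where "x = u * b + v * H" by (auto simp: idl2_def)
   hence "a * x = u * (a * b) + (a * v) * H" by (simp add: algebra_simps)
   thus "a * x \<in> idl2 (a * b) H" unfolding idl2_def by blast
  qed
 next
  fix y assume "y \<in> idl2 a H"
  then obtain u v where "y = u * a + v * H" by (auto simp: idl2_def)
  hence "y - a * u = 0 * (a * b) + v * H" by simp
  thus "\<exists>x\<in>UNIV. y - a * x \<in> idl2 (a * b) H" unfolding idl2_def by blast
 qed (use sub in "auto intro: subsp_UNIV ideal_subsp idl2_ideal lin_on_mult")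
 hence "codim sc2 (idl2 a H) (idl2 (a * b) H) m" using assms(4) by simp
 from codim_add[OF _ _ _ sub _ this assms(3)] show ?thesis
  by (simp add: add.commute ideal_subsp idl2_ideal subsp_UNIV)
qed

text \<open>\<open>smooth_at a E\<close>: the curve \<open>a = 0\<close> is smooth, and \<open>E\<close> restricts functions to it.\<close>

definition smooth_at :: "fps2 => (fps2 => complex fps) => bool" where
 "smooth_at a E \<longleftrightarrow> comm_ring_hom E \<and> (\<forall>c. E (const2 c) = fps_const c) \<and> surj E \<and> (\<forall>F. E F = 0 \<longleftrightarrow> a dvd F)"

lemma smooth_atD:
 assumes "smooth_at a E"
 shows "comm_ring_hom E" "E (const2 c) = fps_const c" "\<exists>F. E F = g" "E F = 0 \<longleftrightarrow> a dvd F" "a ~= 0"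
  "E H ~= 0 ==> a dvd x * H ==> a dvd x" "E a = 0"
proof -
 interpret comm_ring_hom E using assms by (simp add: smooth_at_def)
 show "comm_ring_hom E" by unfold_locales
 show "E (const2 c) = fps_const c" and e: "E F = 0 \<longleftrightarrow> a dvd F" for c F using assms by (auto simp: smooth_at_def)
 show s: "\<exists>F. E F = g" for g using assms by (auto simp: smooth_at_def surj_def) metis
 show "E H ~= 0 ==> a dvd x * H ==> a dvd x" by (simp add: hom_mult flip: e)
 show "E a = 0" by (simp add: e)
 show "a ~= 0"
 proof
  assume "a = 0"
  obtain F where F: "E F = fps_X" using s by blast
  obtain G where G: "E G = F $ 0" using s by blast
  have inj: "A = B" if "E A = E B" for A B
   using e[of "A - B"] that \<open>a = 0\<close> by (simp add: hom_minus)
  obtain A where A: "E A = fps_X * E U" using s by blast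
  have "E U = 0 \<or> E U ~= 0" by simp
  \<comment> \<open>If \<open>a = 0\<close>, then \<open>E\<close> is an isomorphism onto the series
    in one variable, where one of any two elements divides the other. Neither of \<open>U\<close>
    and \<open>V\<close> divides the other.\<close>
  obtain B where B: "E B * E V = E U \<or> E B * E U = E V"
  proof (cases "subdegree (E V) \<le> subdegree (E U)")
   case True
   show ?thesis
   proof (cases "E U = 0")
    case True thus ?thesis using that[of 0] by simp
   next
    case False
    have "E V ~= 0" using inj[of V 0] by (auto simp: V_def)
    hence "E V dvd E U" using True False by (simp add: fps_dvd_iff)
    thus ?thesis using s that by (metis dvdE mult.commute)
   qed
  next
   case False
   have "E U ~= 0" using inj[of U 0] by (auto simp: U_def)
   moreover have "E V ~= 0" using inj[of V 0] by (auto simp: V_def)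
   ultimately have "E U dvd E V" using False by (simp add: fps_dvd_iff)
   thus ?thesis using s that by (metis dvdE mult.commute)
  qed
  hence "B * V = U \<or> B * U = V" using inj by (metis hom_mult)
  moreover have "(B * V) $ 0 ~= U $ 0" by (simp add: V_def U_def)
  moreover have "(B * U) $ 1 $ 0 ~= V $ 1 $ 0" by (simp add: V_def U_def)
  ultimately show False by metis
 qed
qed

lemma cdim_smooth:
 assumes "smooth_at a E" "E H ~= 0"
 shows "cdim (idl2 a H) (subdegree (E H))"
proof -
 note d = smooth_atD[OF assms(1)]
 interpret comm_ring_hom E by (rule d(1))
 let ?W = "{x. E H dvd x}"
 have W: "subsp sc1 ?W" by (auto simp: subsp_def vector_space_sc1 sc1_def)
 have "codim sc2 UNIV (idl2 a H) (subdegree (E H)) \<longleftrightarrow> codim sc1 UNIV ?W (subdegree (E H))"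
 proof (rule codim_map[where T = E])
  fix x
  show "E x \<in> ?W \<longleftrightarrow> x \<in> idl2 a H"
  proof
   assume "E x \<in> ?W"
   hence "E H dvd E x" by simp
   then obtain g where g: "E x = E H * g" by (rule dvdE)
   obtain y where "E y = g" using d(3) by blast
   hence "E (x - y * H) = 0" using g by (simp add: hom_minus hom_mult)
   hence "a dvd x - y * H" using d(4) by blast
   then obtain z where "x - y * H = a * z" by (rule dvdE)
   hence "x = z * a + y * H" by (simp add: algebra_simps)
   thus "x \<in> idl2 a H" unfolding idl2_def by blast
  next
   assume "x \<in> idl2 a H"
   then obtain u v where "x = u * a + v * H" unfolding idl2_def by blast
   thus "E x \<in> ?W" by (simp add: hom_add hom_mult d(7))
  qed
 next
  fix y :: "complex fps"
  obtain F where "E F = y" using d(3) by blast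
  thus "\<exists>x\<in>UNIV. y - E x \<in> ?W" by (intro bexI[of _ F]) auto
 qed (auto simp: subsp_UNIV W lin_on_def hom_add sc2_def sc1_def hom_mult d(2))
 moreover have "codim sc1 UNIV ?W (card {..<subdegree (E H)})"
 proof (rule codim_index[where fi = "\<lambda>x i. if i < subdegree (E H) then x $ i else 0"])
  show "coord_on sc1 UNIV ?W {..<subdegree (E H)} (\<lambda>x i. if i < subdegree (E H) then x $ i else 0)"
   unfolding coord_on_def
  proof (intro conjI ballI allI impI)
   fix x :: "complex fps"
   show "(\<forall>i\<in>{..<subdegree (E H)}. (if i < subdegree (E H) then x $ i else 0) = 0) = (x \<in> ?W)"
    using assms(2) by (cases "x = 0") (auto simp: fps_dvd_iff intro: subdegree_geI nth_less_subdegree_zero)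
  next
   fix g :: "nat => complex" assume "\<forall>i. i \<notin> {..<subdegree (E H)} \<longrightarrow> g i = 0"
   thus "\<exists>x\<in>UNIV. (\<lambda>i. if i < subdegree (E H) then x $ i else 0) = g"
    by (intro bexI[of _ "Abs_fps g"]) auto
  qed (auto simp: sc1_def)
 qed auto
 ultimately show ?thesis by simp
qed

lemma smooth_at_lin:
 assumes "b $ 0 = 0"
 shows "smooth_at (lin b) (ev fps_X b)"
proof -
 have "ev fps_X b (fps_const g) = g" for g by (simp add: ev_const)
 hence "surj (ev fps_X b)" by (metis surjI)
 thus ?thesis using assms ev_hom[of fps_X b] by (auto simp: smooth_at_def ev_const2 lin_dvd_iff)
qed

lemma ev_0_X: "ev 0 fps_X F $ n = F $ n $ 0"
proof -
 have "ev 0 fps_X F $ n = (\<Sum>k\<le>n. if k = n then F $ k $ 0 else 0)"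
  unfolding ev_def fps_nth_Abs_fps by (rule sum.cong) (auto simp: fps_X_power_mult_right_nth)
 thus ?thesis by simp
qed

text \<open>The vertical line u = 0 is not a graph over u, so it gets its own parametrisation (0,
  t).\<close>

lemma smooth_at_U: "smooth_at U (ev 0 fps_X)"
 unfolding smooth_at_def
proof (intro conjI allI)
 show h: "comm_ring_hom (ev 0 fps_X)" by (rule ev_hom) auto
 interpret comm_ring_hom "ev 0 fps_X" by (rule h)
 have "ev 0 fps_X (Abs_fps (\<lambda>n. fps_const (g $ n))) = g" for g by (rule fps_ext) (simp add: ev_0_X)
 thus "surj (ev 0 fps_X)" by (metis surjI)
 fix F
 show "ev 0 fps_X F = 0 \<longleftrightarrow> U dvd F"
 proof
  assume "ev 0 fps_X F = 0"
  hence "F $ n $ 0 = 0" for n by (metis ev_0_X fps_zero_nth)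
  hence "F = U * Abs_fps (\<lambda>n. fps_shift 1 (F $ n))"
   using fps_shift_decomp[of "F $ n" for n] by (intro fps_ext) (simp add: U_def)
  thus "U dvd F" by (rule dvdI)
 next
  assume "U dvd F"
  then obtain G where "F = U * G" by (rule dvdE)
  thus "ev 0 fps_X F = 0" by (simp add: hom_mult ev_U)
 qed
qed (simp add: ev_const2)

lemma fps2_unit:
 assumes "Y $ 0 $ 0 ~= 0"
 shows "(Y :: fps2) dvd 1"
proof -
 have "Y $ 0 * inverse (Y $ 0) = 1" using assms by (simp add: inverse_mult_eq_1')
 from fps_right_inverse[OF this] show ?thesis by (metis dvd_triv_left)
qed

lemma cdim_unit: "a dvd 1 ==> cdim (idl2 a H) 0"
proof -
 assume "a dvd 1"
 then obtain y where "1 = a * y" by (rule dvdE)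
 hence "x = (x * y) * a + 0 * H" for x by (simp add: mult.commute[of y])
 hence "UNIV \<subseteq> idl2 a H" unfolding idl2_def by blast
 thus ?thesis using codim_0_iff[OF subsp_UNIV(2)] by blast
qed

lemma cdim_prod_list:
 assumes "\<And>aE. aE \<in> set ps ==> smooth_at (fst aE) (snd aE) \<and> snd aE H ~= 0"
  "cdim (idl2 Y H) m"
 shows "cdim (idl2 (prod_list (map fst ps) * Y) H) ((\<Sum>(a, E)\<leftarrow>ps. subdegree (E H)) + m)"
 using assms(1)
proof (induction ps)
 case (Cons p ps)
 obtain a E where [simp]: "p = (a, E)" by (cases p)
 have s: "smooth_at a E" "E H ~= 0" using Cons.prems[of p] by auto
 have "cdim (idl2 (a * (prod_list (map fst ps) * Y)) H) (subdegree (E H) + ((\<Sum>(a, E)\<leftarrow>ps. subdegree (E H)) + m))"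
  by (rule cdim_mult[OF smooth_atD(6,5)[OF s(1)] cdim_smooth[OF s] Cons.IH]) (use s Cons.prems in auto)
 thus ?case by (simp add: algebra_simps)
qed (use assms(2) in simp)

subsection \<open>Base change\<close>

lemma lift_pow_hom: "N > 0 ==> comm_ring_hom (lift_pow N)"
proof (rule comm_ring_homI)
 assume N: "N > 0"
 show "lift_pow N 1 = 1" by (rule fps_ext) (simp add: lift_pow_def)
 show "lift_pow N (x + y) = lift_pow N x + lift_pow N y" for x y
  by (rule fps_ext) (simp add: lift_pow_def fps_compose_add_distrib)
 show "lift_pow N (x * y) = lift_pow N x * lift_pow N y" for x y
  by (rule fps_ext) (simp add: lift_pow_def fps_mult_nth fps_compose_sum_distrib fps_compose_mult_distrib N)
qed

lemma lift_pow_lift_pow: "M > 0 ==> N > 0 ==> lift_pow M (lift_pow N F) = lift_pow (M * N) F"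
 by (rule fps_ext) (simp add: lift_pow_def fps_X_power_compose_power flip: fps_compose_assoc)

lemma lift_pow_const: "lift_pow N (const2 c) = const2 c"
 by (rule fps_ext) (simp add: lift_pow_def const2_def)

text \<open>The series in u and v form a free module over the image of u -> u^N, with basis 1, u,
  ..., u^(N-1); this is the coordinate of index r.\<close>

definition proj_pow :: "nat => nat => fps2 => fps2" where
 "proj_pow N r F = Abs_fps (\<lambda>k. Abs_fps (\<lambda>i. F $ k $ (N * i + r)))"

lemma proj_pow_add: "proj_pow N r (F + G) = proj_pow N r F + proj_pow N r G"
 by (intro fps_ext) (simp add: proj_pow_def)

lemma proj_pow_lift_mult:
 assumes "r < N"
 shows "proj_pow N r (lift_pow N A * F) = A * proj_pow N r F"
proof -
 have 1: "((g oo fps_X ^ N) * f) $ (N * i + r) = (g * Abs_fps (\<lambda>i. f $ (N * i + r))) $ i" for g f :: "complex fps" and i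
 proof -
  have "((g oo fps_X ^ N) * f) $ (N * i + r) = (\<Sum>m=0..N*i+r. (if N dvd m then g $ (m div N) else 0) * f $ (N * i + r - m))"
   by (simp add: fps_mult_nth fps_nth_compose_X_power)
  also have "\<dots> = (\<Sum>m\<in>(\<lambda>j. N * j) ` {0..i}. (if N dvd m then g $ (m div N) else 0) * f $ (N * i + r - m))"
  proof (rule sum.mono_neutral_right)
   show "\<forall>m\<in>{0..N*i+r} - (\<lambda>j. N * j) ` {0..i}. (if N dvd m then g $ (m div N) else 0) * f $ (N * i + r - m) = 0"
   proof
    fix m assume m: "m \<in> {0..N*i+r} - (\<lambda>j. N * j) ` {0..i}"
    have "\<not> N dvd m"
    proof
     assume "N dvd m"
     then obtain j where j: "m = N * j" by auto
     hence "N * j < N * (i + 1)" using m assms by auto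
     hence "j < i + 1" by (simp only: mult_less_cancel1)
     thus False using m j by auto
    qed
    thus "(if N dvd m then g $ (m div N) else 0) * f $ (N * i + r - m) = 0" by simp
   qed
  qed (use assms in "auto intro!: mult_le_mono trans_le_add1")
  also have "\<dots> = (\<Sum>j=0..i. g $ j * f $ (N * (i - j) + r))"
  proof (subst sum.reindex)
   show "inj_on (\<lambda>j. N * j) {0..i}" using assms by (auto simp: inj_on_def)
   show "sum ((\<lambda>m. (if N dvd m then g $ (m div N) else 0) * f $ (N * i + r - m)) \<circ> (\<lambda>j. N * j)) {0..i} = (\<Sum>j=0..i. g $ j * f $ (N * (i - j) + r))"
    using assms by (intro sum.cong) (auto simp: diff_mult_distrib2)
  qed
  finally show ?thesis by (simp add: fps_mult_nth)
 qed
 show ?thesis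
 proof (rule fps_ext, rule fps_ext)
  fix k i
  have "proj_pow N r (lift_pow N A * F) $ k $ i = (\<Sum>l=0..k. ((A $ l oo fps_X ^ N) * F $ (k - l)) $ (N * i + r))"
   by (simp add: proj_pow_def fps_mult_nth[of "lift_pow N A"] fps_sum_nth) (simp add: lift_pow_def)
  also have "\<dots> = (A * proj_pow N r F) $ k $ i"
   by (simp add: 1 fps_mult_nth[of A] fps_sum_nth proj_pow_def)
  finally show "proj_pow N r (lift_pow N A * F) $ k $ i = (A * proj_pow N r F) $ k $ i" .
 qed
qed

lemma proj_pow_decomp:
 assumes "N > 0"
 shows "F = (\<Sum>r<N. U ^ r * lift_pow N (proj_pow N r F))"
proof (rule fps_ext, rule fps_ext)
 fix k i
 have "(\<Sum>r<N. U ^ r * lift_pow N (proj_pow N r F)) $ k $ i = (\<Sum>r<N. if r = i mod N then F $ k $ i else 0)"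
  unfolding fps_sum_nth
 proof (rule sum.cong[OF refl])
  fix r assume r: "r \<in> {..<N}"
  have Ur: "U ^ r = fps_const (fps_X ^ r)" by (simp add: U_def)
  have dv: "N dvd i - r \<longleftrightarrow> r = i mod N" if "r \<le> i"
   using that r by (metis lessThan_iff mod_eq_dvd_iff_nat mod_less)
  have "(U ^ r * lift_pow N (proj_pow N r F)) $ k $ i = (if i < r then 0 else (proj_pow N r F $ k oo fps_X ^ N) $ (i - r))"
   by (simp add: Ur lift_pow_def fps_X_power_mult_nth)
  also have "\<dots> = (if r = i mod N then F $ k $ i else 0)"
  proof (cases "i < r")
   case True
   hence "r ~= i mod N" by (metis mod_less_eq_dividend not_le)
   thus ?thesis using True by simp
  next
   case False
   show ?thesis
   proof (cases "r = i mod N")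
    case True
    hence "N * ((i - r) div N) + r = i" using False dv by (metis add.commute dvd_mult_div_cancel le_add_diff_inverse not_less)
    thus ?thesis using dv by (simp add: fps_nth_compose_X_power proj_pow_def)
   next
    case F: False
    thus ?thesis using dv by (simp add: fps_nth_compose_X_power)
   qed
  qed
  finally show "(U ^ r * lift_pow N (proj_pow N r F)) $ k $ i = (if r = i mod N then F $ k $ i else 0)" .
 qed
 also have "\<dots> = F $ k $ i" using assms by simp
 finally show "F $ k $ i = (\<Sum>r<N. U ^ r * lift_pow N (proj_pow N r F)) $ k $ i" by simp
qed

text \<open>The base change is free, so membership in an extended ideal can be tested coordinate by
  coordinate.\<close>

lemma idl2_lift_pow_iff:
 assumes "N > 0"
 shows "F \<in> idl2 (lift_pow N G) (lift_pow N H) \<longleftrightarrow> (\<forall>r<N. proj_pow N r F \<in> idl2 G H)"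
proof
 interpret l: comm_ring_hom "lift_pow N" by (rule lift_pow_hom[OF assms])
 {
  assume "F \<in> idl2 (lift_pow N G) (lift_pow N H)"
  then obtain x y where "F = x * lift_pow N G + y * lift_pow N H" unfolding idl2_def by blast
  hence "F = lift_pow N G * x + lift_pow N H * y" by simp
  hence "proj_pow N r F = proj_pow N r x * G + proj_pow N r y * H" if "r < N" for r
   using that by (simp only: proj_pow_add proj_pow_lift_mult mult.commute[of G] mult.commute[of H])
  thus "\<forall>r<N. proj_pow N r F \<in> idl2 G H" unfolding idl2_def by blast
 }
 {
  assume *: "\<forall>r<N. proj_pow N r F \<in> idl2 G H"
  have "lift_pow N (proj_pow N r F) \<in> idl2 (lift_pow N G) (lift_pow N H)" if "r < N" for r
  proof -
   have "proj_pow N r F \<in> idl2 G H" using * that by blast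
   then obtain x y where "proj_pow N r F = x * G + y * H" unfolding idl2_def by blast
   hence "lift_pow N (proj_pow N r F) = lift_pow N x * lift_pow N G + lift_pow N y * lift_pow N H"
    by (simp add: l.hom_add l.hom_mult)
   thus ?thesis unfolding idl2_def by blast
  qed
  hence "(\<Sum>r<N. U ^ r * lift_pow N (proj_pow N r F)) \<in> idl2 (lift_pow N G) (lift_pow N H)"
   by (intro subsp_sum[OF ideal_subsp[OF idl2_ideal]] is_idealD(3)[OF idl2_ideal]) auto
  thus "F \<in> idl2 (lift_pow N G) (lift_pow N H)" using proj_pow_decomp[OF assms, of F] by simp
 }
qed

lemma cdim_lift_pow:
 assumes "N > 0" "cdim (idl2 G H) n"
 shows "cdim (idl2 (lift_pow N G) (lift_pow N H)) (N * n)"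
proof -
 obtain fi where fi: "coord_on sc2 UNIV (idl2 G H) {..<n} fi" using assms(2) by (auto simp: codim_def)
 note c = coord_onD[OF fi subsp_UNIV(2) UNIV_I]
 interpret l: comm_ring_hom "lift_pow N" by (rule lift_pow_hom[OF assms(1)])
 have psc: "proj_pow N r (sc2 a F) = sc2 a (proj_pow N r F)" if "r < N" for r a F
  unfolding sc2_def using proj_pow_lift_mult[OF that, of "const2 a" F] by (simp add: lift_pow_const)
 have pl: "proj_pow N r (\<Sum>s<N. U ^ s * lift_pow N (A s)) = A r" if "r < N" for r A
 proof -
  have Us: "proj_pow N r (U ^ s) = (if s = r then 1 else 0)" if "s < N" for s
  proof (rule fps_ext, rule fps_ext)
   fix k i
   have "U ^ s = fps_const (fps_X ^ s)" by (simp add: U_def)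
   moreover have "N * i + r = s \<longleftrightarrow> i = 0 \<and> r = s" using that \<open>r < N\<close> by (cases i) auto
   ultimately show "proj_pow N r (U ^ s) $ k $ i = (if s = r then 1 else 0) $ k $ i"
    by (auto simp: proj_pow_def)
  qed
  have "proj_pow N r (\<Sum>s\<in>S. U ^ s * lift_pow N (A s)) = (\<Sum>s\<in>S. A s * proj_pow N r (U ^ s))" if "finite S" for S
   using that
  proof (induction S rule: finite_induct)
   case empty
   show ?case by (intro fps_ext) (simp add: proj_pow_def)
  next
   case (insert s S)
   thus ?case using proj_pow_lift_mult[OF \<open>r < N\<close>, of "A s" "U ^ s"] by (simp add: proj_pow_add mult.commute)
  qed
  hence "proj_pow N r (\<Sum>s<N. U ^ s * lift_pow N (A s)) = (\<Sum>s<N. A s * proj_pow N r (U ^ s))" by simp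
  also have "\<dots> = (\<Sum>s<N. if s = r then A s else 0)" by (rule sum.cong) (auto simp: Us)
  finally show ?thesis using that by simp
 qed
 define py where "py F = (\<lambda>(r, i). if r < N then fi (proj_pow N r F) i else 0)" for F
 have "coord_on sc2 UNIV (idl2 (lift_pow N G) (lift_pow N H)) ({..<N} \<times> {..<n}) py"
  unfolding coord_on_def
 proof (intro conjI ballI allI impI)
  fix F
  have "(\<forall>i\<in>{..<N} \<times> {..<n}. py F i = 0) \<longleftrightarrow> (\<forall>r<N. \<forall>i\<in>{..<n}. fi (proj_pow N r F) i = 0)"
   by (auto simp: py_def)
  thus "(\<forall>i\<in>{..<N} \<times> {..<n}. py F i = 0) \<longleftrightarrow> F \<in> idl2 (lift_pow N G) (lift_pow N H)"
   by (simp only: c(4) idl2_lift_pow_iff[OF assms(1)])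
 next
  fix g :: "nat \<times> nat => complex" assume g: "\<forall>i. i \<notin> {..<N} \<times> {..<n} \<longrightarrow> g i = 0"
  have "\<exists>x. fi x = (\<lambda>i. g (r, i))" for r
  proof -
   have "g (r, i) = 0" if "i \<notin> {..<n}" for i using g that by auto
   from coord_on_surj[OF fi, of "\<lambda>i. g (r, i)", OF this] show ?thesis by blast
  qed
  then obtain A where A: "\<And>r. fi (A r) = (\<lambda>i. g (r, i))" by metis
  have "py (\<Sum>s<N. U ^ s * lift_pow N (A s)) = g" using g by (auto simp: py_def pl A)
  thus "\<exists>x\<in>UNIV. py x = g" by blast
 next
  fix F i assume "i \<notin> {..<N} \<times> {..<n}"
  thus "py F i = 0" using c(6)[of "snd i" "proj_pow N (fst i) F"] by (cases i) (auto simp: py_def)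
 qed (auto simp: py_def proj_pow_add psc c(1,2) split: prod.splits)
 from codim_index[OF this] show ?thesis by simp
qed

text \<open>Finiteness descends: the quotient before base change embeds into the one after it as the
  coordinate r = 0.\<close>

lemma cdim_lift_pow_imp:
 assumes "N > 0" "cdim (idl2 (lift_pow N G) (lift_pow N H)) M"
 shows "\<exists>n. cdim (idl2 G H) n"
proof -
 interpret l: comm_ring_hom "lift_pow N" by (rule lift_pow_hom[OF assms(1)])
 have "\<exists>m\<le>M. codim sc2 UNIV (idl2 G H) m"
 proof (rule codim_inj[where T = "lift_pow N", OF subsp_UNIV(2) subsp_UNIV(2) ideal_subsp[OF idl2_ideal] subset_UNIV _ subset_UNIV _ assms(2)])
  show "lin_on sc2 sc2 UNIV (lift_pow N)" by (auto simp: lin_on_def l.hom_add l.hom_mult sc2_def lift_pow_const)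
  fix x
  have p1: "proj_pow N r 1 = (if r = 0 then 1 else 0)" if "r < N" for r
   by (intro fps_ext) (use that assms(1) in "auto simp: proj_pow_def")
  have "proj_pow N r (lift_pow N x) = (if r = 0 then x else 0)" if "r < N" for r
   using proj_pow_lift_mult[OF that, of x 1] p1[OF that] by simp
  thus "lift_pow N x \<in> idl2 (lift_pow N G) (lift_pow N H) \<longleftrightarrow> x \<in> idl2 G H"
   using idl2_lift_pow_iff[OF assms(1), of "lift_pow N x" G H] assms(1) is_idealD(1)[OF idl2_ideal] by auto
 qed
 thus ?thesis by blast
qed

subsection \<open>Comparing intersection numbers branch by branch\<close>

text \<open>Each Puiseux root splits off a factor v - b(u) after a base change and lowers the order
  in v by one; at order 0 a unit remains. Later base changes only reparametrise the factors already
  found.\<close>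

lemma regular_factorization:
 fixes G :: fps2
 assumes "\<And>j. j < n ==> G $ j $ 0 = 0" "G $ n $ 0 ~= 0"
 shows "\<exists>N>0. \<exists>bs Y. (\<forall>b\<in>set bs. b $ 0 = 0) \<and> Y dvd 1 \<and> lift_pow N G = prod_list (map lin bs) * Y"
 using assms
proof (induction n arbitrary: G)
 case 0
 have "lift_pow 1 G dvd 1" using 0 by (intro fps2_unit) (simp add: lift_pow_def)
 thus ?case by (intro exI[of _ 1] conjI exI[of _ "[]"] exI[of _ "lift_pow 1 G"]) auto
next
 case (Suc n)
 obtain N b where N: "N > 0" "b $ 0 = 0" "ev (fps_X ^ N) b G = 0" using puiseux_root[of "Suc n" G] Suc.prems by auto
 interpret l: comm_ring_hom "lift_pow N" by (rule lift_pow_hom[OF N(1)])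
 have "ev fps_X b (lift_pow N G) = 0" using ev_lift_pow[of 1 N b G] N by simp
 hence "lin b dvd lift_pow N G" using lin_dvd_iff[OF N(2)] by simp
 then obtain Q where Q: "lift_pow N G = lin b * Q" by (rule dvdE)
 have Qk: "Q $ k $ 0 = G $ Suc k $ 0" for k
 proof -
  have "lift_pow N G $ Suc k = Q $ k - b * Q $ Suc k"
   unfolding Q by (simp add: lin_def V_def algebra_simps)
  moreover have "lift_pow N G $ Suc k $ 0 = G $ Suc k $ 0" by (simp add: lift_pow_def)
  ultimately show ?thesis using N by simp
 qed
 obtain M bs Y where M: "M > 0" "\<forall>b\<in>set bs. b $ 0 = 0" "Y dvd 1" "lift_pow M Q = prod_list (map lin bs) * Y"
  using Suc.IH[of Q] Suc.prems by (auto simp: Qk)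
 interpret m: comm_ring_hom "lift_pow M" by (rule lift_pow_hom[OF M(1)])
 have "lift_pow M (lin b) = lin (b oo fps_X ^ M)"
 proof -
  have "lift_pow M V = V" by (rule fps_ext) (simp add: lift_pow_def V_def fps_X_def)
  moreover have "lift_pow M (fps_const b) = fps_const (b oo fps_X ^ M)" by (rule fps_ext) (simp add: lift_pow_def)
  ultimately show ?thesis by (simp add: lin_def m.hom_minus)
 qed
 hence "lift_pow (M * N) G = prod_list (map lin ((b oo fps_X ^ M) # bs)) * Y"
  using M(4) Q by (simp add: m.hom_mult flip: lift_pow_lift_pow[OF M(1) N(1)])
 thus ?case using M N by (intro exI[of _ "M * N"] conjI exI[of _ "(b oo fps_X ^ M) # bs"] exI[of _ Y]) auto
qed

lemma U_power_regular:
 assumes "(G :: fps2) ~= 0"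
 obtains e G' n where "G = U ^ e * G'" "\<And>j. j < n ==> G' $ j $ 0 = 0" "G' $ n $ 0 ~= 0"
proof -
 define P where "P e \<longleftrightarrow> (\<exists>k. G $ k ~= 0 \<and> subdegree (G $ k) = e)" for e
 define e where "e = (LEAST e. P e)"
 obtain k where "G $ k ~= 0" using assms by (auto simp: fps_eq_iff)
 hence "P (subdegree (G $ k))" unfolding P_def by blast
 hence "P e" unfolding e_def by (rule LeastI)
 then obtain k where k: "G $ k ~= 0" "subdegree (G $ k) = e" unfolding P_def by blast
 have le: "e \<le> subdegree (G $ j)" if "G $ j ~= 0" for j
  unfolding e_def by (rule Least_le) (use that in "auto simp: P_def")
 define G' where "G' = Abs_fps (\<lambda>j. fps_shift e (G $ j))"
 have "fps_X ^ e * fps_shift e (G $ j) = G $ j" for j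
  using le[of j] fps_shift_times_fps_X_power[of e "G $ j"] by (cases "G $ j = 0") (auto simp only: mult.commute[of "fps_X ^ e"] fps_shift_zero mult_zero_left)
 hence "G = U ^ e * G'" by (intro fps_ext) (simp add: U_def fps_const_power G'_def)
 moreover define n where "n = (LEAST j. G' $ j $ 0 ~= 0)"
 have "G' $ k $ 0 ~= 0" using k by (auto simp: G'_def)
 hence "G' $ n $ 0 ~= 0" unfolding n_def by (rule LeastI)
 moreover have "G' $ j $ 0 = 0" if "j < n" for j using not_less_Least[of j "\<lambda>j. G' $ j $ 0 ~= 0"] that by (auto simp: n_def)
 ultimately show thesis using that by blast
qed

text \<open>Intersection numbers add over the branches of \<open>G\<close>, so they depend only on
  the orders along these. The hypothesis ranges over all formal curves on \<open>G\<close>, which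
  spares an enumeration of the branches in applications.\<close>

theorem branch_cdim:
 assumes "G ~= 0"
  and H: "\<And>a b. a $ 0 = 0 ==> b $ 0 = 0 ==> (a ~= 0 \<or> b ~= 0) ==> ev a b G = 0 ==>
   ev a b H1 ~= 0 \<and> ev a b H2 ~= 0 \<and> subdegree (ev a b H1) = subdegree (ev a b H2)"
 shows "\<exists>m. cdim (idl2 G H1) m \<and> cdim (idl2 G H2) m"
proof -
 obtain e G' n where G: "G = U ^ e * G'" and G': "\<And>j. j < n ==> G' $ j $ 0 = 0" "G' $ n $ 0 ~= 0"
  using U_power_regular[OF assms(1)] by metis
 obtain N bs Y where N: "N > 0" and bs: "\<And>b. b \<in> set bs ==> b $ 0 = 0" and Y: "Y dvd 1"
  and fac: "lift_pow N G' = prod_list (map lin bs) * Y"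
  using regular_factorization[of n G'] G' by blast
 interpret l: comm_ring_hom "lift_pow N" by (rule lift_pow_hom[OF N])
 have X0: "((fps_X :: complex fps) ^ N) $ 0 = 0" using N by simp
 have Gb: "ev (fps_X ^ N) b G = 0" if "b \<in> set bs" for b
 proof -
  interpret e: comm_ring_hom "ev (fps_X ^ N) b" by (rule ev_hom[OF X0 bs[OF that]])
  interpret f: comm_ring_hom "ev fps_X b" by (rule ev_hom) (use bs[OF that] in auto)
  have "lin b dvd prod_list (map lin bs)" using that by (intro prod_list_dvd) auto
  hence "lin b dvd lift_pow N G'" unfolding fac by simp
  hence "ev fps_X b (lift_pow N G') = 0" using lin_dvd_iff[OF bs[OF that]] by simp
  thus ?thesis using ev_lift_pow[of 1 N b G'] N by (simp add: G e.hom_mult)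
 qed
 have U0: "ev 0 fps_X G = 0" if "e > 0"
 proof -
  interpret e: comm_ring_hom "ev 0 fps_X" by (rule ev_hom) auto
  show ?thesis using that by (simp add: G e.hom_mult e.hom_power ev_U)
 qed
 \<comment> \<open>The base change multiplies the codimension by \<open>N\<close>. The factor
   \<open>U ^ e\<close> is treated before the base change, hence its contribution appears multiplied
   by \<open>N\<close>; in the final comparison \<open>N\<close> cancels.\<close>
 have main: "\<exists>m. cdim (idl2 G H) m \<and> (\<Sum>b\<leftarrow>bs. subdegree (ev (fps_X ^ N) b H)) + N * (e * subdegree (ev 0 fps_X H)) = N * m"
  if h: "\<And>b. b \<in> set bs ==> ev (fps_X ^ N) b H ~= 0" "e > 0 ==> ev 0 fps_X H ~= 0" for H
 proof -
  have evb: "ev fps_X b (lift_pow N H) = ev (fps_X ^ N) b H" for b using ev_lift_pow[of 1 N b H] N by simp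
  have "cdim (idl2 (prod_list (map fst (map (\<lambda>b. (lin b, ev fps_X b)) bs)) * Y) (lift_pow N H))
    ((\<Sum>(a, E)\<leftarrow>map (\<lambda>b. (lin b, ev fps_X b)) bs. subdegree (E (lift_pow N H))) + 0)"
   by (rule cdim_prod_list[OF _ cdim_unit[OF Y]]) (use bs h(1) in "auto simp: evb smooth_at_lin")
  hence 1: "cdim (idl2 (lift_pow N G') (lift_pow N H)) (\<Sum>b\<leftarrow>bs. subdegree (ev (fps_X ^ N) b H))"
   unfolding fac by (simp add: o_def evb)
  then obtain m where m: "cdim (idl2 G' H) m" using cdim_lift_pow_imp[OF N] by blast
  have Nm: "(\<Sum>b\<leftarrow>bs. subdegree (ev (fps_X ^ N) b H)) = N * m"
   by (rule cdim_unique[OF 1 cdim_lift_pow[OF N m] idl2_ideal])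
  have "cdim (idl2 (prod_list (map fst (replicate e (U, ev 0 fps_X))) * G') H)
    ((\<Sum>(a, E)\<leftarrow>replicate e (U, ev 0 fps_X). subdegree (E H)) + m)"
   by (rule cdim_prod_list[OF _ m]) (use h(2) in "auto simp: smooth_at_U")
  hence "cdim (idl2 G H) (e * subdegree (ev 0 fps_X H) + m)"
   unfolding G by (simp add: sum_list_replicate)
  thus ?thesis using Nm by (intro exI[of _ "e * subdegree (ev 0 fps_X H) + m"]) (simp add: algebra_simps)
 qed
 have Xne: "(fps_X :: complex fps) ^ N ~= 0" by simp
 have Hb: "ev (fps_X ^ N) b H1 ~= 0 \<and> ev (fps_X ^ N) b H2 ~= 0 \<and> subdegree (ev (fps_X ^ N) b H1) = subdegree (ev (fps_X ^ N) b H2)"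
  if "b \<in> set bs" for b
  using H[OF X0 bs[OF that] _ Gb[OF that]] Xne by blast
 have HU: "ev 0 fps_X H1 ~= 0 \<and> ev 0 fps_X H2 ~= 0 \<and> subdegree (ev 0 fps_X H1) = subdegree (ev 0 fps_X H2)" if "e > 0"
  using H[of 0 fps_X] U0[OF that] by simp
 obtain m1 where m1: "cdim (idl2 G H1) m1" "(\<Sum>b\<leftarrow>bs. subdegree (ev (fps_X ^ N) b H1)) + N * (e * subdegree (ev 0 fps_X H1)) = N * m1"
  using main[of H1] Hb HU by blast
 obtain m2 where m2: "cdim (idl2 G H2) m2" "(\<Sum>b\<leftarrow>bs. subdegree (ev (fps_X ^ N) b H2)) + N * (e * subdegree (ev 0 fps_X H2)) = N * m2"
  using main[of H2] Hb HU by blast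
 have "(\<Sum>b\<leftarrow>bs. subdegree (ev (fps_X ^ N) b H1)) = (\<Sum>b\<leftarrow>bs. subdegree (ev (fps_X ^ N) b H2))"
  using Hb by (intro arg_cong[of _ _ sum_list] map_cong) auto
 moreover have "e * subdegree (ev 0 fps_X H1) = e * subdegree (ev 0 fps_X H2)" using HU by (cases e) auto
 ultimately have "N * m1 = N * m2" using m1(2) m2(2) by metis
 thus ?thesis using m1 m2 N by auto
qed

section \<open>Adding a smooth branch to a plane curve germ\<close>

text \<open>Nakayama: the ideals W + (g^k) decrease strictly as long as g^k is outside
  \<open>W\<close>, because 1 - x g is a unit. If g^n were outside \<open>W\<close>, there would be
  n + 1 strict steps, too many for codimension n.\<close>

lemma nilpotent_mod_ideal:
 assumes "is_ideal W" "cdim W n" "g $ 0 $ 0 = 0"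
 shows "g ^ n \<in> W"
proof (rule ccontr)
 assume nW: "g ^ n \<notin> W"
 note i = is_idealD[OF assms(1)]
 define Wk where "Wk k = {w + x * g ^ k | w x. w \<in> W}" for k
 have mem: "w + x * g ^ k \<in> Wk k" if "w \<in> W" for w x k using that by (auto simp: Wk_def)
 have Wk: "is_ideal (Wk k)" for k
  unfolding is_ideal_def
 proof (intro conjI ballI allI)
  show "0 \<in> Wk k" using mem[OF i(1), of 0 k] by simp
  fix a assume "a \<in> Wk k"
  then obtain w x where a: "w \<in> W" "a = w + x * g ^ k" by (auto simp: Wk_def)
  show "r * a \<in> Wk k" for r
   using mem[OF i(3)[OF a(1), of r], of "r * x" k] a by (simp add: algebra_simps)
  fix b assume "b \<in> Wk k"
  then obtain w' x' where b: "w' \<in> W" "b = w' + x' * g ^ k" by (auto simp: Wk_def)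
  show "a + b \<in> Wk k" using mem[OF i(2)[OF a(1) b(1)], of "x + x'" k] a b by (simp add: algebra_simps)
 qed
 have WW: "W \<subseteq> Wk k" for k using mem[of _ 0 k] by auto
 have dec: "Wk (Suc k) \<subseteq> Wk k" for k
 proof
  fix a assume "a \<in> Wk (Suc k)"
  then obtain w x where a: "w \<in> W" "a = w + x * g ^ Suc k" by (auto simp: Wk_def)
  thus "a \<in> Wk k" using mem[OF a(1), of "x * g" k] by (simp add: algebra_simps)
 qed
 have strict: "Wk (Suc k) ~= Wk k" if "k \<le> n" for k
 proof
  assume "Wk (Suc k) = Wk k"
  moreover have "g ^ k \<in> Wk k" using mem[OF i(1), of 1 k] by simp
  ultimately have "g ^ k \<in> Wk (Suc k)" by simp
  then obtain w x where w: "w \<in> W" "g ^ k = w + x * g ^ Suc k" unfolding Wk_def by blast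
  have "(1 - x * g) $ 0 $ 0 ~= 0" using assms(3) by simp
  then obtain y where y: "1 = (1 - x * g) * y" using fps2_unit by blast
  have "w = g ^ k * (1 - x * g)" using w(2) by (simp add: algebra_simps)
  hence "w * y = g ^ k" using y by (metis mult.assoc mult.right_neutral)
  hence "g ^ k \<in> W" using i(4)[OF w(1), of y] by simp
  hence "g ^ (n - k) * g ^ k \<in> W" by (rule i(3))
  thus False using nW that by (simp flip: power_add)
 qed
 have ex: "\<exists>d. cdim (Wk k) d \<and> d \<le> n" for k
 proof -
  obtain n' m where "n' + m = n" "cdim (Wk k) m"
   using codim_split[OF assms(2) ideal_subsp[OF assms(1)] ideal_subsp[OF Wk] subsp_UNIV(2) WW subset_UNIV] by blast
  thus ?thesis by auto
 qed
 have "\<exists>d\<ge>k. cdim (Wk k) d" if "k \<le> Suc n" for k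
  using that
 proof (induction k)
  case 0
  thus ?case using ex[of 0] by auto
 next
  case (Suc k)
  then obtain d where d: "d \<ge> k" "cdim (Wk k) d" by auto
  obtain d' where d': "cdim (Wk (Suc k)) d'" using ex by blast
  obtain n' m' where nm: "n' + m' = d'" "codim sc2 (Wk k) (Wk (Suc k)) n'" "cdim (Wk k) m'"
   using codim_split[OF d' ideal_subsp[OF Wk] ideal_subsp[OF Wk] subsp_UNIV(2) dec subset_UNIV] by blast
  have "m' = d" using cdim_unique[OF nm(3) d(2) Wk] .
  moreover have "n' ~= 0"
  proof
   assume "n' = 0"
   hence "Wk k \<subseteq> Wk (Suc k)" using nm(2) codim_0_iff[OF ideal_subsp[OF Wk]] by metis
   thus False using strict[of k] dec[of k] Suc.prems by auto
  qed
  ultimately show ?case using d' d nm by (intro exI[of _ d']) auto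
 qed
 then obtain d where d: "d \<ge> Suc n" "cdim (Wk (Suc n)) d" by blast
 obtain d' where d': "cdim (Wk (Suc n)) d'" "d' \<le> n" using ex by blast
 show False using cdim_unique[OF d(2) d'(1) Wk] d(1) d'(2) by simp
qed

lemma smooth_idl2_iff:
 assumes "smooth_at a E"
 shows "x \<in> idl2 a H \<longleftrightarrow> E H dvd E x"
proof
 note d = smooth_atD[OF assms(1)]
 interpret comm_ring_hom E by (rule d(1))
 {
  assume "E H dvd E x"
  then obtain g where g: "E x = E H * g" by (rule dvdE)
  obtain y where "E y = g" using d(3) by blast
  hence "E (x - y * H) = 0" using g by (simp add: hom_minus hom_mult)
  hence "a dvd x - y * H" using d(4) by blast
  then obtain z where "x - y * H = a * z" by (rule dvdE)
  hence "x = z * a + y * H" by (simp add: algebra_simps)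
  thus "x \<in> idl2 a H" unfolding idl2_def by blast
 }
 assume "x \<in> idl2 a H"
 then obtain u v where "x = u * a + v * H" unfolding idl2_def by blast
 thus "E H dvd E x" by (simp add: hom_add hom_mult d(7))
qed

lemma is_deriv_dudv: "is_deriv du" "is_deriv dv"
proof -
 show "is_deriv dv" unfolding is_deriv_def dv_def by simp
 show "is_deriv du" unfolding is_deriv_def
 proof (intro conjI allI)
  show "du (x + y) = du x + du y" for x y by (rule fps_ext) (simp add: du_def)
  show "du (x * y) = du x * y + x * du y" for x y
   by (rule fps_ext) (simp add: du_def fps_mult_nth fps_deriv_sum sum.distrib)
 qed
qed

lemma subdegree_fps_deriv: "g $ 0 = 0 ==> g ~= 0 ==> fps_deriv g ~= 0 \<and> Suc (subdegree (fps_deriv g)) = subdegree g"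
 for g :: "complex fps"
proof -
 assume g: "g $ 0 = 0" "g ~= 0"
 hence "subdegree g > 0" by (metis nth_subdegree_nonzero not_gr_zero)
 then obtain m where m: "subdegree g = Suc m" by (cases "subdegree g") auto
 have "fps_deriv g $ m ~= 0" using nth_subdegree_nonzero[OF g(2)] m by (simp del: of_nat_Suc)
 moreover have "fps_deriv g $ i = 0" if "i < m" for i
 proof -
  have "g $ (i + 1) = 0" by (rule nth_less_subdegree_zero) (use m that in simp)
  thus ?thesis by simp
 qed
 ultimately have "subdegree (fps_deriv g) = m" by (intro subdegreeI)
 moreover have "fps_deriv g ~= 0" using \<open>fps_deriv g $ m ~= 0\<close> by (metis fps_zero_nth)
 ultimately show ?thesis using m by (intro conjI) (assumption, linarith)
qed

text \<open>
 The curve \<open>q = 0\<close> is the smooth branch \<open>s \<mapsto> (s, b(s))\<close>; \<open>E\<close> is the restriction to it and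
 \<open>i\<close> the intersection number with \<open>f = 0\<close>.
\<close>

locale smooth_branch =
 fixes b :: "complex fps" and q Y f :: fps2
 assumes b0: "b $ 0 = 0" and qY: "q = Y * lin b" and Y0: "Y $ 0 $ 0 ~= 0"
  and f0: "f $ 0 $ 0 = 0" and Ef: "ev fps_X b f ~= 0"
  and isolated: "\<And>a c. a $ 0 = 0 ==> c $ 0 = 0 ==> a ~= 0 \<or> c ~= 0 ==> ev a c f = 0 ==>
   ev a c (du f) = 0 ==> ev a c (dv f) ~= 0"
begin

abbreviation "E \<equiv> ev fps_X b"
definition "i = subdegree (E f)"
text \<open>The Jacobian determinant of (f, q). Since \<open>dv q\<close> is a unit, it can replace
  \<open>du f\<close> as a generator of the Jacobian ideal, and on \<open>q = 0\<close> it is that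
  unit times the derivative of \<open>f\<close> along the branch.\<close>

definition "G = dv q * du f - du q * dv f"
definition "c = dv q * f + q * dv f"

lemma Ehom: "comm_ring_hom E" by (rule ev_hom) (use b0 in auto)
sublocale E: comm_ring_hom E by (rule Ehom)

lemma smooth_q: "smooth_at q E"
proof -
 obtain y where y: "1 = Y * y" using fps2_unit[OF Y0] by (rule dvdE)
 have "q dvd F \<longleftrightarrow> lin b dvd F" for F
 proof
  assume "lin b dvd F"
  then obtain k where "F = lin b * k" by (rule dvdE)
  hence "F = (Y * y) * (lin b * k)" using y by simp
  hence "F = q * (y * k)" by (simp add: qY)
  thus "q dvd F" by simp
 qed (auto simp: qY dest: dvd_mult_right)
 thus ?thesis using smooth_at_lin[OF b0] by (simp add: smooth_at_def)
qed

lemmas sq = smooth_atD[OF smooth_q]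

lemma qv0: "dv q $ 0 $ 0 ~= 0"
proof -
 have "dv (lin b) = 1" by (rule fps_ext) (simp add: dv_def lin_def V_def)
 hence "dv q = dv Y * lin b + Y" unfolding qY using is_derivD(2)[OF is_deriv_dudv(2), of Y "lin b"] by simp
 moreover have "lin b $ 0 $ 0 = 0" using b0 by (simp add: lin_def V_def)
 ultimately show ?thesis using Y0 by simp
qed

lemma qv_inverse: obtains z where "dv q * z = 1"
 using fps2_unit[OF qv0] by (metis dvdE)

lemma Eqv: "E (dv q) $ 0 ~= 0" using qv0 by (simp add: ev_nth_0)

lemma Eqv_nz: "E (dv q) ~= 0" using Eqv by auto

lemma E_deriv: "fps_deriv (E F) = E (du F) + E (dv F) * fps_deriv b"
 using ev_chain_rule[of fps_X b F] b0 by simp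

lemma E_tangent: "E (du q) + E (dv q) * fps_deriv b = 0"
 using E_deriv[of q] sq(7) by simp

lemma i_pos: "i > 0"
 using Ef f0 unfolding i_def by (metis ev_nth_0 nth_subdegree_nonzero not_gr_zero)

lemma EG: "E G = E (dv q) * fps_deriv (E f)"
proof -
 have "E (du q) = - (E (dv q) * fps_deriv b)" using E_tangent by (simp add: eq_neg_iff_add_eq_0)
 thus ?thesis by (simp add: G_def E.hom_minus E.hom_mult E_deriv algebra_simps)
qed

lemma EG': "E G ~= 0" "subdegree (E G) = i - 1"
proof -
 have d: "fps_deriv (E f) ~= 0 \<and> Suc (subdegree (fps_deriv (E f))) = subdegree (E f)"
  by (rule subdegree_fps_deriv) (use f0 Ef in "auto simp: ev_nth_0")
 show "E G ~= 0" using d Eqv_nz by (simp add: EG)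
 have "subdegree (E (dv q)) = 0" using Eqv by simp
 moreover have "subdegree (E G) = subdegree (E (dv q)) + subdegree (fps_deriv (E f))"
  unfolding EG using d Eqv_nz by (intro subdegree_mult) auto
 ultimately show "subdegree (E G) = i - 1" using d[THEN conjunct2] unfolding i_def by linarith
qed

lemma Ec: "E c ~= 0" "subdegree (E c) = i"
proof -
 have "E c = E (dv q) * E f" by (simp add: c_def E.hom_add E.hom_mult sq(7))
 moreover have "subdegree (E (dv q)) = 0" using Eqv by simp
 ultimately show "E c ~= 0" "subdegree (E c) = i" using Eqv_nz Ef by (auto simp: i_def)
qed

text \<open>
 On a branch of the polar curve \<open>G = 0\<close> the differentials of \<open>f\<close> and \<open>q\<close> are proportional,
 so that orders of vanishing can be compared by differentiating along the branch.
\<close>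

lemma polar_branch:
 assumes a: "a $ 0 = 0" "d $ 0 = 0" "a ~= 0 \<or> d ~= 0" and G0: "ev a d G = 0"
 shows "ev a d (dv f) ~= 0" "ev a d c ~= 0" "ev a d (q * dv f) ~= 0"
  "subdegree (ev a d c) = subdegree (ev a d (q * dv f))"
proof -
 let ?e = "ev a d"
 interpret e: comm_ring_hom ?e by (rule ev_hom[OF a(1,2)])
 have q0: "?e q $ 0 = 0" "?e f $ 0 = 0" using f0 b0 by (auto simp: ev_nth_0 qY lin_def V_def)
 have qv: "?e (dv q) $ 0 ~= 0" using qv0 by (simp add: ev_nth_0)
 hence qvn: "?e (dv q) ~= 0" by auto
 \<comment> \<open>The branch is not the curve \<open>q = 0\<close> itself, because \<open>G\<close>
   does not vanish identically there.\<close>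
 have qn: "?e q ~= 0"
 proof
  assume "?e q = 0"
  moreover have "?e Y ~= 0" using Y0 by (metis ev_nth_0 fps_zero_nth)
  ultimately have "?e (lin b) = 0" by (simp add: qY e.hom_mult)
  hence d: "d = b oo a" using ev_lin[OF b0 a(2,1)] by simp
  have "E G oo a = ?e G" using ev_compose[of fps_X b a G] a d by simp
  hence "a = 0" using G0 EG'(1) a by (simp add: fps_compose_eq_0_iff)
  thus False using d a by simp
 qed
 have G0': "?e (dv q) * ?e (du f) = ?e (du q) * ?e (dv f)" using G0 by (simp add: G_def e.hom_minus e.hom_mult)
 note ch = ev_chain_rule[OF a(1,2)]
 have 1: "?e (dv q) * fps_deriv (?e f) = fps_deriv (?e q) * ?e (dv f)"
 proof -
  have "?e (dv q) * fps_deriv (?e f) = (?e (dv q) * ?e (du f)) * fps_deriv a + ?e (dv q) * ?e (dv f) * fps_deriv d"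
   by (simp add: ch algebra_simps)
  also have "\<dots> = fps_deriv (?e q) * ?e (dv f)" unfolding G0' by (simp add: ch algebra_simps)
  finally show ?thesis .
 qed
 have dq: "fps_deriv (?e q) ~= 0" "Suc (subdegree (fps_deriv (?e q))) = subdegree (?e q)"
  using subdegree_fps_deriv[OF q0(1) qn] by auto
 have fn: "?e f ~= 0"
 proof
  assume f: "?e f = 0"
  hence fv: "?e (dv f) = 0" using 1 dq by simp
  hence "?e (du f) = 0" using G0' qvn by simp
  thus False using isolated[OF a f] fv by blast
 qed
 have df: "fps_deriv (?e f) ~= 0" "Suc (subdegree (fps_deriv (?e f))) = subdegree (?e f)"
  using subdegree_fps_deriv[OF q0(2) fn] by auto
 show fv: "?e (dv f) ~= 0" using 1 df qvn by auto
 have sqv: "subdegree (?e (dv q)) = 0" using qv by simp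
 have "subdegree (fps_deriv (?e f)) = subdegree (fps_deriv (?e q)) + subdegree (?e (dv f))"
  using arg_cong[OF 1, of subdegree] sqv qvn df dq fv by simp
 hence 2: "subdegree (?e f) = subdegree (?e q) + subdegree (?e (dv f))" using dq df by simp
 show "?e (q * dv f) ~= 0" using qn fv by (simp add: e.hom_mult)
 \<comment> \<open>Along the branch q_v d(q f) = c dq, so the order of \<open>c\<close> is that of q
   f minus that of q, which is the order of \<open>f\<close>.\<close>
 have "?e (dv q) * fps_deriv (?e q * ?e f) = ?e q * (?e (dv q) * fps_deriv (?e f)) + ?e (dv q) * fps_deriv (?e q) * ?e f"
  by (simp add: algebra_simps)
 also have "\<dots> = fps_deriv (?e q) * ?e c" unfolding 1 by (simp add: c_def e.hom_add e.hom_mult algebra_simps)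
 finally have 3: "?e (dv q) * fps_deriv (?e q * ?e f) = fps_deriv (?e q) * ?e c" .
 have dqf: "fps_deriv (?e q * ?e f) ~= 0" "Suc (subdegree (fps_deriv (?e q * ?e f))) = subdegree (?e q * ?e f)"
  using subdegree_fps_deriv[of "?e q * ?e f"] q0 qn fn by auto
 show c: "?e c ~= 0" using 3 dqf qvn by auto
 have "subdegree (fps_deriv (?e q * ?e f)) = subdegree (fps_deriv (?e q)) + subdegree (?e c)"
  using arg_cong[OF 3, of subdegree] sqv qvn dqf dq c by simp
 hence "subdegree (?e c) = subdegree (?e f)" using dq dqf qn fn by simp
 thus "subdegree (?e c) = subdegree (?e (q * dv f))" using 2 qn fv by (simp add: e.hom_mult)
qed

lemma jacobian_ideal: "idl2 (du f) (dv f) = idl2 G (dv f)"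
proof (intro subset_antisym idl2_subset idl2_ideal)
 obtain z where z: "dv q * z = 1" by (rule qv_inverse)
 have "du f = (dv q * z) * du f" using z by simp
 also have "\<dots> = z * G + (z * du q) * dv f" by (simp add: G_def algebra_simps)
 finally show "du f \<in> idl2 G (dv f)" unfolding idl2_def by blast
 have "G = dv q * du f + (- du q) * dv f" by (simp add: G_def)
 thus "G \<in> idl2 (du f) (dv f)" unfolding idl2_def by blast
qed (rule idl_gens)+

lemma G_nz: "G ~= 0" using EG'(1) by auto

lemma milnor_finite: "\<exists>mu. cdim (idl2 (du f) (dv f)) mu"
 unfolding jacobian_ideal using branch_cdim[OF G_nz, of "dv f" "dv f"] polar_branch(1) by blast

lemma d_prod: "du (f * q) = du f * q + f * du q" "dv (f * q) = c"
 using is_derivD(2)[OF is_deriv_dudv(1), of f q] is_derivD(2)[OF is_deriv_dudv(2), of f q]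
 by (auto simp: c_def)

lemma jacobian_ideal_prod: "idl2 (du (f * q)) (dv (f * q)) = idl2 (q * G) c"
proof (intro subset_antisym idl2_subset idl2_ideal)
 obtain z where z: "dv q * z = 1" by (rule qv_inverse)
 have *: "q * G = dv q * du (f * q) - du q * c" by (simp add: d_prod G_def c_def algebra_simps)
 have "du (f * q) = (dv q * z) * du (f * q)" using z by simp
 also have "\<dots> = z * (q * G) + (z * du q) * c" unfolding * by (simp add: algebra_simps)
 finally show "du (f * q) \<in> idl2 (q * G) c" unfolding idl2_def by blast
 show "dv (f * q) \<in> idl2 (q * G) c" unfolding d_prod by (rule idl_gens)
 have "q * G = dv q * du (f * q) + (- du q) * dv (f * q)" using * by (simp add: d_prod)
 thus "q * G \<in> idl2 (du (f * q)) (dv (f * q))" unfolding idl2_def by blast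
 show "c \<in> idl2 (du (f * q)) (dv (f * q))" using idl_gens(5) d_prod(2) by metis
qed

text \<open>The Jacobian ideal of f q is (q G, c). Splitting off \<open>q\<close> contributes
  \<open>i\<close> and leaves (G, c). On the polar curve \<open>c\<close> has the same orders as q
  f_v, so \<open>q\<close> can be split off again: this contributes \<open>i - 1\<close> and leaves
  the Jacobian ideal (G, f_v) of \<open>f\<close>.\<close>

theorem milnor_prod:
 assumes "cdim (idl2 (du f) (dv f)) mu"
 shows "cdim (idl2 (du (f * q)) (dv (f * q))) (mu + 2 * i - 1)"
proof -
 obtain m where m: "cdim (idl2 G c) m" "cdim (idl2 G (q * dv f)) m"
  using branch_cdim[OF G_nz, of c "q * dv f"] polar_branch(2,3,4) by blast
 have "cdim (idl2 (q * dv f) G) ((i - 1) + mu)"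
 proof (rule cdim_mult[OF sq(6)[OF EG'(1)] sq(5)])
  show "cdim (idl2 q G) (i - 1)" using cdim_smooth[OF smooth_q EG'(1)] EG'(2) by simp
  show "cdim (idl2 (dv f) G) mu" using assms jacobian_ideal idl2_commute by metis
 qed
 hence "m = (i - 1) + mu" using cdim_unique[OF m(2) _ idl2_ideal] idl2_commute by metis
 moreover have "cdim (idl2 (q * G) c) (i + m)"
 proof (rule cdim_mult[OF sq(6)[OF Ec(1)] sq(5) _ m(1)])
  show "cdim (idl2 q c) i" using cdim_smooth[OF smooth_q Ec(1)] Ec(2) by simp
 qed
 moreover have "i + m = mu + 2 * i - 1" using calculation(1) i_pos by simp
 ultimately show ?thesis unfolding jacobian_ideal_prod by simp
qed

definition log_der :: "fps2 => fps2 => bool" where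
 "log_der al bt \<longleftrightarrow> f dvd al * du f + bt * dv f"

definition r :: nat where
 "r = (LEAST n. \<exists>al bt. log_der al bt \<and> E (al * du q + bt * dv q) ~= 0 \<and> n = subdegree (E (al * du q + bt * dv q)))"

text \<open>The Hamiltonian field of \<open>f\<close> annihilates \<open>f\<close> and maps
  \<open>q\<close> to \<open>G\<close>. So the minimum defining \<open>r\<close> is over a nonempty
  set, and it is at most i - 1.\<close>

lemma hamiltonian: "log_der (- dv f) (du f)" "E (- dv f * du q + du f * dv q) = E G"
 by (simp_all add: log_der_def G_def algebra_simps)

lemma log_der_order:
 assumes "log_der al bt"
 shows "fps_X ^ r dvd E (al * du q + bt * dv q)"
proof (cases "E (al * du q + bt * dv q) = 0")
 case False
 hence "r \<le> subdegree (E (al * du q + bt * dv q))" unfolding r_def by (intro Least_le) (use assms in blast)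
 thus ?thesis using False by (simp add: fps_dvd_iff)
qed simp

lemma r_le: "r \<le> i - 1"
 unfolding r_def by (rule Least_le) (use hamiltonian EG' in metis)

lemma log_der_attained:
 obtains al bt where "log_der al bt" "E (al * du q + bt * dv q) = fps_X ^ r"
proof -
 let ?P = "\<lambda>n. \<exists>al bt. log_der al bt \<and> E (al * du q + bt * dv q) ~= 0 \<and> n = subdegree (E (al * du q + bt * dv q))"
 have "?P (subdegree (E G))" using hamiltonian EG' by metis
 hence "?P r" unfolding r_def by (rule LeastI)
 then obtain al bt where ab: "log_der al bt" "E (al * du q + bt * dv q) ~= 0" "r = subdegree (E (al * du q + bt * dv q))"
  by blast
 hence "E (al * du q + bt * dv q) dvd fps_X ^ r" by (simp add: fps_dvd_iff)
 then obtain g where g: "fps_X ^ r = E (al * du q + bt * dv q) * g" by (rule dvdE)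
 obtain h where h: "E h = g" using sq(3) by blast
 show thesis
 proof (rule that[of "h * al" "h * bt"])
  have "h * al * du f + h * bt * dv f = h * (al * du f + bt * dv f)" by (simp add: algebra_simps)
  thus "log_der (h * al) (h * bt)" using ab(1) by (simp add: log_der_def)
  have "h * al * du q + h * bt * dv q = h * (al * du q + bt * dv q)" by (simp add: algebra_simps)
  thus "E (h * al * du q + h * bt * dv q) = fps_X ^ r" using g h by (simp add: E.hom_mult)
 qed
qed

text \<open>Two inclusions of ideals. First \<open>A\<close> \<subseteq> (q, f), where (q, f) has
  codimension i and the quotient is R/W' by multiplication with \<open>q\<close>. Then
  \<open>W'\<close> \<subseteq> \<open>J\<close>, where \<open>J\<close> is the Tjurina ideal of
  \<open>f\<close> and the quotient has dimension \<open>r\<close>. The sum is ta + r + i.\<close>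

theorem tjurina_prod:
 assumes "cdim (idl3 (du f) (dv f) f) ta"
 shows "cdim (idl3 (du (f * q)) (dv (f * q)) (f * q)) (ta + i + r)"
proof -
 obtain z where z: "dv q * z = 1" by (rule qv_inverse)
 have zE: "E (dv q) * E z = 1" using arg_cong[OF z, of E] by (simp add: E.hom_mult)
 define A where "A = idl3 (q * G) c (q * f)"
 define W' where "W' = idl3 G (q * dv f) f"
 define J where "J = idl3 G (dv f) f"
 have J: "idl3 (du f) (dv f) f = J"
  unfolding J_def
 proof (intro subset_antisym idl3_subset idl3_ideal)
  have "du f = (dv q * z) * du f" using z by simp
  also have "\<dots> = z * G + (z * du q) * dv f + 0 * f" by (simp add: G_def algebra_simps)
  finally show "du f \<in> idl3 G (dv f) f" unfolding idl3_def by blast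
  have "G = dv q * du f + (- du q) * dv f + 0 * f" by (simp add: G_def)
  thus "G \<in> idl3 (du f) (dv f) f" unfolding idl3_def by blast
 qed (rule idl_gens)+
 have A: "idl3 (du (f * q)) (dv (f * q)) (f * q) = A"
  unfolding A_def
 proof (intro subset_antisym idl3_subset idl3_ideal)
  have *: "q * G = dv q * du (f * q) - du q * c" by (simp add: d_prod G_def c_def algebra_simps)
  have "du (f * q) = (dv q * z) * du (f * q)" using z by simp
  also have "\<dots> = z * (q * G) + (z * du q) * c + 0 * (q * f)" unfolding * by (simp add: algebra_simps)
  finally show "du (f * q) \<in> idl3 (q * G) c (q * f)" unfolding idl3_def by blast
  show "dv (f * q) \<in> idl3 (q * G) c (q * f)" unfolding d_prod by (rule idl_gens)
  show "f * q \<in> idl3 (q * G) c (q * f)" by (metis idl_gens(3) mult.commute)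
  have "q * G = dv q * du (f * q) + (- du q) * dv (f * q) + 0 * (f * q)" using * by (simp add: d_prod)
  thus "q * G \<in> idl3 (du (f * q)) (dv (f * q)) (f * q)" unfolding idl3_def by blast
  show "c \<in> idl3 (du (f * q)) (dv (f * q)) (f * q)" using idl_gens(2) d_prod(2) by metis
  show "q * f \<in> idl3 (du (f * q)) (dv (f * q)) (f * q)" by (metis idl_gens(3) mult.commute)
 qed
 have sub1: "W' \<subseteq> J" unfolding W'_def J_def
  by (intro idl3_subset idl3_ideal idl_gens is_idealD(3)[OF idl3_ideal])
 have cE: "c \<in> idl2 q f"
 proof -
  have "c = dv f * q + dv q * f" by (simp add: c_def)
  thus ?thesis unfolding idl2_def by blast
 qed
 have sub2: "A \<subseteq> idl2 q f" unfolding A_def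
  by (intro idl3_subset idl2_ideal cE is_idealD(4)[OF idl2_ideal] idl_gens)
 obtain h where h: "E h = fps_X ^ r" using sq(3) by blast
 have "cdim (idl2 q h) r" using cdim_smooth[OF smooth_q, of h] h by simp
 \<comment> \<open>Multiplication by f_v identifies R/(q, h) with J/W'. A relation placing f_v x in
   \<open>W'\<close> amounts to a logarithmic derivation whose value on \<open>q\<close> restricts
   to x q_v on the branch, so x must vanish there to order \<open>r\<close>.\<close>
 moreover have "cdim (idl2 q h) r \<longleftrightarrow> codim sc2 J W' r"
 proof (rule codim_map[where T = "\<lambda>x. dv f * x"])
  show "range ((*) (dv f)) \<subseteq> J" unfolding J_def using is_idealD(4)[OF idl3_ideal idl_gens(2)] by blast
  fix x
  show "dv f * x \<in> W' \<longleftrightarrow> x \<in> idl2 q h"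
  proof
   assume "dv f * x \<in> W'"
   then obtain ze y w where e: "dv f * x = ze * G + y * (q * dv f) + w * f" unfolding W'_def idl3_def by blast
   have "(- ze * dv q) * du f + (x - q * y + ze * du q) * dv f = f * w"
    using e by (simp add: G_def algebra_simps)
   hence "log_der (- ze * dv q) (x - q * y + ze * du q)" by (simp add: log_der_def)
   from log_der_order[OF this]
   have "fps_X ^ r dvd E ((- ze * dv q) * du q + (x - q * y + ze * du q) * dv q)" .
   also have "(- ze * dv q) * du q + (x - q * y + ze * du q) * dv q = (x - q * y) * dv q" by (simp add: algebra_simps)
   also have "E \<dots> = E x * E (dv q)" by (simp add: E.hom_mult E.hom_minus sq(7))
   finally have "fps_X ^ r dvd E x * E (dv q)" .
   hence "fps_X ^ r dvd (E x * E (dv q)) * E z" by simp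
   also have "(E x * E (dv q)) * E z = E x" using zE by simp
   finally show "x \<in> idl2 q h" using smooth_idl2_iff[OF smooth_q] h by simp
  next
   assume "x \<in> idl2 q h"
   hence "fps_X ^ r dvd E x" using smooth_idl2_iff[OF smooth_q] h by simp
   then obtain g where g: "E x = fps_X ^ r * g" by (rule dvdE)
   obtain al bt where ab: "log_der al bt" "E (al * du q + bt * dv q) = fps_X ^ r" by (rule log_der_attained)
   obtain k where k: "E k = g * E (dv q)" using sq(3) by blast
   have "E (x * dv q - k * (al * du q + bt * dv q)) = 0" using ab g k by (simp add: E.hom_mult E.hom_minus)
   hence "q dvd x * dv q - k * (al * du q + bt * dv q)" using sq(4) by blast
   then obtain y where y: "x * dv q - k * (al * du q + bt * dv q) = q * y" by (rule dvdE)
   obtain w where w: "al * du f + bt * dv f = f * w" using ab(1) unfolding log_der_def by (rule dvdE)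
   have "dv f * x = dv f * (x * dv q) * z" using z by (metis mult.assoc mult.right_neutral)
   also have "x * dv q = q * y + k * (al * du q + bt * dv q)" using y by (simp add: algebra_simps)
   also have "dv f * (q * y + k * (al * du q + bt * dv q)) * z
     = (- k * al * z) * G + (y * z) * (q * dv f) + (z * k * dv q) * (al * du f + bt * dv f)"
    by (simp add: G_def algebra_simps)
   also have "\<dots> = (- k * al * z) * G + (y * z) * (q * dv f) + (z * k * dv q * w) * f" unfolding w by simp
   finally show "dv f * x \<in> W'" unfolding W'_def idl3_def by blast
  qed
 next
  fix y assume "y \<in> J"
  then obtain p x w where "y = p * G + x * dv f + w * f" unfolding J_def idl3_def by blast
  hence "y - dv f * x = p * G + 0 * (q * dv f) + w * f" by simp
  thus "\<exists>x\<in>UNIV. y - dv f * x \<in> W'" unfolding W'_def idl3_def by blast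
 qed (use sub1 in "auto simp: W'_def J_def intro: subsp_UNIV ideal_subsp idl3_ideal lin_on_mult")
 ultimately have "codim sc2 J W' r" by simp
 hence W'dim: "cdim W' (r + ta)"
  by (intro codim_add[OF _ _ _ sub1 subset_UNIV]) (use assms J in "auto simp: W'_def J_def intro: subsp_UNIV ideal_subsp idl3_ideal")
 have "cdim W' (r + ta) \<longleftrightarrow> codim sc2 (idl2 q f) A (r + ta)"
 proof (rule codim_map[where T = "\<lambda>x. q * x"])
  show "range ((*) q) \<subseteq> idl2 q f" using is_idealD(4)[OF idl2_ideal idl_gens(4)] by blast
  fix x
  show "q * x \<in> A \<longleftrightarrow> x \<in> W'"
  proof
   assume "q * x \<in> A"
   then obtain y ze w where e: "q * x = y * (q * G) + ze * c + w * (q * f)" unfolding A_def idl3_def by blast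
   have "ze * c = q * (x - y * G - w * f)" using e by (simp add: algebra_simps)
   hence "q dvd ze * c" by simp
   hence "q dvd ze" by (rule sq(6)[OF Ec(1)])
   then obtain ze' where z': "ze = q * ze'" by (rule dvdE)
   have "q * x = q * (y * G + ze' * (q * dv f) + (w + ze' * dv q) * f)" using e by (simp add: z' c_def algebra_simps)
   hence "x = y * G + ze' * (q * dv f) + (w + ze' * dv q) * f" using sq(5) by (metis mult_cancel_left)
   thus "x \<in> W'" unfolding W'_def idl3_def by blast
  next
   assume "x \<in> W'"
   then obtain y ze w where "x = y * G + ze * (q * dv f) + w * f" unfolding W'_def idl3_def by blast
   hence "q * x = y * (q * G) + (q * ze) * c + (w - ze * dv q) * (q * f)" by (simp add: c_def algebra_simps)
   thus "q * x \<in> A" unfolding A_def idl3_def by blast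
  qed
 next
  fix y assume "y \<in> idl2 q f"
  then obtain u v where y: "y = u * q + v * f" unfolding idl2_def by blast
  have "f = (dv q * z) * f" using z by simp
  hence f: "f = z * (c - q * dv f)" by (simp add: c_def algebra_simps)
  have "y - q * (u - v * z * dv f) = v * f + q * (v * z * dv f)" using y by (simp add: algebra_simps)
  also have "\<dots> = 0 * (q * G) + (v * z) * c + 0 * (q * f)" by (subst f) (simp add: algebra_simps)
  finally show "\<exists>x\<in>UNIV. y - q * x \<in> A" unfolding A_def idl3_def by blast
 qed (use sub2 in "auto simp: W'_def A_def intro: subsp_UNIV ideal_subsp idl3_ideal idl2_ideal lin_on_mult")
 hence "codim sc2 (idl2 q f) A (r + ta)" using W'dim by simp
 moreover have "cdim (idl2 q f) i" using cdim_smooth[OF smooth_q Ef] by (simp add: i_def)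
 ultimately have "cdim A ((r + ta) + i)"
  by (intro codim_add[OF _ _ _ sub2 subset_UNIV]) (auto simp: A_def intro: subsp_UNIV ideal_subsp idl3_ideal idl2_ideal)
 thus ?thesis unfolding A by (simp add: algebra_simps)
qed

lemma tjurina_finite: "\<exists>ta. cdim (idl3 (du f) (dv f) f) ta"
proof -
 obtain mu where "cdim (idl2 (du f) (dv f)) mu" using milnor_finite by blast
 moreover have "idl2 (du f) (dv f) \<subseteq> idl3 (du f) (dv f) f" by (intro idl2_subset idl3_ideal idl_gens)
 ultimately show ?thesis
  using codim_split[OF _ ideal_subsp[OF idl2_ideal] ideal_subsp[OF idl3_ideal] subsp_UNIV(2) _ subset_UNIV] by blast
qed

text \<open>The wedge times each partial derivative of \<open>f\<close> is a multiple of
  \<open>f\<close>, and the Jacobian ideal contains powers of \<open>U\<close> and of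
  \<open>V\<close> because the singularity is isolated. These powers are coprime, so
  \<open>f\<close> divides the wedge itself. This is the easy half of Saito's criterion,
  locally.\<close>

lemma log_der_wedge:
 assumes "log_der al bt" "log_der al' bt'"
 shows "f dvd al * bt' - al' * bt"
proof -
 let ?w = "al * bt' - al' * bt"
 obtain mu where mu: "cdim (idl2 (du f) (dv f)) mu" using milnor_finite by blast
 have "?w * du f = bt' * (al * du f + bt * dv f) - bt * (al' * du f + bt' * dv f)" by (simp add: algebra_simps)
 hence 1: "f dvd ?w * du f" using assms by (simp add: log_der_def)
 have "?w * dv f = al * (al' * du f + bt' * dv f) - al' * (al * du f + bt * dv f)" by (simp add: algebra_simps)
 hence 2: "f dvd ?w * dv f" using assms by (simp add: log_der_def)
 have J: "f dvd ?w * x" if "x \<in> idl2 (du f) (dv f)" for x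
 proof -
  obtain u v where "x = u * du f + v * dv f" using \<open>x \<in> _\<close> unfolding idl2_def by blast
  hence "?w * x = u * (?w * du f) + v * (?w * dv f)" by (simp add: algebra_simps)
  thus ?thesis using 1 2 by simp
 qed
 have "U ^ mu \<in> idl2 (du f) (dv f)" "V ^ mu \<in> idl2 (du f) (dv f)"
  by (rule nilpotent_mod_ideal[OF idl2_ideal mu], simp add: U_def V_def)+
 hence "f dvd ?w * U ^ mu" "f dvd ?w * V ^ mu" using J by blast+
 then obtain g1 g2 where g: "?w * U ^ mu = f * g1" "?w * V ^ mu = f * g2" by (metis dvdE)
 have fn: "f ~= 0" using Ef by auto
 have "f * (g1 * V ^ mu) = (?w * U ^ mu) * V ^ mu" unfolding g(1) by (rule mult.assoc[symmetric])
 also have "\<dots> = (?w * V ^ mu) * U ^ mu" by simp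
 also have "\<dots> = f * (g2 * U ^ mu)" unfolding g(2) by (rule mult.assoc)
 finally have "f * (g1 * V ^ mu) = f * (g2 * U ^ mu)" .
 hence eq: "g1 * V ^ mu = U ^ mu * g2" using fn by simp
 interpret e: comm_ring_hom "ev 0 fps_X" by (rule ev_hom) auto
 note sU = smooth_atD[OF smooth_at_U]
 have EV: "ev 0 fps_X (V ^ mu) ~= 0" by (simp add: e.hom_power ev_V)
 have "U ^ n dvd g" if "U ^ n dvd g * V ^ mu" for n g
  using that
 proof (induction n arbitrary: g)
  case (Suc n)
  have "U dvd U ^ Suc n" by simp
  hence "U dvd g * V ^ mu" using Suc.prems by (rule dvd_trans)
  hence "U dvd g" by (rule sU(6)[OF EV])
  then obtain h where h: "g = U * h" by (rule dvdE)
  have "U * U ^ n dvd U * (h * V ^ mu)" using Suc.prems h by simp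
  hence "U ^ n dvd h * V ^ mu" using sU(5) by simp
  hence "U ^ n dvd h" by (rule Suc.IH)
  thus ?case using h by simp
 qed simp
 hence "U ^ mu dvd g1" using eq by (metis dvd_triv_left)
 then obtain k where "g1 = U ^ mu * k" by (rule dvdE)
 hence "U ^ mu * ?w = U ^ mu * (f * k)" using g(1) by simp
 moreover have "U ^ mu ~= 0" using sU(5) by simp
 ultimately have "?w = f * k" by (simp only: mult_cancel_left) simp
 thus ?thesis by (rule dvdI)
qed

text \<open>Wedge the tangent derivation with one that attains the order \<open>r\<close>. Up to a
  unit the wedge restricts to \<open>E al\<close> times a power r of the parameter, and it is
  divisible by \<open>E f\<close>, which has order \<open>i\<close>.\<close>

lemma tangent_order:
 assumes "log_der al bt" "E (al * du q + bt * dv q) = 0"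
 shows "fps_X ^ (i - r) dvd E al"
proof -
 obtain al' bt' where ab: "log_der al' bt'" "E (al' * du q + bt' * dv q) = fps_X ^ r" by (rule log_der_attained)
 have uq: "E (du q) = - (E (dv q) * fps_deriv b)" using E_tangent by (simp add: eq_neg_iff_add_eq_0)
 have "E (dv q) * (E bt - E al * fps_deriv b) = 0"
  using assms(2) by (simp add: E.hom_add E.hom_mult uq)
 hence bt: "E bt = E al * fps_deriv b" using Eqv_nz by simp
 have "E (al * bt' - al' * bt) * E (dv q) = E al * (E al' * E (du q) + E bt' * E (dv q))"
  by (simp add: E.hom_minus E.hom_mult bt uq algebra_simps)
 also have "\<dots> = E al * fps_X ^ r" using ab by (simp add: E.hom_add E.hom_mult)
 finally have e: "E (al * bt' - al' * bt) * E (dv q) = E al * fps_X ^ r" .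
 obtain k where "al * bt' - al' * bt = f * k" using log_der_wedge[OF assms(1) ab(1)] by (rule dvdE)
 hence "E f dvd E al * fps_X ^ r" using e by (metis E.hom_mult dvd_triv_left mult.assoc)
 moreover have "(fps_X :: complex fps) ^ i dvd E f" using Ef by (simp add: fps_dvd_iff i_def)
 ultimately have "(fps_X :: complex fps) ^ i dvd E al * fps_X ^ r" by (rule dvd_trans[rotated])
 moreover have "(fps_X :: complex fps) ^ i = fps_X ^ (i - r) * fps_X ^ r" using r_le by (simp flip: power_add)
 ultimately show ?thesis by simp
qed

end

section \<open>Convergent and formal power series\<close>

lemma convI: "R > 0 ==> (\<And>i j. norm (F $ j $ i) \<le> C * R ^ (i + j)) ==> F \<in> conv"
 unfolding conv_def by blast

lemma convE:
 assumes "F \<in> conv"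
 obtains C R where "C \<ge> 0" "R \<ge> 1" "\<And>i j. norm (F $ j $ i) \<le> C * R ^ (i + j)"
proof -
 obtain C R where CR: "R > 0" "\<And>i j. norm (F $ j $ i) \<le> C * R ^ (i + j)" using assms unfolding conv_def by blast
 have C: "C \<ge> 0" using order_trans[OF norm_ge_zero CR(2)[of 0 0]] by simp
 have "norm (F $ j $ i) \<le> C * (max R 1) ^ (i + j)" for i j
 proof -
  have "R ^ (i + j) \<le> (max R 1) ^ (i + j)" using CR(1) by (intro power_mono) auto
  thus ?thesis using CR(2)[of j i] C mult_left_mono[of "R ^ (i + j)" "(max R 1) ^ (i + j)" C] by linarith
 qed
 thus thesis using that[of C "max R 1"] C by simp
qed

lemma conv2E:
 assumes "F \<in> conv" "G \<in> conv"
 obtains C D M where "C \<ge> 0" "D \<ge> 0" "M \<ge> 1" "\<And>i j. norm (F $ j $ i) \<le> C * M ^ (i + j)" "\<And>i j. norm (G $ j $ i) \<le> D * M ^ (i + j)"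
proof -
 obtain C R where F: "C \<ge> 0" "R \<ge> 1" "\<And>i j. norm (F $ j $ i) \<le> C * R ^ (i + j)" using convE[OF assms(1)] by metis
 obtain D T where G: "D \<ge> 0" "T \<ge> 1" "\<And>i j. norm (G $ j $ i) \<le> D * T ^ (i + j)" using convE[OF assms(2)] by metis
 have "C * R ^ n \<le> C * (max R T) ^ n" "D * T ^ n \<le> D * (max R T) ^ n" for n
  using F G by (auto intro!: mult_left_mono power_mono)
 thus thesis using F G by (intro that[of C D "max R T"] order_trans[OF F(3)] order_trans[OF G(3)]) auto
qed

lemma conv_add:
 assumes "F \<in> conv" "G \<in> conv"
 shows "F + G \<in> conv"
proof -
 obtain C D M where M: "C \<ge> 0" "D \<ge> 0" "M \<ge> 1" "\<And>i j. norm (F $ j $ i) \<le> C * M ^ (i + j)" "\<And>i j. norm (G $ j $ i) \<le> D * M ^ (i + j)"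
  by (rule conv2E[OF assms], rule that)
 have "norm ((F + G) $ j $ i) \<le> (C + D) * M ^ (i + j)" for i j
  using M(4,5)[of j i] norm_triangle_ineq[of "F $ j $ i" "G $ j $ i"] by (simp add: distrib_right)
 thus ?thesis using M(3) by (intro convI[of M]) auto
qed

lemma fps2_mult_nth: "(F * G) $ j $ i = (\<Sum>b=0..j. \<Sum>a=0..i. F $ b $ a * G $ (j - b) $ (i - a))" for F G :: fps2
 by (simp add: fps_mult_nth fps_sum_nth)

lemma conv_mult:
 assumes "F \<in> conv" "G \<in> conv"
 shows "F * G \<in> conv"
proof -
 obtain C D M where M: "C \<ge> 0" "D \<ge> 0" "M \<ge> 1" "\<And>i j. norm (F $ j $ i) \<le> C * M ^ (i + j)" "\<And>i j. norm (G $ j $ i) \<le> D * M ^ (i + j)"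
  by (rule conv2E[OF assms], rule that)
 have bd: "norm (F $ b $ a * G $ (j - b) $ (i - a)) \<le> C * D * M ^ (i + j)" if "b \<le> j" "a \<le> i" for a b i j
 proof -
  have "norm (F $ b $ a) * norm (G $ (j - b) $ (i - a)) \<le> (C * M ^ (a + b)) * (D * M ^ ((i - a) + (j - b)))"
   using M by (intro mult_mono) auto
  also have "\<dots> = C * D * M ^ ((a + b) + ((i - a) + (j - b)))" by (simp only: power_add mult_ac)
  also have "(a + b) + ((i - a) + (j - b)) = i + j" using that by simp
  finally show ?thesis by (simp add: norm_mult)
 qed
 have le2: "real (n + 1) \<le> 2 ^ n" for n by (induction n) auto
 show ?thesis
 proof (rule convI[of "2 * M"])
  fix i j
  have "norm ((F * G) $ j $ i) \<le> (\<Sum>b=0..j. \<Sum>a=0..i. norm (F $ b $ a * G $ (j - b) $ (i - a)))"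
   unfolding fps2_mult_nth by (rule order_trans[OF norm_sum sum_mono[OF norm_sum]])
  also have "\<dots> \<le> (\<Sum>b=0..j. \<Sum>a=0..i. C * D * M ^ (i + j))" by (intro sum_mono bd) auto
  also have "\<dots> = (real (j + 1) * real (i + 1)) * (C * D * M ^ (i + j))" by simp
  also have "\<dots> \<le> (2 ^ j * 2 ^ i) * (C * D * M ^ (i + j))"
   using M by (intro mult_right_mono mult_mono le2) auto
  also have "\<dots> = C * D * (2 * M) ^ (i + j)" by (simp add: power_add)
  finally show "norm ((F * G) $ j $ i) \<le> C * D * (2 * M) ^ (i + j)" .
 qed (use M in auto)
qed

lemma conv_finite_support:
 assumes "\<And>i j. i \<ge> N \<or> j \<ge> N ==> F $ j $ i = 0"
 shows "F \<in> conv"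
proof (rule convI[of 1])
 fix i j
 show "norm (F $ j $ i) \<le> (\<Sum>b<N. \<Sum>a<N. norm (F $ b $ a)) * 1 ^ (i + j)"
 proof (cases "i < N \<and> j < N")
  case True
  have "norm (F $ j $ i) \<le> (\<Sum>a<N. norm (F $ j $ a))" using True by (intro member_le_sum) auto
  also have "\<dots> \<le> (\<Sum>b<N. \<Sum>a<N. norm (F $ b $ a))"
   using True by (intro member_le_sum[of j "{..<N}" "\<lambda>b. \<Sum>a<N. norm (F $ b $ a)"]) (auto intro: sum_nonneg)
  finally show ?thesis by simp
 next
  case False
  thus ?thesis using assms[of i j] by (auto intro!: sum_nonneg)
 qed
qed simp

lemma conv_gens: "const2 c \<in> conv" "U \<in> conv" "V \<in> conv" "1 \<in> conv" "0 \<in> conv"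
 by (rule conv_finite_support[of 2], auto simp: const2_def U_def V_def fps_X_def)+

lemma conv_minus: "F \<in> conv ==> - F \<in> conv" "F \<in> conv ==> G \<in> conv ==> F - G \<in> conv"
proof -
 have m: "- F \<in> conv" if F: "F \<in> conv" for F
 proof -
  obtain C R where "C \<ge> 0" "R \<ge> 1" "\<And>i j. norm (F $ j $ i) \<le> C * R ^ (i + j)" using convE[OF F] by metis
  thus ?thesis by (intro convI[of R _ C]) auto
 qed
 show "F \<in> conv ==> - F \<in> conv" "F \<in> conv ==> G \<in> conv ==> F - G \<in> conv"
  using m conv_add[of F "- G"] by auto
qed

lemma conv_power: "F \<in> conv ==> F ^ n \<in> conv"
 by (induction n) (auto intro: conv_gens conv_mult)

lemma conv_inverse:
 assumes "H \<in> conv" "H $ 0 $ 0 = 0"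
 obtains K where "K \<in> conv" "(1 - H) * K = 1"
proof -
 have "(1 - H) $ 0 $ 0 ~= 0" using assms(2) by simp
 then obtain K where K: "1 = (1 - H) * K" using fps2_unit by blast
 obtain C R where CR: "C \<ge> 0" "R \<ge> 1" "\<And>i j. norm (H $ j $ i) \<le> C * R ^ (i + j)" using convE[OF assms(1)] by metis
 \<comment> \<open>So small that C ((1 + 2 rh)^2 - 1) \<le> 6 C rh \<le> 1, where 1 + 2 rh bounds
   the geometric sums. Then the recursion K = 1 + H K preserves the bound S^(i + j).\<close>
 define rh where "rh = 1 / (6 * C + 2)"
 define S where "S = R / rh"
 have rh: "rh > 0" "rh \<le> 1 / 2" "6 * C * rh \<le> 1" using CR by (auto simp: rh_def)
 have RS: "R = rh * S" using rh by (simp add: S_def)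
 have S: "S > 0" using CR rh by (simp add: S_def)
 have geo: "(\<Sum>a=0..n. rh ^ a) \<le> 1 + 2 * rh" for n
 proof (induction n)
  case (Suc n)
  have "(\<Sum>a=0..Suc n. rh ^ a) = 1 + rh * (\<Sum>a=0..n. rh ^ a)"
   by (simp only: sum.atLeast0_atMost_Suc_shift sum_distrib_left) simp
  also have "\<dots> \<le> 1 + rh * (1 + 2 * rh)" using Suc rh by (intro add_left_mono mult_left_mono) auto
  also have "\<dots> \<le> 1 + rh * 2" using rh by (intro add_left_mono mult_left_mono) auto
  finally show ?case by simp
 qed (use rh in auto)
 have bound: "norm (K $ j $ i) \<le> S ^ (i + j)" for i j
 proof (induction "i + j" arbitrary: i j rule: less_induct)
  case less
  have "K = 1 + H * K" using K by (simp add: algebra_simps)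
  hence "K $ j $ i = (1 :: fps2) $ j $ i + (\<Sum>b=0..j. \<Sum>a=0..i. H $ b $ a * K $ (j - b) $ (i - a))"
   by (metis fps2_mult_nth fps_add_nth)
  show ?case
  proof (cases "i = 0 \<and> j = 0")
   case True
   thus ?thesis using \<open>K $ j $ i = _\<close> assms(2) by simp
  next
   case False
   have trm: "norm (H $ b $ a * K $ (j - b) $ (i - a)) \<le> C * S ^ (i + j) * (rh ^ b * rh ^ a) - (if a = 0 \<and> b = 0 then C * S ^ (i + j) else 0)"
    if "b \<le> j" "a \<le> i" for a b
   proof (cases "a = 0 \<and> b = 0")
    case True
    thus ?thesis using assms(2) by simp
   next
    case F: False
    have "norm (K $ (j - b) $ (i - a)) \<le> S ^ ((i - a) + (j - b))" using F that False by (intro less) auto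
    hence "norm (H $ b $ a) * norm (K $ (j - b) $ (i - a)) \<le> (C * R ^ (a + b)) * S ^ ((i - a) + (j - b))"
     using CR S by (intro mult_mono) auto
    also have "\<dots> = C * (rh ^ b * rh ^ a) * S ^ ((a + b) + ((i - a) + (j - b)))"
     by (simp add: RS power_mult_distrib power_add)
    also have "(a + b) + ((i - a) + (j - b)) = i + j" using that by simp
    finally show ?thesis using F by (auto simp: norm_mult algebra_simps)
   qed
   have "norm (K $ j $ i) = norm (\<Sum>b=0..j. \<Sum>a=0..i. H $ b $ a * K $ (j - b) $ (i - a))"
    using \<open>K $ j $ i = _\<close> False by auto
   also have "\<dots> \<le> (\<Sum>b=0..j. \<Sum>a=0..i. norm (H $ b $ a * K $ (j - b) $ (i - a)))"
    by (rule order_trans[OF norm_sum sum_mono[OF norm_sum]])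
   also have "\<dots> \<le> (\<Sum>b=0..j. \<Sum>a=0..i. C * S ^ (i + j) * (rh ^ b * rh ^ a) - (if a = 0 \<and> b = 0 then C * S ^ (i + j) else 0))"
    by (intro sum_mono trm) auto
   also have "\<dots> = C * S ^ (i + j) * ((\<Sum>b=0..j. rh ^ b) * (\<Sum>a=0..i. rh ^ a)) - C * S ^ (i + j)"
   proof -
    have "(\<Sum>b=0..j. \<Sum>a=0..i. (if a = 0 \<and> b = 0 then C * S ^ (i + j) else 0)) = (\<Sum>b=0..j. if b = 0 then C * S ^ (i + j) else 0)"
     by (rule sum.cong) auto
    moreover have "(\<Sum>b=0..j. \<Sum>a=0..i. C * S ^ (i + j) * (rh ^ b * rh ^ a)) = C * S ^ (i + j) * ((\<Sum>b=0..j. rh ^ b) * (\<Sum>a=0..i. rh ^ a))"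
     unfolding sum_product by (simp only: sum_distrib_left)
    ultimately show ?thesis by (simp add: sum_subtractf)
   qed
   also have "\<dots> \<le> C * S ^ (i + j) * ((1 + 2 * rh) * (1 + 2 * rh)) - C * S ^ (i + j)"
    using CR S rh by (intro diff_right_mono mult_left_mono mult_mono geo) (auto intro!: sum_nonneg)
   also have "\<dots> = S ^ (i + j) * (C * (4 * rh + 4 * rh * rh))" by (simp add: algebra_simps)
   also have "\<dots> \<le> S ^ (i + j) * 1"
   proof (intro mult_left_mono)
    have "4 * rh * rh \<le> 4 * rh * (1 / 2)" using rh by (intro mult_left_mono) auto
    hence "C * (4 * rh + 4 * rh * rh) \<le> C * (6 * rh)" using CR by (intro mult_left_mono) auto
    thus "C * (4 * rh + 4 * rh * rh) \<le> 1" using rh by simp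
   qed (use S in auto)
   finally show ?thesis by simp
  qed
 qed
 have "K \<in> conv" by (rule convI[of S _ 1]) (use S bound in auto)
 thus thesis using that K by metis
qed

text \<open>
 Every series splits as a polynomial plus multiples of \<open>u\<^sup>N\<close> and \<open>v\<^sup>N\<close>; the splitting preserves
 convergence.
\<close>

definition trunc2 :: "nat => fps2 => fps2" where
 "trunc2 N F = Abs_fps (\<lambda>j. Abs_fps (\<lambda>i. if i < N \<and> j < N then F $ j $ i else 0))"
definition upart :: "nat => fps2 => fps2" where
 "upart N F = Abs_fps (\<lambda>j. fps_shift N (F $ j))"
definition vpart :: "nat => fps2 => fps2" where
 "vpart N F = Abs_fps (\<lambda>j. Abs_fps (\<lambda>i. if i < N then F $ (j + N) $ i else 0))"

lemma split2: "F = trunc2 N F + U ^ N * upart N F + V ^ N * vpart N F"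
proof (rule fps_ext, rule fps_ext)
 fix j i
 have "U ^ N = fps_const (fps_X ^ N)" by (simp add: U_def)
 thus "F $ j $ i = (trunc2 N F + U ^ N * upart N F + V ^ N * vpart N F) $ j $ i"
  by (simp add: V_def trunc2_def upart_def vpart_def fps_X_power_mult_nth)
qed

lemma trunc2_conv: "trunc2 N F \<in> conv"
 by (rule conv_finite_support[of N]) (auto simp: trunc2_def)

lemma parts_conv:
 assumes "F \<in> conv"
 shows "upart N F \<in> conv" "vpart N F \<in> conv"
proof -
 obtain C R where CR: "C \<ge> 0" "R \<ge> 1" "\<And>i j. norm (F $ j $ i) \<le> C * R ^ (i + j)" using convE[OF assms] by metis
 have "norm (F $ j $ (i + N)) \<le> (C * R ^ N) * R ^ (i + j)" for i j using CR(3)[of j "i + N"] by (simp add: power_add mult_ac)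
 thus "upart N F \<in> conv" using CR by (intro convI[of R _ "C * R ^ N"]) (auto simp: upart_def)
 have "norm (F $ (j + N) $ i) \<le> (C * R ^ N) * R ^ (i + j)" for i j using CR(3)[of "j + N" i] by (simp add: power_add mult_ac)
 moreover have "0 \<le> (C * R ^ N) * R ^ (i + j)" for i j using CR by simp
 ultimately show "vpart N F \<in> conv" using CR by (intro convI[of R _ "C * R ^ N"]) (auto simp: vpart_def)
qed

lemma conv_split_remainder:
 assumes "F \<in> conv" "F = U ^ N * s + V ^ N * t"
 obtains s' t' where "s' \<in> conv" "t' \<in> conv" "F = U ^ N * s' + V ^ N * t'"
proof -
 have "U ^ N = fps_const (fps_X ^ N)" by (simp add: U_def)
 hence "trunc2 N F = 0" unfolding assms(2) by (intro fps_ext) (simp add: trunc2_def V_def fps_X_power_mult_nth)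
 thus thesis using that[OF parts_conv[OF assms(1)]] split2[of F N] by simp
qed

definition cidl3 :: "fps2 => fps2 => fps2 => fps2 set" where
 "cidl3 A B C = {a * A + b * B + c * C | a b c. a \<in> conv \<and> b \<in> conv \<and> c \<in> conv}"

lemma cidl3_closed:
 shows "x \<in> cidl3 A B C ==> y \<in> cidl3 A B C ==> x + y \<in> cidl3 A B C" "x \<in> cidl3 A B C ==> r \<in> conv ==> r * x \<in> cidl3 A B C"
  "0 \<in> cidl3 A B C"
proof -
 assume "x \<in> cidl3 A B C"
 then obtain a b c where x: "a \<in> conv" "b \<in> conv" "c \<in> conv" "x = a * A + b * B + c * C" unfolding cidl3_def by blast
 {
  assume "y \<in> cidl3 A B C"
  then obtain a' b' c' where y: "a' \<in> conv" "b' \<in> conv" "c' \<in> conv" "y = a' * A + b' * B + c' * C" unfolding cidl3_def by blast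
  have "x + y = (a + a') * A + (b + b') * B + (c + c') * C" using x y by (simp add: algebra_simps)
  thus "x + y \<in> cidl3 A B C"
   unfolding cidl3_def using conv_add[OF x(1) y(1)] conv_add[OF x(2) y(2)] conv_add[OF x(3) y(3)] by blast
 }
 assume "r \<in> conv"
 have "r * x = (r * a) * A + (r * b) * B + (r * c) * C" using x by (simp add: algebra_simps)
 thus "r * x \<in> cidl3 A B C"
  unfolding cidl3_def using conv_mult[OF \<open>r \<in> conv\<close>] x by blast
next
 have "0 = 0 * A + 0 * B + 0 * C" by simp
 thus "0 \<in> cidl3 A B C" unfolding cidl3_def using conv_gens(5) by blast
qed

lemma subsp_conv: "subsp sc2 conv"
 by (auto simp: subsp_def vector_space_sc2 sc2_def conv_gens conv_add conv_mult)

lemma subsp_cidl3: "subsp sc2 (cidl3 A B C)"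
 by (auto simp: subsp_def vector_space_sc2 sc2_def cidl3_closed conv_gens)

lemma cidl3_conv: "A \<in> conv ==> B \<in> conv ==> C \<in> conv ==> cidl3 A B C \<subseteq> conv"
 unfolding cidl3_def by (auto intro!: conv_add conv_mult)

text \<open>An ideal of finite codimension contains high powers of u and v, and a convergent element
  of the formal ideal is a convergent combination up to multiples of such powers. So it suffices to
  place u^n and v^n in the convergent ideal; polynomials then represent all classes.\<close>

lemma codim_conv:
 assumes "A \<in> conv" "B \<in> conv" "C \<in> conv" and n: "cdim (idl3 A B C) n"
 shows "codim sc2 conv (cidl3 A B C) n"
proof -
 let ?I = "cidl3 A B C"
 have red: "\<exists>w s t. w \<in> ?I \<and> s \<in> conv \<and> t \<in> conv \<and> x = w + U ^ N * s + V ^ N * t"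
  if "x \<in> conv" "x \<in> idl3 A B C" for x N
 proof -
  obtain a b c where x: "x = a * A + b * B + c * C" using \<open>x \<in> idl3 A B C\<close> unfolding idl3_def by blast
  define w where "w = trunc2 N a * A + trunc2 N b * B + trunc2 N c * C"
  have w: "w \<in> ?I" unfolding w_def cidl3_def using trunc2_conv by blast
  have sp: "y - trunc2 N y = U ^ N * upart N y + V ^ N * vpart N y" for y using split2[of y N] by (simp add: algebra_simps)
  have "x - w = (a - trunc2 N a) * A + (b - trunc2 N b) * B + (c - trunc2 N c) * C" by (simp add: x w_def algebra_simps)
  hence e: "x - w = U ^ N * (upart N a * A + upart N b * B + upart N c * C) + V ^ N * (vpart N a * A + vpart N b * B + vpart N c * C)"
   unfolding sp
   by (simp add: algebra_simps)
  have "w \<in> conv" using cidl3_conv[OF assms(1-3)] w by blast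
  hence "x - w \<in> conv" using conv_minus that by blast
  then obtain s t where "s \<in> conv" "t \<in> conv" "x - w = U ^ N * s + V ^ N * t" by (rule conv_split_remainder[OF _ e])
  hence "x = w + U ^ N * s + V ^ N * t" by (simp add: algebra_simps)
  thus ?thesis using w \<open>s \<in> conv\<close> \<open>t \<in> conv\<close> by blast
 qed
 have pw: "U ^ n \<in> idl3 A B C" "V ^ n \<in> idl3 A B C"
  by (rule nilpotent_mod_ideal[OF idl3_ideal n], simp add: U_def V_def)+
 \<comment> \<open>Nakayama for (u^n, v^n) by elimination: each power is an element of
   \<open>cidl3 A B C\<close> plus multiples of u^(n+1) and v^(n+1). The resulting 2 x 2 system is
   solved with inverses that are again convergent.\<close>
 obtain w1 s1 t1 where 1: "w1 \<in> ?I" "s1 \<in> conv" "t1 \<in> conv" "U ^ n = w1 + U ^ Suc n * s1 + V ^ Suc n * t1"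
  using red[OF conv_power[OF conv_gens(2)] pw(1), of "Suc n"] by blast
 obtain w2 s2 t2 where 2: "w2 \<in> ?I" "s2 \<in> conv" "t2 \<in> conv" "V ^ n = w2 + U ^ Suc n * s2 + V ^ Suc n * t2"
  using red[OF conv_power[OF conv_gens(3)] pw(2), of "Suc n"] by blast
 have "U * s1 \<in> conv" "(U * s1) $ 0 $ 0 = 0" by (intro conv_mult conv_gens 1) (simp add: U_def)
 then obtain e1 where e1: "e1 \<in> conv" "(1 - U * s1) * e1 = 1" by (rule conv_inverse)
 have "V * t2 \<in> conv" "(V * t2) $ 0 $ 0 = 0" by (intro conv_mult conv_gens 2) (simp add: V_def)
 then obtain e2 where e2: "e2 \<in> conv" "(1 - V * t2) * e2 = 1" by (rule conv_inverse)
 have solve: "x = e * (w + r)" if "x = w + h * x + r" "(1 - h) * e = 1" for x e w r h :: fps2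
  using that by Groebner_Basis.algebra
 have u: "U ^ n = e1 * (w1 + V * t1 * V ^ n)" by (rule solve[OF _ e1(2)]) (use 1(4) in "simp add: mult_ac")
 have v: "V ^ n = e2 * (w2 + U * s2 * U ^ n)" by (rule solve[OF _ e2(2)]) (use 2(4) in "simp add: ac_simps")
 have "e1 * V * t1 * e2 * U * s2 \<in> conv" "(e1 * V * t1 * e2 * U * s2) $ 0 $ 0 = 0"
  by (intro conv_mult conv_gens 1 2 e1 e2) (simp add: V_def U_def)
 then obtain e3 where e3: "e3 \<in> conv" "(1 - e1 * V * t1 * e2 * U * s2) * e3 = 1" by (rule conv_inverse)
 have "U ^ n = e3 * (e1 * w1 + e1 * V * t1 * e2 * w2)"
  by (rule solve[OF _ e3(2)]) (subst u, subst v, simp add: algebra_simps)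
 moreover have "e3 * (e1 * w1 + e1 * V * t1 * e2 * w2) \<in> ?I"
  using 1 2 e1 e2 e3 by (intro cidl3_closed conv_mult conv_gens)
 ultimately have UI: "U ^ n \<in> ?I" by (simp only:)
 have VI: "V ^ n \<in> ?I"
  by (subst v) (use 1 2 e1 e2 UI in "intro cidl3_closed conv_mult conv_gens")
 have iff: "x \<in> idl3 A B C \<longleftrightarrow> x \<in> ?I" if xc: "x \<in> conv" for x
 proof
  assume "x \<in> idl3 A B C"
  then obtain w s t where "w \<in> ?I" "s \<in> conv" "t \<in> conv" "x = w + U ^ n * s + V ^ n * t" using red[OF xc] by blast
  hence "x = w + s * U ^ n + t * V ^ n" by simp
  moreover have "w + s * U ^ n + t * V ^ n \<in> ?I"
   using UI VI \<open>w \<in> ?I\<close> \<open>s \<in> conv\<close> \<open>t \<in> conv\<close> by (intro cidl3_closed)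
  ultimately show "x \<in> ?I" by (simp only:)
 next
  show "x \<in> ?I ==> x \<in> idl3 A B C" unfolding cidl3_def idl3_def by blast
 qed
 have "codim sc2 conv ?I n \<longleftrightarrow> codim sc2 UNIV (idl3 A B C) n"
 proof (rule codim_map[where T = "\<lambda>x. x"])
  fix y :: fps2
  have "y - trunc2 n y = U ^ n * upart n y + V ^ n * vpart n y" using split2[of y n] by (simp add: algebra_simps)
  hence "y - trunc2 n y \<in> idl3 A B C" using pw is_idealD(2,4)[OF idl3_ideal] by metis
  thus "\<exists>x\<in>conv. y - x \<in> idl3 A B C" using trunc2_conv by blast
 qed (use iff in "auto simp: subsp_conv subsp_UNIV ideal_subsp[OF idl3_ideal] lin_on_def")
 thus ?thesis using n by simp
qed

lemma quot_basis_codim: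
 assumes "quot_basis E W B" "subsp sc2 E" "subsp sc2 W" "W \<subseteq> E"
 shows "codim sc2 E W (card B)"
proof -
 have B: "finite B" "B \<subseteq> E" using assms(1) by (auto simp: quot_basis_def)
 define P where "P F c \<longleftrightarrow> (\<forall>b. b \<notin> B \<longrightarrow> c b = 0) \<and> F - (\<Sum>b\<in>B. const2 (c b) * b) \<in> W" for F and c :: "fps2 => complex"
 have ex1: "\<exists>!c. P F c" if "F \<in> E" for F using assms(1) that by (auto simp: quot_basis_def P_def)
 define fi where "fi F = (THE c. P F c)" for F
 have fi: "P F (fi F)" if "F \<in> E" for F unfolding fi_def by (rule theI'[OF ex1[OF that]])
 have fieq: "fi F = c" if "F \<in> E" "P F c" for F c using ex1[OF that(1)] fi[OF that(1)] that(2) by blast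
 note s = subspD[OF assms(2)] and w = subspD[OF assms(3)]
 have "coord_on sc2 E W B fi"
  unfolding coord_on_def
 proof (intro conjI ballI allI impI)
  fix x y i assume xy: "x \<in> E" "y \<in> E"
  have "x + y - (\<Sum>b\<in>B. const2 (fi x b + fi y b) * b) = (x - (\<Sum>b\<in>B. const2 (fi x b) * b)) + (y - (\<Sum>b\<in>B. const2 (fi y b) * b))"
   by (simp add: distrib_right sum.distrib)
  also have "\<dots> \<in> W" using fi[OF xy(1)] fi[OF xy(2)] unfolding P_def by (intro w(2)) auto
  finally have "P (x + y) (\<lambda>b. fi x b + fi y b)"
   using fi[OF xy(1)] fi[OF xy(2)] unfolding P_def by (intro conjI allI impI) auto
  thus "fi (x + y) i = fi x i + fi y i" using fieq[OF s(2)[OF xy]] by simp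
 next
  fix c x i assume x: "x \<in> E"
  have "sc2 c x - (\<Sum>b\<in>B. const2 (c * fi x b) * b) = sc2 c (x - (\<Sum>b\<in>B. const2 (fi x b) * b))"
   by (simp add: sc2_def right_diff_distrib sum_distrib_left mult.assoc)
  also have "\<dots> \<in> W" using fi[OF x] unfolding P_def by (intro w(3)) auto
  finally have "P (sc2 c x) (\<lambda>b. c * fi x b)" using fi[OF x] unfolding P_def by (intro conjI allI impI) auto
  thus "fi (sc2 c x) i = c * fi x i" using fieq[OF s(3)[OF x]] by simp
 next
  fix x assume x: "x \<in> E"
  show "(\<forall>i\<in>B. fi x i = 0) = (x \<in> W)"
  proof
   assume "\<forall>i\<in>B. fi x i = 0"
   thus "x \<in> W" using fi[OF x] unfolding P_def by simp
  next
   assume "x \<in> W"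
   hence "P x (\<lambda>_. 0)" by (simp add: P_def)
   thus "\<forall>i\<in>B. fi x i = 0" using fieq[OF x] by simp
  qed
 next
  fix x i assume "x \<in> E" "i \<notin> B"
  thus "fi x i = 0" using fi unfolding P_def by blast
 next
  fix g :: "fps2 => complex" assume g: "\<forall>i. i \<notin> B \<longrightarrow> g i = 0"
  let ?x = "\<Sum>b\<in>B. const2 (g b) * b"
  have x: "?x \<in> E" using B s(3) by (intro subsp_sum[OF assms(2)]) (auto simp flip: sc2_def)
  have "P ?x g" using g w(1) by (simp add: P_def)
  thus "\<exists>x\<in>E. fi x = g" using fieq[OF x] x by blast
 qed
 thus ?thesis by (rule codim_index[OF _ B(1)])
qed

lemma quot_dim_eq:
 assumes "codim sc2 E W n" "subsp sc2 E" "subsp sc2 W" "W \<subseteq> E"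
 shows "quot_dim E W = n"
 unfolding quot_dim_def
proof (rule the_equality)
 obtain fi where fi: "coord_on sc2 E W {..<n} fi" using assms(1) by (auto simp: codim_def)
 note c = coord_onD[OF fi assms(2)] and s = subspD[OF assms(2)]
 obtain b where b: "\<And>i. i \<in> {..<n} ==> b i \<in> E" "\<And>i j. i \<in> {..<n} ==> fi (b i) j = (if i = j then 1 else 0)"
  using coord_on_unit_vectors[OF fi] by blast
 have inj: "inj_on b {..<n}"
 proof (rule inj_onI)
  fix x y assume "x \<in> {..<n}" "y \<in> {..<n}" "b x = b y"
  thus "x = y" using b(2)[of x x] b(2)[of y x] by (metis zero_neq_one)
 qed
 have "quot_basis E W (b ` {..<n})"
  unfolding quot_basis_def
 proof (intro conjI ballI)
  fix F assume F: "F \<in> E"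
  have sum: "(\<Sum>x\<in>b ` {..<n}. const2 (d x) * x) = (\<Sum>i<n. sc2 (d (b i)) (b i))" for d
   by (simp add: sum.reindex[OF inj] sc2_def)
  have key: "F - (\<Sum>x\<in>b ` {..<n}. const2 (d x) * x) \<in> W \<longleftrightarrow> (\<forall>j<n. d (b j) = fi F j)" for d
  proof -
   have S: "(\<Sum>i<n. sc2 (d (b i)) (b i)) \<in> E" using b s by (intro subsp_sum[OF assms(2)]) auto
   have "fi (\<Sum>i<n. sc2 (d (b i)) (b i)) j = (if j < n then d (b j) else 0)" for j
   proof -
    have "fi (\<Sum>i<n. sc2 (d (b i)) (b i)) j = (\<Sum>i<n. d (b i) * fi (b i) j)"
     by (rule coord_on_sum[OF fi assms(2)]) (auto intro: b(1))
    also have "\<dots> = (\<Sum>i<n. if i = j then d (b i) else 0)" by (rule sum.cong) (auto simp: b(2))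
    finally show ?thesis by simp
   qed
   thus ?thesis unfolding sum using c(4)[OF s(5)[OF F S]] c(3)[OF F S] by auto
  qed
  show "\<exists>!d. (\<forall>x. x \<notin> b ` {..<n} \<longrightarrow> d x = 0) \<and> F - (\<Sum>x\<in>b ` {..<n}. const2 (d x) * x) \<in> W"
  proof (rule ex1I[of _ "\<lambda>x. if x \<in> b ` {..<n} then fi F (inv_into {..<n} b x) else 0"])
   show "(\<forall>x. x \<notin> b ` {..<n} \<longrightarrow> (if x \<in> b ` {..<n} then fi F (inv_into {..<n} b x) else 0) = 0) \<and>
    F - (\<Sum>x\<in>b ` {..<n}. const2 (if x \<in> b ` {..<n} then fi F (inv_into {..<n} b x) else 0) * x) \<in> W"
    using inj by (auto simp only: key) (auto simp: inv_into_f_f)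
   fix d assume d: "(\<forall>x. x \<notin> b ` {..<n} \<longrightarrow> d x = 0) \<and> F - (\<Sum>x\<in>b ` {..<n}. const2 (d x) * x) \<in> W"
   hence "\<forall>j<n. d (b j) = fi F j" using key by blast
   thus "d = (\<lambda>x. if x \<in> b ` {..<n} then fi F (inv_into {..<n} b x) else 0)"
    using d inj by (intro ext) (auto simp: inv_into_f_f)
  qed
 qed (use b in auto)
 thus "\<exists>B. quot_basis E W B \<and> card B = n" using inj by (intro exI[of _ "b ` {..<n}"]) (auto simp: card_image)
 fix m assume "\<exists>B. quot_basis E W B \<and> card B = m"
 then obtain B where "quot_basis E W B" "card B = m" by blast
 hence "codim sc2 E W m" using quot_basis_codim assms by blast
 thus "m = n" using codim_unique assms by blast
qed

lemma milnor_eq: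
 assumes "du g \<in> conv" "dv g \<in> conv" "cdim (idl2 (du g) (dv g)) mu" "germ f p = g"
 shows "milnor f p = mu"
proof -
 have "{a * du g + b * dv g | a b. a \<in> conv \<and> b \<in> conv} = cidl3 (du g) (dv g) 0"
  unfolding cidl3_def by auto
 hence "milnor f p = quot_dim conv (cidl3 (du g) (dv g) 0)" unfolding milnor_def Let_def assms(4) by simp
 also have "\<dots> = mu"
  by (rule quot_dim_eq[OF codim_conv subsp_conv subsp_cidl3 cidl3_conv])
   (use assms conv_gens in "auto simp flip: idl2_idl3")
 finally show ?thesis .
qed

lemma tjurina_eq:
 assumes "du g \<in> conv" "dv g \<in> conv" "g \<in> conv" "cdim (idl3 (du g) (dv g) g) ta" "germ f p = g"
 shows "tjurina f p = ta"
proof -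
 have "tjurina f p = quot_dim conv (cidl3 (du g) (dv g) g)" unfolding tjurina_def Let_def assms(5) cidl3_def ..
 also have "\<dots> = ta"
  by (rule quot_dim_eq[OF codim_conv subsp_conv subsp_cidl3 cidl3_conv]) (use assms in auto)
 finally show ?thesis .
qed

section \<open>Adding a smooth branch in arbitrary coordinates\<close>

text \<open>Exchanges u and v. A branch with vertical tangent is not a graph over u, and swapping
  reduces it to one that is.\<close>

definition swp :: "fps2 => fps2" where "swp F = Abs_fps (\<lambda>j. Abs_fps (\<lambda>i. F $ i $ j))"

lemma swp_swp [simp]: "swp (swp F) = F"
 by (intro fps_ext) (simp add: swp_def)

lemma swp_hom: "comm_ring_hom swp"
proof (rule comm_ring_homI)
 show "swp 1 = 1" by (intro fps_ext) (simp add: swp_def)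
 show "swp (x + y) = swp x + swp y" for x y by (intro fps_ext) (simp add: swp_def)
 show "swp (x * y) = swp x * swp y" for x y
 proof (rule fps_ext, rule fps_ext)
  fix j i
  have "swp (x * y) $ j $ i = (\<Sum>b=0..i. \<Sum>a=0..j. x $ b $ a * y $ (i - b) $ (j - a))" by (simp add: swp_def fps2_mult_nth)
  also have "\<dots> = (\<Sum>a=0..j. \<Sum>b=0..i. x $ b $ a * y $ (i - b) $ (j - a))" by (rule sum.swap)
  also have "\<dots> = (swp x * swp y) $ j $ i" by (simp only: fps2_mult_nth) (simp add: swp_def)
  finally show "swp (x * y) $ j $ i = (swp x * swp y) $ j $ i" .
 qed
qed

interpretation swp: comm_ring_hom swp by (rule swp_hom)

lemma swp_du: "du (swp F) = swp (dv F)" and swp_dv: "dv (swp F) = swp (du F)"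
 by (intro fps_ext; simp add: swp_def du_def dv_def flip: fps_of_nat of_nat_Suc del: of_nat_Suc)+

lemma swp_ev:
 assumes "a $ 0 = 0" "b $ 0 = 0"
 shows "ev b a (swp F) = ev a b F"
proof -
 have h: "comm_ring_hom (\<lambda>F. ev b a (swp F))" by (rule comm_ring_hom_comp[OF ev_hom swp_hom]) (use assms in auto)
 have sV: "swp V = U" by (intro fps_ext) (auto simp: swp_def U_def V_def fps_X_def)
 have "ev b a (swp F) = ev a (ev b a (swp V)) F"
 proof (rule ev_unique[OF h])
  fix g
  have 1: "swp (fps_const g) $ k oo b = fps_const (g $ k)" for k
  proof -
   have "swp (fps_const g) $ k = fps_const (g $ k)" by (intro fps_ext) (auto simp: swp_def)
   thus ?thesis by simp
  qed
  show "ev b a (swp (fps_const g)) = g oo a"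
   by (rule fps_ext) (simp add: ev_def 1 fps_compose_nth atLeast0AtMost)
 qed (simp_all add: sV ev_U assms)
 thus ?thesis by (simp add: sV ev_U assms)
qed

lemma swp_idl3: "x \<in> idl3 (swp A) (swp B) (swp C) \<longleftrightarrow> swp x \<in> idl3 A B C"
proof
 assume "x \<in> idl3 (swp A) (swp B) (swp C)"
 then obtain a b c where "x = a * swp A + b * swp B + c * swp C" unfolding idl3_def by blast
 hence "swp x = swp a * A + swp b * B + swp c * C" by (simp add: swp.hom_add swp.hom_mult)
 thus "swp x \<in> idl3 A B C" unfolding idl3_def by blast
next
 assume "swp x \<in> idl3 A B C"
 then obtain a b c where "swp x = a * A + b * B + c * C" unfolding idl3_def by blast
 hence "swp (swp x) = swp a * swp A + swp b * swp B + swp c * swp C" by (simp only: swp.hom_add swp.hom_mult)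
 thus "x \<in> idl3 (swp A) (swp B) (swp C)" unfolding idl3_def swp_swp by blast
qed

lemma swp_cdim: "cdim (idl3 (swp A) (swp B) (swp C)) n \<longleftrightarrow> cdim (idl3 A B C) n"
proof (rule codim_map[where T = swp])
 show "lin_on sc2 sc2 UNIV swp"
 proof -
  have "swp (const2 c) = const2 c" for c by (intro fps_ext) (auto simp: swp_def const2_def)
  thus ?thesis by (simp add: lin_on_def swp.hom_add swp.hom_mult sc2_def)
 qed
 fix y show "\<exists>x\<in>UNIV. y - swp x \<in> idl3 A B C"
  using is_idealD(1)[OF idl3_ideal] by (intro bexI[of _ "swp y"]) auto
qed (auto simp: subsp_UNIV ideal_subsp[OF idl3_ideal] swp_idl3)

lemma idl3_swap: "idl3 A B C = idl3 B A C"
 by (intro subset_antisym idl3_subset idl3_ideal idl_gens)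

text \<open>
 \<open>branch_numbers f q a b r\<close> collects the effect of adding the smooth branch \<open>q = 0\<close>,
 parametrised by \<open>(a, b)\<close>, to the germ \<open>f = 0\<close>: with \<open>i\<close> the intersection number, \<open>mu\<close> grows by
 \<open>2i - 1\<close> and \<open>ta\<close> by \<open>i + r\<close>, where \<open>r\<close> is the least order along the branch of \<open>th(q)\<close> for
 logarithmic derivations \<open>th = al \<partial>\<^sub>u + bt \<partial>\<^sub>v\<close> of \<open>f\<close>.
\<close>

definition branch_numbers :: "fps2 => fps2 => complex fps => complex fps => nat => bool" where
 "branch_numbers f q a b r \<longleftrightarrow> (let i = subdegree (ev a b f) in
   r \<le> i - 1 \<and> i > 0 \<and>
   (\<exists>mu. cdim (idl3 (du f) (dv f) 0) mu \<and> cdim (idl3 (du (f * q)) (dv (f * q)) 0) (mu + 2 * i - 1)) \<and>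
   (\<exists>ta. cdim (idl3 (du f) (dv f) f) ta \<and> cdim (idl3 (du (f * q)) (dv (f * q)) (f * q)) (ta + i + r)) \<and>
   (\<forall>al bt. f dvd al * du f + bt * dv f \<longrightarrow> fps_X ^ r dvd ev a b (al * du q + bt * dv q)) \<and>
   (\<forall>al bt py. f dvd al * du f + bt * dv f \<longrightarrow> ev a b al = py * fps_deriv a \<longrightarrow> ev a b bt = py * fps_deriv b \<longrightarrow>
    fps_X ^ (i - r) dvd py) \<and>
   (\<exists>al bt. f dvd al * du f + bt * dv f \<and> ev a b (al * du q + bt * dv q) ~= 0 \<and>
    subdegree (ev a b (al * du q + bt * dv q)) = r))"

lemma fps_X_power_dvd_iff: "fps_X ^ n dvd (g :: complex fps) \<longleftrightarrow> g = 0 \<or> n \<le> subdegree g"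
 by (cases "g = 0") (auto simp: fps_dvd_iff fps_X_power_subdegree)

lemma branch_numbers_graph:
 assumes a: "a $ 0 = 0" "a $ 1 ~= 0" and b: "b $ 0 = 0"
  and q: "ev a b q = 0" "du q $ 0 $ 0 ~= 0 \<or> dv q $ 0 $ 0 ~= 0"
  and f: "f $ 0 $ 0 = 0" "ev a b f ~= 0"
  and isolated: "\<And>a c. a $ 0 = 0 ==> c $ 0 = 0 ==> a ~= 0 \<or> c ~= 0 ==> ev a c f = 0 ==>
   ev a c (du f) = 0 ==> ev a c (dv f) ~= 0"
 shows "\<exists>r. branch_numbers f q a b r"
proof -
 \<comment> \<open>Reparametrising by the compositional inverse of \<open>a\<close> turns the branch
   into the graph (s, d(s)). As \<open>a\<close> has order 1, orders along the branch do not
   change.\<close>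
 define c where "c = fps_inv a"
 have c0: "c $ 0 = 0" by (simp add: c_def fps_inv_def)
 have ca: "c oo a = fps_X" unfolding c_def by (rule fps_inv) (use a in auto)
 have ac: "a oo c = fps_X" unfolding c_def by (rule fps_inv_right) (use a in auto)
 define d where "d = b oo c"
 have d0: "d $ 0 = 0" using b by (simp add: d_def)
 have da: "d oo a = b" unfolding d_def using fps_compose_assoc[OF a(1) c0, of b] ca by simp
 have Ea: "ev fps_X d F oo a = ev a b F" for F
  using ev_compose[of fps_X d a F] a d0 da by simp
 have Ec: "ev fps_X d F = ev a b F oo c" for F
  using ev_compose[of a b c F] a b c0 ac by (simp add: d_def)
 have "lin d dvd q" using lin_dvd_iff[OF d0] Ec[of q] q(1) by simp
 then obtain Y where "q = lin d * Y" by (rule dvdE)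
 hence qY: "q = Y * lin d" by simp
 have Y0: "Y $ 0 $ 0 ~= 0"
 proof
  assume Y: "Y $ 0 $ 0 = 0"
  have l0: "lin d $ 0 $ 0 = 0" using d0 by (simp add: lin_def V_def)
  have "du q = du Y * lin d + Y * du (lin d)" "dv q = dv Y * lin d + Y * dv (lin d)"
   unfolding qY by (rule is_derivD(2)[OF is_deriv_dudv(1)] is_derivD(2)[OF is_deriv_dudv(2)])+
  thus False using q(2) Y l0 by simp
 qed
 have "ev fps_X d f ~= 0" using Ea[of f] f(2) by auto
 then interpret smooth_branch d q Y f
  by unfold_locales (use d0 qY Y0 f isolated in "auto simp only:")
 have sa: "subdegree a = 1" using a by (intro subdegreeI) auto
 hence an: "a ~= 0" by auto
 have sdc: "subdegree (g oo a) = subdegree g" for g :: "complex fps" using a sa by simp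
 have g0: "g oo a = 0 \<longleftrightarrow> g = 0" for g :: "complex fps" using a an by (simp add: fps_compose_eq_0_iff)
 have dvda: "fps_X ^ n dvd g oo a \<longleftrightarrow> fps_X ^ n dvd g" for n and g :: "complex fps"
  by (simp add: fps_X_power_dvd_iff sdc g0)
 have i: "subdegree (ev a b f) = i" unfolding i_def by (simp add: sdc flip: Ea)
 have a'0: "fps_deriv a $ 0 ~= 0" using a by simp
 hence a'unit: "subdegree (fps_deriv a) = 0" "fps_deriv a ~= 0" by (auto simp del: fps_deriv_nth fps_deriv_eq_0_iff) 
 have "branch_numbers f q a b r"
  unfolding branch_numbers_def Let_def i
 proof (intro conjI allI impI)
  show "r \<le> i - 1" "i > 0" by (rule r_le i_pos)+
  show "\<exists>mu. cdim (idl3 (du f) (dv f) 0) mu \<and> cdim (idl3 (du (f * q)) (dv (f * q)) 0) (mu + 2 * i - 1)"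
   using milnor_finite milnor_prod unfolding idl2_idl3 by blast
  show "\<exists>ta. cdim (idl3 (du f) (dv f) f) ta \<and> cdim (idl3 (du (f * q)) (dv (f * q)) (f * q)) (ta + i + r)"
   using tjurina_finite tjurina_prod by blast
  show "fps_X ^ r dvd ev a b (al * du q + bt * dv q)" if "f dvd al * du f + bt * dv f" for al bt
   using log_der_order[of al bt] that by (simp add: log_der_def dvda flip: Ea)
  show "fps_X ^ (i - r) dvd py" if h: "f dvd al * du f + bt * dv f" "ev a b al = py * fps_deriv a" "ev a b bt = py * fps_deriv b" for al bt py
  proof -
   interpret e: comm_ring_hom "ev a b" by (rule ev_hom[OF a(1) b])
   have "ev a b (al * du q + bt * dv q) = py * fps_deriv (ev a b q)"
    unfolding ev_chain_rule[OF a(1) b] by (simp add: e.hom_add e.hom_mult h(2,3) algebra_simps)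
   hence "ev fps_X d (al * du q + bt * dv q) = 0" using q(1) by (simp add: g0 flip: Ea)
   hence "fps_X ^ (i - r) dvd ev fps_X d al" using tangent_order[of al bt] h(1) by (simp add: log_der_def)
   hence "fps_X ^ (i - r) dvd py * fps_deriv a" by (simp only: dvda Ea[symmetric] h(2)[symmetric])
   thus ?thesis using a'unit unfolding fps_X_power_dvd_iff by (metis add.right_neutral mult_eq_0_iff subdegree_mult)
  qed
  obtain al bt where "log_der al bt" "E (al * du q + bt * dv q) = fps_X ^ r" by (rule log_der_attained)
  thus "\<exists>al bt. f dvd al * du f + bt * dv f \<and> ev a b (al * du q + bt * dv q) ~= 0 \<and>
    subdegree (ev a b (al * du q + bt * dv q)) = r"
   by (intro exI[of _ al] exI[of _ bt]) (simp add: log_der_def g0 sdc fps_X_power_subdegree flip: Ea)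
 qed
 thus ?thesis by blast
qed

lemma branch_numbers_swp:
 assumes "branch_numbers (swp f) (swp q) b a r" "a $ 0 = 0" "b $ 0 = 0"
 shows "branch_numbers f q a b r"
proof -
 have c0: "cdim (idl3 (swp B) (swp A) 0) n \<longleftrightarrow> cdim (idl3 A B 0) n" for A B n
  using swp_cdim[of A B 0 n] idl3_swap[of "swp B" "swp A" 0] by simp
 have c1: "cdim (idl3 (swp B) (swp A) (swp C)) n \<longleftrightarrow> cdim (idl3 A B C) n" for A B C n
  using swp_cdim[of A B C n] idl3_swap[of "swp B" "swp A"] by simp
 have log: "swp f dvd swp bt * swp (dv f) + swp al * swp (du f)" if d: "f dvd al * du f + bt * dv f" for al bt
 proof -
  obtain k where "al * du f + bt * dv f = f * k" using d by (rule dvdE)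
  hence "swp bt * swp (dv f) + swp al * swp (du f) = swp f * swp k" by (metis add.commute swp.hom_add swp.hom_mult)
  thus ?thesis by simp
 qed
 have evl: "ev b a (swp bt * swp (dv q) + swp al * swp (du q)) = ev a b (al * du q + bt * dv q)" for al bt
  using swp_ev[OF assms(2,3), of "al * du q + bt * dv q"] by (simp add: swp.hom_add swp.hom_mult add.commute)
 have pr: "swp f * swp q = swp (f * q)" by (simp add: swp.hom_mult)
 note h = assms(1)[unfolded branch_numbers_def Let_def pr swp_du swp_dv c0 c1 swp_ev[OF assms(2,3)]]
 note h1 = h[THEN conjunct1] h[THEN conjunct2, THEN conjunct1] and h2 = h[THEN conjunct2, THEN conjunct2]
 note h3 = h2[THEN conjunct1] h2[THEN conjunct2, THEN conjunct1] and h4 = h2[THEN conjunct2, THEN conjunct2]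
 note h5 = h4[THEN conjunct1] and h6 = h4[THEN conjunct2, THEN conjunct1] and h7 = h4[THEN conjunct2, THEN conjunct2]
 show ?thesis
  unfolding branch_numbers_def Let_def
 proof (intro conjI allI impI)
  fix al bt assume d: "f dvd al * du f + bt * dv f"
  show "fps_X ^ r dvd ev a b (al * du q + bt * dv q)" using h5 log[OF d] unfolding evl[symmetric] by blast
  fix py assume "ev a b al = py * fps_deriv a" "ev a b bt = py * fps_deriv b"
  hence "ev b a (swp bt) = py * fps_deriv b" "ev b a (swp al) = py * fps_deriv a" by (simp_all only: swp_ev[OF assms(2,3)])
  thus "fps_X ^ (subdegree (ev a b f) - r) dvd py" using h6 log[OF d] by blast
 next
  obtain al bt where ab: "swp f dvd al * swp (dv f) + bt * swp (du f)" "ev b a (al * swp (dv q) + bt * swp (du q)) ~= 0"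
   "subdegree (ev b a (al * swp (dv q) + bt * swp (du q))) = r" using h7 by blast
  obtain k where "al * swp (dv f) + bt * swp (du f) = swp f * k" using ab(1) by (rule dvdE)
  hence "swp (al * swp (dv f) + bt * swp (du f)) = swp (swp f * k)" by simp
  hence "swp bt * du f + swp al * dv f = f * swp k" by (simp add: swp.hom_add swp.hom_mult add.commute)
  thus "\<exists>al bt. f dvd al * du f + bt * dv f \<and> ev a b (al * du q + bt * dv q) ~= 0 \<and>
    subdegree (ev a b (al * du q + bt * dv q)) = r"
   using ab(2,3) by (intro exI[of _ "swp bt"] exI[of _ "swp al"]) (simp flip: evl)
 qed (rule h1 h3)+
qed

theorem branch_numbers_exist:
 assumes a: "a $ 0 = 0" "b $ 0 = 0" "a $ 1 ~= 0 \<or> b $ 1 ~= 0"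
  and q: "ev a b q = 0" "du q $ 0 $ 0 ~= 0 \<or> dv q $ 0 $ 0 ~= 0"
  and f: "f $ 0 $ 0 = 0" "ev a b f ~= 0"
  and isolated: "\<And>a c. a $ 0 = 0 ==> c $ 0 = 0 ==> a ~= 0 \<or> c ~= 0 ==> ev a c f = 0 ==>
   ev a c (du f) = 0 ==> ev a c (dv f) ~= 0"
 shows "\<exists>r. branch_numbers f q a b r"
proof (cases "a $ 1 ~= 0")
 case True
 show ?thesis by (rule branch_numbers_graph) (use assms True in auto)
next
 case False
 have n0: "swp F $ 0 $ 0 = F $ 0 $ 0" for F by (simp add: swp_def)
 have "\<exists>r. branch_numbers (swp f) (swp q) b a r"
 proof (rule branch_numbers_graph)
  fix c d :: "complex fps" assume h: "c $ 0 = 0" "d $ 0 = 0" "c ~= 0 \<or> d ~= 0" "ev c d (swp f) = 0" "ev c d (du (swp f)) = 0"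
  show "ev c d (dv (swp f)) ~= 0"
   using isolated[of d c] h by (auto simp: swp_du swp_dv swp_ev)
 qed (use assms False in "auto simp: swp_du swp_dv swp_ev n0")
 thus ?thesis using branch_numbers_swp a by blast
qed

section \<open>Hilbert functions\<close>

definition sc3 :: "complex => poly3 => poly3" where "sc3 c F = cc c * F"

lemma vector_space_sc3: "vector_space sc3"
proof
 fix a b x y
 have "cc (a + b) = cc a + cc b" "cc (a * b) = cc a * cc b" "cc 1 = 1" by (simp_all add: one_pCons)
 thus "sc3 a (x + y) = sc3 a x + sc3 a y" "sc3 (a + b) x = sc3 a x + sc3 b x" "sc3 a (sc3 b x) = sc3 (a * b) x" "sc3 1 x = x"
  unfolding sc3_def by (simp_all only: distrib_left distrib_right mult.assoc mult_1_left)
qed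

lemma sc3_mult: "A * sc3 c x = sc3 c (A * x)" "sc3 c x * A = sc3 c (x * A)"
 unfolding sc3_def by simp_all

lemma sc3_add: "sc3 c (x + y) = sc3 c x + sc3 c y"
 unfolding sc3_def by (rule distrib_left)

lemma sc3_0 [simp]: "sc3 c 0 = 0" "sc3 0 x = 0"
 unfolding sc3_def by simp_all

lemma sc3_hom: "comm_ring_hom E ==> E (sc3 c x) = E (cc c) * E x"
proof -
 assume "comm_ring_hom E"
 then interpret E: comm_ring_hom E .
 show ?thesis by (simp only: sc3_def E.hom_mult)
qed

lemma vector_space_smult: "vector_space (Polynomial.smult :: complex => _)"
 by unfold_locales (simp_all add: smult_add_left smult_add_right)

definition S :: "int => poly3 set" where "S n = {F. homogeneous n F}"

lemma S_iff [simp]: "F \<in> S n \<longleftrightarrow> homogeneous n F" by (simp add: S_def)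

lemma homogeneous_scale: "homogeneous n F ==> homogeneous n (sc3 c F)"
 using homogeneous_mult[OF homogeneous_gens(1), of n F c] unfolding sc3_def add_0 .

lemma subsp_S: "subsp sc3 (S n)"
 by (auto simp: subsp_def vector_space_sc3 homogeneous_add intro: homogeneous_scale)

lemma subsp_0: "vector_space sc ==> subsp sc {0}"
 by (auto simp: subsp_def module_iff_vector_space[symmetric] module.scale_zero_right)

definition sdim :: "int => nat" where "sdim n = (if n < 0 then 0 else nat ((n + 1) * (n + 2) div 2))"

text \<open>The binomial polynomial also vanishes at -1 and -2, so it may be used slightly below
  degree 0.\<close>

lemma sdim_eq:
 assumes "n \<ge> - 2"
 shows "2 * int (sdim n) = (n + 1) * (n + 2)"
proof (cases "n < 0")
 case False
 have "even ((n + 1) * (n + 2))" by simp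
 hence "2 * ((n + 1) * (n + 2) div 2) = (n + 1) * (n + 2)" by (rule dvd_mult_div_cancel)
 moreover have "(n + 1) * (n + 2) div 2 \<ge> 0" using False by simp
 ultimately show ?thesis using False by (simp add: sdim_def)
next
 case True
 hence "n = - 1 \<or> n = - 2" using assms by auto
 thus ?thesis by (auto simp: sdim_def)
qed

lemma codim_S: "codim sc3 (S n) {0} (sdim n)"
proof (cases "n < 0")
 case True
 hence "S n = {0}" using homogeneous_neg by auto
 thus ?thesis using codim_self[OF subsp_S[of n]] True by (simp add: sdim_def)
next
 case False
 then obtain m where [simp]: "n = int m" by (metis int_nat_eq linorder_not_less)
 define I where "I = {(i, j, k). i + j + k = m}"
 have "I = (\<lambda>(i, j). (i, j, m - (i + j))) ` (SIGMA i:{..m}. {..m - i})"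
  by (force simp: I_def)
 moreover have "inj_on (\<lambda>(i, j). (i, j, m - (i + j))) (SIGMA i:{..m}. {..m - i})" by (auto simp: inj_on_def)
 ultimately have "card I = (\<Sum>i\<le>m. m - i + 1)" "finite I" by (auto simp: card_image)
 moreover have "(\<Sum>i\<le>m. m - i + 1) = (m + 1) * (m + 2) div 2"
 proof -
  have "(\<Sum>i\<le>m. m - i + 1) = (\<Sum>i\<le>m. i + 1)" by (rule sum.reindex_bij_witness[of _ "\<lambda>i. m - i" "\<lambda>i. m - i"]) auto
  also have "2 * \<dots> = (m + 1) * (m + 2)" by (induction m) auto
  finally show ?thesis by simp
 qed
 ultimately have card: "card I = sdim n" "finite I" by (auto simp: sdim_def nat_div_distrib nat_mult_distrib nat_add_distrib)
 have "coord_on sc3 (S n) {0} I (\<lambda>F (i, j, k). c3 F i j k)"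
  unfolding coord_on_def
 proof (intro conjI ballI allI impI)
  fix F :: poly3 and c ijk assume F: "F \<in> S n"
  show "(case ijk of (i, j, k) => c3 (sc3 c F) i j k) = c * (case ijk of (i, j, k) => c3 F i j k)"
   by (simp add: sc3_def split: prod.splits)
  show "(\<forall>ijk\<in>I. (case ijk of (i, j, k) => c3 F i j k) = 0) \<longleftrightarrow> F \<in> {0}"
  proof
   assume z: "\<forall>ijk\<in>I. (case ijk of (i, j, k) => c3 F i j k) = 0"
   have "c3 F i j k = 0" for i j k
   proof (cases "i + j + k = m")
    case False
    thus ?thesis using F by (fastforce simp: homogeneous_def)
   qed (use z in "auto simp: I_def")
   thus "F \<in> {0}" using c3_eqI[of F 0] by auto
  qed auto
  assume "ijk \<notin> I"
  thus "(case ijk of (i, j, k) => c3 F i j k) = 0" using F by (cases ijk) (fastforce simp: I_def homogeneous_def)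
 next
  fix g :: "nat \<times> nat \<times> nat => complex" assume g: "\<forall>ijk. ijk \<notin> I \<longrightarrow> g ijk = 0"
  define F where "F = (\<Sum>(i, j, k)\<in>I. monom (monom (monom (g (i, j, k)) i) j) k)"
  have c: "c3 F i j k = g (i, j, k)" for i j k
  proof -
   have "c3 F i j k = (\<Sum>x\<in>I. if x = (i, j, k) then g x else 0)"
    unfolding F_def coeff_sum
   proof (rule sum.cong[OF refl])
    fix x :: "nat \<times> nat \<times> nat"
    show "coeff (coeff (coeff (case x of (i, j, k) => monom (monom (monom (g (i, j, k)) i) j) k) k) j) i = (if x = (i, j, k) then g x else 0)"
     by (cases x) auto
   qed
   thus ?thesis using card(2) g by simp
  qed
  hence "F \<in> S n" using g by (force simp: homogeneous_def I_def)
  thus "\<exists>F\<in>S n. (\<lambda>(i, j, k). c3 F i j k) = g" using c by (intro bexI[of _ F]) auto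
 qed (auto split: prod.splits)
 from codim_index[OF this card(2)] show ?thesis using card by simp
qed

definition Cpoly :: "nat => complex poly set" where "Cpoly n = {p. \<forall>k\<ge>n. coeff p k = 0}"

lemma subsp_Cpoly: "subsp Polynomial.smult (Cpoly n)"
 by (auto simp: subsp_def vector_space_smult Cpoly_def)

lemma codim_Cpoly: "codim Polynomial.smult (Cpoly n) {0} n"
proof -
 have "coord_on Polynomial.smult (Cpoly n) {0} {..<n} (\<lambda>p k. if k < n then coeff p k else 0)"
  unfolding coord_on_def
 proof (intro conjI ballI allI impI)
  fix p assume p: "p \<in> Cpoly n"
  show "(\<forall>i\<in>{..<n}. (if i < n then coeff p i else 0) = 0) \<longleftrightarrow> p \<in> {0}"
  proof
   assume z: "\<forall>i\<in>{..<n}. (if i < n then coeff p i else 0) = 0"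
   have "coeff p k = 0" for k using z p by (cases "k < n") (auto simp: Cpoly_def)
   thus "p \<in> {0}" by (auto simp: poly_eq_iff)
  qed auto
 next
  fix g :: "nat => complex" assume g: "\<forall>i. i \<notin> {..<n} \<longrightarrow> g i = 0"
  define p where "p = (\<Sum>k<n. monom (g k) k)"
  have "coeff p k = g k" for k using g by (simp add: p_def coeff_sum)
  thus "\<exists>p\<in>Cpoly n. (\<lambda>k. if k < n then coeff p k else 0) = g" using g by (intro bexI[of _ p]) (auto simp: Cpoly_def)
 qed auto
 from codim_index[OF this] show ?thesis by simp
qed

lemma rank_nullity:
 assumes E: "subsp sc E" and sc': "vector_space sc'" and T: "lin_on sc sc' E T" and n: "codim sc E {0} n"
 obtains k m where "k + m = n" "subsp sc {x \<in> E. T x = 0}" "codim sc {x \<in> E. T x = 0} {0} k"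
  "subsp sc' (T ` E)" "codim sc' (T ` E) {0} m"
proof -
 interpret v: vector_space sc using E by (simp add: subsp_def)
 interpret w: vector_space sc' by fact
 note e = subspD[OF E]
 have t: "T (x + y) = T x + T y" "T (sc c x) = sc' c (T x)" if "x \<in> E" "y \<in> E" for x y c
  using T that by (auto simp: lin_on_def)
 have T0: "T 0 = 0" using t(2)[of 0 0 0] e(1) by simp
 have K: "subsp sc {x \<in> E. T x = 0}" using e T0 by (auto simp: subsp_def t v.vector_space_axioms)
 have I: "subsp sc' (T ` E)"
  unfolding subsp_def
 proof (intro conjI ballI allI sc')
  show "0 \<in> T ` E" using T0 e(1) by (metis imageI)
  fix x assume "x \<in> T ` E"
  then obtain u where u: "u \<in> E" "x = T u" by blast
  show "sc' c x \<in> T ` E" for c unfolding u(2) t(2)[OF u(1,1), symmetric] by (intro imageI e(3) u)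
  fix y assume "y \<in> T ` E"
  then obtain v where v: "v \<in> E" "y = T v" by blast
  show "x + y \<in> T ` E" unfolding u(2) v(2) t(1)[OF u(1) v(1), symmetric] by (intro imageI e(2) u v)
 qed
 have Z: "subsp sc {0}" "subsp sc' {0}" by (rule subsp_0, unfold_locales)+
 obtain k m where km: "k + m = n" "codim sc {x \<in> E. T x = 0} {0} k" "codim sc E {x \<in> E. T x = 0} m"
  using codim_split[OF n Z(1) K E] e(1) T0 by auto
 have "codim sc E {x \<in> E. T x = 0} m \<longleftrightarrow> codim sc' (T ` E) {0} m"
  by (rule codim_map[OF E I Z(2) T]) (use e(1) T0 in force)+
 thus thesis using that[OF km(1) K km(2) I] km(3) by simp
qed

lemma dim_mono:
 assumes "codim sc G {0} n" "codim sc E {0} m" "subsp sc G" "subsp sc E" "E \<subseteq> G"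
 shows "m \<le> n" "m = n ==> E = G"
proof -
 have 0: "subsp sc {0}" using assms(3) by (intro subsp_0) (simp add: subsp_def)
 have "{0} \<subseteq> E" using subspD(1)[OF assms(4)] by simp
 note m = codim_mono[OF assms(1,2) 0 assms(4,3) this assms(5)]
 show "m \<le> n" "m = n ==> E = G" by (fact m)+
qed

lemma dim_unique: "codim sc E {0} n ==> codim sc E {0} m ==> subsp sc E ==> n = m"
 using dim_mono(1)[of sc E n E m] dim_mono(1)[of sc E m E n] by force

lemma dim_inj:
 assumes E: "subsp sc E" and sc': "vector_space sc'" and T: "lin_on sc sc' E T" and n: "codim sc E {0} n"
  and inj: "\<And>x. x \<in> E ==> T x = 0 ==> x = 0"
 shows "subsp sc' (T ` E)" "codim sc' (T ` E) {0} n"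
proof -
 obtain k m where km: "k + m = n" "subsp sc {x \<in> E. T x = 0}" "codim sc {x \<in> E. T x = 0} {0} k"
  "subsp sc' (T ` E)" "codim sc' (T ` E) {0} m" by (rule rank_nullity[OF E sc' T n])
 have e: "{x \<in> E. T x = 0} = {0}" using subspD(1)[OF km(2)] inj by blast
 have "k = 0" using dim_unique[OF km(3)[unfolded e] codim_self km(2)[unfolded e]] km(2)[unfolded e] .
 thus "subsp sc' (T ` E)" "codim sc' (T ` E) {0} n" using km by simp_all
qed

definition scf :: "complex => (nat => poly3) => nat => poly3" where "scf c v i = sc3 c (v i)"

lemma vector_space_scf: "vector_space scf"
proof -
 interpret vector_space sc3 by (rule vector_space_sc3)
 show ?thesis
  by unfold_locales (auto simp: fun_eq_iff scf_def scale_right_distrib scale_left_distrib)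
qed

text \<open>Functions on the natural numbers, padded by 0, rather than \<open>vec\<close>: they form
  an additive group as a type, as the dimension theory above requires.\<close>

definition graded_vecs :: "int list => int => (nat => poly3) set" where
 "graded_vecs es n = {v. (\<forall>i<length es. homogeneous (n - es ! i) (v i)) \<and> (\<forall>i\<ge>length es. v i = 0)}"

lemma subsp_graded_vecs: "subsp scf (graded_vecs es n)"
 by (auto simp: subsp_def vector_space_scf graded_vecs_def scf_def homogeneous_add intro: homogeneous_scale)

lemma subsp_scf_0: "subsp scf {0}"
 by (rule subsp_0[OF vector_space_scf])

lemma codim_graded_vecs: "codim scf (graded_vecs es n) {0} (\<Sum>e\<leftarrow>es. sdim (n - e))"
proof -
 have "\<forall>m. \<exists>fi. coord_on sc3 (S m) {0} {..<sdim m} fi" using codim_S by (simp add: codim_def)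
 then obtain fi where fi: "\<And>m. coord_on sc3 (S m) {0} {..<sdim m} (fi m)" by metis
 note c = coord_onD[OF fi subsp_S]
 define I where "I = (SIGMA i:{..<length es}. {..<sdim (n - es ! i)})"
 define py where "py v = (\<lambda>(i, j). if i < length es then fi (n - es ! i) (v i) j else 0)" for v
 have S: "i < length es ==> v i \<in> S (n - es ! i)" if "v \<in> graded_vecs es n" for v i
  using that by (simp add: graded_vecs_def)
 have "coord_on scf (graded_vecs es n) {0} I py"
  unfolding coord_on_def
 proof (intro conjI ballI allI impI)
  fix x y ij assume "x \<in> graded_vecs es n" "y \<in> graded_vecs es n"
  thus "py (x + y) ij = py x ij + py y ij" using c(1) S by (cases ij) (auto simp: py_def)
 next
  fix x k ij assume "x \<in> graded_vecs es n"
  thus "py (scf k x) ij = k * py x ij" using c(2) S by (cases ij) (auto simp: py_def scf_def)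
 next
  fix x assume x: "x \<in> graded_vecs es n"
  show "(\<forall>ij\<in>I. py x ij = 0) \<longleftrightarrow> x \<in> {0}"
  proof
   assume z: "\<forall>ij\<in>I. py x ij = 0"
   have "x i = 0" for i
   proof (cases "i < length es")
    case True
    hence "\<forall>j\<in>{..<sdim (n - es ! i)}. fi (n - es ! i) (x i) j = 0" using z by (auto simp: py_def I_def)
    thus ?thesis using c(4)[OF S[OF x True]] by simp
   qed (use x in "simp add: graded_vecs_def")
   thus "x \<in> {0}" by auto
  next
   assume "x \<in> {0}"
   thus "\<forall>ij\<in>I. py x ij = 0" using c(4)[OF subspD(1)[OF subsp_S]] by (auto simp: py_def I_def)
  qed
 next
  fix x ij assume "x \<in> graded_vecs es n" "ij \<notin> I"
  thus "py x ij = 0" using c(6) S by (cases ij) (auto simp: py_def I_def)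
 next
  fix g :: "nat \<times> nat => complex" assume g: "\<forall>ij. ij \<notin> I \<longrightarrow> g ij = 0"
  have "\<exists>x. i < length es \<longrightarrow> x \<in> S (n - es ! i) \<and> fi (n - es ! i) x = (\<lambda>j. g (i, j))" for i
  proof (cases "i < length es")
   case True
   have "(\<lambda>j. g (i, j)) j = 0" if "j \<notin> {..<sdim (n - es ! i)}" for j using g that by (auto simp: I_def)
   from coord_on_surj[OF fi, of "n - es ! i" "\<lambda>j. g (i, j)", OF this] show ?thesis by blast
  qed simp
  then obtain x where x: "\<And>i. i < length es ==> x i \<in> S (n - es ! i) \<and> fi (n - es ! i) (x i) = (\<lambda>j. g (i, j))" by metis
  define v where "v i = (if i < length es then x i else 0)" for i
  have "v \<in> graded_vecs es n" using x by (auto simp: v_def graded_vecs_def)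
  moreover have "py v = g" using x g by (auto simp: py_def v_def I_def)
  ultimately show "\<exists>x\<in>graded_vecs es n. py x = g" by blast
 qed
 moreover have "finite I" by (simp add: I_def)
 moreover have "card I = (\<Sum>e\<leftarrow>es. sdim (n - e))"
  by (simp add: I_def sum_list_sum_nth atLeast0LessThan)
 ultimately show ?thesis using codim_index by metis
qed

section \<open>Factors of homogeneous polynomials\<close>

text \<open>Lowest and highest degrees both add up to n over the two factors, so in each factor they
  coincide.\<close>

lemma factor_monom:
 fixes P Q :: "'a::idom poly"
 assumes "P * Q = monom c n" "c ~= 0"
 shows "P = monom (coeff P (degree P)) (degree P)"
proof -
 have nz: "P ~= 0" "Q ~= 0" using assms by auto
 let ?s = "\<lambda>p :: 'a poly. subdegree (fps_of_poly p)"
 have s: "?s p \<le> degree p" "\<And>k. k < ?s p ==> coeff p k = 0" if "p ~= 0" for p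
 proof -
  have "fps_of_poly p $ ?s p ~= 0" using that by (intro nth_subdegree_nonzero) simp
  thus "?s p \<le> degree p" by (intro le_degree) simp
  fix k assume "k < ?s p"
  thus "coeff p k = 0" by fastforce
 qed
 have "?s (P * Q) = ?s P + ?s Q" using nz by (simp add: fps_of_poly_mult)
 moreover have "?s (P * Q) = n"
  unfolding assms(1) by (rule subdegreeI) (use assms(2) in auto)
 moreover have "degree P + degree Q = n" using degree_mult_eq[OF nz] assms by (simp add: degree_monom_eq)
 ultimately have "?s P = degree P" using s(1)[OF nz(1)] s(1)[OF nz(2)] by simp
 thus ?thesis using s(2)[OF nz(1)] by (intro poly_eqI) (auto simp: coeff_eq_0 linorder_neq_iff)
qed

lemma factor_homogeneous:
 assumes "homogeneous n (F * G)" "F * G ~= 0"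
 shows "homogeneous (int (tdeg F)) F" "int (tdeg F) + int (tdeg G) = n"
proof -
 have "n \<ge> 0" using homogeneous_neg[OF _ assms(1)] assms(2) by (cases "n < 0") auto
 then obtain m where m: "n = int m" by (metis nonneg_int_cases)
 have *: "graded F * graded G = monom (F * G) m" using assms(1) by (simp add: m homogeneous_iff graded.hom_mult)
 have "graded F = monom (hcomp (tdeg F) F) (tdeg F)"
  unfolding tdeg_def by (rule factor_monom[OF * assms(2)])
 hence "poly (graded F) 1 = hcomp (tdeg F) F" by (metis poly_monom power_one mult_1_right)
 hence "hcomp (tdeg F) F = F" by (simp only: graded_at_1)
 thus "homogeneous (int (tdeg F)) F" using homogeneous_comp[of "tdeg F" F] by (simp only:)
 have "tdeg (F * G) = m" using tdeg_homogeneous[of m "F * G"] assms m by simp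
 thus "int (tdeg F) + int (tdeg G) = n" using tdeg_mult[of F G] assms m by auto
qed

lemma homogeneous_divide:
 assumes "homogeneous N (g * h)" "homogeneous M h" "h ~= 0"
 shows "homogeneous (N - M) g"
proof (cases "g = 0")
 case False
 hence nz: "g * h ~= 0" using assms(3) by simp
 have "M = int (tdeg h)"
 proof -
  have "M \<ge> 0" using homogeneous_neg[OF _ assms(2)] assms(3) by force
  then obtain m where "M = int m" by (metis nonneg_int_cases)
  thus ?thesis using tdeg_homogeneous assms(2,3) by simp
 qed
 hence "N - M = int (tdeg g)" using factor_homogeneous(2)[OF assms(1) nz] by simp
 thus ?thesis using factor_homogeneous(1)[OF assms(1) nz] by (simp only:)
qed simp

lemma tdeg_0_unit: "F ~= 0 ==> tdeg F = 0 ==> F dvd 1"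
proof -
 assume "F ~= 0" "tdeg F = 0"
 then obtain c where c: "F = cc c" "c ~= 0" using tdeg_0[of F] by auto
 hence "1 = F * cc (inverse c)" by (simp add: one_pCons)
 thus ?thesis by (rule dvdI)
qed

lemma irreducible_factor:
 fixes E :: "poly3 => 'b::idom"
 assumes "comm_ring_hom E" "F ~= 0" "E F = 0"
 shows "\<exists>p. irreducible p \<and> p dvd F \<and> E p = 0"
 using assms(2,3)
proof (induction "tdeg F" arbitrary: F rule: less_induct)
 case less
 interpret E: comm_ring_hom E by fact
 have nu: "\<not> F dvd 1"
 proof
  assume "F dvd 1"
  then obtain g where "1 = F * g" by (rule dvdE)
  hence "1 = E F * E g" by (metis E.hom_mult E.hom_one)
  thus False using less.prems(2) by simp
 qed
 show ?case
 proof (cases "irreducible F")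
  case False
  then obtain g h where gh: "F = g * h" "\<not> g dvd 1" "\<not> h dvd 1"
   using less nu by (auto simp: irreducible_def)
  have nz: "g ~= 0" "h ~= 0" using gh less by auto
  have "tdeg g > 0" "tdeg h > 0" using tdeg_0_unit gh nz by blast+
  moreover have "tdeg F = tdeg g + tdeg h" unfolding gh by (rule tdeg_mult[OF nz])
  ultimately have "tdeg g < tdeg F" "tdeg h < tdeg F" by auto
  moreover have "E g = 0 \<or> E h = 0" using less gh by (simp add: E.hom_mult)
  ultimately obtain p where "irreducible p" "p dvd g \<or> p dvd h" "E p = 0" using less(1) nz by metis
  thus ?thesis using gh by auto
 qed (use less in auto)
qed

lemma irreducible_prime_elem: "irreducible (p :: poly3) ==> prime_elem p"
 by (rule irreducible_imp_prime_elem)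

lemma prime_dvd_mult3: "irreducible (p :: poly3) ==> p dvd a * b ==> p dvd a \<or> p dvd b"
 using irreducible_prime_elem prime_elem_dvd_mult_iff by blast

lemma squarefree_factor:
 assumes "squarefree (p * h)" "irreducible p"
 shows "\<not> p dvd h"
proof
 assume "p dvd h"
 hence "p ^ 2 dvd p * h" by (simp add: power2_eq_square mult_dvd_mono)
 thus False using assms unfolding squarefree_def irreducible_def by blast
qed

lemma not_dvd_partial:
 assumes "D \<in> {dx, dy, dz}" "D p ~= 0"
 shows "\<not> p dvd D p"
proof
 assume "p dvd D p"
 then obtain k where k: "D p = p * k" by (rule dvdE)
 hence "p ~= 0" "k ~= 0" using assms by auto
 hence "tdeg p \<le> tdeg (D p)" using k tdeg_mult by simp
 thus False using tdeg_d[OF assms] by simp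
qed

lemma partial_nonzero:
 assumes "homogeneous (int n) F" "n > 0" "F ~= 0"
 shows "\<exists>D\<in>{dx, dy, dz}. D F ~= 0"
proof (rule ccontr)
 assume "\<not> ?thesis"
 hence "of_nat n * F = 0" using euler[OF assms(1)] by auto
 thus False using assms by auto
qed

subsection \<open>Reduced curves have isolated singularities\<close>

text \<open>A complex polynomial splits into linear factors, so a series that is a root equals one
  of the constant roots. Nonconstant series are thus transcendental.\<close>

lemma poly_fps_root:
 fixes g :: "complex fps"
 assumes "poly (map_poly fps_const p) g = 0" "p ~= 0"
 shows "\<exists>r. g = fps_const r"
 using assms
proof (induction "degree p" arbitrary: p)
 case 0
 then obtain c where "p = [:c:]" by (metis degree_eq_zeroE)
 thus ?case using 0 by simp
next
 case (Suc n)
 hence "\<not> constant (poly p)" by (simp add: constant_degree)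
 then obtain r where "poly p r = 0" using fundamental_theorem_of_algebra by blast
 then obtain p' where p': "p = [:- r, 1:] * p'" by (metis dvdE poly_eq_0_iff_dvd)
 interpret h: map_poly_comm_ring_hom fps_const by unfold_locales (auto simp flip: fps_const_add fps_const_mult)
 have "(g - fps_const r) * poly (map_poly fps_const p') g = 0"
  using Suc.prems(1) unfolding p' h.hom_mult poly_mult by (simp flip: fps_const_neg)
 hence "g = fps_const r \<or> poly (map_poly fps_const p') g = 0" by auto
 moreover have p0: "p' ~= 0" using p' Suc.prems(2) by auto
 moreover have "degree p = Suc (degree p')" unfolding p' using degree_mult_eq[of "[:- r, 1:]" p'] p0 by simp
 moreover have "degree p' = n" using calculation Suc.hyps(2) by simp
 ultimately show ?case using Suc.hyps(1) by blast
qed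

text \<open>A weak form of Bezout by counting. In large degree n the forms modulo (A, B) have
  dimension al * bt by the Koszul resolution, whereas on a common curve the monomials in
  \<open>x\<close> and \<open>y\<close> would restrict to n + 1 independent series, because
  \<open>E x = 1\<close> and \<open>E y\<close> is transcendental.\<close>

lemma no_common_curve:
 fixes Ga1 Ga2 Ga3 :: "complex fps"
 defines "E \<equiv> \<lambda>F. subst3 fps_const F Ga1 Ga2 Ga3"
 assumes A: "homogeneous (int al) A" "irreducible A" and B: "homogeneous (int bt) B" "\<not> A dvd B"
  and E: "E A = 0" "E B = 0" and x: "homogeneous 1 x" "E x = 1" and y: "homogeneous 1 y" "\<And>r. E y ~= fps_const r"
 shows False
proof -
 have hc: "comm_ring_hom (fps_const :: complex => _)" by (rule comm_ring_homI) (auto simp flip: fps_const_add fps_const_mult)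
 have Eh: "comm_ring_hom E" unfolding E_def by (rule subst3_hom[OF hc])
 interpret E: comm_ring_hom E by (rule Eh)
 have Ecc: "E (cc c) = fps_const c" for c unfolding E_def by (rule subst3_gens(1)[OF hc])
 have A0: "A ~= 0" using A by auto
 \<comment> \<open>Large enough for the Koszul count to be polynomial, and at least al * bt, so that
   n + 1 independent restrictions are too many.\<close>
 define n where "n = al + bt + al * bt"
 define Ph where "Ph w = w 0 * A + w 1 * B" for w :: "nat => poly3"
 define Ps where "Ps w i = (if i = 0 then w * B else if i = 1 then - w * A else 0)" for w and i :: nat
 define G where "G = graded_vecs [int al, int bt] (int n)"
 have G: "w \<in> G \<longleftrightarrow> homogeneous (int n - int al) (w 0) \<and> homogeneous (int n - int bt) (w 1) \<and> (\<forall>i\<ge>2. w i = 0)" for w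
  by (auto simp: G_def graded_vecs_def less_Suc_eq)
 have lin: "lin_on scf sc3 X Ph" "lin_on sc3 scf Y Ps" "lin_on sc3 sc1 Y E" for X Y
  by (auto simp: lin_on_def Ph_def Ps_def fun_eq_iff scf_def sc3_mult sc3_add sc1_def sc3_hom[OF Eh] E.hom_add Ecc algebra_simps) (simp add: sc3_def)
 have dG: "codim scf G {0} (sdim (int n - int al) + sdim (int n - int bt))" using codim_graded_vecs[of "[int al, int bt]" "int n"] by (simp add: G_def)
 obtain k1 m1 where 1: "k1 + m1 = sdim (int n - int al) + sdim (int n - int bt)" "subsp scf {w \<in> G. Ph w = 0}" "codim scf {w \<in> G. Ph w = 0} {0} k1"
  "subsp sc3 (Ph ` G)" "codim sc3 (Ph ` G) {0} m1"
  by (rule rank_nullity[OF subsp_graded_vecs[of "[int al, int bt]" "int n", folded G_def] vector_space_sc3 lin(1) dG])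
 have "{w \<in> G. Ph w = 0} = Ps ` S (int n - int bt - int al)"
 proof (intro subset_antisym subsetI)
  fix w assume "w \<in> {w \<in> G. Ph w = 0}"
  hence w: "w \<in> G" "w 0 * A + w 1 * B = 0" by (simp_all add: Ph_def)
  have "w 1 * B = A * (- w 0)" using w(2) by (simp add: eq_neg_iff_add_eq_0 add.commute mult.commute)
  hence "A dvd w 1" using prime_dvd_mult3[OF A(2), of "w 1" B] B(2) by simp
  then obtain v where v: "w 1 = - v * A" by (metis dvdE minus_minus mult.commute)
  have "A * (w 0 - v * B) = 0" using w(2) unfolding v by simp
  hence "w 0 = v * B" using A0 by simp
  hence "w i = Ps v i" for i using w(1) v by (cases "i \<ge> 2") (auto simp: G Ps_def not_le less_Suc_eq numeral_2_eq_2)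
  hence "w = Ps v" by (rule ext)
  moreover have "homogeneous (int n - int bt) (v * A)" using w(1) v by (simp add: G)
  hence "v \<in> S (int n - int bt - int al)" using homogeneous_divide[OF _ A(1) A0] by simp
  ultimately show "w \<in> Ps ` S (int n - int bt - int al)" by blast
 next
  fix w assume "w \<in> Ps ` S (int n - int bt - int al)"
  then obtain v where v: "homogeneous (int n - int bt - int al) v" "w = Ps v" by auto
  have "homogeneous (int n - int al) (v * B)" "homogeneous (int n - int bt) (v * A)"
   using homogeneous_mult[OF v(1) B(1)] homogeneous_mult[OF v(1) A(1)] by simp_all
  thus "w \<in> {w \<in> G. Ph w = 0}" by (simp add: G v(2) Ps_def Ph_def)
 qed
 moreover have "v = 0" if "Ps v = 0" for v using fun_cong[OF that, of 1] A0 by (simp add: Ps_def)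
 ultimately have k1: "k1 = sdim (int n - int bt - int al)"
  using dim_unique[OF 1(3) _ 1(2)] dim_inj(2)[OF subsp_S vector_space_scf lin(2) codim_S] by metis
 obtain k2 m2 where 2: "k2 + m2 = sdim (int n)" "subsp sc3 {F \<in> S (int n). E F = 0}" "codim sc3 {F \<in> S (int n). E F = 0} {0} k2"
  "subsp sc1 (E ` S (int n))" "codim sc1 (E ` S (int n)) {0} m2"
  by (rule rank_nullity[OF subsp_S vector_space_sc1 lin(3) codim_S])
 have "Ph ` G \<subseteq> {F \<in> S (int n). E F = 0}"
  using homogeneous_mult[OF _ A(1), of "int n - int al"] homogeneous_mult[OF _ B(1), of "int n - int bt"] E
  by (force simp: G Ph_def E.hom_add E.hom_mult intro: homogeneous_add)
 hence "m1 \<le> k2" by (rule dim_mono(1)[OF 2(3) 1(5) 2(2) 1(4)])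
 have hp: "homogeneous (int k) (z ^ k)" if "homogeneous 1 z" for z k
 proof (induction k)
  case (Suc k)
  thus ?case using homogeneous_mult[OF that Suc] by simp
 qed (use homogeneous_gens(1)[of 1] in "simp add: one_pCons")
 define T where "T p = poly (map_poly fps_const p) (E y)" for p
 have "T ` Cpoly (Suc n) \<subseteq> E ` S (int n)"
 proof (rule image_subsetI)
  fix p assume "p \<in> Cpoly (Suc n)"
  hence "degree p \<le> n" by (intro degree_le) (auto simp: Cpoly_def)
  hence "degree (map_poly fps_const p) \<le> n" by (rule order_trans[OF degree_map_poly_le])
  hence "T p = (\<Sum>k\<le>n. fps_const (coeff p k) * E y ^ k)"
   unfolding T_def poly_altdef by (intro sum.mono_neutral_cong_left) (auto simp: coeff_map_poly coeff_eq_0 intro!: le_degree)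
  also have "\<dots> = E (\<Sum>k\<le>n. sc3 (coeff p k) (y ^ k * x ^ (n - k)))"
   by (simp add: E.hom_sum sc3_hom[OF Eh] E.hom_mult E.hom_power Ecc x)
  finally have "T p = E (\<Sum>k\<le>n. sc3 (coeff p k) (y ^ k * x ^ (n - k)))" .
  moreover have "homogeneous (int n) (sc3 (coeff p k) (y ^ k * x ^ (n - k)))" if "k \<le> n" for k
   using homogeneous_scale homogeneous_mult[OF hp[OF y(1), of k] hp[OF x(1), of "n - k"]] that by (simp add: of_nat_diff)
  ultimately show "T p \<in> E ` S (int n)" by (auto intro!: imageI homogeneous_sum)
 qed
 moreover interpret h: map_poly_comm_ring_hom fps_const by unfold_locales (auto simp flip: fps_const_add fps_const_mult)
 have "lin_on Polynomial.smult sc1 (Cpoly (Suc n)) T"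
  by (simp add: lin_on_def T_def h.hom_add sc1_def map_poly_smult)
 from dim_inj[OF subsp_Cpoly vector_space_sc1 this codim_Cpoly]
 have "subsp sc1 (T ` Cpoly (Suc n))" "codim sc1 (T ` Cpoly (Suc n)) {0} (Suc n)"
  using poly_fps_root[of _ "E y"] y(2) unfolding T_def by blast+
 ultimately have "Suc n \<le> m2" using dim_mono(1)[OF 2(5) _ 2(4)] by blast
 moreover have s: "2 * int (sdim (int m)) = (int m + 1) * (int m + 2)" for m by (rule sdim_eq) simp
 have i: "int n - int al = int (n - al)" "int n - int bt = int (n - bt)" "int (n - bt) - int al = int (n - al - bt)" by (auto simp: n_def)
 have "2 * int (sdim (int n)) - 2 * int (sdim (int n - int al)) - 2 * int (sdim (int n - int bt)) + 2 * int (sdim (int n - int bt - int al)) = 2 * int (al * bt)"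
  unfolding i s by (simp add: n_def algebra_simps)
 ultimately have "n < al * bt" using 1(1) 2(1) k1 \<open>m1 \<le> k2\<close> by linarith
 thus False by (simp add: n_def)
qed

lemma reduced_curveE:
 assumes "reduced_curve f"
 obtains d where "d > 0" "homogeneous (int d) f" "f ~= 0" "squarefree f"
proof -
 from assms obtain d where d: "d > 0" "homogeneous d f" "squarefree f" unfolding reduced_curve_def by blast
 moreover have "f ~= 0"
 proof
  assume "f = 0"
  hence "(0 :: poly3)\<^sup>2 dvd f" by simp
  thus False using d(3) unfolding squarefree_def by (metis dvd_0_left_iff zero_neq_one)
 qed
 ultimately show ?thesis using that[of "nat d"] by simp
qed

lemma irreducible_homogeneous:
 assumes "homogeneous n f" "f ~= 0" "irreducible p" "f = p * h"
 shows "homogeneous (int (tdeg p)) p" "tdeg p > 0" "homogeneous (int (tdeg h)) h" "p ~= 0" "h ~= 0"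
proof -
 show nz: "p ~= 0" "h ~= 0" using assms by auto
 show "homogeneous (int (tdeg p)) p" "homogeneous (int (tdeg h)) h"
  using factor_homogeneous(1)[of n p h] factor_homogeneous(1)[of n h p] assms by (auto simp: mult.commute)
 show "tdeg p > 0" using tdeg_0_unit[OF nz(1)] assms(3) by auto
qed

text \<open>The formal curve lies on an irreducible factor p of f = p h. Since \<open>f\<close> is
  squarefree, \<open>h\<close> is nonzero along it, so all partial derivatives of p vanish there.
  But a nonzero one is of smaller degree and therefore shares no curve with p.\<close>

lemma isolated_singularities:
 fixes Ga1 Ga2 Ga3 :: "complex fps"
 defines "E \<equiv> \<lambda>F. subst3 fps_const F Ga1 Ga2 Ga3"
 assumes f: "reduced_curve f" and E: "E f = 0" "E (dx f) = 0" "E (dy f) = 0" "E (dz f) = 0"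
  and x: "homogeneous 1 x" "E x = 1" and y: "homogeneous 1 y" "\<And>r. E y ~= fps_const r"
 shows False
proof -
 obtain d where d: "d > 0" "homogeneous (int d) f" "f ~= 0" "squarefree f" using f by (rule reduced_curveE)
 have hc: "comm_ring_hom (fps_const :: complex => _)" by (rule comm_ring_homI) (auto simp flip: fps_const_add fps_const_mult)
 have Eh: "comm_ring_hom E" unfolding E_def by (rule subst3_hom[OF hc])
 interpret E: comm_ring_hom E by (rule Eh)
 obtain p where p: "irreducible p" "p dvd f" "E p = 0" using irreducible_factor[OF Eh d(3) E(1)] by blast
 then obtain h where h: "f = p * h" by auto
 note ph = irreducible_homogeneous[OF d(2,3) p(1) h]
 have nd: "\<not> p dvd h" using squarefree_factor[of p h] d(4) p(1) h by simp
 have "E h ~= 0"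
  using no_common_curve[of "tdeg p" p "tdeg h" h Ga1 Ga2 Ga3 x y] ph p nd x y unfolding E_def by blast
 obtain D where D: "D \<in> {dx, dy, dz}" "D p ~= 0" using partial_nonzero[OF ph(1,2,4)] by blast
 have "is_deriv D" using D(1) is_deriv_d by blast
 hence "E (D f) = E (D p) * E h" using p(3) by (simp add: h is_derivD E.hom_add E.hom_mult)
 moreover have "E (D f) = 0" using D(1) E by blast
 ultimately have "E (D p) = 0" using \<open>E h ~= 0\<close> by simp
 moreover have "homogeneous (int (tdeg p) - 1) (D p)" using homogeneous_d[OF ph(1)] D(1) by blast
 hence "homogeneous (int (tdeg p - 1)) (D p)" using ph(2) by simp
 ultimately show False
  using no_common_curve[of "tdeg p" p "tdeg p - 1" "D p" Ga1 Ga2 Ga3 x y] ph p not_dvd_partial[OF D] x y unfolding E_def by blast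
qed

section \<open>Vectors proportional to a primitive vector of polynomials\<close>

lemma proportional_primitive:
 fixes f1 f2 f3 :: poly3
 assumes "f1 ~= 0" and c: "w1 * f2 = w2 * f1" "w1 * f3 = w3 * f1"
  and prim: "\<And>p. irreducible p ==> p dvd f1 ==> p dvd f2 ==> p dvd f3 ==> False"
 shows "\<exists>g. w1 = g * f1 \<and> w2 = g * f2 \<and> w3 = g * f3"
proof -
 define d where "d = gcd f1 w1"
 have d0: "d ~= 0" using assms(1) by (simp add: d_def)
 obtain a b where ab: "f1 = d * a" "w1 = d * b" "coprime a b"
  using gcd_coprime_exists[of f1 w1] d0 unfolding d_def by (auto simp: mult.commute)
 have "b * f2 = w2 * a" "b * f3 = w3 * a" using c d0 unfolding ab by auto
 hence "a dvd b * f2" "a dvd b * f3" by simp_all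
 hence "a dvd f2" "a dvd f3" using ab(3) by (auto simp: coprime_dvd_mult_right_iff)
 moreover have "a dvd f1" unfolding ab by simp
 moreover have "a ~= 0" using ab assms(1) by auto
 ultimately have "a dvd 1" using prim prime_divisor_exists[of a] by (meson dvd_trans prime_elem_imp_irreducible prime_imp_prime_elem)
 then obtain a' where "1 = a * a'" by (rule dvdE)
 hence w1: "w1 = (a' * b) * f1" unfolding ab by (metis mult.assoc mult.commute mult.left_commute mult_1_right)
 hence "w2 * f1 = (a' * b) * f2 * f1" "w3 * f1 = (a' * b) * f3 * f1" unfolding c[symmetric] by simp_all
 hence "w2 = (a' * b) * f2" "w3 = (a' * b) * f3" using assms(1) by (metis mult_right_cancel)+
 thus ?thesis using w1 by blast
qed

lemma proportional_primitive':
 fixes f1 f2 f3 :: poly3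
 assumes c: "w1 * f2 = w2 * f1" "w1 * f3 = w3 * f1" "w2 * f3 = w3 * f2"
  and prim: "\<And>p. irreducible p ==> p dvd f1 ==> p dvd f2 ==> p dvd f3 ==> False"
  and nz: "f1 ~= 0 \<or> f2 ~= 0 \<or> f3 ~= 0"
 shows "\<exists>g. w1 = g * f1 \<and> w2 = g * f2 \<and> w3 = g * f3"
proof -
 consider "f1 ~= 0" | "f2 ~= 0" | "f3 ~= 0" using nz by blast
 thus ?thesis
 proof cases
  case 1
  thus ?thesis using proportional_primitive[of f1 w1 f2 w2 f3 w3] c prim by blast
 next
  case 2
  thus ?thesis using proportional_primitive[of f2 w2 f1 w1 f3 w3] c prim by metis
 next
  case 3
  thus ?thesis using proportional_primitive[of f3 w3 f1 w1 f2 w2] c prim by metis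
 qed
qed

text \<open>By Euler's formula a common factor p of the partial derivatives divides f, say f = p h.
  Then p divides (D p) h for a partial derivative D with D p \<noteq> 0, although it divides neither
  factor.\<close>

lemma gradient_primitive:
 assumes f: "reduced_curve f" and p: "irreducible p" "p dvd dx f" "p dvd dy f" "p dvd dz f"
 shows False
proof -
 obtain d where d: "d > 0" "homogeneous (int d) f" "f ~= 0" "squarefree f" using f by (rule reduced_curveE)
 have "p dvd of_nat d * f" unfolding euler[OF d(2), symmetric] using p by (intro dvd_add dvd_mult)
 moreover have "of_nat d * cc (inverse (of_nat d)) = 1" using d(1) by (simp add: of_nat_poly one_pCons)
 hence "cc (inverse (of_nat d)) * (of_nat d * f) = f" by (metis mult.assoc mult.commute mult_1_left)
 ultimately have "p dvd f" by (metis dvd_mult)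
 then obtain h where h: "f = p * h" by (rule dvdE)
 note ph = irreducible_homogeneous[OF d(2,3) p(1) h]
 have nd: "\<not> p dvd h" using squarefree_factor[of p h] d(4) p(1) h by simp
 obtain D where D: "D \<in> {dx, dy, dz}" "D p ~= 0" using partial_nonzero[OF ph(1,2,4)] by blast
 have "is_deriv D" using D(1) is_deriv_d by blast
 hence "D f = D p * h + p * D h" by (simp add: h is_derivD)
 moreover have "p dvd D f" using D(1) p by blast
 ultimately have "p dvd D p * h" by (metis dvd_add_left_iff dvd_triv_left)
 thus False using prime_dvd_mult3[OF p(1)] nd not_dvd_partial[OF D] by blast
qed

section \<open>Smooth conics\<close>

definition dot :: "(nat => 'a::comm_ring_1) => (nat => 'a) => 'a" where
 "dot v w = v 0 * w 0 + v 1 * w 1 + v 2 * w 2"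

definition gen :: "nat => poly3" where "gen i = (if i = 0 then xx else if i = 1 then yy else zz)"

definition grad :: "poly3 => nat => poly3" where
 "grad F i = (if i = 0 then dx F else if i = 1 then dy F else dz F)"

abbreviation subst_vec :: "(complex => 'a::comm_ring_1) => poly3 => (nat => 'a) => 'a" where
 "subst_vec h F v \<equiv> subst3 h F (v 0) (v 1) (v 2)"

abbreviation eval_vec :: "poly3 => (nat => complex) => complex" where
 "eval_vec F v \<equiv> eval3 F (v 0) (v 1) (v 2)"

lemma eval3_hom: "comm_ring_hom (\<lambda>F. eval3 F x y z)"
 by (rule subst3_hom[OF comm_ring_hom_id])

lemma eval3_simps:
 "eval3 (F + G) x y z = eval3 F x y z + eval3 G x y z" "eval3 (F * G) x y z = eval3 F x y z * eval3 G x y z"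
 "eval3 (F - G) x y z = eval3 F x y z - eval3 G x y z" "eval3 (- F) x y z = - eval3 F x y z" "eval3 0 x y z = 0" "eval3 1 x y z = 1"
 "eval3 (F ^ n) x y z = eval3 F x y z ^ n" "eval3 (of_nat n) x y z = of_nat n"
 "eval3 (cc c) x y z = c" "eval3 xx x y z = x" "eval3 yy x y z = y" "eval3 zz x y z = z"
proof -
 interpret comm_ring_hom "\<lambda>F. eval3 F x y z" by (rule eval3_hom)
 show "eval3 (F + G) x y z = eval3 F x y z + eval3 G x y z" "eval3 (F * G) x y z = eval3 F x y z * eval3 G x y z"
 "eval3 (F - G) x y z = eval3 F x y z - eval3 G x y z" "eval3 (- F) x y z = - eval3 F x y z" "eval3 0 x y z = 0" "eval3 1 x y z = 1"
 "eval3 (F ^ n) x y z = eval3 F x y z ^ n" "eval3 (of_nat n) x y z = of_nat n"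
  by (rule hom_add hom_mult hom_minus hom_uminus hom_zero hom_one hom_power hom_of_nat)+
qed (rule subst3_gens[OF comm_ring_hom_id])+

lemma poly_zero_off_0:
 fixes p :: "complex poly"
 assumes "\<And>x. x ~= 0 ==> poly p x = 0"
 shows "p = 0"
proof (rule ccontr)
 assume "p ~= 0"
 hence "finite {x. poly p x = 0}" by (rule poly_roots_finite)
 moreover have "UNIV - {0} \<subseteq> {x. poly p x = 0}" using assms by auto
 ultimately have "finite (UNIV - {0 :: complex})" by (rule rev_finite_subset)
 thus False by (simp add: infinite_UNIV_char_0)
qed

lemma eval3_zero:
 assumes "\<And>x y z. x ~= 0 ==> y ~= 0 ==> z ~= 0 ==> eval3 F x y z = 0"
 shows "F = 0"
proof -
 have id: "map_poly (\<lambda>c. c) r = r" for r :: "complex poly" by simp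
 have "c3 F i j k = 0" for i j k
 proof -
  have 1: "map_poly (\<lambda>q. poly (map_poly (\<lambda>r. poly r x) q) y) F = 0" if "x ~= 0" "y ~= 0" for x y
   by (rule poly_zero_off_0) (use assms[OF that] in "simp add: subst3_def id")
  have 2: "map_poly (\<lambda>r. poly r x) (coeff F k) = 0" if "x ~= 0" for x
  proof (rule poly_zero_off_0)
   fix y :: complex assume "y ~= 0"
   from arg_cong[OF 1[OF that this], of "\<lambda>p. coeff p k"]
   show "poly (map_poly (\<lambda>r. poly r x) (coeff F k)) y = 0" by (simp add: coeff_map_poly)
  qed
  have "coeff (coeff F k) j = 0"
  proof (rule poly_zero_off_0)
   fix x :: complex assume "x ~= 0"
   from arg_cong[OF 2[OF this], of "\<lambda>p. coeff p j"]
   show "poly (coeff (coeff F k) j) x = 0" by simp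
  qed
  thus ?thesis by simp
 qed
 thus ?thesis using c3_eqI[of F 0] by auto
qed

lemma eval3_eqI:
 assumes "\<And>x y z. eval3 F x y z = eval3 G x y z"
 shows "F = G"
proof -
 have "F - G = 0" by (rule eval3_zero) (simp add: eval3_simps assms)
 thus ?thesis by simp
qed

lemma eval3_subst3_poly: "poly (subst3 (\<lambda>c. [:c:]) F a b c) t = eval3 F (poly a t) (poly b t) (poly c t)"
proof -
 have 1: "comm_ring_hom (\<lambda>p :: complex poly. poly p t)" by (rule comm_ring_homI) auto
 have 2: "comm_ring_hom (\<lambda>c :: complex. [:c:])" by (rule comm_ring_homI) (auto simp: one_pCons)
 show ?thesis using hom_subst3[OF 1 2, of F a b c] by simp
qed

lemma eval3_subst3_cc:
 "eval3 (subst3 cc F a b c) x y z = eval3 F (eval3 a x y z) (eval3 b x y z) (eval3 c x y z)"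
 using hom_subst3[OF eval3_hom[of x y z] hom_cc(2), of F a b c] by (simp add: eval3_simps)

lemma eval3_scale: "homogeneous (int n) F ==> eval3 F (t * x) (t * y) (t * z) = t ^ n * eval3 F x y z"
 by (rule subst3_scale[OF comm_ring_hom_id])

lemma quadratic_form:
 assumes "homogeneous 2 q"
 shows "\<exists>A B C D E F. q = cc A * xx * xx + cc B * yy * yy + cc C * zz * zz + cc D * xx * yy + cc E * xx * zz + cc F * yy * zz"
proof -
 have h1: "homogeneous 1 G ==> \<exists>a b c. G = cc a * xx + cc b * yy + cc c * zz" for G
 proof -
  assume G: "homogeneous 1 G"
  from homogeneous_d[OF G] obtain a b c where "dx G = cc a" "dy G = cc b" "dz G = cc c"
   using homogeneous_const by fastforce
  thus ?thesis using euler[of 1 G] G by (intro exI[of _ a] exI[of _ b] exI[of _ c]) (simp add: mult.commute)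
 qed
 have "homogeneous 1 (dx q)" "homogeneous 1 (dy q)" "homogeneous 1 (dz q)" using homogeneous_d[OF assms] by simp_all
 then obtain a b c a' b' c' a'' b'' c'' where
  d: "dx q = cc a * xx + cc b * yy + cc c * zz" "dy q = cc a' * xx + cc b' * yy + cc c' * zz"
   "dz q = cc a'' * xx + cc b'' * yy + cc c'' * zz" using h1 by metis
 have eu: "of_nat 2 * q = xx * dx q + yy * dy q + zz * dz q" using euler[of 2 q] assms by simp
 have e: "2 * eval3 q x y z = x * (a * x + b * y + c * z) + y * (a' * x + b' * y + c' * z) + z * (a'' * x + b'' * y + c'' * z)" for x y z
 proof -
  have "eval3 (of_nat 2 * q) x y z = eval3 (xx * dx q + yy * dy q + zz * dz q) x y z" by (simp only: eu)
  thus ?thesis by (simp only: d eval3_simps) simp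
 qed
 show ?thesis
 proof (intro exI, rule eval3_eqI)
  fix x y z
  show "eval3 q x y z = eval3 (cc (a / 2) * xx * xx + cc (b' / 2) * yy * yy + cc (c'' / 2) * zz * zz + cc ((b + a') / 2) * xx * yy
   + cc ((c + a'') / 2) * xx * zz + cc ((c' + b'') / 2) * yy * zz) x y z"
   using e[of x y z] by (simp only: eval3_simps) (simp add: field_simps)
 qed
qed

text \<open>A basis \<open>p0\<close>, \<open>p1\<close>, \<open>e\<close> in which the conic
  becomes z^2 = x y, with dual basis \<open>n0\<close>, \<open>n1\<close>, \<open>n2\<close>. The
  point \<open>p0\<close> will be the point at infinity of the parametrisation.\<close>

locale conic =
 fixes q :: poly3 and p0 p1 e n0 n1 n2 :: "nat => complex"
 assumes q_homogeneous: "homogeneous 2 q"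
  and q_pt: "\<And>x y z. eval_vec q (\<lambda>i. x * p0 i + y * p1 i + z * e i) = z\<^sup>2 - x * y"
  and dual: "\<And>x y z. dot n0 (\<lambda>i. x * p0 i + y * p1 i + z * e i) = x"
   "\<And>x y z. dot n1 (\<lambda>i. x * p0 i + y * p1 i + z * e i) = y"
   "\<And>x y z. dot n2 (\<lambda>i. x * p0 i + y * p1 i + z * e i) = z"
  and basis: "\<And>v i. i < 3 ==> dot n0 v * p0 i + dot n1 v * p1 i + dot n2 v * e i = v i"

lemma lt_3: "i < (3::nat) \<longleftrightarrow> i = 0 \<or> i = 1 \<or> i = 2" by auto

theorem conic_exists:
 assumes q: "smooth_conic q" and p0: "eval_vec q p0 = 0" "p0 0 ~= 0 \<or> p0 1 ~= 0 \<or> p0 2 ~= 0"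
 shows "\<exists>p1 e n0 n1 n2. conic q p0 p1 e n0 n1 n2"
proof -
 have hq: "homogeneous 2 q" using q by (simp add: smooth_conic_def)
 obtain A B C D E F where qe: "q = cc A * xx * xx + cc B * yy * yy + cc C * zz * zz + cc D * xx * yy + cc E * xx * zz + cc F * yy * zz"
  using quadratic_form[OF hq] by blast
 define Q where "Q x y z = A * x * x + B * y * y + C * z * z + D * x * y + E * x * z + F * y * z" for x y z
 have Q: "eval3 q x y z = Q x y z" for x y z unfolding qe Q_def by (simp only: eval3_simps)
 have G: "eval3 (dx q) x y z = 2 * A * x + D * y + E * z" "eval3 (dy q) x y z = 2 * B * y + D * x + F * z"
  "eval3 (dz q) x y z = 2 * C * z + E * x + F * y" for x y z
  unfolding qe by (simp_all only: is_derivD(1,2)[OF is_deriv_d(1)] is_derivD(1,2)[OF is_deriv_d(2)] is_derivD(1,2)[OF is_deriv_d(3)] d_gens eval3_simps)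
   (simp_all add: algebra_simps)
 have smooth: "2 * A * x + D * y + E * z ~= 0 \<or> 2 * B * y + D * x + F * z ~= 0 \<or> 2 * C * z + E * x + F * y ~= 0"
  if "(x, y, z) ~= (0, 0, 0)" "Q x y z = 0" for x y z
  using q that unfolding smooth_conic_def Q G by blast
 define a b c where "a = p0 0" and "b = p0 1" and "c = p0 2"
 have Q0: "Q a b c = 0" using p0 by (simp add: Q a_def b_def c_def)
 define g1 g2 g3 where "g1 = 2 * A * a + D * b + E * c" and "g2 = 2 * B * b + D * a + F * c" and "g3 = 2 * C * c + E * a + F * b"
 have "g1 ~= 0 \<or> g2 ~= 0 \<or> g3 ~= 0" using smooth[of a b c] p0(2) Q0 by (auto simp: a_def b_def c_def g1_def g2_def g3_def)
 hence "\<exists>v1 v2 v3. g1 * v1 + g2 * v2 + g3 * v3 = 1"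
  by (metis add.commute add.right_neutral mult_zero_right right_inverse)
 then obtain v1 v2 v3 where v: "g1 * v1 + g2 * v2 + g3 * v3 = 1" by blast
 \<comment> \<open>The second intersection of the conic with the line through the given point p and
   v: since Q p = 0 and the gradient at p pairs to 1 with v, Q (k p - v) = Q v - k, so k = Q v
   works.\<close>
 define a' b' c' where "a' = Q v1 v2 v3 * a - v1" and "b' = Q v1 v2 v3 * b - v2" and "c' = Q v1 v2 v3 * c - v3"
 define h1 h2 h3 where "h1 = 2 * A * a' + D * b' + E * c'" and "h2 = 2 * B * b' + D * a' + F * c'" and "h3 = 2 * C * c' + E * a' + F * b'"
 have gg: "g1 * a + g2 * b + g3 * c = 0" 
 proof -
  have "g1 * a + g2 * b + g3 * c = 2 * Q a b c" unfolding Q_def g1_def g2_def g3_def by (simp add: algebra_simps)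
  thus ?thesis using Q0 by simp
 qed
 have ga: "g1 * a' + g2 * b' + g3 * c' = -1" using gg v unfolding a'_def b'_def c'_def by Groebner_Basis.algebra
 have Q1: "Q a' b' c' = 0"
 proof -
  have "Q a' b' c' = (Q v1 v2 v3)\<^sup>2 * Q a b c - Q v1 v2 v3 * (g1 * v1 + g2 * v2 + g3 * v3) + Q v1 v2 v3"
  proof -
   have "Q (k * a - v1) (k * b - v2) (k * c - v3) = k\<^sup>2 * Q a b c - k * (g1 * v1 + g2 * v2 + g3 * v3) + Q v1 v2 v3" for k
    unfolding Q_def g1_def g2_def g3_def by Groebner_Basis.algebra
   thus ?thesis unfolding a'_def b'_def c'_def .
  qed
  thus ?thesis using v Q0 by simp
 qed
 have ha: "h1 * a' + h2 * b' + h3 * c' = 0" 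
 proof -
  have "h1 * a' + h2 * b' + h3 * c' = 2 * Q a' b' c'" unfolding Q_def h1_def h2_def h3_def by (simp add: algebra_simps)
  thus ?thesis using Q1 by simp
 qed
 have hg: "h1 * a + h2 * b + h3 * c = -1" using ga unfolding g1_def g2_def g3_def h1_def h2_def h3_def by Groebner_Basis.algebra
 \<comment> \<open>The intersection of the tangents at the two points, that is, the vector
   orthogonal to both for the bilinear form. By \<open>det\<close> it completes them to a
   basis.\<close>
 define u1 u2 u3 where "u1 = g2 * h3 - g3 * h2" and "u2 = g3 * h1 - g1 * h3" and "u3 = g1 * h2 - g2 * h1"
 have gu: "g1 * u1 + g2 * u2 + g3 * u3 = 0" "h1 * u1 + h2 * u2 + h3 * u3 = 0" unfolding u1_def u2_def u3_def by Groebner_Basis.algebra+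
 have det: "(b * c' - c * b') * u1 + (c * a' - a * c') * u2 + (a * b' - b * a') * u3 = -1"
 proof -
  have "(b * c' - c * b') * u1 + (c * a' - a * c') * u2 + (a * b' - b * a') * u3 =
   (g1 * a + g2 * b + g3 * c) * (h1 * a' + h2 * b' + h3 * c') - (h1 * a + h2 * b + h3 * c) * (g1 * a' + g2 * b' + g3 * c')"
   unfolding u1_def u2_def u3_def by Groebner_Basis.algebra
  thus ?thesis using ga ha hg by simp
 qed
 \<comment> \<open>Otherwise this vector would be orthogonal to a whole basis, hence a singular
   point of the conic.\<close>
 have Qu: "Q u1 u2 u3 ~= 0"
 proof
  assume z: "Q u1 u2 u3 = 0"
  define k1 k2 k3 where "k1 = 2 * A * u1 + D * u2 + E * u3" and "k2 = 2 * B * u2 + D * u1 + F * u3" and "k3 = 2 * C * u3 + E * u1 + F * u2"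
  have k: "k1 * a + k2 * b + k3 * c = 0" "k1 * a' + k2 * b' + k3 * c' = 0" "k1 * u1 + k2 * u2 + k3 * u3 = 0"
   using gu(1) gu(2) z unfolding k1_def k2_def k3_def g1_def g2_def g3_def h1_def h2_def h3_def Q_def by Groebner_Basis.algebra+
  have "k1 = 0" "k2 = 0" "k3 = 0" using k det by Groebner_Basis.algebra+
  moreover have "(u1, u2, u3) ~= (0, 0, 0)" using det by auto
  ultimately show False using smooth[OF _ z] unfolding k1_def k2_def k3_def by blast
 qed
 define w where "w = csqrt (Q u1 u2 u3)"
 have w: "w * w = Q u1 u2 u3" "w ~= 0" using Qu power2_csqrt[of "Q u1 u2 u3"] by (auto simp: w_def power2_eq_square)
 define r where "r = 1 / w"
 have r: "r * w = 1" using w by (simp add: r_def)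
 define l1 l2 l3 where "l1 = r * u1" and "l2 = r * u2" and "l3 = r * u3"
 have gl: "g1 * l1 + g2 * l2 + g3 * l3 = 0" "h1 * l1 + h2 * l2 + h3 * l3 = 0" using gu unfolding l1_def l2_def l3_def by Groebner_Basis.algebra+
 have Ql: "Q l1 l2 l3 = 1"
 proof -
  have "Q l1 l2 l3 = r * r * Q u1 u2 u3" unfolding Q_def l1_def l2_def l3_def by Groebner_Basis.algebra
  thus ?thesis using r w by Groebner_Basis.algebra
 qed
 have det': "- w * ((b * c' - c * b') * l1 + (c * a' - a * c') * l2 + (a * b' - b * a') * l3) = 1"
  using det r unfolding l1_def l2_def l3_def by Groebner_Basis.algebra
 define V :: "complex => complex => complex => nat => complex" where "V x y z = (\<lambda>i. if i = 0 then x else if i = 1 then y else z)" for x y z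
 have [simp]: "V x y z 0 = x" "V x y z (Suc 0) = y" "V x y z 2 = z" for x y z by (auto simp: V_def)
 note p0s = a_def[symmetric] b_def[symmetric, unfolded One_nat_def] c_def[symmetric]
 have "conic q p0 (V a' b' c') (V l1 l2 l3) (V (- w * (b' * l3 - c' * l2)) (- w * (c' * l1 - a' * l3)) (- w * (a' * l2 - b' * l1)))
  (V (- w * (l2 * c - l3 * b)) (- w * (l3 * a - l1 * c)) (- w * (l1 * b - l2 * a)))
  (V (- w * (b * c' - c * b')) (- w * (c * a' - a * c')) (- w * (a * b' - b * a')))"
 proof (unfold_locales, goal_cases)
  case 1 show ?case by (rule hq)
 next
  case (2 x y z)
  have "Q (x * a + y * a' + z * l1) (x * b + y * b' + z * l2) (x * c + y * c' + z * l3) =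
   x\<^sup>2 * Q a b c + y\<^sup>2 * Q a' b' c' + z\<^sup>2 * Q l1 l2 l3 + x * y * (g1 * a' + g2 * b' + g3 * c')
   + x * z * (g1 * l1 + g2 * l2 + g3 * l3) + y * z * (h1 * l1 + h2 * l2 + h3 * l3)"
   unfolding Q_def g1_def g2_def g3_def h1_def h2_def h3_def by Groebner_Basis.algebra
  thus ?case unfolding Q by (simp add: p0s Q0 Q1 Ql ga gl)
 next
  case (3 x y z)
  show ?case using det' by (simp add: dot_def p0s) Groebner_Basis.algebra
 next
  case (4 x y z)
  show ?case using det' by (simp add: dot_def p0s) Groebner_Basis.algebra
 next
  case (5 x y z)
  show ?case using det' by (simp add: dot_def p0s) Groebner_Basis.algebra
 next
  case (6 v i)
  define v0 v1 v2 where v: "v0 = v 0" "v1 = v 1" "v2 = v 2"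
  note vs = v(1)[symmetric] v(2)[symmetric, unfolded One_nat_def] v(3)[symmetric]
  from 6 consider (0) "i = 0" | (1) "i = 1" | (2) "i = 2" by linarith
  thus ?case
  proof cases
   case 0
   show ?thesis using det' by (simp add: 0 dot_def p0s vs) Groebner_Basis.algebra
  next
   case 1
   show ?thesis using det' by (simp add: 1 dot_def p0s vs) Groebner_Basis.algebra
  next
   case 2
   show ?thesis using det' by (simp add: 2 dot_def p0s vs) Groebner_Basis.algebra
  qed
 qed
 thus ?thesis by blast
qed

lemma (in conic) coordinates:
 fixes v :: "nat => complex"
 obtains x y z where "\<And>i. i < 3 ==> v i = x * p0 i + y * p1 i + z * e i"
  "dot n0 v = x" "dot n1 v = y" "dot n2 v = z"
 using basis by metis

definition line_sub :: "(nat => complex) => poly3" where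
 "line_sub n = cc (n 0) * xx + cc (n 1) * yy + cc (n 2) * zz"

lemma eval3_line_sub: "eval3 (line_sub n) x y z = n 0 * x + n 1 * y + n 2 * z"
 unfolding line_sub_def by (simp only: eval3_simps)

lemma divide_zsq_minus_xy:
 fixes G :: poly3
 shows "\<exists>Q A B. G = (zz * zz - xx * yy) * Q + [:A:] + zz * [:B:]"
proof (induction G)
 case 0
 show ?case by (rule exI[of _ 0], rule exI[of _ 0], rule exI[of _ 0]) simp
next
 case (pCons a G)
 then obtain Q A B where G: "G = (zz * zz - xx * yy) * Q + [:A:] + zz * [:B:]" by blast
 have c: "[:a:] + [:[:0, 1:] * [:[:0, 1:]:] * B:] = [:a:] + xx * yy * [:B:]" by simp
 have "pCons a G = [:a:] + zz * G" by simp
 also have "\<dots> = (zz * zz - xx * yy) * (zz * Q + [:B:]) + ([:a:] + xx * yy * [:B:]) + zz * [:A:]"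
  unfolding G by (simp only: algebra_simps)
 also have "[:a:] + xx * yy * [:B:] = [:a + [:0, 1:] * [:[:0, 1:]:] * B:]" by simp
 finally show ?case by blast
qed

lemma reverse_degree:
 fixes p r :: "complex poly"
 assumes "\<And>t. t ~= 0 ==> poly p t = t ^ N * poly r (inverse t)"
 shows "degree p \<le> N" "coeff p N = coeff r 0"
proof -
 let ?D = "degree r"
 have "monom 1 ?D * p - monom 1 N * reflect_poly r = 0"
 proof (rule poly_zero_off_0)
  fix t :: complex assume "t ~= 0"
  thus "poly (monom 1 ?D * p - monom 1 N * reflect_poly r) t = 0"
   using assms[of t] by (simp add: poly_monom poly_reflect_poly_nz)
 qed
 hence e: "monom 1 ?D * p = monom 1 N * reflect_poly r" by simp
 have "degree p \<le> N"
 proof (cases "p = 0")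
  case False
  hence "r ~= 0" using e by auto
  hence "?D + degree p = N + degree (reflect_poly r)"
   using arg_cong[OF e, of degree] False by (simp add: degree_mult_eq degree_monom_eq)
  thus ?thesis using degree_reflect_poly_le[of r] by linarith
 qed simp
 moreover have "coeff p N = coeff (monom 1 ?D * p) (?D + N)" by (simp add: coeff_monom_mult)
 hence "coeff p N = coeff r 0" unfolding e by (simp add: coeff_monom_mult coeff_reflect_poly)
 ultimately show "degree p \<le> N" "coeff p N = coeff r 0" by auto
qed

lemma const_poly_hom: "comm_ring_hom (\<lambda>c :: complex. [:c:])"
 by (rule comm_ring_homI) (auto simp: one_pCons)

section \<open>Restriction of polynomials to the parametrised conic\<close>

context conic
begin

definition P :: "nat => complex poly" where "P i = [:p1 i, e i, p0 i:]"

definition E :: "poly3 => complex poly" where "E F = subst_vec (\<lambda>c. [:c:]) F P"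

abbreviation pt :: "complex => nat => complex" where "pt t i \<equiv> poly (P i) t"

lemma pt_eq: "pt t i = t\<^sup>2 * p0 i + 1 * p1 i + t * e i"
 by (simp add: P_def power2_eq_square algebra_simps)

lemma E_hom: "comm_ring_hom E"
 unfolding E_def[abs_def] by (rule subst3_hom[OF const_poly_hom])

lemma poly_E: "poly (E F) t = eval_vec F (pt t)"
 unfolding E_def by (rule eval3_subst3_poly)

lemma dot_pt: "dot n0 (pt t) = t\<^sup>2" "dot n1 (pt t) = 1" "dot n2 (pt t) = t"
 unfolding pt_eq dual by (rule refl)+

lemma E_q: "E q = 0"
proof (rule poly_zero_off_0)
 fix t
 show "poly (E q) t = 0" unfolding poly_E pt_eq using q_pt[of "t\<^sup>2" 1 t] by simp
qed

lemma q_nonzero: "q ~= 0"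
 using q_pt[of 0 0 1] by (auto simp: eval3_simps)

lemma on_conic:
 assumes "eval_vec q v = 0" "dot n1 v ~= 0"
 shows "\<And>i. i < 3 ==> v i = dot n1 v * pt (dot n2 v / dot n1 v) i"
proof -
 obtain x y z where c: "\<And>i. i < 3 ==> v i = x * p0 i + y * p1 i + z * e i" "dot n0 v = x" "dot n1 v = y" "dot n2 v = z" using coordinates[of v] by blast
 hence "eval_vec q (\<lambda>i. x * p0 i + y * p1 i + z * e i) = 0" using assms(1) by simp
 hence "z\<^sup>2 = x * y" unfolding q_pt by simp
 hence "y * (z / y)\<^sup>2 = x" using assms(2) c(3) by (simp add: power2_eq_square)
 thus "i < 3 ==> v i = dot n1 v * pt (dot n2 v / dot n1 v) i" for i
 proof -
  have y: "y * (z / y) = z" using assms(2) c(3) by simp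
  have "y * pt (z / y) i = (y * (z / y)\<^sup>2) * p0 i + y * p1 i + (y * (z / y)) * e i"
   unfolding pt_eq by (simp only: distrib_left mult_1_left mult.assoc)
  thus "i < 3 ==> v i = dot n1 v * pt (dot n2 v / dot n1 v) i" unfolding y \<open>y * (z / y)\<^sup>2 = x\<close> using c by simp
 qed
qed

text \<open>In the coordinates of the normal form, divide by z^2 - x y. The remainder A + z B, with
  A and B free of z, vanishes at both square roots z of x y, which forces A = B = 0.\<close>

lemma E_eq_0_imp_dvd:
 assumes F: "homogeneous (int n) F" and E: "E F = 0"
 shows "q dvd F"
proof -
 let ?M = "\<lambda>i. cc (p0 i) * xx + cc (p1 i) * yy + cc (e i) * zz"
 define G where "G = subst_vec cc F ?M"
 have G: "eval3 G x y z = eval_vec F (\<lambda>i. x * p0 i + y * p1 i + z * e i)" for x y z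
  unfolding G_def eval3_subst3_cc by (simp only: eval3_simps mult.commute)
 obtain Q A B where QAB: "G = (zz * zz - xx * yy) * Q + [:A:] + zz * [:B:]" using divide_zsq_minus_xy by blast
 have ind: "eval3 [:A:] x y z = eval3 [:A:] x y 0" for A x y z by (cases "A = 0") (simp_all add: subst3_def map_poly_pCons)
 have Gz: "eval3 G x y z = 0" if "z * z = x * y" "y ~= 0" for x y z
 proof -
  have "x * p0 i + y * p1 i + z * e i = y * pt (z / y) i" for i
  proof -
   have y: "y * (z / y) = z" "y * (z / y)\<^sup>2 = x" using that by (simp_all add: power2_eq_square)
   have "y * pt (z / y) i = (y * (z / y)\<^sup>2) * p0 i + y * p1 i + (y * (z / y)) * e i"
    unfolding pt_eq by (simp only: distrib_left mult_1_left mult.assoc)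
   thus ?thesis unfolding y ..
  qed
  hence "eval3 G x y z = y ^ n * eval_vec F (pt (z / y))" unfolding G by (simp add: eval3_scale[OF F])
  thus ?thesis using E poly_E[of F "z / y"] by simp
 qed
 have AB: "eval3 [:A:] x y 0 = 0 \<and> eval3 [:B:] x y 0 = 0" if "x ~= 0" "y ~= 0" for x y
 proof -
  define z where "z = csqrt (x * y)"
  have z: "z * z = x * y" "z ~= 0" using that power2_csqrt[of "x * y"] by (auto simp: z_def power2_eq_square)
  have "eval3 [:A:] x y 0 + w * eval3 [:B:] x y 0 = 0" if "w * w = x * y" for w
   using Gz[OF that \<open>y ~= 0\<close>] that unfolding QAB eval3_simps ind[of A _ _ w] ind[of B _ _ w] by simp
  from this[of z] this[of "- z"] z have "eval3 [:A:] x y 0 = 0" "z * eval3 [:B:] x y 0 = 0" by simp_all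
  thus ?thesis using z by simp
 qed
 have "[:A:] = 0" "[:B:] = 0" by (rule eval3_zero, subst ind, use AB in blast)+
 hence GQ: "G = (zz * zz - xx * yy) * Q" using QAB by simp
 have "F = q * subst3 cc Q (line_sub n0) (line_sub n1) (line_sub n2)"
 proof (rule eval3_eqI)
  fix a b c :: complex
  define v where "v = (\<lambda>i :: nat. if i = 0 then a else if i = 1 then b else c)"
  have abc: "a = v 0" "b = v 1" "c = v 2" by (simp_all add: v_def)
  obtain x y z where c: "\<And>i. i < 3 ==> v i = x * p0 i + y * p1 i + z * e i" "dot n0 v = x" "dot n1 v = y" "dot n2 v = z" using coordinates[of v] by blast
  have "eval_vec F v = eval3 G x y z" unfolding G using c(1) by simp
  also have "\<dots> = (z * z - x * y) * eval3 Q x y z" unfolding GQ by (simp only: eval3_simps)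
  also have "z * z - x * y = eval_vec q v" using c(1) q_pt[of x y z] by (simp add: power2_eq_square)
  also have "eval3 Q x y z = eval_vec (subst3 cc Q (line_sub n0) (line_sub n1) (line_sub n2)) v"
   unfolding eval3_subst3_cc eval3_line_sub c(2-4)[symmetric] dot_def ..
  finally show "eval3 F a b c = eval3 (q * subst3 cc Q (line_sub n0) (line_sub n1) (line_sub n2)) a b c"
   unfolding eval3_simps abc .
 qed
 thus ?thesis by (rule dvdI)
qed

text \<open>Expressed in 1/t, the parametrisation is t^2 times a polynomial curve starting at
  \<open>p0\<close>. This bounds the degree, and the top coefficient is the value at
  infinity.\<close>

lemma degree_E:
 assumes F: "homogeneous (int n) F"
 shows "degree (E F) \<le> 2 * n" "coeff (E F) (2 * n) = eval_vec F p0"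
proof -
 let ?R = "\<lambda>i. [:p0 i, e i, p1 i:]"
 have "poly (E F) t = t ^ (2 * n) * poly (subst_vec (\<lambda>c. [:c:]) F ?R) (inverse t)" if "t ~= 0" for t
 proof -
  have "pt t i = t\<^sup>2 * poly (?R i) (inverse t)" for i
  proof -
   define u where "u = inverse t"
   have "t * u = 1" using that by (simp add: u_def)
   hence "t\<^sup>2 * (p0 i + u * (e i + u * p1 i)) = t\<^sup>2 * p0 i + 1 * p1 i + t * e i" by Groebner_Basis.algebra
   thus ?thesis unfolding pt_eq by (simp add: u_def)
  qed
  thus ?thesis unfolding poly_E eval3_subst3_poly by (simp only: eval3_scale[OF F] power_mult)
 qed
 from reverse_degree[OF this] show "degree (E F) \<le> 2 * n" "coeff (E F) (2 * n) = eval_vec F p0"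
  using eval3_subst3_poly[of F "?R 0" "?R 1" "?R 2" 0] by (simp_all add: poly_0_coeff_0)
qed

text \<open>\<open>E\<close> maps to a domain and a form in its kernel is a multiple of
  \<open>q\<close>. So \<open>q\<close> divides one factor of any factorisation, and by degrees the
  other factor is constant.\<close>

lemma q_irreducible: "irreducible q"
proof (rule irreducibleI)
 show "q ~= 0" by (rule q_nonzero)
 have t2: "tdeg q = 2" using tdeg_homogeneous[of 2 q] q_homogeneous q_nonzero by simp
 show "\<not> q dvd 1"
 proof
  assume "q dvd 1"
  then obtain h where h: "1 = q * h" by (rule dvdE)
  hence "h ~= 0" by auto
  hence "tdeg (1 :: poly3) = 2 + tdeg h" using tdeg_mult[OF q_nonzero, of h] h t2 by simp
  moreover have "tdeg (1 :: poly3) = 0" using tdeg_homogeneous[of 0 1] by (simp add: one_pCons)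
  ultimately show False by simp
 qed
 fix g h assume gh: "q = g * h"
 hence nz: "g ~= 0" "h ~= 0" using q_nonzero by auto
 have hom: "homogeneous (int (tdeg g)) g" "homogeneous (int (tdeg h)) h"
  using factor_homogeneous(1)[of 2 g h] factor_homogeneous(1)[of 2 h g] q_homogeneous gh q_nonzero by (auto simp: mult.commute)
 interpret E: comm_ring_hom E by (rule E_hom)
 have deg: "tdeg q = tdeg g + tdeg h" unfolding gh by (rule tdeg_mult[OF nz])
 have "E g * E h = 0" using E_q unfolding gh by (simp add: E.hom_mult)
 hence "q dvd g \<or> q dvd h" using E_eq_0_imp_dvd[OF hom(1)] E_eq_0_imp_dvd[OF hom(2)] by auto
 hence "tdeg q \<le> tdeg g \<or> tdeg q \<le> tdeg h"
  using nz tdeg_mult[OF q_nonzero] by (metis dvdE le_add1 mult_zero_right)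
 thus "g dvd 1 \<or> h dvd 1" using deg tdeg_0_unit[OF nz(1)] tdeg_0_unit[OF nz(2)] by auto
qed

end

lemma isotropic_vector:
 assumes "homogeneous 2 q"
 shows "\<exists>p. eval_vec q p = 0 \<and> (p 0 ~= 0 \<or> p 1 ~= 0 \<or> p 2 ~= 0)"
proof -
 obtain A B C D E F where q: "q = cc A * xx * xx + cc B * yy * yy + cc C * zz * zz + cc D * xx * yy + cc E * xx * zz + cc F * yy * zz"
  using quadratic_form[OF assms] by blast
 have Q: "eval3 q x y z = A * x * x + B * y * y + C * z * z + D * x * y + E * x * z + F * y * z" for x y z
  unfolding q by (simp only: eval3_simps)
 show ?thesis
 proof (cases "A = 0")
  case True
  thus ?thesis by (intro exI[of _ "\<lambda>i. if i = 0 then 1 else 0"]) (simp add: Q)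
 next
  case False
  define s where "s = csqrt (D\<^sup>2 - 4 * A * B)"
  have s: "s * s = D * D - 4 * A * B" using power2_csqrt[of "D\<^sup>2 - 4 * A * B"] by (simp add: s_def power2_eq_square)
  define x where "x = (s - D) / (2 * A)"
  have "2 * A * x = s - D" using False by (simp add: x_def)
  hence "4 * A * (A * x * x + B + D * x) = 0" using s by Groebner_Basis.algebra
  hence "A * x * x + B + D * x = 0" using False by simp
  thus ?thesis by (intro exI[of _ "\<lambda>i. if i = 0 then x else if i = 1 then 1 else 0"]) (simp add: Q)
 qed
qed

text \<open>The affine parameter t misses the point \<open>p0\<close>. Taking \<open>p0\<close> off
  the curve makes every intersection point visible at a finite t.\<close>

theorem conic_through_general_point:
 assumes q: "smooth_conic q" and f: "homogeneous (int n) f" "f ~= 0" "q \<notin> Irr f"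
 shows "\<exists>p0 p1 e n0 n1 n2. conic q p0 p1 e n0 n1 n2 \<and> eval_vec f p0 ~= 0 \<and> \<not> q dvd f"
proof -
 have hq: "homogeneous 2 q" using q by (simp add: smooth_conic_def)
 obtain p where p: "eval_vec q p = 0" "p 0 ~= 0 \<or> p 1 ~= 0 \<or> p 2 ~= 0" using isotropic_vector[OF hq] by blast
 from conic_exists[OF q p] obtain p1 e n0 n1 n2 where "conic q p p1 e n0 n1 n2" by blast
 then interpret c: conic q p p1 e n0 n1 n2 .
 have nd: "\<not> q dvd f" using f(3) c.q_irreducible by (simp add: Irr_def)
 hence "c.E f ~= 0" using c.E_eq_0_imp_dvd[OF f(1)] by blast
 then obtain t where "poly (c.E f) t ~= 0" using poly_zero_off_0 by blast
 hence t: "eval_vec f (c.pt t) ~= 0" by (simp add: c.poly_E)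
 have "eval_vec q (c.pt t) = 0" using c.poly_E[of q t] c.E_q by simp
 moreover have "c.pt t 0 ~= 0 \<or> c.pt t 1 ~= 0 \<or> c.pt t 2 ~= 0" using c.dot_pt(2)[of t] by (auto simp: dot_def)
 ultimately show ?thesis using conic_exists[OF q, of "c.pt t"] t nd by blast
qed

section \<open>Local equations along the conic\<close>

definition cls :: "(nat => complex) => vec3 set" where "cls v = proj_rel `` {(v 0, v 1, v 2)}"

abbreviation nonzero_vec :: "(nat => complex) => bool" where "nonzero_vec v \<equiv> v 0 ~= 0 \<or> v 1 ~= 0 \<or> v 2 ~= 0"

lemma in_cls:
 assumes "nonzero_vec v"
 shows "w \<in> cls v \<longleftrightarrow> (\<exists>c. c ~= 0 \<and> w = (c * v 0, c * v 1, c * v 2))"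
 using assms by (cases w) (auto simp: cls_def proj_rel_def)

lemma cls_in_P2: "nonzero_vec v ==> cls v \<in> P2"
 unfolding P2_def cls_def by (rule quotientI) auto

lemma P2_cases:
 assumes "p \<in> P2"
 obtains v where "nonzero_vec v" "p = cls v"
proof -
 obtain k where k: "k \<in> UNIV - {(0, 0, 0)}" "p = proj_rel `` {k}" using assms unfolding P2_def by (rule quotientE)
 then obtain x y z where xyz: "(x, y, z) ~= (0, 0, 0)" "p = proj_rel `` {(x, y, z)}" by (cases k) auto
 thus ?thesis using that[of "\<lambda>i. if i = 0 then x else if i = 1 then y else z"] by (simp add: cls_def)
qed

lemma cls_eq_iff:
 assumes v: "nonzero_vec v" and w: "nonzero_vec w"
 shows "cls v = cls w \<longleftrightarrow> (\<exists>c. c ~= 0 \<and> (\<forall>i<3. w i = c * v i))"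
proof
 assume "cls v = cls w"
 moreover have "(w 0, w 1, w 2) \<in> cls w" unfolding in_cls[OF w] by (rule exI[of _ 1]) simp
 ultimately have "(w 0, w 1, w 2) \<in> cls v" by simp
 then obtain c where "c ~= 0" "(w 0, w 1, w 2) = (c * v 0, c * v 1, c * v 2)" unfolding in_cls[OF v] by blast
 thus "\<exists>c. c ~= 0 \<and> (\<forall>i<3. w i = c * v i)" by (intro exI[of _ c]) (auto simp: lt_3)
next
 assume "\<exists>c. c ~= 0 \<and> (\<forall>i<3. w i = c * v i)"
 then obtain c where c: "c ~= 0" "w 0 = c * v 0" "w 1 = c * v 1" "w 2 = c * v 2" by auto
 show "cls v = cls w"
 proof (intro subset_antisym subsetI)
  fix x assume "x \<in> cls v"
  then obtain k where k: "k ~= 0" "x = (k * v 0, k * v 1, k * v 2)" unfolding in_cls[OF v] by blast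
  thus "x \<in> cls w" unfolding in_cls[OF w] using c by (intro exI[of _ "k / c"]) simp
 next
  fix x assume "x \<in> cls w"
  then obtain k where k: "k ~= 0" "x = (k * w 0, k * w 1, k * w 2)" unfolding in_cls[OF w] by blast
  thus "x \<in> cls v" unfolding in_cls[OF v] using c by (intro exI[of _ "k * c"]) simp
 qed
qed

lemma cls_in_points:
 assumes v: "nonzero_vec v" and F: "homogeneous (int n) F"
 shows "cls v \<in> points F \<longleftrightarrow> eval_vec F v = 0"
proof
 assume "cls v \<in> points F"
 moreover have "(v 0, v 1, v 2) \<in> cls v" unfolding in_cls[OF v] by (rule exI[of _ 1]) simp
 ultimately show "eval_vec F v = 0" unfolding points_def by fast
next
 assume e: "eval_vec F v = 0"
 have "eval3 F x y z = 0" if "(x, y, z) \<in> cls v" for x y z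
  using that unfolding in_cls[OF v] using e by (auto simp: eval3_scale[OF F])
 thus "cls v \<in> points F" using cls_in_P2[OF v] by (auto simp: points_def)
qed

lemma permutation3: "distinct [a, b, w] ==> {a, b, w} = {0, 1, 2 :: nat} ==>
  (a, b, w) \<in> {(0, 1, 2), (0, 2, 1), (1, 2, 0), (1, 0, 2), (2, 0, 1), (2, 1, 0)}"
proof -
 assume d: "distinct [a, b, w]" and e: "{a, b, w} = {0, 1, 2 :: nat}"
 have m: "a \<in> {0, 1, 2}" "b \<in> {0, 1, 2}" "w \<in> {0, 1, 2}" unfolding e[symmetric] by simp_all
 hence "a = 0 \<or> a = 1 \<or> a = 2" "b = 0 \<or> b = 1 \<or> b = 2" "w = 0 \<or> w = 1 \<or> w = 2" by simp_all
 thus ?thesis using d by (elim disjE) simp_all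
qed

text \<open>The affine coordinates do not depend on the representative chosen in
  \<open>germ\<close>. The index \<open>w\<close> is the coordinate set to 1, and leaving the
  indices variable treats the three charts at once.\<close>

lemma germ_chart:
 assumes v: "nonzero_vec v"
 obtains a b w where "distinct [a, b, w]" "{a, b, w} = {0, 1, 2 :: nat}" "v w ~= 0"
  "\<And>F. germ F (cls v) = subst_vec const2 F (\<lambda>i. if i = w then 1 else if i = a then const2 (v a / v w) + U else const2 (v b / v w) + V)"
proof -
 have "(v 0, v 1, v 2) \<in> cls v" unfolding in_cls[OF v] by (rule exI[of _ 1]) simp
 hence "(SOME w. w \<in> cls v) \<in> cls v" by (rule someI)
 then obtain c where c: "c ~= 0" "(SOME w. w \<in> cls v) = (c * v 0, c * v 1, c * v 2)" unfolding in_cls[OF v] by blast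
 have z: "const2 0 = 0" by (simp add: const2_def)
 consider (z) "v 2 ~= 0" | (y) "v 2 = 0" "v 1 ~= 0" | (x) "v 2 = 0" "v 1 = 0" "v 0 ~= 0" using v by blast
 thus ?thesis
 proof cases
  case z
  show ?thesis by (rule that[of 0 1 2]) (use z c in "auto simp: germ_def")
 next
  case y
  show ?thesis by (rule that[of 0 2 1]) (use y c in "auto simp: germ_def z")
 next
  case x
  show ?thesis by (rule that[of 1 2 0]) (use x c in "auto simp: germ_def z")
 qed
qed

lemma const2_hom: "comm_ring_hom const2"
 by (rule comm_ring_homI) (simp_all add: const2_def flip: fps_const_add fps_const_mult)

lemma fps_const_hom: "comm_ring_hom (fps_const :: complex => _)"
 by (rule comm_ring_homI) (simp_all flip: fps_const_add fps_const_mult)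

lemma fps2_nth_00_hom: "comm_ring_hom (\<lambda>G :: fps2. G $ 0 $ 0)"
 by (rule comm_ring_homI) (simp_all add: fps_mult_nth)

section \<open>Homogeneous polynomials and derivations in an affine chart\<close>

locale chart =
 fixes v :: "nat => complex" and a b w :: nat
 assumes abw: "distinct [a, b, w]" "{a, b, w} = {0, 1, 2 :: nat}" and vw: "v w ~= 0"
begin

definition L :: "nat => fps2" where
 "L i = (if i = w then 1 else if i = a then const2 (v a / v w) + U else const2 (v b / v w) + V)"

definition Ph :: "poly3 => fps2" where "Ph F = subst_vec const2 F L"

sublocale Ph: comm_ring_hom Ph
 unfolding Ph_def[abs_def] by (rule subst3_hom[OF const2_hom])

lemma Ph_gens: "Ph (cc c) = const2 c" "i < 3 ==> Ph (gen i) = L i"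
 unfolding Ph_def lt_3 by (auto simp: subst3_gens[OF const2_hom] gen_def)

lemma L_simps: "L w = 1" "L a = const2 (v a / v w) + U" "L b = const2 (v b / v w) + V"
 using abw(1) by (auto simp: L_def)

lemma less_3: "i < 3 \<longleftrightarrow> i = a \<or> i = b \<or> i = w"
proof -
 have "i < 3 \<longleftrightarrow> i \<in> {0, 1, 2}" by auto
 hence "i < 3 \<longleftrightarrow> i \<in> {a, b, w}" by (simp only: abw(2))
 thus ?thesis by simp
qed

lemma dot_perm: "dot x y = x a * y a + x b * y b + x w * y w"
 using permutation3[OF abw] by (auto simp: dot_def)

lemma du_const: "du (const2 c) = 0" "dv (const2 c) = 0" "du U = 1" "dv U = 0" "du V = 0" "dv V = 1"
proof -
 show "du (const2 c) = 0" by (rule fps_ext) (simp add: du_def const2_def)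
 show "dv (const2 c) = 0" "dv U = 0" "dv V = 1" by (simp_all add: dv_def const2_def U_def V_def)
 show "du U = 1" by (rule fps_ext) (simp add: du_def U_def)
 show "du V = 0" by (rule fps_ext) (simp add: du_def V_def fps_X_def)
qed

lemma du_L: "du (L a) = 1" "du (L b) = 0" "du (L w) = 0" "dv (L a) = 0" "dv (L b) = 1" "dv (L w) = 0"
 unfolding L_simps by (simp_all add: is_derivD[OF is_deriv_dudv(1)] is_derivD[OF is_deriv_dudv(2)] du_const)

lemma du_Ph: "du (Ph F) = Ph (grad F a)" "dv (Ph F) = Ph (grad F b)"
proof -
 have *: "de (Ph F) = dot (\<lambda>i. Ph (grad F i)) (\<lambda>i. de (L i))" if "is_deriv de" "\<And>c. de (const2 c) = 0" for de
 proof -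
  have "de (Ph F) = Ph (dx F) * de (Ph xx) + Ph (dy F) * de (Ph yy) + Ph (dz F) * de (Ph zz)"
   by (rule chain_rule[OF Ph.comm_ring_hom_axioms that(1)]) (unfold Ph_gens(1), rule that(2))
  moreover have "Ph xx = L 0" "Ph yy = L 1" "Ph zz = L 2" using Ph_gens(2)[of 0] Ph_gens(2)[of 1] Ph_gens(2)[of 2] by (simp_all add: gen_def)
  ultimately show ?thesis by (simp add: dot_def grad_def)
 qed
 show "du (Ph F) = Ph (grad F a)" using *[OF is_deriv_dudv(1) du_const(1)] unfolding dot_perm du_L by simp
 show "dv (Ph F) = Ph (grad F b)" using *[OF is_deriv_dudv(2) du_const(2)] unfolding dot_perm du_L by simp
qed

lemma euler_dot:
 assumes "homogeneous (int n) F"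
 shows "dot gen (grad F) = of_nat n * F"
 using euler[OF assms] by (simp only: dot_def gen_def grad_def) simp

lemma Ph_euler:
 assumes "homogeneous (int n) F"
 shows "L a * Ph (grad F a) + L b * Ph (grad F b) + Ph (grad F w) = of_nat n * Ph F"
proof -
 have "Ph (dot gen (grad F)) = of_nat n * Ph F" unfolding euler_dot[OF assms] Ph.hom_mult Ph.hom_of_nat ..
 moreover have "a < 3" "b < 3" "w < 3" using less_3 by auto
 ultimately show ?thesis unfolding dot_perm Ph.hom_add Ph.hom_mult by (simp add: Ph_gens L_simps(1))
qed

lemma Ph_conv: "Ph F \<in> conv"
proof -
 have L: "L i \<in> conv" for i unfolding L_def by (auto intro!: conv_gens conv_add)
 have g: "Ph (gen i) \<in> conv" if "i < 3" for i unfolding Ph_gens(2)[OF that] by (rule L)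
 show ?thesis
  using g[of 0] g[of 1] g[of 2]
  by (induction F rule: poly3_induct) (simp_all add: Ph_gens conv_gens gen_def Ph.hom_add Ph.hom_mult conv_add conv_mult)
qed

lemma Ph_nth_0:
 assumes "homogeneous (int n) F"
 shows "Ph F $ 0 $ 0 = (1 / v w) ^ n * eval_vec F v"
proof -
 have L: "L i $ 0 $ 0 = 1 / v w * v i" if "i < 3" for i
  using that vw unfolding less_3 by (auto simp: L_simps const2_def U_def V_def)
 have "Ph F $ 0 $ 0 = eval_vec F (\<lambda>i. L i $ 0 $ 0)"
  unfolding Ph_def using hom_subst3[OF fps2_nth_00_hom const2_hom, of F "L 0" "L 1" "L 2"] by (simp add: const2_def)
 also have "\<dots> = eval_vec F (\<lambda>i. 1 / v w * v i)" using L[of 0] L[of 1] L[of 2] by simp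
 also have "\<dots> = (1 / v w) ^ n * eval_vec F v" by (rule eval3_scale[OF assms])
 finally show ?thesis .
qed

text \<open>Subtracting \<open>th w\<close> times the Euler field makes the derivation annihilate
  the coordinate set to 1, so that it acts on the chart. By Euler's formula its value on
  \<open>F\<close> changes only by a multiple of \<open>F\<close>.\<close>

lemma derivation_Ph:
 assumes "homogeneous (int n) F"
 shows "(Ph (th a) - L a * Ph (th w)) * du (Ph F) + (Ph (th b) - L b * Ph (th w)) * dv (Ph F)
  = Ph (dot th (grad F)) - of_nat n * Ph F * Ph (th w)"
 unfolding du_Ph dot_perm Ph.hom_add Ph.hom_mult Ph_euler[OF assms, symmetric] by (simp only: algebra_simps) 

lemma ev_Ph:
 assumes "al $ 0 = 0" "bt $ 0 = 0"
 shows "ev al bt (Ph F) = subst_vec fps_const F (\<lambda>i. ev al bt (L i))"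
 unfolding Ph_def using hom_subst3[OF ev_hom[OF assms] const2_hom, of F "L 0" "L 1" "L 2"] by (simp add: ev_const2)

end

locale chart_curve = chart +
 fixes Ga :: "nat => complex fps"
 assumes Ga_0: "\<And>i. i < 3 ==> Ga i $ 0 = v i"
begin

definition u where "u = inverse (Ga w)"
definition al where "al = Ga a * u - fps_const (v a / v w)"
definition bt where "bt = Ga b * u - fps_const (v b / v w)"

lemma lt: "a < 3" "b < 3" "w < 3" using less_3 by auto

lemma u: "Ga w * u = 1" "u ~= 0" "u $ 0 = 1 / v w"
proof -
 have "Ga w $ 0 ~= 0" using Ga_0[OF lt(3)] vw by simp
 thus "Ga w * u = 1" unfolding u_def by (metis inverse_mult_eq_1 mult.commute)
 thus "u ~= 0" by auto
 show "u $ 0 = 1 / v w" unfolding u_def using Ga_0[OF lt(3)] by (simp add: divide_inverse)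
qed

lemma albt_0: "al $ 0 = 0" "bt $ 0 = 0"
 using Ga_0 lt u(3) by (simp_all add: al_def bt_def)

lemma ev_L: "i < 3 ==> ev al bt (L i) = u * Ga i"
proof -
 interpret e: comm_ring_hom "ev al bt" by (rule ev_hom[OF albt_0])
 show "i < 3 ==> ev al bt (L i) = u * Ga i"
  unfolding less_3 using u(1) by (auto simp: L_simps e.hom_add ev_const2 ev_U ev_V albt_0 mult.commute) (simp_all add: al_def bt_def mult.commute)
qed

lemma ev_Ph_homogeneous: "homogeneous (int n) F ==> ev al bt (Ph F) = u ^ n * subst_vec fps_const F Ga"
 unfolding ev_Ph[OF albt_0] by (simp add: ev_L subst3_scale[OF fps_const_hom])

lemma albt_deriv:
 "fps_deriv al = u * (fps_deriv (Ga a) - Ga a * u * fps_deriv (Ga w))"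
 "fps_deriv bt = u * (fps_deriv (Ga b) - Ga b * u * fps_deriv (Ga w))"
proof -
 have "fps_deriv (Ga w * u) = 0" unfolding u(1) by simp
 hence "Ga w * fps_deriv u + fps_deriv (Ga w) * u = 0" by simp
 hence "Ga w * (fps_deriv u + u * u * fps_deriv (Ga w)) = 0" using u(1) by Groebner_Basis.algebra
 moreover have "Ga w ~= 0" using u(1) by auto
 ultimately have du: "fps_deriv u = - (u * u * fps_deriv (Ga w))" by (simp add: eq_neg_iff_add_eq_0)
 show "fps_deriv al = u * (fps_deriv (Ga a) - Ga a * u * fps_deriv (Ga w))"
  "fps_deriv bt = u * (fps_deriv (Ga b) - Ga b * u * fps_deriv (Ga w))"
  unfolding al_def bt_def by (simp_all add: du algebra_simps)
qed

text \<open>The radial part g disappears in the chart, and the multiple h of the velocity survives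
  up to the unit u^n \<open>Ga w\<close>.\<close>

lemma ev_tangent:
 assumes "\<And>i. i < 3 ==> homogeneous (int n) (th i)"
  and "\<And>i. i < 3 ==> subst_vec fps_const (th i) Ga = g * Ga i + h * fps_deriv (Ga i)"
 shows "ev al bt (Ph (th a) - L a * Ph (th w)) = (u ^ n * Ga w * h) * fps_deriv al"
  "ev al bt (Ph (th b) - L b * Ph (th w)) = (u ^ n * Ga w * h) * fps_deriv bt"
proof -
 interpret e: comm_ring_hom "ev al bt" by (rule ev_hom[OF albt_0])
 have "ev al bt (Ph (th i) - L i * Ph (th w)) = (u ^ n * Ga w * h) * (u * (fps_deriv (Ga i) - Ga i * u * fps_deriv (Ga w)))" if i: "i < 3" for i
 proof -
  have "ev al bt (Ph (th i) - L i * Ph (th w)) = u ^ n * (g * Ga i + h * fps_deriv (Ga i)) - u * Ga i * (u ^ n * (g * Ga w + h * fps_deriv (Ga w)))"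
   by (simp only: e.hom_minus e.hom_mult ev_Ph_homogeneous[OF assms(1)[OF i]] ev_Ph_homogeneous[OF assms(1)[OF lt(3)]] assms(2) i lt ev_L)
  also have "\<dots> = (u ^ n * Ga w * h) * (u * (fps_deriv (Ga i) - Ga i * u * fps_deriv (Ga w)))"
  proof -
   have "X * (g * G + h * G') - y * G * (X * (g * W + h * W')) = X * W * h * (y * (G' - G * y * W'))" if "W * y = 1"
    for X G G' W W' y :: "complex fps"
    using that by Groebner_Basis.algebra
   thus ?thesis using u(1) by blast
  qed
  finally show ?thesis .
 qed
 thus "ev al bt (Ph (th a) - L a * Ph (th w)) = (u ^ n * Ga w * h) * fps_deriv al"
  "ev al bt (Ph (th b) - L b * Ph (th w)) = (u ^ n * Ga w * h) * fps_deriv bt"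
  unfolding albt_deriv using lt by blast+
qed

end

section \<open>Taylor expansion of polynomials at a parameter value\<close>

definition tay :: "complex => complex poly => complex fps" where "tay t p = fps_of_poly (p \<circ>\<^sub>p [:t, 1:])"

lemma tay_hom: "comm_ring_hom (tay t)"
 by (rule comm_ring_homI) (simp_all add: tay_def pcompose_add pcompose_mult pcompose_1 fps_of_poly_add fps_of_poly_mult)

lemma tay_nth_0: "tay t p $ 0 = poly p t"
 by (simp add: tay_def poly_pcompose)

lemma tay_const: "tay t [:c:] = fps_const c"
 by (simp add: tay_def)

lemma fps_deriv_tay: "fps_deriv (tay t p) = tay t (pderiv p)"
 by (simp add: tay_def fps_of_poly_pderiv[symmetric] pderiv_pcompose pderiv_pCons)

lemma tay_linear: "tay t [:- t, 1:] = fps_X"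
 by (simp add: tay_def)

lemma subdegree_tay:
 assumes "p ~= 0"
 shows "tay t p ~= 0" "subdegree (tay t p) = order t p"
proof -
 interpret T: comm_ring_hom "tay t" by (rule tay_hom)
 obtain h where h: "p = [:- t, 1:] ^ order t p * h" "\<not> [:- t, 1:] dvd h" using order_decomp[OF assms, of t] by blast
 hence "tay t h $ 0 ~= 0" by (simp add: tay_nth_0 poly_eq_0_iff_dvd)
 hence "tay t h ~= 0" "subdegree (tay t h) = 0" by auto
 moreover have "tay t p = fps_X ^ order t p * tay t h" using arg_cong[OF h(1), of "tay t"] unfolding T.hom_mult T.hom_power tay_linear .
 ultimately show "tay t p ~= 0" "subdegree (tay t p) = order t p" by simp_all
qed

lemma tay_dvd_iff: "fps_X ^ r dvd tay t p \<longleftrightarrow> [:- t, 1:] ^ r dvd p"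
proof (cases "p = 0")
 case False
 thus ?thesis using subdegree_tay[OF False, of t] by (simp add: fps_X_power_dvd_iff order_divides)
next
 case True
 thus ?thesis by (simp add: tay_def)
qed

lemma fps_X_power_dvd_unit_mult:
 assumes "y $ 0 ~= 0"
 shows "fps_X ^ r dvd y * g \<longleftrightarrow> fps_X ^ r dvd (g :: complex fps)"
proof (cases "g = 0")
 case False
 moreover have "y ~= 0" "subdegree y = 0" using assms by auto
 ultimately show ?thesis by (simp add: fps_X_power_dvd_iff)
qed simp

lemma homogeneous_dot:
 assumes "\<And>i. i < 3 ==> homogeneous n (x i)" "\<And>i. i < 3 ==> homogeneous m (y i)"
 shows "homogeneous (n + m) (dot x y)"
 unfolding dot_def using assms by (intro homogeneous_add homogeneous_mult) simp_all

section \<open>Intersection points of curve and conic, and their local numbers\<close>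

locale conic_curve = conic +
 fixes f :: poly3 and d :: nat
 assumes q_smooth: "smooth_conic q" and f_reduced: "reduced_curve f" and f_homogeneous: "homogeneous (int d) f"
  and f_nd: "\<not> q dvd f" and f_p0: "eval_vec f p0 ~= 0"
begin

lemma d_pos: "d > 0"
proof -
 obtain d' where "d' > 0" "homogeneous (int d') f" "f ~= 0" using f_reduced by (rule reduced_curveE)
 thus ?thesis using homogeneous_unique[OF f_homogeneous, of "int d'"] by simp
qed

lemma Ef: "E f ~= 0" "degree (E f) = 2 * d"
proof -
 have "coeff (E f) (2 * d) ~= 0" "degree (E f) \<le> 2 * d" using degree_E[OF f_homogeneous] f_p0 by auto
 thus "E f ~= 0" "degree (E f) = 2 * d" using le_degree by (auto intro: antisym)
qed

abbreviation point :: "complex => vec3 set" where "point t \<equiv> cls (pt t)"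

lemma pt_nonzero: "nonzero_vec (pt t)"
 using dot_pt(2)[of t] by (auto simp: dot_def)

definition roots :: "complex set" where "roots = {t. poly (E f) t = 0}"

lemma finite_roots: "finite roots"
 unfolding roots_def by (rule poly_roots_finite[OF Ef(1)])

lemma points_bij: "bij_betw point roots (points f \<inter> points q)"
 unfolding bij_betw_def
proof (intro conjI inj_onI subset_antisym subsetI)
 fix s t assume "point s = point t"
 then obtain c where c: "\<And>i. i < 3 ==> pt t i = c * pt s i" using cls_eq_iff[OF pt_nonzero[of s] pt_nonzero[of t]] by blast
 have s: "dot n (pt t) = c * dot n (pt s)" for n unfolding dot_def using c[of 0] c[of 1] c[of 2] by (simp add: algebra_simps)
 show "s = t" using s[of n1] s[of n2] unfolding dot_pt by simp
next
 fix p assume "p \<in> point ` roots"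
 then obtain t where t: "p = point t" "poly (E f) t = 0" by (auto simp: roots_def)
 have "eval_vec q (pt t) = 0" using poly_E[of q t] E_q by simp
 thus "p \<in> points f \<inter> points q"
  using t cls_in_points[OF pt_nonzero[of t] f_homogeneous] cls_in_points[OF pt_nonzero[of t], of 2 q] q_homogeneous by (simp add: poly_E)
next
 fix p assume p: "p \<in> points f \<inter> points q"
 hence "p \<in> P2" by (simp add: points_def)
 then obtain v where v: "nonzero_vec v" "p = cls v" by (rule P2_cases)
 have z: "eval_vec f v = 0" "eval_vec q v = 0"
  using p v(2) cls_in_points[OF v(1) f_homogeneous] cls_in_points[OF v(1), of 2 q] q_homogeneous by simp_all
 have n1: "dot n1 v ~= 0"
 proof
  assume n1: "dot n1 v = 0"
  obtain x y z' where c: "\<And>i. i < 3 ==> v i = x * p0 i + y * p1 i + z' * e i" "dot n0 v = x" "dot n1 v = y" "dot n2 v = z'"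
   using coordinates[of v] by blast
  have "eval_vec q (\<lambda>i. x * p0 i + y * p1 i + z' * e i) = 0" using z(2) c(1)[of 0] c(1)[of 1] c(1)[of 2] by simp
  hence "z'\<^sup>2 = x * y" unfolding q_pt by simp
  hence yz: "y = 0" "z' = 0" using n1 c(3) by simp_all
  hence "v 0 = x * p0 0" "v 1 = x * p0 1" "v 2 = x * p0 2" using c(1)[of 0] c(1)[of 1] c(1)[of 2] by simp_all
  hence "x ^ d * eval_vec f p0 = 0" using z(1) eval3_scale[OF f_homogeneous, of x "p0 0" "p0 1" "p0 2"] by simp
  hence "x = 0" using f_p0 by simp
  thus False using v(1) \<open>v 0 = x * p0 0\<close> \<open>v 1 = x * p0 1\<close> \<open>v 2 = x * p0 2\<close> by simp
 qed
 define t where "t = dot n2 v / dot n1 v"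
 have vt: "v i = dot n1 v * pt t i" if "i < 3" for i unfolding t_def by (rule on_conic[OF z(2) n1 that])
 have "(dot n1 v) ^ d * eval_vec f (pt t) = eval_vec f v"
  unfolding eval3_scale[OF f_homogeneous, symmetric] using vt[of 0] vt[of 1] vt[of 2] by simp
 hence "poly (E f) t = 0" using z(1) n1 by (simp add: poly_E)
 moreover have "p = point t" unfolding v(2) using cls_eq_iff[OF pt_nonzero[of t] v(1)] n1 vt by metis
 ultimately show "p \<in> point ` roots" by (auto simp: roots_def)
qed

lemma tay_E: "tay t (E F) = subst_vec fps_const F (\<lambda>i. tay t (P i))"
 unfolding E_def hom_subst3[OF tay_hom const_poly_hom] tay_const ..

definition log_vec :: "nat => (nat => poly3) => bool" where
 "log_vec n th \<longleftrightarrow> (\<forall>i<3. homogeneous (int n) (th i)) \<and> dot th (grad f) = 0"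

text \<open>With i = \<open>order t (E f)\<close>, the growth of mu by 2 i - 1 and of tau by i + r
  changes \<open>eps\<close> by i - r - 1; the 1 for the point itself makes the contribution to
  \<open>k_number\<close> equal to i - r. The last clause determines r at a simple tangency in a
  smooth point of the curve, as needed for the examples.\<close>

definition local_number :: "complex => nat => bool" where
 "local_number t r \<longleftrightarrow> r < order t (E f) \<and>
   eps (f * q) (point t) - eps f (point t) + 1 = int (order t (E f)) - int r \<and>
   (\<forall>th n. log_vec n th \<longrightarrow> [:- t, 1:] ^ r dvd E (dot th (grad q))) \<and>
   (\<forall>th n g h. log_vec n th \<longrightarrow> (\<forall>i<3. E (th i) = g * P i + h * pderiv (P i)) \<longrightarrow>
    [:- t, 1:] ^ (order t (E f) - r) dvd h) \<and>
   (order t (E f) \<ge> 2 \<longrightarrow> (\<exists>i<3. eval_vec (grad f i) (pt t) ~= 0) \<longrightarrow> r \<ge> 1)"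

lemma homogeneous_grad: "homogeneous (int n) F ==> homogeneous (int (n - 1)) (grad F i)"
proof (cases "n = 0")
 case True
 assume F: "homogeneous (int n) F"
 then obtain c where "F = cc c" using homogeneous_const True by auto
 thus ?thesis by (simp add: grad_def)
next
 case False
 assume "homogeneous (int n) F"
 from homogeneous_d[OF this] show ?thesis using False by (simp add: grad_def)
qed

lemma pt_immersion:
 assumes "\<And>i. i < 3 ==> poly (pderiv (P i)) t = l * pt t i"
 shows False
proof -
 have *: "poly (pderiv (P i)) t = (2 * t) * p0 i + 0 * p1 i + 1 * e i" for i by (simp add: P_def pderiv_pCons)
 have "dot n (\<lambda>i. poly (pderiv (P i)) t) = l * dot n (pt t)" for n
  using assms[of 0] assms[of 1] assms[of 2] by (simp add: dot_def algebra_simps)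
 from this[of n1] this[of n2] show False unfolding * dual dot_pt by simp
qed

theorem local_number_exists:
 assumes t: "poly (E f) t = 0"
 shows "\<exists>r. local_number t r"
proof -
 obtain a b w where abw: "distinct [a, b, w]" "{a, b, w} = {0, 1, 2 :: nat}" "pt t w ~= 0" and
  germ: "\<And>F. germ F (point t) = subst_vec const2 F (\<lambda>i. if i = w then 1 else if i = a then const2 (pt t a / pt t w) + U else const2 (pt t b / pt t w) + V)"
  by (rule germ_chart[OF pt_nonzero[of t]]) (rule that)
 define Ga where "Ga i = tay t (P i)" for i
 interpret chart_curve "pt t" a b w Ga
  by unfold_locales (use abw in "simp_all add: Ga_def tay_nth_0")
 interpret ev: comm_ring_hom "ev al bt" by (rule ev_hom[OF albt_0])
 interpret T: comm_ring_hom "tay t" by (rule tay_hom)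
 have germ: "germ F (point t) = Ph F" for F unfolding germ Ph_def L_def ..
 have evE: "ev al bt (Ph F) = u ^ n * tay t (E F)" if "homogeneous (int n) F" for F n
  unfolding ev_Ph_homogeneous[OF that] tay_E Ga_def ..
 have u0: "u ^ n $ 0 ~= 0" for n using u(3) vw by simp
 have un: "(u ^ n * g = 0) = (g = 0)" for n g using u(2) by simp
 have derivGa: "fps_deriv (Ga i) = tay t (pderiv (P i))" for i by (simp add: Ga_def fps_deriv_tay)
 have hq: "homogeneous (int 2) q" using q_homogeneous by simp
 have evq: "ev al bt (Ph q) = 0" unfolding evE[OF hq] E_q by simp
 have evf: "ev al bt (Ph f) ~= 0" "subdegree (ev al bt (Ph f)) = order t (E f)"
 proof -
  note s = subdegree_tay[OF Ef(1), of t]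
  show "ev al bt (Ph f) ~= 0" unfolding evE[OF f_homogeneous] un by (rule s(1))
  have "subdegree (u ^ d) = 0" using u0[of d] by auto
  moreover have "u ^ d ~= 0" using u(2) by simp
  ultimately show "subdegree (ev al bt (Ph f)) = order t (E f)"
   unfolding evE[OF f_homogeneous] using s by simp
 qed
 have f00: "Ph f $ 0 $ 0 = 0" unfolding Ph_nth_0[OF f_homogeneous] using t by (simp add: poly_E)
 have q00: "Ph q $ 0 $ 0 = 0" unfolding Ph_nth_0[OF hq] using poly_E[of q t] E_q by simp
 have grad0: "Ph (grad F a) $ 0 $ 0 ~= 0 \<or> Ph (grad F b) $ 0 $ 0 ~= 0"
  if F: "homogeneous (int n) F" "Ph F $ 0 $ 0 = 0" "\<exists>i<3. eval_vec (grad F i) (pt t) ~= 0" for F n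
 proof (rule ccontr)
  assume c: "\<not> ?thesis"
  have "(L a * Ph (grad F a) + L b * Ph (grad F b) + Ph (grad F w)) $ 0 $ 0 = 0"
   unfolding Ph_euler[OF F(1)] using F(2) by simp
  hence "Ph (grad F w) $ 0 $ 0 = 0" using c by simp
  hence "Ph (grad F i) $ 0 $ 0 = 0" if "i < 3" for i using c that unfolding less_3 by auto
  hence "eval_vec (grad F i) (pt t) = 0" if "i < 3" for i
   using that unfolding Ph_nth_0[OF homogeneous_grad[OF F(1)]] using vw by simp
  thus False using F(3) by blast
 qed
 have gq: "\<exists>i<3. eval_vec (grad q i) (pt t) ~= 0"
 proof -
  have "eval_vec q (pt t) = 0" using poly_E[of q t] E_q by simp
  moreover have "(pt t 0, pt t 1, pt t 2) ~= (0, 0, 0)" using pt_nonzero[of t] by auto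
  ultimately have "eval_vec (dx q) (pt t) ~= 0 \<or> eval_vec (dy q) (pt t) ~= 0 \<or> eval_vec (dz q) (pt t) ~= 0"
   using q_smooth unfolding smooth_conic_def by blast
  thus ?thesis
  proof (elim disjE)
  qed (rule exI[of _ 0], simp add: grad_def, rule exI[of _ 1], simp add: grad_def, rule exI[of _ 2], simp add: grad_def)
 qed
 have q1: "du (Ph q) $ 0 $ 0 ~= 0 \<or> dv (Ph q) $ 0 $ 0 ~= 0" unfolding du_Ph by (rule grad0[OF hq q00 gq])
 \<comment> \<open>If the affine curve were not immersed at this point, the velocity of the
   parametrisation would be proportional to the position vector, which \<open>pt_immersion\<close>
   excludes.\<close>
 have ab1: "al $ 1 ~= 0 \<or> bt $ 1 ~= 0"
 proof (rule ccontr)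
  assume "\<not> ?thesis"
  hence "fps_deriv al $ 0 = 0" "fps_deriv bt $ 0 = 0" by auto
  hence z: "fps_deriv (Ga a) $ 0 - Ga a $ 0 * u $ 0 * fps_deriv (Ga w) $ 0 = 0"
   "fps_deriv (Ga b) $ 0 - Ga b $ 0 * u $ 0 * fps_deriv (Ga w) $ 0 = 0"
   unfolding albt_deriv using u(3) vw by simp_all
  define l where "l = u $ 0 * fps_deriv (Ga w) $ 0"
  have "fps_deriv (Ga i) $ 0 = l * Ga i $ 0" if "i < 3" for i
  proof -
   have "Ga w $ 0 * u $ 0 = 1" using arg_cong[OF u(1), of "\<lambda>g. g $ 0"] by (simp add: fps_mult_nth)
   hence "fps_deriv (Ga w) $ 0 = l * Ga w $ 0" unfolding l_def by (simp add: mult_ac)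
   moreover have "fps_deriv (Ga a) $ 0 = l * Ga a $ 0" "fps_deriv (Ga b) $ 0 = l * Ga b $ 0"
    using z unfolding l_def by simp_all
   ultimately show ?thesis using that unfolding less_3 by blast
  qed
  thus False using pt_immersion[of t l] unfolding derivGa tay_nth_0 by (simp add: Ga_def tay_nth_0)
 qed
 \<comment> \<open>By Euler's formula all three homogeneous partial derivatives of \<open>f\<close>
   vanish along the formal curve, and one of its affine coordinates is nonconstant; this contradicts
   reducedness.\<close>
 have isolated: "ev a' c (dv (Ph f)) ~= 0"
  if c: "a' $ 0 = 0" "c $ 0 = 0" "a' ~= 0 \<or> c ~= 0" "ev a' c (Ph f) = 0" "ev a' c (du (Ph f)) = 0" for a' c
 proof
  assume c6: "ev a' c (dv (Ph f)) = 0"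
  interpret e: comm_ring_hom "ev a' c" by (rule ev_hom[OF c(1,2)])
  define De where "De i = ev a' c (L i)" for i
  have eP: "ev a' c (Ph F) = subst_vec fps_const F De" for F unfolding ev_Ph[OF c(1,2)] De_def ..
  have "ev a' c (L a * Ph (grad f a) + L b * Ph (grad f b) + Ph (grad f w)) = 0"
   unfolding Ph_euler[OF f_homogeneous] e.hom_mult c(4) by simp
  hence "ev a' c (Ph (grad f w)) = 0" using c(5) c6 unfolding du_Ph e.hom_add e.hom_mult by simp
  hence z: "ev a' c (Ph (grad f i)) = 0" if "i < 3" for i using that c(5) c6 unfolding du_Ph less_3 by auto
  have gen: "homogeneous 1 (gen i)" for i by (simp add: gen_def)
  have gE: "subst_vec fps_const (gen i) De = De i" if "i < 3" for i
   using eP[of "gen i"] unfolding Ph_gens(2)[OF that] by (simp add: De_def)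
  have nc: "g = 0" if "g $ 0 = 0" "fps_const k + g = fps_const r" for g :: "complex fps" and k r
  proof -
   have "g = fps_const (r - k)" using that(2) by (simp add: algebra_simps flip: fps_const_sub)
   thus ?thesis using that(1) by simp
  qed
  have De: "De a = fps_const (pt t a / pt t w) + a'" "De b = fps_const (pt t b / pt t w) + c" "De w = 1"
   unfolding De_def L_simps by (simp_all add: e.hom_add ev_const2 ev_U ev_V c)
  obtain i where i: "i < 3" "\<And>r. De i ~= fps_const r"
  proof (cases "a' = 0")
   case True
   thus ?thesis using that[of b] lt nc[OF c(2)] c(3) De by metis
  next
   case False
   thus ?thesis using that[of a] lt nc[OF c(1)] De by metis
  qed
  show False
   by (rule isolated_singularities[OF f_reduced, of "De 0" "De 1" "De 2" "gen w" "gen i"])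
    (use z[of 0] z[of 1] z[of 2] c(4) gE[OF lt(3)] gE[OF i(1)] i(2) gen De(3) in "simp_all add: eP grad_def")
 qed
 obtain r where "branch_numbers (Ph f) (Ph q) al bt r"
  using branch_numbers_exist[OF albt_0 ab1 evq q1 f00 evf(1) isolated] by blast
 note r = this[unfolded branch_numbers_def Let_def evf(2)]
 have conv: "du (Ph F) \<in> conv" "dv (Ph F) \<in> conv" "Ph F \<in> conv" for F unfolding du_Ph by (rule Ph_conv)+
 show ?thesis
  unfolding local_number_def
 proof (intro exI[of _ r] conjI allI impI)
  from r show ro: "r < order t (E f)" by linarith
  obtain mu where mu: "cdim (idl3 (du (Ph f)) (dv (Ph f)) 0) mu" "cdim (idl3 (du (Ph f * Ph q)) (dv (Ph f * Ph q)) 0) (mu + 2 * order t (E f) - 1)"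
   using r by blast
  obtain ta where ta: "cdim (idl3 (du (Ph f)) (dv (Ph f)) (Ph f)) ta" "cdim (idl3 (du (Ph f * Ph q)) (dv (Ph f * Ph q)) (Ph f * Ph q)) (ta + order t (E f) + r)"
   using r by blast
  have i20: "idl3 x y 0 = idl2 x y" for x y by (simp add: idl3_def idl2_def)
  have "milnor f (point t) = mu" using milnor_eq[OF conv(1,2) _ germ] mu(1) unfolding i20 by blast
  moreover have "milnor (f * q) (point t) = mu + 2 * order t (E f) - 1"
   using milnor_eq[OF conv(1,2) _ germ, of "f * q"] mu(2) unfolding i20 Ph.hom_mult by blast
  moreover have "tjurina f (point t) = ta" using tjurina_eq[OF conv _ germ] ta(1) by blast
  moreover have "tjurina (f * q) (point t) = ta + order t (E f) + r"
   using tjurina_eq[OF conv _ germ, of "f * q"] ta(2) unfolding Ph.hom_mult by blast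
  ultimately show "eps (f * q) (point t) - eps f (point t) + 1 = int (order t (E f)) - int r"
   using ro unfolding eps_def by simp
 next
  fix th n assume th: "log_vec n th"
  have "Ph f dvd (Ph (th a) - L a * Ph (th w)) * du (Ph f) + (Ph (th b) - L b * Ph (th w)) * dv (Ph f)"
   unfolding derivation_Ph[OF f_homogeneous] using th by (simp add: log_vec_def)
  hence "fps_X ^ r dvd ev al bt ((Ph (th a) - L a * Ph (th w)) * du (Ph q) + (Ph (th b) - L b * Ph (th w)) * dv (Ph q))"
   using r by blast
  hence "fps_X ^ r dvd ev al bt (Ph (dot th (grad q)))"
   unfolding derivation_Ph[OF hq] ev.hom_minus ev.hom_mult evq by simp
  moreover have "homogeneous (int (n + 1)) (dot th (grad q))"
   unfolding of_nat_add using th homogeneous_grad[OF hq] by (intro homogeneous_dot) (simp_all add: log_vec_def)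
  ultimately show "[:- t, 1:] ^ r dvd E (dot th (grad q))"
   using evE by (simp only: fps_X_power_dvd_unit_mult[OF u0] tay_dvd_iff)
 next
  fix th n g h assume th: "log_vec n th" and tangent: "\<forall>i<3. E (th i) = g * P i + h * pderiv (P i)"
  have "Ph f dvd (Ph (th a) - L a * Ph (th w)) * du (Ph f) + (Ph (th b) - L b * Ph (th w)) * dv (Ph f)"
   unfolding derivation_Ph[OF f_homogeneous] using th by (simp add: log_vec_def)
  moreover have "subst_vec fps_const (th i) Ga = tay t g * Ga i + tay t h * fps_deriv (Ga i)" if "i < 3" for i
   using tangent that unfolding derivGa unfolding Ga_def tay_E[symmetric] T.hom_mult[symmetric] T.hom_add[symmetric] by simp
  hence "ev al bt (Ph (th a) - L a * Ph (th w)) = (u ^ n * Ga w * tay t h) * fps_deriv al"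
   "ev al bt (Ph (th b) - L b * Ph (th w)) = (u ^ n * Ga w * tay t h) * fps_deriv bt"
   using ev_tangent[of n th "tay t g" "tay t h"] th by (auto simp: log_vec_def)
  ultimately have "fps_X ^ (order t (E f) - r) dvd u ^ n * Ga w * tay t h" using r by blast
  moreover have "(u ^ n * Ga w) $ 0 ~= 0" using u0[of n] vw by (simp add: Ga_def tay_nth_0)
  ultimately show "[:- t, 1:] ^ (order t (E f) - r) dvd h"
   using fps_X_power_dvd_unit_mult[of "u ^ n * Ga w"] tay_dvd_iff by blast
 next
  \<comment> \<open>Curve and conic share their tangent here and \<open>f\<close> is smooth. A
    logarithmic derivation is tangent to \<open>f\<close> at the point, hence to \<open>q\<close>,
    so its value on \<open>q\<close> vanishes there.\<close>
  assume o2: "order t (E f) \<ge> 2" and gf: "\<exists>i<3. eval_vec (grad f i) (pt t) ~= 0"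
  have f1: "du (Ph f) $ 0 $ 0 ~= 0 \<or> dv (Ph f) $ 0 $ 0 ~= 0" unfolding du_Ph by (rule grad0[OF f_homogeneous f00 gf])
  have d0: "fps_deriv (ev al bt F) $ 0 = du F $ 0 $ 0 * al $ 1 + dv F $ 0 $ 0 * bt $ 1" for F
   unfolding ev_chain_rule[OF albt_0] by (simp add: ev_nth_0)
  have "ev al bt (Ph f) $ 1 = 0" using nth_less_subdegree_zero[of 1 "ev al bt (Ph f)"] o2 evf(2) by simp
  hence 1: "du (Ph f) $ 0 $ 0 * al $ 1 + dv (Ph f) $ 0 $ 0 * bt $ 1 = 0" unfolding d0[symmetric] by simp
  have 2: "du (Ph q) $ 0 $ 0 * al $ 1 + dv (Ph q) $ 0 $ 0 * bt $ 1 = 0" unfolding d0[symmetric] evq by simp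
  obtain x y where xy: "Ph f dvd x * du (Ph f) + y * dv (Ph f)" "ev al bt (x * du (Ph q) + y * dv (Ph q)) ~= 0"
   "subdegree (ev al bt (x * du (Ph q) + y * dv (Ph q))) = r" using r by blast
  obtain z where "x * du (Ph f) + y * dv (Ph f) = Ph f * z" using xy(1) by (rule dvdE)
  from arg_cong[OF this, of "\<lambda>g. g $ 0 $ 0"]
  have 3: "x $ 0 $ 0 * du (Ph f) $ 0 $ 0 + y $ 0 $ 0 * dv (Ph f) $ 0 $ 0 = 0" using f00 by simp
  have "x0 * qu + y0 * qv = 0" if "fu * a1 + fv * b1 = 0" "qu * a1 + qv * b1 = 0" "x0 * fu + y0 * fv = 0" "fu ~= 0 \<or> fv ~= 0" "a1 ~= 0 \<or> b1 ~= 0"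
   for x0 y0 qu qv fu fv a1 b1 :: complex
  proof -
   have "fu * (a1 * y0 - b1 * x0) = 0" "fv * (a1 * y0 - b1 * x0) = 0" using that(1,3) by Groebner_Basis.algebra+
   hence "a1 * y0 - b1 * x0 = 0" using that(4) by auto
   hence "a1 * (x0 * qu + y0 * qv) = 0" "b1 * (x0 * qu + y0 * qv) = 0" using that(2) by Groebner_Basis.algebra+
   thus ?thesis using that(5) by auto
  qed
  from this[OF 1 2 3 f1 ab1] have "ev al bt (x * du (Ph q) + y * dv (Ph q)) $ 0 = 0" by (simp add: ev_nth_0)
  hence "subdegree (ev al bt (x * du (Ph q) + y * dv (Ph q))) ~= 0" using xy(2) by (metis nth_subdegree_nonzero)
  thus "r \<ge> 1" using xy(3) by simp
 qed
qed

end

section \<open>The Hilbert function of the module of derivations\<close>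

abbreviation der_vecs :: "int => (nat => poly3) set" where "der_vecs \<equiv> graded_vecs [0, 0, 0]"

lemma der_vecs_iff: "th \<in> der_vecs n \<longleftrightarrow> (\<forall>i<3. homogeneous n (th i)) \<and> (\<forall>i\<ge>3. th i = 0)"
proof -
 have "[0, 0, 0] ! i = (0 :: int)" if "i < 3" for i :: nat using that by (auto simp: lt_3)
 thus ?thesis by (auto simp: graded_vecs_def)
qed

definition D :: "poly3 => int => (nat => poly3) set" where
 "D f n = {th \<in> der_vecs n. dot th (grad f) = 0}"

lemma dot_add: "dot (x + y) z = dot x z + dot y z" "dot z (x + y) = dot z x + dot z y"
 by (simp_all add: dot_def algebra_simps)

lemma dot_scf: "dot (scf c x) z = sc3 c (dot x z)"
 by (simp add: dot_def scf_def sc3_mult sc3_add)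

lemma subsp_D: "subsp scf (D f n)"
 using subspD[OF subsp_graded_vecs[of "[0, 0, 0]" n]]
 by (auto simp: subsp_def vector_space_scf D_def dot_add dot_scf) (simp add: dot_def)

lemma D_subset: "D f n \<subseteq> der_vecs n"
 by (auto simp: D_def)

definition hD :: "poly3 => int => nat" where "hD f n = (THE h. codim scf (D f n) {0} h)"

lemma lin_on_dot: "lin_on scf sc3 E (\<lambda>th. dot th v)"
 by (auto simp: lin_on_def dot_add dot_scf)

lemma hD_exists:
 assumes f: "homogeneous (int d) f"
 shows "\<exists>h. codim scf (D f n) {0} h \<and> 3 * sdim n \<le> h + sdim (n + int d - 1)"
proof -
 obtain h m where hm: "h + m = (\<Sum>e\<leftarrow>[0, 0, 0]. sdim (n - e))" "codim scf (D f n) {0} h"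
  "subsp sc3 ((\<lambda>th. dot th (grad f)) ` der_vecs n)" "codim sc3 ((\<lambda>th. dot th (grad f)) ` der_vecs n) {0} m"
  unfolding D_def by (rule rank_nullity[OF subsp_graded_vecs vector_space_sc3 lin_on_dot[where v = "grad f"] codim_graded_vecs]) blast
 have g: "homogeneous (int d - 1) (grad f i)" for i using homogeneous_d[OF f] by (simp add: grad_def)
 have "(\<lambda>th. dot th (grad f)) ` der_vecs n \<subseteq> S (n + int d - 1)"
 proof (rule image_subsetI)
  fix th assume th: "th \<in> der_vecs n"
  have "homogeneous (n + (int d - 1)) (dot th (grad f))" using th g by (intro homogeneous_dot) (simp_all add: der_vecs_iff)
  thus "dot th (grad f) \<in> S (n + int d - 1)" by (simp add: algebra_simps)
 qed
 hence "m \<le> sdim (n + int d - 1)"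
  using dim_mono(1)[OF codim_S hm(4) subsp_S hm(3)] by simp
 thus ?thesis using hm by (intro exI[of _ h]) simp
qed

lemma codim_D_iff:
 assumes "homogeneous (int d) f"
 shows "codim scf (D f n) {0} h \<longleftrightarrow> hD f n = h"
proof -
 obtain h' where h': "codim scf (D f n) {0} h'" using hD_exists[OF assms] by blast
 hence "hD f n = h'" unfolding hD_def by (intro the_equality dim_unique[OF _ _ subsp_D])
 thus ?thesis using h' dim_unique[OF _ h' subsp_D] by metis
qed

lemma hD_lower:
 assumes "homogeneous (int d) f"
 shows "3 * sdim n \<le> hD f n + sdim (n + int d - 1)"
 using hD_exists[OF assms, of n] codim_D_iff[OF assms] by auto

lemma hD_neg: "homogeneous (int d) f ==> n < 0 ==> hD f n = 0"
proof -
 assume f: "homogeneous (int d) f" and n: "n < 0"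
 have "der_vecs n = {0}" using homogeneous_neg[OF n] by (auto simp: der_vecs_iff fun_eq_iff) (metis linorder_not_less)
 hence "D f n = {0}" using D_subset[of f n] subspD(1)[OF subsp_D, of f n] by auto
 thus ?thesis using codim_D_iff[OF f] codim_self[OF subsp_scf_0] by metis
qed

section \<open>Derivations along the conic\<close>

lemma coprime_linear_factors: "s ~= t ==> coprime [:- s, 1:] [:- t, 1 :: complex:]"
proof (rule coprimeI)
 fix c assume st: "s ~= t" and c: "c dvd [:- s, 1:]" "c dvd [:- t, 1:]"
 hence "c dvd [:- s, 1:] - [:- t, 1:]" by (intro dvd_diff c)
 hence "c dvd [:t - s:]" by simp
 moreover have "[:t - s:] dvd 1" using st by simp
 ultimately show "c dvd 1" by (rule dvd_trans)
qed

lemma prod_linear_powers_dvd: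
 fixes p :: "complex poly"
 assumes "finite A" "\<And>t. t \<in> A ==> [:- t, 1:] ^ n t dvd p"
 shows "(\<Prod>t\<in>A. [:- t, 1:] ^ n t) dvd p"
 using assms
proof (induction A rule: finite_induct)
 case (insert s A)
 have "coprime ([:- s, 1:] ^ n s) (\<Prod>t\<in>A. [:- t, 1:] ^ n t)"
  using insert.hyps by (intro prod_coprime_right coprime_power_left_iff[THEN iffD2] coprime_power_right_iff[THEN iffD2] disjI1 coprime_linear_factors impI)
   (auto intro!: coprime_linear_factors)
 thus ?case using insert by (simp add: divides_mult)
qed simp

lemma degree_prod_linear_powers:
 "finite A ==> degree (\<Prod>t\<in>A. [:- t, 1 :: complex:] ^ n t) = (\<Sum>t\<in>A. n t)"
 by (subst degree_prod_eq_sum_degree) (auto simp: degree_power_eq)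

context conic_curve
begin

definition rn :: "complex => nat" where "rn t = (SOME r. local_number t r)"

lemma rn: "t \<in> roots ==> local_number t (rn t)"
proof -
 assume "t \<in> roots"
 hence "poly (E f) t = 0" by (simp add: roots_def)
 from someI_ex[OF local_number_exists[OF this]] show ?thesis by (simp only: rn_def)
qed

text \<open>The forced zeros: \<open>R\<close> for theta(q) on the conic, \<open>K\<close> below for
  the tangent field once theta(q) vanishes there. The local exponents add up to the intersection
  multiplicity, so the degrees add up to 2 d, and the degree of \<open>K\<close> is
  \<open>k_number f q\<close>.\<close>

definition R :: "complex poly" where "R = (\<Prod>t\<in>roots. [:- t, 1:] ^ rn t)"
definition K :: "complex poly" where "K = (\<Prod>t\<in>roots. [:- t, 1:] ^ (order t (E f) - rn t))"

lemma RK_nonzero: "R ~= 0" "K ~= 0"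
 using finite_roots by (simp_all add: R_def K_def)

lemma sum_order: "(\<Sum>t\<in>roots. order t (E f)) = 2 * d"
proof -
 have "degree (\<Prod>t\<in>roots. [:- t, 1:] ^ order t (E f)) = degree (E f)"
  using arg_cong[OF complex_poly_decompose[of "E f"], of degree] Ef(1) by (simp add: roots_def)
 thus ?thesis unfolding degree_prod_linear_powers[OF finite_roots] Ef(2) .
qed

lemma degree_K: "int (degree K) = k_number f q"
proof -
 have "k_number f q = (\<Sum>t\<in>roots. 1 + (eps (f * q) (point t) - eps f (point t)))"
  unfolding k_number_def eps_union_def using sum.reindex_bij_betw[OF points_bij, of "\<lambda>p. eps (f * q) p - eps f p"]
   bij_betw_same_card[OF points_bij] by (simp add: sum.distrib)
 also have "\<dots> = (\<Sum>t\<in>roots. int (order t (E f) - rn t))"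
  by (rule sum.cong) (use rn in "force simp: local_number_def")+
 finally show ?thesis unfolding K_def degree_prod_linear_powers[OF finite_roots] by simp
qed

lemma degree_R: "degree R + degree K = 2 * d"
proof -
 have "degree R + degree K = (\<Sum>t\<in>roots. order t (E f))"
  unfolding R_def K_def degree_prod_linear_powers[OF finite_roots] sum.distrib[symmetric]
  by (rule sum.cong) (use rn in "force simp: local_number_def")+
 thus ?thesis by (simp only: sum_order)
qed

lemma k_number_eq: "k_number f q = 2 * int d - (\<Sum>t\<in>roots. int (rn t))"
proof -
 have "degree R = (\<Sum>t\<in>roots. rn t)" unfolding R_def by (rule degree_prod_linear_powers[OF finite_roots])
 thus ?thesis unfolding degree_K[symmetric] using degree_R by (simp flip: of_nat_sum)
qed

lemma log_vec_D: "th \<in> D f (int n) ==> log_vec n th"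
 by (simp add: D_def der_vecs_iff log_vec_def)

lemma R_dvd: "th \<in> D f (int n) ==> R dvd E (dot th (grad q))"
 unfolding R_def by (rule prod_linear_powers_dvd[OF finite_roots]) (use rn log_vec_D in "unfold local_number_def, blast")

sublocale E: comm_ring_hom E by (rule E_hom)

text \<open>Differentiate q along the line pt + s v at s = 0, using the normal form of the
  conic.\<close>

lemma grad_q_pt:
 assumes "\<And>i. i < 3 ==> v i = x * p0 i + y * p1 i + z * e i"
 shows "dot v (\<lambda>i. eval_vec (grad q i) (pt t)) = 2 * t * z - x - t\<^sup>2 * y"
proof -
 define Ps where "Ps F = subst_vec (\<lambda>c. [:c:]) F (\<lambda>i. [:pt t i, v i:])" for F
 have h: "comm_ring_hom Ps" unfolding Ps_def[abs_def] by (rule subst3_hom[OF const_poly_hom])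
 have g: "Ps (cc c) = [:c:]" "Ps xx = [:pt t 0, v 0:]" "Ps yy = [:pt t 1, v 1:]" "Ps zz = [:pt t 2, v 2:]" for c
  unfolding Ps_def by (rule subst3_gens[OF const_poly_hom])+
 have ev: "poly (Ps F) s = eval_vec F (\<lambda>i. pt t i + s * v i)" for F s
  unfolding Ps_def eval3_subst3_poly by simp
 have "Ps q - ([:t, z:] * [:t, z:] - [:t\<^sup>2, x:] * [:1, y:]) = 0"
 proof (rule poly_zero_off_0)
  fix s
  have "pt t i + s * v i = (t\<^sup>2 + s * x) * p0 i + (1 + s * y) * p1 i + (t + s * z) * e i" if "i < 3" for i
   unfolding pt_eq assms[OF that] by (simp add: algebra_simps)
  hence "poly (Ps q) s = eval_vec q (\<lambda>i. (t\<^sup>2 + s * x) * p0 i + (1 + s * y) * p1 i + (t + s * z) * e i)"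
   unfolding ev by simp
  thus "poly (Ps q - ([:t, z:] * [:t, z:] - [:t\<^sup>2, x:] * [:1, y:])) s = 0"
   unfolding q_pt by (simp add: power2_eq_square algebra_simps)
 qed
 hence "poly (pderiv (Ps q)) 0 = poly (pderiv ([:t, z:] * [:t, z:] - [:t\<^sup>2, x:] * [:1, y:])) 0" by simp
 moreover have "pderiv (Ps q) = Ps (dx q) * pderiv (Ps xx) + Ps (dy q) * pderiv (Ps yy) + Ps (dz q) * pderiv (Ps zz)"
  by (rule chain_rule[OF h is_deriv_pderiv]) (simp add: g pderiv_pCons)
 hence "poly (pderiv (Ps q)) 0 = dot v (\<lambda>i. eval_vec (grad q i) (pt t))"
  unfolding g by (simp add: pderiv_pCons ev dot_def grad_def)
 ultimately show ?thesis by (simp add: pderiv_pCons)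
qed

abbreviation cdot :: "(nat => complex) => (nat => complex poly) => complex poly" where
 "cdot n v \<equiv> dot (\<lambda>i. [:n i:]) v"

text \<open>In the basis \<open>p0\<close>, \<open>p1\<close>, \<open>e\<close> the parametrisation
  is (t^2, 1, t) with velocity (2 t, 0, 1). If (x, y, z) is a combination of the two, its
  coefficient at the velocity is z - t y.\<close>

definition tang :: "(nat => poly3) => complex poly" where
 "tang th = cdot n2 (\<lambda>i. E (th i)) - [:0, 1:] * cdot n1 (\<lambda>i. E (th i))"

lemma poly_cdot: "poly (cdot n v) t = dot n (\<lambda>i. poly (v i) t)"
 by (simp add: dot_def)

lemma E_dot: "E (dot x y) = dot (\<lambda>i. E (x i)) (\<lambda>i. E (y i))"
 unfolding dot_def E.hom_add E.hom_mult ..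

lemma tangent_decomposition:
 assumes "E (dot th (grad q)) = 0"
 shows "i < 3 ==> E (th i) = cdot n1 (\<lambda>i. E (th i)) * P i + tang th * pderiv (P i)"
  "[:0, 1:] * tang th = cdot n0 (\<lambda>i. E (th i)) - [:0, 1:] * cdot n2 (\<lambda>i. E (th i))"
proof -
 have *: "\<exists>x y z. (\<forall>i<3. poly (E (th i)) t = x * p0 i + y * p1 i + z * e i) \<and> poly (cdot n0 (\<lambda>i. E (th i))) t = x \<and>
   poly (cdot n1 (\<lambda>i. E (th i))) t = y \<and> poly (cdot n2 (\<lambda>i. E (th i))) t = z \<and> 2 * t * z - x - t\<^sup>2 * y = 0" for t
 proof -
  define v where "v i = poly (E (th i)) t" for i
  obtain x y z where c: "\<And>i. i < 3 ==> v i = x * p0 i + y * p1 i + z * e i" "dot n0 v = x" "dot n1 v = y" "dot n2 v = z"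
   using coordinates[of v] by blast
  have "poly (E (dot th (grad q))) t = dot v (\<lambda>i. eval_vec (grad q i) (pt t))"
   unfolding E_dot by (simp add: dot_def v_def poly_E)
  hence "2 * t * z - x - t\<^sup>2 * y = poly (E (dot th (grad q))) t" using grad_q_pt[OF c(1), of t] by (simp only:)
  hence "2 * t * z - x - t\<^sup>2 * y = 0" unfolding assms by simp
  thus ?thesis using c unfolding poly_cdot v_def by blast
 qed
 show "E (th i) = cdot n1 (\<lambda>i. E (th i)) * P i + tang th * pderiv (P i)" if "i < 3"
 proof -
  have "E (th i) - (cdot n1 (\<lambda>i. E (th i)) * P i + tang th * pderiv (P i)) = 0"
  proof (rule poly_zero_off_0)
   fix t
   obtain x y z where c: "\<forall>i<3. poly (E (th i)) t = x * p0 i + y * p1 i + z * e i" "poly (cdot n0 (\<lambda>i. E (th i))) t = x"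
    "poly (cdot n1 (\<lambda>i. E (th i))) t = y" "poly (cdot n2 (\<lambda>i. E (th i))) t = z" "2 * t * z - x - t\<^sup>2 * y = 0" using *[of t] by blast
   have d: "poly (pderiv (P i)) t = 2 * t * p0 i + e i" by (simp add: P_def pderiv_pCons)
   have "poly (cdot n1 (\<lambda>i. E (th i)) * P i + tang th * pderiv (P i)) t = y * (t\<^sup>2 * p0 i + 1 * p1 i + t * e i) + (z - t * y) * (2 * t * p0 i + e i)"
    by (simp only: tang_def poly_add poly_mult poly_diff c pt_eq d) simp
   also have "\<dots> = x * p0 i + y * p1 i + z * e i" using c(5) by Groebner_Basis.algebra
   finally show "poly (E (th i) - (cdot n1 (\<lambda>i. E (th i)) * P i + tang th * pderiv (P i))) t = 0" using c(1) that by simp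
  qed
  thus ?thesis by simp
 qed
 have "[:0, 1:] * tang th - (cdot n0 (\<lambda>i. E (th i)) - [:0, 1:] * cdot n2 (\<lambda>i. E (th i))) = 0"
 proof (rule poly_zero_off_0)
  fix t
  obtain x y z where c: "poly (cdot n0 (\<lambda>i. E (th i))) t = x"
   "poly (cdot n1 (\<lambda>i. E (th i))) t = y" "poly (cdot n2 (\<lambda>i. E (th i))) t = z" "2 * t * z - x - t\<^sup>2 * y = 0" using *[of t] by blast
  have "poly ([:0, 1:] * tang th - (cdot n0 (\<lambda>i. E (th i)) - [:0, 1:] * cdot n2 (\<lambda>i. E (th i)))) t = t * (z - t * y) - (x - t * z)"
   by (simp only: tang_def poly_add poly_mult poly_diff c) simp
  thus "poly ([:0, 1:] * tang th - (cdot n0 (\<lambda>i. E (th i)) - [:0, 1:] * cdot n2 (\<lambda>i. E (th i)))) t = 0"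
   using c(4) by (simp add: algebra_simps power2_eq_square)
 qed
 thus "[:0, 1:] * tang th = cdot n0 (\<lambda>i. E (th i)) - [:0, 1:] * cdot n2 (\<lambda>i. E (th i))" by simp
qed

lemma K_dvd:
 assumes "th \<in> D f (int n)" "E (dot th (grad q)) = 0"
 shows "K dvd tang th"
 unfolding K_def
 by (rule prod_linear_powers_dvd[OF finite_roots])
  (use rn log_vec_D[OF assms(1)] tangent_decomposition(1)[OF assms(2)] in "unfold local_number_def, blast")

lemma degree_tang:
 assumes "th \<in> D f (int n)" "E (dot th (grad q)) = 0"
 shows "degree (tang th) \<le> 2 * n"
proof (cases "tang th = 0")
 case False
 have c: "degree (cdot m (\<lambda>i. E (th i))) \<le> 2 * n" for m
  using assms(1) unfolding dot_def D_def by (intro degree_add_le order_trans[OF degree_mult_le]) (simp_all add: der_vecs_iff degree_E(1))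
 \<comment> \<open>The definition of \<open>tang\<close> only gives degree 2 n + 1. Tangency also
   expresses t times \<open>tang\<close> by terms of degree at most 2 n + 1, which saves
   one.\<close>
 have "degree ([:0, 1:] * tang th) \<le> 2 * n + 1"
  unfolding tangent_decomposition(2)[OF assms(2)] using c[of n0] c[of n2]
  by (intro degree_diff_le order_trans[OF degree_mult_le]) simp_all
 thus ?thesis using degree_mult_eq[of "[:0, 1:]" "tang th"] False by simp
qed simp

text \<open>Without tangent part the derivation is a multiple g of the Euler field along the conic,
  where then theta(f) = g d f. As theta(f) = 0 and \<open>f\<close> is not identically zero on the
  conic, g = 0.\<close>

lemma tang_0_imp_q_dvd:
 assumes "th \<in> D f (int n)" "E (dot th (grad q)) = 0" "tang th = 0" "i < 3"
 shows "q dvd th i"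
proof -
 define g where "g = cdot n1 (\<lambda>i. E (th i))"
 have e: "E (th i) = g * P i" if "i < 3" for i using tangent_decomposition(1)[OF assms(2) that] assms(3) by (simp add: g_def)
 have "P i = E (gen i)" if "i < 3" for i
  using that subst3_gens[OF const_poly_hom, where a = "P 0" and b = "P 1" and c = "P 2"] unfolding lt_3 by (auto simp: E_def gen_def)
 hence e': "E (th i) = g * E (gen i)" if "i < 3" for i using e that by simp
 have "dot gen (grad f) = of_nat d * f" using euler[OF f_homogeneous] by (simp only: dot_def gen_def grad_def) simp
 hence "g * (of_nat d * E f) = g * E (dot gen (grad f))" by (simp add: E.hom_mult E.hom_of_nat)
 also have "\<dots> = E (dot th (grad f))" unfolding dot_def using e'[of 0] e'[of 1] e'[of 2] by (simp add: E.hom_add E.hom_mult algebra_simps)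
 also have "\<dots> = 0" using assms(1) by (simp add: D_def)
 finally have "g = 0" using Ef(1) d_pos by simp
 hence "E (th i) = 0" using e[OF assms(4)] by simp
 moreover have "homogeneous (int n) (th i)" using assms(1,4) by (simp add: D_def der_vecs_iff)
 ultimately show ?thesis by (intro E_eq_0_imp_dvd)
qed

lemma E_sc3: "E (sc3 c F) = Polynomial.smult c (E F)"
proof -
 have "E (cc c) = [:c:]" unfolding E_def by (rule subst3_gens[OF const_poly_hom])
 thus ?thesis using sc3_hom[OF E_hom] by simp
qed

lemma tang_linear: "tang (x + y) = tang x + tang y" "tang (scf c x) = Polynomial.smult c (tang x)"
 by (simp_all add: tang_def dot_def scf_def E_sc3 E.hom_add smult_add_right smult_diff_right)

definition qD :: "nat => (nat => poly3) set" where "qD n = {th \<in> D f (int n). \<forall>i. q dvd th i}"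

lemma qD_eq: "qD n = (\<lambda>th i. q * th i) ` D f (int n - 2)"
proof (intro subset_antisym subsetI)
 fix th assume "th \<in> qD n"
 hence th: "th \<in> D f (int n)" "\<And>i. q dvd th i" by (auto simp: qD_def)
 then obtain et where et: "\<And>i. th i = q * et i" unfolding dvd_def by metis
 have "homogeneous (int n - 2) (et i)" if i: "i < 3" for i
  using homogeneous_divide[of "int n" "et i" q 2] th(1) i q_homogeneous q_nonzero by (simp add: D_def der_vecs_iff et mult.commute)
 moreover have "et i = 0" if "i \<ge> 3" for i using th(1) that et[of i] q_nonzero by (simp add: D_def der_vecs_iff)
 moreover have "q * dot et (grad f) = dot th (grad f)" by (simp add: dot_def et algebra_simps)
 hence "dot et (grad f) = 0" using th(1) q_nonzero by (simp add: D_def)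
 ultimately have "et \<in> D f (int n - 2)" by (simp add: D_def der_vecs_iff)
 moreover have "th = (\<lambda>i. q * et i)" using et by (rule ext)
 ultimately show "th \<in> (\<lambda>th i. q * th i) ` D f (int n - 2)" by blast
next
 fix th assume "th \<in> (\<lambda>th i. q * th i) ` D f (int n - 2)"
 then obtain et where et: "et \<in> D f (int n - 2)" "th = (\<lambda>i. q * et i)" by blast
 have "homogeneous (2 + (int n - 2)) (th i)" if "i < 3" for i
  unfolding et(2) by (rule homogeneous_mult[OF q_homogeneous]) (use et(1) that in "simp add: D_def der_vecs_iff")
 moreover have "dot th (grad f) = q * dot et (grad f)" by (simp add: dot_def et(2) algebra_simps)
 ultimately show "th \<in> qD n" using et by (simp add: qD_def D_def der_vecs_iff)
qed

text \<open>Rank and nullity twice, along \<open>D f (int n)\<close> \<supseteq> \<open>A\<close>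
  \<supseteq> \<open>qD n\<close>, the last being \<open>q\<close> times the derivations of degree n
  - 2. The quotients embed into polynomials of degree at most 2 n + 2 - deg R and 2 n - deg K;
  truncated subtraction covers the case where only 0 is left.\<close>

theorem hD_bound:
 "hD f (int n) \<le> hD f (int n - 2) + (2 * n + 3 - degree R) + (2 * n + 1 - degree K)"
proof -
 define A where "A = {th \<in> D f (int n). E (dot th (grad q)) = 0}"
 have gq: "homogeneous (int 1) (grad q i)" for i using homogeneous_grad[of 2 q i] q_homogeneous by simp
 note div = div_plus_div_distrib_dvd_left div_smult_left
 have cp: "x div g \<in> Cpoly (Suc N - degree g)" if "g dvd x" "degree x \<le> N" "g ~= 0" for x g :: "complex poly" and N
 proof -
  obtain y where y: "x = g * y" using \<open>g dvd x\<close> unfolding dvd_def by blast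
  have "coeff y k = 0" if k: "k \<ge> Suc N - degree g" for k
  proof (cases "y = 0")
   case False
   hence "degree g + degree y \<le> N" using \<open>degree x \<le> N\<close> \<open>g ~= 0\<close> by (simp add: y degree_mult_eq)
   thus ?thesis using k by (intro coeff_eq_0) linarith
  qed simp
  thus ?thesis using \<open>g ~= 0\<close> by (simp add: y Cpoly_def)
 qed
 define rh where "rh th = E (dot th (grad q)) div R" for th
 define ta where "ta th = tang th div K" for th
 have codim_D: "codim scf (D f k) {0} (hD f k)" for k using codim_D_iff[OF f_homogeneous] by blast
 have "lin_on scf Polynomial.smult (D f (int n)) rh"
  unfolding lin_on_def rh_def by (auto simp: dot_add dot_scf E.hom_add E_sc3 div R_dvd)
 from rank_nullity[OF subsp_D vector_space_smult this codim_D]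
 obtain k1 m1 where 1: "k1 + m1 = hD f (int n)" "subsp scf {th \<in> D f (int n). rh th = 0}" "codim scf {th \<in> D f (int n). rh th = 0} {0} k1"
  "subsp Polynomial.smult (rh ` D f (int n))" "codim Polynomial.smult (rh ` D f (int n)) {0} m1" by blast
 have A: "{th \<in> D f (int n). rh th = 0} = A" unfolding A_def rh_def using dvd_div_eq_0_iff[OF R_dvd] by blast
 have "rh ` D f (int n) \<subseteq> Cpoly (Suc (2 * n + 2) - degree R)"
 proof (rule image_subsetI)
  fix th assume th: "th \<in> D f (int n)"
  have "homogeneous (int (n + 1)) (dot th (grad q))" unfolding of_nat_add
   by (rule homogeneous_dot) (use th gq in "simp_all add: D_def der_vecs_iff")
  hence "degree (E (dot th (grad q))) \<le> 2 * n + 2" using degree_E(1) by fastforce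
  thus "rh th \<in> Cpoly (Suc (2 * n + 2) - degree R)" using cp R_dvd[OF th] RK_nonzero unfolding rh_def by blast
 qed
 hence m1: "m1 \<le> Suc (2 * n + 2) - degree R" by (rule dim_mono(1)[OF codim_Cpoly 1(5) subsp_Cpoly 1(4)])
 have Kd: "K dvd tang th" "degree (tang th) \<le> 2 * n" if "th \<in> A" for th using K_dvd degree_tang that unfolding A_def by blast+
 have "lin_on scf Polynomial.smult A ta" unfolding lin_on_def ta_def by (auto simp: tang_linear div Kd)
 from rank_nullity[OF 1(2)[unfolded A] vector_space_smult this 1(3)[unfolded A]]
 obtain k2 m2 where 2: "k2 + m2 = k1" "codim scf {th \<in> A. ta th = 0} {0} k2" "subsp Polynomial.smult (ta ` A)" "codim Polynomial.smult (ta ` A) {0} m2" by blast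
 have "ta ` A \<subseteq> Cpoly (Suc (2 * n) - degree K)" unfolding ta_def using cp Kd RK_nonzero by blast
 hence m2: "m2 \<le> Suc (2 * n) - degree K" by (rule dim_mono(1)[OF codim_Cpoly 2(4) subsp_Cpoly 2(3)])
 have "{th \<in> A. ta th = 0} = qD n"
 proof (intro subset_antisym subsetI)
  fix th assume "th \<in> {th \<in> A. ta th = 0}"
  hence th: "th \<in> A" "tang th = 0" using dvd_div_eq_0_iff[OF Kd(1)] by (auto simp: ta_def)
  have "q dvd th i" for i
  proof (cases "i < 3")
   case True
   thus ?thesis using tang_0_imp_q_dvd[OF _ _ th(2) True] th unfolding A_def by blast
  qed (use th in "simp add: A_def D_def der_vecs_iff")
  thus "th \<in> qD n" using th by (simp add: qD_def A_def)
 next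
  fix th assume th: "th \<in> qD n"
  then obtain et where et: "th = (\<lambda>i. q * et i)" unfolding qD_eq by blast
  have "dot th (grad q) = q * dot et (grad q)" by (simp add: dot_def et algebra_simps)
  moreover have "tang th = 0" using E_q by (simp add: tang_def dot_def et E.hom_mult)
  ultimately show "th \<in> {th \<in> A. ta th = 0}" using th E_q by (simp add: A_def qD_def E.hom_mult ta_def)
 qed
 moreover have "lin_on scf scf (D f (int n - 2)) (\<lambda>th i. q * th i)" by (auto simp: lin_on_def scf_def sc3_mult distrib_left)
 from dim_inj[OF subsp_D vector_space_scf this codim_D] have "subsp scf (qD n)" "codim scf (qD n) {0} (hD f (int n - 2))"
  unfolding qD_eq using q_nonzero by (auto simp: fun_eq_iff)
 ultimately have "k2 = hD f (int n - 2)" using dim_unique 2(2) by metis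
 thus ?thesis using 1(1) 2(1) m1 m2 by simp
qed

end

section \<open>Hilbert polynomials from Chern polynomials\<close>

text \<open>Homogeneous components with integer degrees, because shifted degrees n - e can be
  negative.\<close>

definition hc :: "int => poly3 => poly3" where "hc n F = (if n < 0 then 0 else hcomp (nat n) F)"

lemma hc_homogeneous [simp]: "homogeneous n (hc n F)"
 using homogeneous_comp[of "nat n" F] by (cases "n < 0") (simp_all add: hc_def)

lemma hc_add: "hc n (F + G) = hc n F + hc n G"
 by (simp add: hc_def graded.hom_add)

lemma hc_0 [simp]: "hc n 0 = 0"
 by (simp add: hc_def)

lemma hc_sum: "hc n (sum F A) = (\<Sum>i\<in>A. hc n (F i))"
 by (induction A rule: infinite_finite_induct) (auto simp: hc_add)

lemma hc_id: "homogeneous n F ==> hc n F = F"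
proof (cases "n < 0")
 case False
 assume "homogeneous n F"
 thus ?thesis using False comp_homogeneous[of "nat n" F "nat n"] by (simp add: hc_def)
qed (use homogeneous_neg in "auto simp: hc_def")

lemma hc_mult:
 assumes A: "homogeneous m A"
 shows "hc n (A * F) = A * hc (n - m) F"
proof (cases "A = 0")
 case False
 hence "m \<ge> 0" using homogeneous_neg[OF _ A] by force
 then obtain m' where m: "m = int m'" by (metis nonneg_int_cases)
 have g: "hcomp k (A * F) = (if m' \<le> k then A * hcomp (k - m') F else 0)" for k
  using A by (simp add: m homogeneous_iff graded.hom_mult coeff_monom_mult)
 show ?thesis by (auto simp: hc_def m g nat_diff_distrib)
qed simp

definition gp :: "int list => poly3 vec set => int => (nat => poly3) set" where
 "gp ds M n = {v \<in> graded_vecs ds n. vec (length ds) v \<in> M}"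

text \<open>A homogeneous vector in the image of a graded map is already the image of the
  homogeneous part of any preimage. Hence \<open>T\<close> computes the graded pieces of the
  image.\<close>

lemma step_map:
 fixes A :: "poly3 mat"
 assumes A: "graded_map es ds A"
 defines "T \<equiv> \<lambda>v i. if i < length ds then \<Sum>j<length es. A $$ (i, j) * v j else 0"
 shows "lin_on scf scf X T" "v \<in> graded_vecs es n ==> T v \<in> graded_vecs ds n"
  "vec (length ds) (T v) = A *\<^sub>v vec (length es) v"
  "y \<in> gp ds ((\<lambda>w. A *\<^sub>v w) ` carrier_vec (length es)) n ==> y \<in> T ` graded_vecs es n"
proof -
 have dim: "dim_row A = length ds" "dim_col A = length es" using A by (auto simp: graded_map_def)
 show "lin_on scf scf X T"
  by (auto simp: lin_on_def T_def fun_eq_iff scf_def distrib_left sum.distrib sc3_mult) (simp add: sc3_def sum_distrib_left)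
 show "v \<in> graded_vecs es n ==> T v \<in> graded_vecs ds n"
 proof -
  assume v: "v \<in> graded_vecs es n"
  have "homogeneous (n - ds ! i) (A $$ (i, j) * v j)" if "i < length ds" "j < length es" for i j
   using homogeneous_mult[of "es ! j - ds ! i" "A $$ (i, j)" "n - es ! j" "v j"] A v that by (simp add: graded_map_def graded_vecs_def)
  thus ?thesis by (auto simp: T_def graded_vecs_def intro!: homogeneous_sum)
 qed
 show "vec (length ds) (T v) = A *\<^sub>v vec (length es) v"
  by (rule eq_vecI) (auto simp: dim T_def scalar_prod_def atLeast0LessThan)
 assume "y \<in> gp ds ((\<lambda>w. A *\<^sub>v w) ` carrier_vec (length es)) n"
 then obtain w where w: "w \<in> carrier_vec (length es)" "vec (length ds) y = A *\<^sub>v w" and y: "y \<in> graded_vecs ds n" by (auto simp: gp_def)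
 define x where "x j = (if j < length es then hc (n - es ! j) (vec_index w j) else 0)" for j
 have "y i = T x i" for i
 proof (cases "i < length ds")
  case True
  have yi: "y i = (\<Sum>j<length es. A $$ (i, j) * vec_index w j)"
   using arg_cong[OF w(2), of "\<lambda>w. vec_index w i"] True w(1) by (simp add: dim scalar_prod_def atLeast0LessThan)
  have "y i = hc (n - ds ! i) (y i)" using y True by (simp add: hc_id graded_vecs_def)
  also have "\<dots> = (\<Sum>j<length es. A $$ (i, j) * x j)"
   unfolding yi hc_sum
  proof (rule sum.cong[OF refl])
   fix j assume "j \<in> {..<length es}"
   hence j: "j < length es" by simp
   have "hc (n - ds ! i) (A $$ (i, j) * vec_index w j) = A $$ (i, j) * hc (n - ds ! i - (es ! j - ds ! i)) (vec_index w j)"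
    using A True j by (intro hc_mult) (simp add: graded_map_def)
   thus "hc (n - ds ! i) (A $$ (i, j) * vec_index w j) = A $$ (i, j) * x j" using j by (simp add: x_def)
  qed
  finally show ?thesis using True by (simp add: T_def)
 qed (use y in "simp add: T_def graded_vecs_def")
 hence "y = T x" by (rule ext)
 moreover have "x \<in> graded_vecs es n" by (simp add: x_def graded_vecs_def)
 ultimately show "y \<in> T ` graded_vecs es n" by blast
qed

lemma sum_list_sdim:
 assumes "\<And>e. e \<in> set es ==> n \<ge> e - 2"
 shows "2 * int (\<Sum>e\<leftarrow>es. sdim (n - e)) = int (length es) * (n + 1) * (n + 2) - (\<Sum>e\<leftarrow>es. e) * (2 * n + 3) + (\<Sum>e\<leftarrow>es. e\<^sup>2)"
 using assms
proof (induction es)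
 case (Cons e es)
 have "2 * int (sdim (n - e)) = (n - e + 1) * (n - e + 2)" using Cons.prems[of e] by (intro sdim_eq) simp
 thus ?case using Cons by (simp add: algebra_simps power2_eq_square)
qed simp

lemma prod_list_coeffs:
 fixes es :: "int list"
 defines "P \<equiv> \<Prod>e\<leftarrow>es. [:1, - e:]"
 shows "coeff P 0 = 1" "coeff P 1 = - (\<Sum>e\<leftarrow>es. e)" "(coeff P 1)\<^sup>2 - 2 * coeff P 2 = (\<Sum>e\<leftarrow>es. e\<^sup>2)"
 unfolding P_def
proof (induction es)
 case (Cons e es)
 define Q where "Q = (\<Prod>e\<leftarrow>es. [:1, - e:])"
 have c: "coeff ([:1, - e:] * Q) 0 = coeff Q 0" "coeff ([:1, - e:] * Q) 1 = coeff Q 1 - e * coeff Q 0"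
  "coeff ([:1, - e:] * Q) 2 = coeff Q 2 - e * coeff Q 1" by (simp_all add: numeral_2_eq_2)
 {
  case 1
  show ?case using Cons(1) by simp
 next
  case 2
  show ?case using Cons(1,2) by simp
 next
  case 3
  have "(coeff Q 1 - e)\<^sup>2 - 2 * (coeff Q 2 - e * coeff Q 1) = ((coeff Q 1)\<^sup>2 - 2 * coeff Q 2) + e\<^sup>2"
   by (simp add: power2_eq_square algebra_simps)
  thus ?case using Cons(1,3) c by (simp add: Q_def)
 }
qed simp_all

text \<open>Riemann-Roch on the projective plane, with \<open>rh\<close> as the rank. Hilbert
  functions are additive on 0 -> ker -> sum of S(-e) -> im -> 0, and by the Whitney formula so are
  c_1 and c_1^2 - 2 c_2. The rank remains unknown at this stage.\<close>

theorem chern_hilbert: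
 assumes "has_chern_poly ds M c"
 shows "coeff c 0 = 1 \<and> (\<exists>rh N. \<forall>n\<ge>N. \<exists>h. codim scf (gp ds M n) {0} h \<and>
  2 * int h = rh * (n + 1) * (n + 2) + coeff c 1 * (2 * n + 3) + (coeff c 1)\<^sup>2 - 2 * coeff c 2)"
 using assms
proof induction
 case (zero ds)
 have "gp ds {0\<^sub>v (length ds)} n = {0}" for n
 proof (intro subset_antisym subsetI)
  fix v assume "v \<in> gp ds {0\<^sub>v (length ds)} n"
  hence v: "v \<in> graded_vecs ds n" "vec (length ds) v = 0\<^sub>v (length ds)" by (auto simp: gp_def)
  have "v i = 0" for i
  proof (cases "i < length ds")
   case True
   thus ?thesis using arg_cong[OF v(2), of "\<lambda>w. vec_index w i"] by simp
  qed (use v(1) in "simp add: graded_vecs_def")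
  thus "v \<in> {0}" by auto
 next
  fix v :: "nat => poly3" assume "v \<in> {0}"
  thus "v \<in> gp ds {0\<^sub>v (length ds)} n" by (auto simp: gp_def graded_vecs_def)
 qed
 hence z: "codim scf (gp ds {0\<^sub>v (length ds)} n) {0} 0" for n using codim_self[OF subsp_scf_0] by (simp only:)
 have "\<forall>n\<ge>0 :: int. \<exists>h. codim scf (gp ds {0\<^sub>v (length ds)} n) {0} h \<and>
   2 * int h = 0 * (n + 1) * (n + 2) + coeff 1 1 * (2 * n + 3) + (coeff 1 1)\<^sup>2 - 2 * coeff 1 2"
  by (intro allI impI exI[of _ "0 :: nat"] conjI z) simp
 thus ?case by (intro conjI) (simp, blast)
next
 case (step es ds A c' c)
 let ?M = "(\<lambda>w. A *\<^sub>v w) ` carrier_vec (length es)"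
 let ?K = "{w \<in> carrier_vec (length es). A *\<^sub>v w = 0\<^sub>v (length ds)}"
 obtain rh' N' where IH: "coeff c' 0 = 1" "\<And>n. n \<ge> N' ==> \<exists>h. codim scf (gp es ?K n) {0} h \<and>
  2 * int h = rh' * (n + 1) * (n + 2) + coeff c' 1 * (2 * n + 3) + (coeff c' 1)\<^sup>2 - 2 * coeff c' 2" using step.IH by blast
 define P where "P = (\<Prod>e\<leftarrow>es. [:1, - e:])"
 note P = prod_list_coeffs[of es, folded P_def]
 obtain y where y: "c * c' - P = [:0, 0, 0, 1:] * y" using step.hyps(4) unfolding P_def by (rule dvdE)
 have y0: "coeff ([:0, 0, 0, 1:] * y) i = 0" if "i < 3" for i using that by (auto simp: lt_3 numeral_2_eq_2)
 have cc': "coeff (c * c') i = coeff P i" if "i < 3" for i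
  using y0[OF that] unfolding y[symmetric] by simp
 have c0: "coeff c 0 = 1" using cc'[of 0] IH(1) P(1) by (simp add: coeff_mult)
 have c1: "coeff c 1 + coeff c' 1 = coeff P 1" using cc'[of 1] IH(1) c0 by (simp add: coeff_mult)
 have c2: "coeff c 2 + coeff c 1 * coeff c' 1 + coeff c' 2 = coeff P 2"
  using cc'[of 2] IH(1) c0 by (simp add: coeff_mult numeral_2_eq_2)
 have sq: "(coeff c 1)\<^sup>2 - 2 * coeff c 2 = (\<Sum>e\<leftarrow>es. e\<^sup>2) - ((coeff c' 1)\<^sup>2 - 2 * coeff c' 2)"
  unfolding P(3)[symmetric] c1[symmetric] c2[symmetric] by (simp add: power2_eq_square algebra_simps)
 have s1: "coeff c 1 = - (\<Sum>e\<leftarrow>es. e) - coeff c' 1" using c1 P(2) by simp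
 obtain N where N: "\<And>e. e \<in> set es ==> N \<ge> e - 2" "N \<ge> N'"
 proof -
  have "finite (insert N' (set es))" by simp
  then obtain N where "\<forall>e\<in>insert N' (set es). e \<le> N" using bdd_above_finite unfolding bdd_above_def by blast
  thus ?thesis using that[of N] by force
 qed
 define T where "T = (\<lambda>v i. if i < length ds then \<Sum>j<length es. A $$ (i, j) * v j else 0)"
 have T: "lin_on scf scf X T" "v \<in> graded_vecs es n ==> T v \<in> graded_vecs ds n" "vec (length ds) (T v) = A *\<^sub>v vec (length es) v"
  "y \<in> gp ds ?M n ==> y \<in> T ` graded_vecs es n" for X v y n
  unfolding T_def using step_map[OF step.hyps(1)] by blast+
 have vec0: "T v = 0 \<longleftrightarrow> vec (length ds) (T v) = 0\<^sub>v (length ds)" for v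
  by (auto simp: T_def fun_eq_iff vec_eq_iff)
 have Im: "gp ds ?M n = T ` graded_vecs es n" for n
  using T(2,4)[of _ n] T(3) by (auto simp: gp_def)
 have Ker: "gp es ?K n = {v \<in> graded_vecs es n. T v = 0}" for n
  using T(3) by (auto simp: gp_def vec0)
 have "\<exists>h. codim scf (gp ds ?M n) {0} h \<and>
  2 * int h = (int (length es) - rh') * (n + 1) * (n + 2) + coeff c 1 * (2 * n + 3) + (coeff c 1)\<^sup>2 - 2 * coeff c 2" if n: "n \<ge> N" for n
 proof -
  obtain k where k: "codim scf (gp es ?K n) {0} k"
   "2 * int k = rh' * (n + 1) * (n + 2) + coeff c' 1 * (2 * n + 3) + (coeff c' 1)\<^sup>2 - 2 * coeff c' 2" using IH(2)[of n] n N(2) by auto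
  obtain k' h where kh: "k' + h = (\<Sum>e\<leftarrow>es. sdim (n - e))" "subsp scf (gp es ?K n)" "codim scf (gp es ?K n) {0} k'" "codim scf (gp ds ?M n) {0} h"
   unfolding Im Ker by (rule rank_nullity[OF subsp_graded_vecs vector_space_scf T(1) codim_graded_vecs])
  have "k' = k" by (rule dim_unique[OF kh(3) k(1) kh(2)])
  note kh(4)
  moreover have "2 * int (\<Sum>e\<leftarrow>es. sdim (n - e)) = int (length es) * (n + 1) * (n + 2) - (\<Sum>e\<leftarrow>es. e) * (2 * n + 3) + (\<Sum>e\<leftarrow>es. e\<^sup>2)"
   by (rule sum_list_sdim) (use N(1) n in force)
  hence "2 * int h = int (length es) * (n + 1) * (n + 2) - (\<Sum>e\<leftarrow>es. e) * (2 * n + 3) + (\<Sum>e\<leftarrow>es. e\<^sup>2) - 2 * int k"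
   unfolding kh(1)[symmetric] using \<open>k' = k\<close> by simp
  hence "2 * int h = (int (length es) - rh') * (n + 1) * (n + 2) + coeff c 1 * (2 * n + 3) + ((coeff c 1)\<^sup>2 - 2 * coeff c 2)"
   unfolding k(2) sq unfolding s1 by (simp add: algebra_simps)
  ultimately show ?thesis by (intro exI[of _ h]) simp
 qed
 thus ?case using c0 by blast
qed

lemma D_eq_gp: "D f n = gp [0, 0, 0] (D0 f) n"
 by (auto simp: D_def gp_def D0_def dot_def grad_def)

corollary curve_hilbert:
 assumes f: "homogeneous (int d) f" and c: "curve_chern_poly f ([:- 1, a:] * [:- 1, b:])"
 shows "\<exists>rh N. \<forall>n\<ge>N. 2 * int (hD f n) = rh * (n + 1) * (n + 2) - (a + b) * (2 * n + 3) + a\<^sup>2 + b\<^sup>2"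
proof -
 let ?c = "[:- 1, a:] * [:- 1, b:]"
 have co: "coeff ?c 1 = - (a + b)" "coeff ?c 2 = a * b" by (simp_all add: numeral_2_eq_2)
 obtain rh N where h: "\<And>n. n \<ge> N ==> \<exists>h. codim scf (D f n) {0} h \<and>
  2 * int h = rh * (n + 1) * (n + 2) + coeff ?c 1 * (2 * n + 3) + (coeff ?c 1)\<^sup>2 - 2 * coeff ?c 2"
  using chern_hilbert[OF c[unfolded curve_chern_poly_def]] unfolding D_eq_gp by blast
 have "2 * int (hD f n) = rh * (n + 1) * (n + 2) - (a + b) * (2 * n + 3) + a\<^sup>2 + b\<^sup>2" if n: "n \<ge> N" for n
 proof -
  obtain h' where "codim scf (D f n) {0} h'"
   "2 * int h' = rh * (n + 1) * (n + 2) + coeff ?c 1 * (2 * n + 3) + (coeff ?c 1)\<^sup>2 - 2 * coeff ?c 2" using h[OF n] by blast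
  thus ?thesis using codim_D_iff[OF f, of n h'] unfolding co by (simp add: power2_eq_square algebra_simps)
 qed
 thus ?thesis by blast
qed

lemma eventually_nonneg:
 fixes x y z N :: int
 assumes "\<And>n. n \<ge> N ==> x * n\<^sup>2 + y * n + z \<ge> 0"
 shows "x \<ge> 0" "x = 0 ==> y \<ge> 0"
proof -
 define n where "n = \<bar>N\<bar> + \<bar>y\<bar> + \<bar>z\<bar> + 1"
 have n: "n \<ge> N" "n \<ge> 1" "\<bar>y\<bar> + \<bar>z\<bar> < n" by (simp_all add: n_def)
 have z: "\<bar>z\<bar> * 1 \<le> \<bar>z\<bar> * n" by (rule mult_left_mono) (use n in simp_all)
 show "x \<ge> 0"
 proof (rule ccontr)
  assume "\<not> x \<ge> 0"
  hence "x * n\<^sup>2 \<le> - 1 * n\<^sup>2" by (intro mult_right_mono) simp_all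
  moreover have "y * n \<le> \<bar>y\<bar> * n" by (rule mult_right_mono) (use n in simp_all)
  moreover have "(\<bar>y\<bar> + \<bar>z\<bar>) * n < n * n" by (rule mult_strict_right_mono) (use n in simp_all)
  ultimately show False using assms[OF n(1)] z by (simp add: power2_eq_square algebra_simps)
 qed
 show "y \<ge> 0" if "x = 0"
 proof (rule ccontr)
  assume "\<not> y \<ge> 0"
  hence "y * n \<le> - 1 * n" using n by (intro mult_right_mono) simp_all
  thus False using assms[OF n(1)] n that by simp
 qed
qed

context conic_curve
begin

text \<open>A squeeze. The conic bound on the growth from n - 2 to n gives rank at most 2 and, at
  rank 2, a + b \<ge> d - 1. The lower bound 3 dim S_n - dim S_(n + d - 1) gives the opposite
  inequalities.\<close>

theorem hilbert_polynomial:
 assumes c: "curve_chern_poly f ([:- 1, a:] * [:- 1, b:])" and ab: "a > 0" "b > 0"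
 shows "a + b = int d - 1" "\<exists>N. \<forall>n\<ge>N. 2 * int (hD f n) = (n - a + 1) * (n - a + 2) + (n - b + 1) * (n - b + 2)"
proof -
 obtain rh N0 where h0: "\<And>n. n \<ge> N0 ==> 2 * int (hD f n) = rh * (n + 1) * (n + 2) - (a + b) * (2 * n + 3) + a\<^sup>2 + b\<^sup>2"
  using curve_hilbert[OF f_homogeneous c] by blast
 define N where "N = max (N0 + 2) (int (degree R + degree K))"
 have h: "2 * int (hD f n) = rh * (n + 1) * (n + 2) - (a + b) * (2 * n + 3) + a\<^sup>2 + b\<^sup>2" if "n \<ge> N - 2" for n
  using that by (intro h0) (simp add: N_def)
 have up: "rh * (4 * n + 2) - 4 * (a + b) \<le> 8 * n + 8 - 4 * int d" if n: "n \<ge> N" for n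
 proof -
  have "n \<ge> 0" using n by (simp add: N_def)
  then obtain m where m: "n = int m" by (metis nonneg_int_cases)
  have "degree R + degree K \<le> m" using n by (simp add: N_def m)
  hence "int (hD f n) \<le> int (hD f (n - 2)) + 4 * n + 4 - 2 * int d" using hD_bound[of m] degree_R by (simp add: m)
  hence "2 * int (hD f n) \<le> 2 * int (hD f (n - 2)) + 8 * n + 8 - 4 * int d" by simp
  moreover have "2 * int (hD f n) = rh * (n + 1) * (n + 2) - (a + b) * (2 * n + 3) + a\<^sup>2 + b\<^sup>2" using n by (intro h) simp
  moreover have "2 * int (hD f (n - 2)) = rh * (n - 2 + 1) * (n - 2 + 2) - (a + b) * (2 * (n - 2) + 3) + a\<^sup>2 + b\<^sup>2" using n by (intro h) simp
  ultimately show ?thesis by (simp add: algebra_simps)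
 qed
 have low: "3 * (n + 1) * (n + 2) - (n + int d) * (n + int d + 1) \<le> rh * (n + 1) * (n + 2) - (a + b) * (2 * n + 3) + a\<^sup>2 + b\<^sup>2" if n: "n \<ge> N" for n
 proof -
  have "n \<ge> 0" using n by (simp add: N_def)
  hence "2 * int (sdim n) = (n + 1) * (n + 2)" "2 * int (sdim (n + int d - 1)) = (n + int d - 1 + 1) * (n + int d - 1 + 2)"
   by (intro sdim_eq; simp)+
  moreover have "3 * int (sdim n) \<le> int (hD f n) + int (sdim (n + int d - 1))" using hD_lower[OF f_homogeneous, of n] by linarith
  moreover have "2 * int (hD f n) = rh * (n + 1) * (n + 2) - (a + b) * (2 * n + 3) + a\<^sup>2 + b\<^sup>2" using n by (intro h) simp
  ultimately show ?thesis by (simp add: algebra_simps)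
 qed
 have 1: "0 * n\<^sup>2 + (8 - 4 * rh) * n + (8 - 4 * int d - 2 * rh + 4 * (a + b)) \<ge> 0" if "n \<ge> N" for n
  using up[OF that] by (simp add: algebra_simps)
 have 2: "(rh - 2) * n\<^sup>2 + (3 * rh - 2 * (a + b) - 8 + 2 * int d) * n + (2 * rh - 3 * (a + b) + a\<^sup>2 + b\<^sup>2 - 6 + int d * (int d + 1)) \<ge> 0" if "n \<ge> N" for n
  using low[OF that] by (simp add: power2_eq_square algebra_simps)
 have rh: "rh = 2" using eventually_nonneg(2)[of N 0, OF 1] eventually_nonneg(1)[of N, OF 2] by simp
 thus "a + b = int d - 1" using 1[of N] eventually_nonneg(2)[of N, OF 2] by simp
 have "2 * int (hD f n) = (n - a + 1) * (n - a + 2) + (n - b + 1) * (n - b + 2)" if "n \<ge> N" for n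
 proof -
  have "2 * int (hD f n) = 2 * (n + 1) * (n + 2) - (a + b) * (2 * n + 3) + a\<^sup>2 + b\<^sup>2" using h[of n] that by (simp add: rh)
  thus ?thesis by (simp add: power2_eq_square algebra_simps)
 qed
 thus "\<exists>N. \<forall>n\<ge>N. 2 * int (hD f n) = (n - a + 1) * (n - a + 2) + (n - b + 1) * (n - b + 2)" by blast
qed

end

section \<open>Freeness\<close>

definition cross :: "(nat => poly3) => (nat => poly3) => nat => poly3" where
 "cross s t i = (if i = 0 then s 1 * t 2 - s 2 * t 1 else if i = 1 then s 2 * t 0 - s 0 * t 2 else s 0 * t 1 - s 1 * t 0)"

lemma sc3_diff: "sc3 c (x - y) = sc3 c x - sc3 c y"
 unfolding sc3_def by (rule right_diff_distrib)

lemma homogeneous_cross: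
 assumes "s \<in> der_vecs n" "t \<in> der_vecs m"
 shows "homogeneous (n + m) (cross s t i)"
proof -
 have "homogeneous n (s j)" "homogeneous m (t j)" if "j < 3" for j using assms that by (simp_all add: der_vecs_iff)
 thus ?thesis unfolding cross_def by (auto intro!: homogeneous_diff homogeneous_mult)
qed

definition primitive :: "(nat => poly3) => bool" where
 "primitive s \<longleftrightarrow> (\<forall>p. irreducible p \<longrightarrow> \<not> (\<forall>i<3. p dvd s i)) \<and> (\<exists>i<3. s i ~= 0)"

lemma ex_lt_3: "(\<exists>i<3::nat. Q i) \<longleftrightarrow> Q 0 \<or> Q 1 \<or> Q 2" and all_lt_3: "(\<forall>i<3::nat. Q i) \<longleftrightarrow> Q 0 \<and> Q 1 \<and> Q 2"
 unfolding lt_3 by auto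

lemma cross_multiple:
 assumes s: "primitive s"
  and c: "w 0 * s 1 = w 1 * s 0" "w 0 * s 2 = w 2 * s 0" "w 1 * s 2 = w 2 * s 1"
 shows "\<exists>g. \<forall>i<3. w i = g * s i"
proof -
 have "\<exists>g. w 0 = g * s 0 \<and> w 1 = g * s 1 \<and> w 2 = g * s 2"
  by (rule proportional_primitive'[OF c]) (use s in "auto simp: primitive_def ex_lt_3 all_lt_3")
 thus ?thesis by (simp add: all_lt_3)
qed

lemma cross_0_multiple:
 assumes "primitive s" "\<And>i. i < 3 ==> cross s t i = 0"
 shows "\<exists>g. \<forall>i<3. t i = g * s i"
 by (rule cross_multiple[OF assms(1)]) (use assms(2)[of 0] assms(2)[of 1] assms(2)[of 2] in "simp_all add: cross_def algebra_simps")

lemma cross_simps: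
 "cross s t 0 = s 1 * t 2 - s 2 * t 1" "cross s t 1 = s 2 * t 0 - s 0 * t 2" "cross s t 2 = s 0 * t 1 - s 1 * t 0"
 by (simp_all add: cross_def)

text \<open>Cramer's rule for three vectors with vanishing determinant; the hypothesis is that
  vanishing.\<close>

lemma cramer_rank_2:
 fixes th s t :: "nat => poly3"
 assumes "dot th (cross s t) = 0" "i < 3" "j < 3"
 shows "th i * cross s t j = s i * cross th t j + t i * cross s th j"
proof -
 have "\<forall>i<3. \<forall>j<3. th i * cross s t j = s i * cross th t j + t i * cross s th j"
  unfolding all_lt_3 cross_simps using assms(1)[unfolded dot_def cross_simps] by - (intro conjI; (simp add: algebra_simps; fail | Groebner_Basis.algebra))
 thus ?thesis using assms(2,3) by blast
qed

text \<open>Exactness of the Koszul complex of x, y, z in the middle. The parts a, b of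
  \<open>A\<close> and \<open>B\<close> without z satisfy x a + y b = 0, so they are multiples of y
  and -x by a common factor; in what is left z can be cancelled.\<close>

lemma koszul_syzygy:
 fixes A B C :: poly3
 assumes "xx * A + yy * B + zz * C = 0"
 shows "\<exists>al bt. C = - xx * al - yy * bt \<and> (\<exists>gm. A = yy * gm + zz * al \<and> B = - xx * gm + zz * bt)"
proof -
 obtain a A1 where A: "A = pCons a A1" by (cases A)
 obtain b B1 where B: "B = pCons b B1" by (cases B)
 have ab: "[:[:0, 1:]:] * a + [:0, 1:] * b = (0 :: complex poly poly)"
  using arg_cong[OF assms, of "\<lambda>F. coeff F 0"] by (simp add: A B)
 have e: "[:0, 1:] * b = - ([:[:0, 1:]:] * a)" by (rule minus_unique[OF ab, symmetric])
 obtain g h where a: "a = pCons g h" by (cases a)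
 have "[:0, 1:] * g = 0"
  using arg_cong[OF e, of "\<lambda>F. coeff F 0"] by (simp add: a)
 hence "g = 0" by simp
 hence ah: "a = [:0, 1:] * h" by (simp add: a)
 have "[:0, 1:] * b = [:0, 1:] * (- [:[:0, 1:]:] * h)" unfolding e ah by (simp only: mult_minus_left mult_minus_right mult.left_commute)
 hence bh: "b = - [:[:0, 1:]:] * h" by simp
 have A': "A = yy * [:h:] + zz * A1" "B = - xx * [:h:] + zz * B1" by (simp_all add: A B ah bh)
 have "x * (y * k + z * v) + y * (- x * k + z * w) + z * c = z * (x * v + y * w + c)" for x y z k v w c :: poly3
  by Groebner_Basis.algebra
 hence "zz * (xx * A1 + yy * B1 + C) = 0" using assms unfolding A' by (simp only:)
 hence z: "xx * A1 + yy * B1 + C = 0" by simp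
 have "C = - (xx * A1 + yy * B1)" by (rule minus_unique[OF z, symmetric])
 hence "C = - xx * A1 - yy * B1" by (simp only: minus_add_distrib diff_conv_add_uminus mult_minus_left)
 thus ?thesis using A' by blast
qed

lemma irreducible_linear:
 assumes "homogeneous 1 l" "l ~= 0"
 shows "irreducible l"
proof (rule irreducibleI)
 have t1: "tdeg l = 1" using tdeg_homogeneous[of 1 l] assms by simp
 have t0: "tdeg (1 :: poly3) = 0" using tdeg_homogeneous[of 0 1] by (simp add: one_pCons)
 show "l ~= 0" by fact
 show "\<not> l dvd 1"
 proof
  assume "l dvd 1"
  then obtain h where h: "1 = l * h" by (rule dvdE)
  hence "h ~= 0" by auto
  thus False using tdeg_mult[OF assms(2), of h] h t1 t0 by simp
 qed
 fix g h assume gh: "l = g * h"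
 hence nz: "g ~= 0" "h ~= 0" using assms by auto
 hence "tdeg g = 0 \<or> tdeg h = 0" using tdeg_mult[OF nz] gh t1 by auto
 thus "g dvd 1 \<or> h dvd 1" using tdeg_0_unit nz by blast
qed

lemma irreducible_gens: "irreducible xx" "irreducible yy" "irreducible zz"
 by (rule irreducible_linear; simp)+

lemma gens_not_dvd: "\<not> xx dvd yy" "\<not> xx dvd zz" "\<not> yy dvd zz" "\<not> yy dvd xx" "\<not> zz dvd xx" "\<not> zz dvd yy"
proof -
 have *: "\<not> F dvd G" if "eval3 F x y z = 0" "eval3 G x y z ~= 0" for F G x y z
  using that by (auto simp: eval3_simps)
 show "\<not> xx dvd yy" "\<not> xx dvd zz" "\<not> yy dvd zz" "\<not> yy dvd xx" "\<not> zz dvd xx" "\<not> zz dvd yy"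
  by (rule *[of _ 0 1 1]; simp only: eval3_simps; simp; fail | rule *[of _ 1 0 1]; simp only: eval3_simps; simp; fail
   | rule *[of _ 1 1 0]; simp only: eval3_simps; simp; fail)+
qed

section \<open>Saito's criterion\<close>

locale plane_curve =
 fixes f :: poly3 and d :: nat
 assumes reduced: "reduced_curve f" and hom: "homogeneous (int d) f"
begin

lemma d0: "d > 0" and f0: "f ~= 0"
proof -
 obtain d' where "d' > 0" "homogeneous (int d') f" "f ~= 0" using reduced by (rule reduced_curveE)
 thus "d > 0" "f ~= 0" using homogeneous_unique[OF hom, of "int d'"] by simp_all
qed

lemma hom_grad: "homogeneous (int d - 1) (grad f i)"
 using homogeneous_d[OF hom] by (simp add: grad_def)

lemma grad_nz: obtains j where "j < 3" "grad f j ~= 0"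
proof -
 obtain D where D: "D \<in> {dx, dy, dz}" "D f ~= 0" using partial_nonzero[OF hom d0 f0] by blast
 hence "grad f 0 ~= 0 \<or> grad f 1 ~= 0 \<or> grad f 2 ~= 0" by (auto simp: grad_def)
 thus ?thesis using that[of 0] that[of 1] that[of 2] by auto
qed

lemma grad_primitive: "primitive (grad f)"
 using gradient_primitive[OF reduced] grad_nz unfolding primitive_def all_lt_3 by (metis grad_def zero_neq_numeral numeral_eq_one_iff semiring_norm(85))

text \<open>Two vectors orthogonal to the gradient have a cross product proportional to it, and the
  factor is a polynomial because the gradient is primitive.\<close>

lemma cross_grad:
 assumes "dot s (grad f) = 0" "dot t (grad f) = 0"
 shows "\<exists>g. \<forall>i<3. cross s t i = g * grad f i"
proof (rule cross_multiple[OF grad_primitive])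
 note d = assms[unfolded dot_def]
 show "cross s t 0 * grad f 1 = cross s t 1 * grad f 0" "cross s t 0 * grad f 2 = cross s t 2 * grad f 0" "cross s t 1 * grad f 2 = cross s t 2 * grad f 1"
  unfolding cross_simps using d by Groebner_Basis.algebra+
qed

text \<open>Cramer's rule with the constant \<open>c\<close> inverted: \<open>cross th t\<close> and
  \<open>cross s th\<close> are multiples of the gradient, and up to \<open>c\<close> the
  multipliers are the coordinates of \<open>th\<close>.\<close>

lemma saito_span:
 assumes s: "dot s (grad f) = 0" and t: "dot t (grad f) = 0"
  and cr: "\<forall>i<3. cross s t i = cc c * grad f i" and c0: "c ~= 0"
 shows "dot th (grad f) = 0 ==> \<exists>u v. \<forall>i<3. th i = u * s i + v * t i"
  "(\<And>i. i < 3 ==> u * s i + v * t i = 0) ==> u = 0 \<and> v = 0"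
proof -
 have c1: "cross s t i = cc c * grad f i" if "i < 3" for i using cr that by blast
 obtain j where j: "j < 3" "grad f j ~= 0" by (rule grad_nz)
 have inv: "cc (inverse c) * cc c = 1" using c0 by (simp add: one_pCons)
 show "\<exists>u v. \<forall>i<3. th i = u * s i + v * t i" if th: "dot th (grad f) = 0"
 proof -
  obtain u where u: "\<And>i. i < 3 ==> cross th t i = u * grad f i" using cross_grad[OF th t] by blast
  obtain v where v: "\<And>i. i < 3 ==> cross s th i = v * grad f i" using cross_grad[OF s th] by blast
  have "dot th (cross s t) = cc c * dot th (grad f)" unfolding dot_def using c1[of 0] c1[of 1] c1[of 2] by (simp only: algebra_simps)
  hence z: "dot th (cross s t) = 0" using th by simp
  have "th i = (cc (inverse c) * u) * s i + (cc (inverse c) * v) * t i" if i: "i < 3" for i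
  proof -
   have "grad f j * (cc c * th i) = grad f j * (u * s i + v * t i)"
    using cramer_rank_2[OF z i j(1)] unfolding c1[OF j(1)] u[OF j(1)] v[OF j(1)] by (simp only: algebra_simps)
   hence e: "cc c * th i = u * s i + v * t i" using j(2) mult_left_cancel by blast
   have "th i = (cc (inverse c) * cc c) * th i" unfolding inv by simp
   also have "\<dots> = cc (inverse c) * (u * s i + v * t i)" unfolding mult.assoc e ..
   finally show ?thesis by (simp only: distrib_left mult.assoc)
  qed
  thus ?thesis by blast
 qed
 show "u = 0 \<and> v = 0" if z: "\<And>i. i < 3 ==> u * s i + v * t i = 0"
 proof -
  have z': "u * s 0 + v * t 0 = 0" "u * s 1 + v * t 1 = 0" "u * s 2 + v * t 2 = 0" by (rule z; simp)+
  have "u * cross s t i = 0 \<and> v * cross s t i = 0" if "i < 3" for i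
  proof -
   have "u * cross s t 0 = 0" "u * cross s t 1 = 0" "u * cross s t 2 = 0" "v * cross s t 0 = 0" "v * cross s t 1 = 0" "v * cross s t 2 = 0"
    unfolding cross_simps using z' by Groebner_Basis.algebra+
   thus ?thesis using that unfolding lt_3 by (elim disjE) (simp_all only: simp_thms)
  qed
  from this[OF j(1)] have "u * (cc c * grad f j) = 0" "v * (cc c * grad f j) = 0" unfolding c1[OF j(1)] by simp_all
  moreover have "cc c * grad f j ~= 0" using j(2) c0 by simp
  ultimately show ?thesis by (metis mult_eq_0_iff)
 qed
qed

lemma saito_free:
 assumes s: "s \<in> D f a" and t: "t \<in> D f b"
  and c: "\<forall>i<3. cross s t i = cc c * grad f i" "c ~= 0"
 shows "free_with_exponents f a b"
proof -
 have st: "dot s (grad f) = 0" "dot t (grad f) = 0" using s t by (simp_all add: D_def)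
 note sp = saito_span[OF st c]
 define A where "A = mat 3 2 (\<lambda>(i, j). if j = 0 then s i else t i)"
 have A: "A \<in> carrier_mat 3 2" by (simp add: A_def)
 have Aw: "vec_index (A *\<^sub>v w) i = s i * vec_index w 0 + t i * vec_index w 1" if "w \<in> carrier_vec 2" "i < 3" for w i
  using that by (simp add: A_def scalar_prod_def numeral_2_eq_2)
 have Awc: "A *\<^sub>v w \<in> carrier_vec 3" for w by (rule carrier_vecI) (simp add: A_def)
 have "graded_map [a, b] [0, 0, 0] A"
 proof -
  have "homogeneous ([a, b] ! j - [0, 0, 0] ! i) (A $$ (i, j))" if "i < 3" "j < 2" for i j
  proof -
   have "[0, 0, 0] ! i = (0 :: int)" using that(1) by (auto simp: lt_3)
   moreover have "j = 0 \<or> j = 1" using that by auto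
   ultimately show ?thesis using s t that by (auto simp: A_def D_def der_vecs_iff)
  qed
  thus ?thesis using A by (simp add: graded_map_def numeral_3_eq_3 numeral_2_eq_2)
 qed
 moreover have "bij_betw (\<lambda>w. A *\<^sub>v w) (carrier_vec 2) (D0 f)"
  unfolding bij_betw_def
 proof (intro conjI inj_onI subset_antisym subsetI)
  fix w w' :: "poly3 vec" assume w: "w \<in> carrier_vec 2" "w' \<in> carrier_vec 2" and e: "A *\<^sub>v w = A *\<^sub>v w'"
  have z: "(vec_index w 0 - vec_index w' 0) * s i + (vec_index w 1 - vec_index w' 1) * t i = 0" if "i < 3" for i
   using arg_cong[OF e, of "\<lambda>w. vec_index w i"] unfolding Aw[OF w(1) that] Aw[OF w(2) that] by (simp add: algebra_simps)
  from sp(2)[OF z] have "vec_index w 0 = vec_index w' 0" "vec_index w 1 = vec_index w' 1" by simp_all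
  thus "w = w'" using w by (intro eq_vecI) (auto simp: numeral_2_eq_2 less_Suc_eq)
 next
  fix y assume "y \<in> (\<lambda>w. A *\<^sub>v w) ` carrier_vec 2"
  then obtain w where w: "w \<in> carrier_vec 2" "y = A *\<^sub>v w" by blast
  have "vec_index y 0 * grad f 0 + vec_index y 1 * grad f 1 + vec_index y 2 * grad f 2 = vec_index w 0 * dot s (grad f) + vec_index w 1 * dot t (grad f)"
   unfolding w(2) by (simp add: Aw[OF w(1)] dot_def algebra_simps)
  thus "y \<in> D0 f" using Awc st by (simp add: D0_def w(2) grad_def)
 next
  fix y assume y: "y \<in> D0 f"
  hence "dot (vec_index y) (grad f) = 0" by (simp add: D0_def dot_def grad_def)
  then obtain u v where uv: "\<And>i. i < 3 ==> vec_index y i = u * s i + v * t i" using sp(1) by blast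
  define w where "w = vec 2 (\<lambda>i. if i = 0 then u else v)"
  have w: "w \<in> carrier_vec 2" by (simp add: w_def)
  have "y = A *\<^sub>v w"
  proof (rule eq_vecI)
   fix i assume "i < dim_vec (A *\<^sub>v w)"
   hence "i < 3" using A by simp
   thus "vec_index y i = vec_index (A *\<^sub>v w) i" unfolding Aw[OF w \<open>i < 3\<close>] uv[OF \<open>i < 3\<close>] by (simp add: w_def)
  qed (use y A in "simp add: D0_def")
  thus "y \<in> (\<lambda>w. A *\<^sub>v w) ` carrier_vec 2" using w by blast
 qed
 ultimately show ?thesis unfolding free_with_exponents_def by blast
qed

section \<open>The ideal of multipliers of the gradient\<close>

definition syz_ideal :: "(nat => poly3) => poly3 set" where
 "syz_ideal s = {g. \<exists>th. dot th (grad f) = 0 \<and> (\<forall>i<3. cross s th i = g * grad f i)}"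

text \<open>The ideal is saturated. Lifts t1, t2, t3 of x g, y g, z g agree up to multiples of
  \<open>s\<close>, as in y t1 - x t2 = l1 s, and the multipliers satisfy a linear relation over x,
  y, z. Koszul exactness then corrects t1 by a multiple of \<open>s\<close> to a vector divisible by
  x, and the quotient is a lift of g.\<close>

lemma syz_ideal_descent:
 assumes s: "dot s (grad f) = 0" "primitive s" and g: "xx * g \<in> syz_ideal s" "yy * g \<in> syz_ideal s" "zz * g \<in> syz_ideal s"
 shows "g \<in> syz_ideal s"
proof -
 have ex: "\<exists>th. dot th (grad f) = 0 \<and> (\<forall>i<3. cross s th i = h * grad f i)" if "h \<in> syz_ideal s" for h using that by (simp add: syz_ideal_def)
 obtain t1 t2 t3 where t: "dot t1 (grad f) = 0" "\<And>i. i < 3 ==> cross s t1 i = xx * g * grad f i"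
  "dot t2 (grad f) = 0" "\<And>i. i < 3 ==> cross s t2 i = yy * g * grad f i"
  "dot t3 (grad f) = 0" "\<And>i. i < 3 ==> cross s t3 i = zz * g * grad f i"
  using ex[OF g(1)] ex[OF g(2)] ex[OF g(3)] by blast
 have cl: "cross s (\<lambda>i. x * v i - y * w i) i = x * cross s v i - y * cross s w i" for x y v w i
  by (simp add: cross_def algebra_simps)
 have "\<exists>l. \<forall>i<3. (\<lambda>i. yy * t1 i - xx * t2 i) i = l * s i"
  by (rule cross_0_multiple[OF s(2)], unfold cl) (simp only: t algebra_simps diff_self)
 then obtain l1 where l1: "\<And>i. i < 3 ==> yy * t1 i - xx * t2 i = l1 * s i" by blast
 have "\<exists>l. \<forall>i<3. (\<lambda>i. zz * t1 i - xx * t3 i) i = l * s i"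
  by (rule cross_0_multiple[OF s(2)], unfold cl) (simp only: t algebra_simps diff_self)
 then obtain l2 where l2: "\<And>i. i < 3 ==> zz * t1 i - xx * t3 i = l2 * s i" by blast
 have "\<exists>l. \<forall>i<3. (\<lambda>i. zz * t2 i - yy * t3 i) i = l * s i"
  by (rule cross_0_multiple[OF s(2)], unfold cl) (simp only: t algebra_simps diff_self)
 then obtain l3 where l3: "\<And>i. i < 3 ==> zz * t2 i - yy * t3 i = l3 * s i" by blast
 obtain i0 where i0: "i0 < 3" "s i0 ~= 0" using s(2) unfolding primitive_def by blast
 have id: "x * (z * b - y * c) + y * - (z * a - x * c) + z * (y * a - x * b) = 0" for x y z a b c :: poly3
  by Groebner_Basis.algebra
 have "s i0 * (xx * l3 + yy * - l2 + zz * l1) = xx * (l3 * s i0) + yy * - (l2 * s i0) + zz * (l1 * s i0)"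
  by (simp only: distrib_left mult_ac minus_mult_left)
 also have "\<dots> = 0" unfolding l1[OF i0(1), symmetric] l2[OF i0(1), symmetric] l3[OF i0(1), symmetric] by (rule id)
 finally have "xx * l3 + yy * - l2 + zz * l1 = 0" using i0(2) mult_eq_0_iff by blast
 from koszul_syzygy[OF this] obtain p r where pr: "l1 = - xx * p - yy * r" by blast
 define u1 where "u1 i = t1 i + r * s i" for i
 define u2 where "u2 i = t2 i - p * s i" for i
 have u: "yy * u1 i = xx * u2 i" if "i < 3" for i
 proof -
  have "y * (v1 + r * v) = x * (v2 - p * v)" if "y * v1 - x * v2 = (- x * p - y * r) * v" for x y v v1 v2 :: poly3
   using that by Groebner_Basis.algebra
  thus ?thesis using l1[OF that] unfolding pr u1_def u2_def by blast
 qed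
 have "xx dvd u1 i" if "i < 3" for i
 proof -
  have "xx dvd yy * u1 i" unfolding u[OF that] by (rule dvd_triv_left)
  thus ?thesis using prime_dvd_mult3[OF irreducible_gens(1)] gens_not_dvd(1) by blast
 qed
 hence "\<forall>i. \<exists>h. i < 3 \<longrightarrow> u1 i = xx * h" unfolding dvd_def by blast
 then obtain et where et: "\<And>i. i < 3 ==> u1 i = xx * et i" by metis
 have x0: "xx * A = xx * B \<longleftrightarrow> A = B" for A B :: poly3 using mult_left_cancel[of xx A B] by auto
 have "xx * dot et (grad f) = dot u1 (grad f)" unfolding dot_def using et[of 0] et[of 1] et[of 2] by (simp only: algebra_simps)
 also have "\<dots> = dot t1 (grad f) + r * dot s (grad f)" unfolding dot_def u1_def by (simp only: algebra_simps)
 also have "\<dots> = xx * 0" using t(1) s(1) by simp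
 finally have "dot et (grad f) = 0" unfolding x0 .
 moreover have "cross s et i = g * grad f i" if i: "i < 3" for i
 proof -
  have "x * cross s v i = cross s w i" if "\<forall>i<3. w i = x * v i" for x v w
   using that by (simp add: cross_def algebra_simps)
  hence "xx * cross s et i = cross s u1 i" using et by blast
  also have "\<dots> = cross s t1 i" by (simp add: cross_def u1_def algebra_simps)
  also have "\<dots> = xx * (g * grad f i)" unfolding t(2)[OF i] by simp
  finally show ?thesis unfolding x0 .
 qed
 ultimately show ?thesis unfolding syz_ideal_def by blast
qed

lemma syz_ideal_1:
 assumes s: "dot s (grad f) = 0" "primitive s" and J: "\<And>g. homogeneous (int J) g ==> g \<in> syz_ideal s"
 shows "1 \<in> syz_ideal s"
proof -
 have "\<forall>g. homogeneous (int (J - k)) g \<longrightarrow> g \<in> syz_ideal s" if "k \<le> J" for k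
  using that
 proof (induction k)
  case (Suc k)
  have e: "int (J - k) = 1 + int (J - Suc k)" using Suc.prems by simp
  show ?case
  proof (intro allI impI)
   fix g assume g: "homogeneous (int (J - Suc k)) g"
   have IH: "F \<in> syz_ideal s" if "homogeneous (int (J - k)) F" for F using Suc that by simp
   have "homogeneous (int (J - k)) (l * g)" if "homogeneous 1 l" for l unfolding e by (rule homogeneous_mult[OF that g])
   hence "l * g \<in> syz_ideal s" if "homogeneous 1 l" for l using IH that by blast
   from syz_ideal_descent[OF s this this this] show "g \<in> syz_ideal s" using homogeneous_gens by blast
  qed
 qed (use J in simp)
 from this[of J] show ?thesis by (simp add: one_pCons)
qed

text \<open>The exact sequence 0 -> S_(n - e) -> D_n -> S_(n + e - (d - 1)): the first map
  multiplies \<open>s\<close>, the second sends th to the g with \<open>cross s th\<close> = g grad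
  f. If the dimensions match, the second map is onto.\<close>

lemma hilbert_syz:
 assumes s: "s \<in> D f e" "primitive s"
 shows "hD f n \<le> sdim (n - e) + sdim (n + e - (int d - 1))"
  "hD f n = sdim (n - e) + sdim (n + e - (int d - 1)) ==> homogeneous (n + e - (int d - 1)) g ==> g \<in> syz_ideal s"
proof -
 obtain j where j: "j < 3" "grad f j ~= 0" by (rule grad_nz)
 have sd: "dot s (grad f) = 0" using s(1) by (simp add: D_def)
 define T where "T th = cross s th j div grad f j" for th
 have T: "cross s th i = T th * grad f i" if th: "dot th (grad f) = 0" and i: "i < 3" for th i
 proof -
  obtain g where g: "\<forall>i<3. cross s th i = g * grad f i" using cross_grad[OF sd th] by blast
  hence "T th = g" unfolding T_def using j by simp
  thus ?thesis using g i by blast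
 qed
 have Tu: "T th = g" if "cross s th j = g * grad f j" for th g unfolding T_def that using j(2) by simp
 have dd: "th \<in> D f n ==> dot th (grad f) = 0" for th by (simp add: D_def)
 have hT: "homogeneous (n + e - (int d - 1)) (T th)" if th: "th \<in> D f n" for th
 proof -
  have "homogeneous (e + n) (T th * grad f j)" unfolding T[OF dd[OF th] j(1), symmetric]
   by (rule homogeneous_cross) (use s(1) th D_subset in blast)+
  from homogeneous_divide[OF this hom_grad j(2)] show ?thesis by (simp add: add.commute)
 qed
 have lin: "lin_on scf sc3 (D f n) T"
  unfolding lin_on_def
 proof (intro conjI ballI allI)
  fix x y assume xy: "x \<in> D f n" "y \<in> D f n"
  have "cross s (x + y) j = (T x + T y) * grad f j"
   unfolding distrib_right T[OF dd[OF xy(1)] j(1), symmetric] T[OF dd[OF xy(2)] j(1), symmetric] by (simp add: cross_def algebra_simps)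
  thus "T (x + y) = T x + T y" by (rule Tu)
 next
  fix c x assume x: "x \<in> D f n"
  have "cross s (scf c x) j = sc3 c (T x) * grad f j"
   unfolding sc3_mult T[OF dd[OF x] j(1), symmetric]
   by (simp add: cross_def scf_def sc3_mult sc3_diff)
  thus "T (scf c x) = sc3 c (T x)" by (rule Tu)
 qed
 define Ker where "Ker = (\<lambda>g i. g * s i) ` S (n - e)"
 define Im where "Im = T ` D f n"
 have KerD: "Ker = {th \<in> D f n. T th = 0}"
 proof (intro subset_antisym subsetI)
  fix th assume "th \<in> Ker"
  then obtain g where g: "homogeneous (n - e) g" "th = (\<lambda>i. g * s i)" by (auto simp: Ker_def)
  have "homogeneous (n - e + e) (th i)" if "i < 3" for i
   unfolding g(2) by (rule homogeneous_mult[OF g(1)]) (use s(1) that in "simp add: D_def der_vecs_iff")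
  moreover have "dot th (grad f) = g * dot s (grad f)" by (simp add: dot_def g(2) algebra_simps)
  ultimately have "th \<in> D f n" using s(1) g by (simp add: D_def der_vecs_iff)
  moreover have "T th = 0" by (rule Tu) (simp add: g(2) cross_def algebra_simps)
  ultimately show "th \<in> {th \<in> D f n. T th = 0}" by simp
 next
  fix th assume "th \<in> {th \<in> D f n. T th = 0}"
  hence th: "th \<in> D f n" "T th = 0" by auto
  then obtain g where g: "\<And>i. i < 3 ==> th i = g * s i" using cross_0_multiple[OF s(2), of th] T[OF dd[OF th(1)]] by auto
  obtain i where i: "i < 3" "s i ~= 0" using s(2) unfolding primitive_def by blast
  have hi: "homogeneous n (g * s i)" unfolding g[OF i(1), symmetric] using th(1) i(1) by (simp add: D_def der_vecs_iff)
  have "homogeneous e (s i)" using s(1) i(1) by (simp add: D_def der_vecs_iff)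
  from homogeneous_divide[OF hi this i(2)] have "homogeneous (n - e) g" .
  moreover have "th k = g * s k" for k using g[of k] th(1) s(1) by (cases "k < 3") (simp_all add: D_def der_vecs_iff)
  hence "th = (\<lambda>i. g * s i)" by (rule ext)
  ultimately show "th \<in> Ker" unfolding Ker_def by simp
 qed
 have "codim scf (D f n) {0} (hD f n)" using codim_D_iff[OF hom] by blast
 from rank_nullity[OF subsp_D vector_space_sc3 lin this] obtain k m where km: "k + m = hD f n"
  "subsp scf Ker" "codim scf Ker {0} k" "subsp sc3 Im" "codim sc3 Im {0} m" unfolding KerD Im_def by blast
 have "lin_on sc3 scf (S (n - e)) (\<lambda>g i. g * s i)" by (auto simp: lin_on_def scf_def sc3_mult distrib_right)
 from dim_inj(2)[OF subsp_S vector_space_scf this codim_S] have "codim scf Ker {0} (sdim (n - e))"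
  unfolding Ker_def using s(2) by (auto simp: primitive_def fun_eq_iff)
 hence k: "k = sdim (n - e)" by (rule dim_unique[OF km(3) _ km(2)])
 have IS: "Im \<subseteq> S (n + e - (int d - 1))" using hT by (auto simp: Im_def)
 note mono = dim_mono[OF codim_S km(5) subsp_S km(4) IS]
 show "hD f n \<le> sdim (n - e) + sdim (n + e - (int d - 1))" using mono(1) km(1) k by simp
 show "g \<in> syz_ideal s" if "hD f n = sdim (n - e) + sdim (n + e - (int d - 1))" "homogeneous (n + e - (int d - 1)) g"
 proof -
  have "m = sdim (n + e - (int d - 1))" using that(1) km(1) k by simp
  hence "g \<in> Im" using mono(2) that(2) by simp
  then obtain th where "th \<in> D f n" "g = T th" unfolding Im_def by blast
  thus ?thesis unfolding syz_ideal_def using T dd by blast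
 qed
qed

lemma hD_0_iff: "hD f n = 0 \<longleftrightarrow> D f n = {0}"
 using codim_D_iff[OF hom, of n 0] codim_0_iff[OF subsp_D, of f n "{0}"] subspD(1)[OF subsp_D[of f n]] by auto

text \<open>Dividing a common factor out of \<open>s\<close> would leave a nonzero derivation of
  smaller degree.\<close>

lemma min_degree_primitive:
 assumes s: "s \<in> D f e" "s ~= 0" and m: "\<And>n. n < e ==> hD f n = 0"
 shows "primitive s"
 unfolding primitive_def
proof (intro conjI allI impI notI)
 obtain i where "s i ~= 0" using s(2) by (auto simp: fun_eq_iff)
 hence i: "i < 3" "s i ~= 0" using s(1) by (auto simp: D_def der_vecs_iff)
 thus "\<exists>i<3. s i ~= 0" by blast
 fix p assume p: "irreducible p" "\<forall>i<3. p dvd s i"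
 hence "\<forall>i. \<exists>h. i < 3 \<longrightarrow> s i = h * p" unfolding dvd_def by (metis mult.commute)
 then obtain h where h: "\<And>i. i < 3 ==> s i = h i * p" by metis
 have p0: "p ~= 0" using p(1) by auto
 have hs: "homogeneous e (h i * p)" if "i < 3" for i
 proof -
  have "homogeneous e (s i)" using s(1) that by (simp add: D_def der_vecs_iff)
  thus ?thesis unfolding h[OF that] .
 qed
 have nz: "p * h i ~= 0" using i h[OF i(1)] by auto
 have hp: "homogeneous (int (tdeg p)) p" using factor_homogeneous(1)[of e p "h i", OF _ nz] hs[OF i(1)] by (simp add: mult.commute)
 define h' where "h' i = (if i < 3 then h i else 0)" for i
 have "p * dot h' (grad f) = dot s (grad f)" using h[of 0] h[of 1] h[of 2] by (simp add: dot_def h'_def algebra_simps)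
 hence "dot h' (grad f) = 0" using s(1) p0 by (simp add: D_def)
 hence "h' \<in> D f (e - int (tdeg p))" using homogeneous_divide[OF hs hp p0] by (simp add: D_def der_vecs_iff h'_def)
 moreover have "tdeg p > 0" using tdeg_0_unit[OF p0] p(1) by auto
 ultimately have "h' = 0" using m[of "e - int (tdeg p)"] unfolding hD_0_iff by auto
 hence "h' i = 0" by simp
 thus False using i h[OF i(1)] by (simp add: h'_def)
qed

theorem free_from_hilbert:
 assumes s: "s \<in> D f a" "s ~= 0" and m: "\<And>n. n < a ==> hD f n = 0" and ab: "a + b = int d - 1"
  and h: "\<And>n. n \<ge> N ==> hD f n = sdim (n - a) + sdim (n - b)"
 shows "free_with_exponents f a b"
proof -
 have prim: "primitive s" by (rule min_degree_primitive[OF s m])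
 have sd: "dot s (grad f) = 0" using s(1) by (simp add: D_def)
 define J where "J = nat \<bar>N - b\<bar>"
 have J: "int J + b \<ge> N" by (simp add: J_def)
 have e: "int J + b + a - (int d - 1) = int J" using ab by simp
 have eb: "int J + b - b = int J" by simp
 have "g \<in> syz_ideal s" if "homogeneous (int J) g" for g
 proof (rule hilbert_syz(2)[OF s(1) prim, of "int J + b"])
  show "hD f (int J + b) = sdim (int J + b - a) + sdim (int J + b + a - (int d - 1))" unfolding e using h[OF J] unfolding eb .
 qed (unfold e, rule that)
 hence "1 \<in> syz_ideal s" by (rule syz_ideal_1[OF sd prim])
 then obtain th where th: "\<And>i. i < 3 ==> cross s th i = 1 * grad f i" unfolding syz_ideal_def by blast
 \<comment> \<open>Only the component of degree \<open>b\<close> matters, since \<open>s\<close> has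
   degree \<open>a\<close> and the gradient has degree a + b.\<close>
 define t where "t i = (if i < 3 then hc b (th i) else 0)" for i
 have hs: "homogeneous a (s i)" if "i < 3" for i using s(1) that by (simp add: D_def der_vecs_iff)
 have hm: "hc (a + b) (s i * F) = s i * hc b F" if "i < 3" for i F using hc_mult[OF hs[OF that], of "a + b"] by simp
 have hd: "hc n (F - G) = hc n F - hc n G" for n F G by (simp add: hc_def graded.hom_minus)
 have "cross s t i = hc (a + b) (cross s th i)" for i
  by (simp add: cross_def t_def hd hm)
 hence ct: "cross s t i = grad f i" if "i < 3" for i
  using th[OF that] hom_grad[of i] by (simp add: ab hc_id)
 have "dot t (grad f) = dot t (cross s t)" using ct[of 0] ct[of 1] ct[of 2] by (simp add: dot_def)
 also have "\<dots> = 0" by (simp add: dot_def cross_def algebra_simps)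
 finally have "t \<in> D f b" by (simp add: D_def der_vecs_iff t_def)
 thus ?thesis using saito_free[OF s(1), of t b 1] ct by (simp add: one_pCons[symmetric])
qed

end

section \<open>Homogeneous bases of free curves\<close>

context plane_curve
begin

definition kosz :: "nat => nat => poly3" where
 "kosz j i = (if i = (j + 1) mod 3 then grad f ((j + 2) mod 3) else if i = (j + 2) mod 3 then - grad f ((j + 1) mod 3) else 0)"

lemma kosz_simps:
 "kosz 0 0 = 0" "kosz 0 1 = grad f 2" "kosz 0 2 = - grad f 1"
 "kosz 1 0 = - grad f 2" "kosz 1 1 = 0" "kosz 1 2 = grad f 0"
 "kosz 2 0 = grad f 1" "kosz 2 1 = - grad f 0" "kosz 2 2 = 0"
 by (simp_all add: kosz_def numeral_2_eq_2)

lemma kosz_log: "j < 3 ==> dot (kosz j) (grad f) = 0"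
proof -
 have "dot (kosz 0) (grad f) = 0" "dot (kosz 1) (grad f) = 0" "dot (kosz 2) (grad f) = 0"
  unfolding dot_def kosz_simps by simp_all
 thus "j < 3 ==> dot (kosz j) (grad f) = 0" unfolding lt_3 by (elim disjE) (simp_all only:)
qed

lemma kosz_cross: "j < 3 ==> i < 3 ==> \<exists>k l. k < 3 \<and> l < 3 \<and> cross (kosz k) (kosz l) i = grad f j * grad f i"
proof -
 assume j: "j < 3" and i: "i < 3"
 have "cross (kosz 1) (kosz 2) i = grad f 0 * grad f i" "cross (kosz 2) (kosz 0) i = grad f 1 * grad f i" "cross (kosz 0) (kosz 1) i = grad f 2 * grad f i"
  using i unfolding lt_3 by (elim disjE; simp only: cross_simps kosz_simps; simp)+
 thus ?thesis using j unfolding lt_3 by (elim disjE) (rule exI[of _ 1], rule exI[of _ 2], simp, rule exI[of _ 2], rule exI[of _ 0], simp,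
  rule exI[of _ 0], rule exI[of _ 1], simp)
qed

lemma hc_cross_sum:
 "hc (int N) (cross v w i) = (\<Sum>k\<le>N. cross (\<lambda>i. hcomp k (v i)) (\<lambda>i. hcomp (N - k) (w i)) i)"
proof -
 have "hcomp N (F * G) = (\<Sum>k\<le>N. hcomp k F * hcomp (N - k) G)" for F G
  by (simp add: graded.hom_mult coeff_mult)
 moreover have "hcomp N (F * G) = (\<Sum>k\<le>N. hcomp (N - k) F * hcomp k G)" for F G
  unfolding calculation by (rule sum.reindex_bij_witness[of _ "\<lambda>k. N - k" "\<lambda>k. N - k"]) auto
 ultimately show ?thesis
  by (simp add: hc_def cross_def graded.hom_minus sum_subtractf)
qed

text \<open>\<open>free_curve\<close> supplies a basis of unknown size and without grading. There
  are at most two columns, as all are orthogonal to the gradient. Padded by zero if necessary, two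
  columns have a unit times the gradient as cross product, and its component of degree d - 1 yields
  a homogeneous pair.\<close>

theorem free_curve_homogeneous_basis:
 assumes "free_curve f"
 shows "\<exists>n m s t c. s \<in> D f (int n) \<and> t \<in> D f (int m) \<and> (\<forall>i<3. cross s t i = cc c * grad f i) \<and> c ~= 0"
proof -
 obtain n A where A: "A \<in> carrier_mat 3 n" and bij: "bij_betw (\<lambda>w. A *\<^sub>v w) (carrier_vec n) (D0 f)"
  using assms unfolding free_curve_def by blast
 obtain j0 where j0: "j0 < 3" "grad f j0 ~= 0" by (rule grad_nz)
 define v where "v j i = (if j < n then A $$ (i, j) else 0)" for i j
 have Aw: "vec_index (A *\<^sub>v w) i = (\<Sum>j<n. v j i * vec_index w j)" if "w \<in> carrier_vec n" "i < 3" for w i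
  using that A by (simp add: v_def scalar_prod_def atLeast0LessThan)
 have D0I: "y \<in> D0 f \<longleftrightarrow> y \<in> carrier_vec 3 \<and> dot (vec_index y) (grad f) = 0" for y
  by (simp add: D0_def dot_def grad_def)
 have v: "dot (v j) (grad f) = 0" for j
 proof (cases "j < n")
  case True
  have "A *\<^sub>v unit_vec n j \<in> D0 f" by (rule bij_betwE[OF bij, rule_format, OF unit_vec_carrier])
  hence "dot (vec_index (A *\<^sub>v unit_vec n j)) (grad f) = 0" by (simp only: D0I)
  moreover have "vec_index (A *\<^sub>v unit_vec n j) i = v j i" if "i < 3" for i
   unfolding Aw[OF unit_vec_carrier that] using True by (simp add: if_distrib cong: if_cong)
  ultimately show ?thesis by (simp add: dot_def)
 qed (simp add: v_def dot_def)
 have "n < 3"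
 proof (rule ccontr)
  assume "\<not> n < 3"
  \<comment> \<open>For n \<ge> 3, zero rows complete \<open>A\<close> to a square matrix. The
    gradient lies in its left kernel, so it is singular, and a vector in the right kernel
    contradicts injectivity.\<close>
  define M where "M = mat n n (\<lambda>(i, j). if i < 3 then v j i else 0)"
  define g where "g = vec n (\<lambda>i. if i < 3 then grad f i else 0)"
  have M: "M \<in> carrier_mat n n" by (simp add: M_def)
  have three: "(\<Sum>j<n. x j) = x 0 + x 1 + x 2" if "\<And>j. j \<ge> 3 ==> x j = 0" for x :: "nat => poly3"
  proof -
   have "(\<Sum>j<n. x j) = (\<Sum>j<3. x j)" using \<open>\<not> n < 3\<close> that by (intro sum.mono_neutral_right) auto
   thus ?thesis by (simp add: eval_nat_numeral)
  qed
  have "vec_index g j0 = grad f j0" using j0(1) \<open>\<not> n < 3\<close> by (simp add: g_def)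
  hence g: "g ~= 0\<^sub>v n" using j0 \<open>\<not> n < 3\<close> by auto
  have "g \<in> carrier_vec n" by (simp add: g_def)
  moreover have "transpose_mat M *\<^sub>v g = 0\<^sub>v n"
  proof (rule eq_vecI)
   fix j assume "j < dim_vec (0\<^sub>v n :: poly3 vec)"
   hence "vec_index (transpose_mat M *\<^sub>v g) j = dot (v j) (grad f)"
    using \<open>\<not> n < 3\<close> by (simp add: M_def g_def scalar_prod_def atLeast0LessThan) (subst three, simp_all add: dot_def)
   thus "vec_index (transpose_mat M *\<^sub>v g) j = vec_index (0\<^sub>v n) j" using v \<open>j < _\<close> by simp
  qed (simp add: M_def)
  ultimately have "det (transpose_mat M) = 0" using det_0_iff_vec_prod_zero[of "transpose_mat M" n] M g by auto
  hence "det M = 0" using det_transpose[OF M] by simp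
  then obtain w where w: "w \<in> carrier_vec n" "w ~= 0\<^sub>v n" "M *\<^sub>v w = 0\<^sub>v n" using det_0_iff_vec_prod_zero[OF M] by blast
  have "vec_index (A *\<^sub>v w) i = vec_index (M *\<^sub>v w) i" if "i < 3" for i
   unfolding Aw[OF w(1) that] using w(1) that \<open>\<not> n < 3\<close> by (simp add: M_def scalar_prod_def atLeast0LessThan)
  hence "A *\<^sub>v w = A *\<^sub>v 0\<^sub>v n" unfolding w(3) using A \<open>\<not> n < 3\<close> by (intro eq_vecI) (auto simp: scalar_prod_def)
  thus False using inj_onD[OF bij_betw_imp_inj_on[OF bij] _ w(1) zero_carrier_vec] w(2) by blast
 qed
 hence n: "n = 0 \<or> n = 1 \<or> n = 2" by auto
 have span: "\<exists>x y. \<forall>i<3. th i = v 0 i * x + v 1 i * y" if th: "dot th (grad f) = 0" for th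
 proof -
  have "vec 3 th \<in> D0 f" unfolding D0I using th by (simp add: dot_def)
  hence "vec 3 th \<in> (\<lambda>w. A *\<^sub>v w) ` carrier_vec n" by (simp only: bij_betw_imp_surj_on[OF bij])
  then obtain w where w: "vec 3 th = A *\<^sub>v w" "w \<in> carrier_vec n" by (rule imageE)
  have "th i = v 0 i * vec_index w 0 + v 1 i * vec_index w 1" if "i < 3" for i
   using arg_cong[OF w(1), of "\<lambda>y. vec_index y i"] Aw[OF w(2) that] that n by (auto simp: v_def numeral_2_eq_2)
  thus ?thesis by blast
 qed
 have cross_c: "cross x y i = cross x' y' i" if "\<And>i. i < 3 ==> x i = x' i" "\<And>i. i < 3 ==> y i = y' i" for x y x' y' i
  using that[of 0] that[of 1] that[of 2] by (simp add: cross_def)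
 obtain c where c: "\<And>i. i < 3 ==> cross (v 0) (v 1) i = c * grad f i" using cross_grad[OF v v, of 0 1] by auto
 \<comment> \<open>Cross products of Koszul derivations are f_j times the gradient; expanded in the
   columns they are multiples of \<open>c\<close> times the gradient. So \<open>c\<close> divides
   every partial derivative of \<open>f\<close>, and these have no common prime factor.\<close>
 have cdvd: "c dvd grad f j" if j: "j < 3" for j
 proof -
  obtain k l where kl: "k < 3" "l < 3" "cross (kosz k) (kosz l) j0 = grad f j * grad f j0" using kosz_cross[OF j j0(1)] by blast
  obtain x x' y y' where xy: "\<forall>i<3. kosz k i = v 0 i * x + v 1 i * x'" "\<forall>i<3. kosz l i = v 0 i * y + v 1 i * y'"
   using span[OF kosz_log[OF kl(1)]] span[OF kosz_log[OF kl(2)]] by blast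
  have "cross (kosz k) (kosz l) j0 = cross (\<lambda>i. v 0 i * x + v 1 i * x') (\<lambda>i. v 0 i * y + v 1 i * y') j0"
   by (rule cross_c) (use xy in simp_all)
  also have "\<dots> = (x * y' - x' * y) * cross (v 0) (v 1) j0" by (simp add: cross_def algebra_simps)
  finally have "grad f j * grad f j0 = (x * y' - x' * y) * c * grad f j0" unfolding kl(3) c[OF j0(1)] by simp
  hence "grad f j = (x * y' - x' * y) * c" using j0(2) mult_right_cancel by blast
  thus ?thesis by simp
 qed
 have cn0: "c ~= 0" using cdvd[OF j0(1)] j0(2) by auto
 have "c dvd 1"
 proof (rule ccontr)
  assume "\<not> c dvd 1"
  then obtain p where "prime p" "p dvd c" using prime_divisor_exists[OF cn0] by blast
  hence "irreducible p" "\<And>j. j < 3 ==> p dvd grad f j" using cdvd dvd_trans by (auto intro: prime_elem_imp_irreducible)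
  thus False using grad_primitive unfolding primitive_def by blast
 qed
 then obtain c' where c': "1 = c * c'" by (rule dvdE)
 have "tdeg c = 0"
 proof -
  have "c' ~= 0" using c' by auto
  hence "tdeg (1 :: poly3) = tdeg c + tdeg c'" using tdeg_mult[OF cn0, of c'] c' by simp
  moreover have "tdeg (1 :: poly3) = 0" using tdeg_homogeneous[of 0 1] by (simp add: one_pCons)
  ultimately show ?thesis by simp
 qed
 then obtain gm where gm: "c = cc gm" using tdeg_0 by blast
 have g0: "gm ~= 0" using cn0 gm by auto
 define s where "s k i = (if i < 3 then hcomp k (v 0 i) else 0)" for k i
 define t where "t k i = (if i < 3 then hcomp k (v 1 i) else 0)" for k i
 have D: "(\<lambda>i. if i < 3 then hcomp k (u i) else 0) \<in> D f (int k)" if u: "dot u (grad f) = 0" for u k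
 proof -
  have "hc (int k + (int d - 1)) (dot u (grad f)) = dot (\<lambda>i. if i < 3 then hcomp k (u i) else 0) (grad f)"
   unfolding dot_def hc_add using hc_mult[OF hom_grad, of "int k + (int d - 1)"] by (simp add: mult.commute hc_def)
  thus ?thesis using u by (simp add: D_def der_vecs_iff homogeneous_comp)
 qed
 have sD: "s k \<in> D f (int k)" and tD: "t k \<in> D f (int k)" for k
  unfolding s_def[abs_def] t_def[abs_def] using D v by simp_all
 define N where "N = d - 1"
 have N: "int N = int d - 1" using d0 by (simp add: N_def)
 \<comment> \<open>For degree reasons each summand of the component of degree d - 1 is a constant
   times the gradient. The constants add up to a nonzero one, so some summand provides the
   pair.\<close>
 have "\<exists>g. cross (s k) (t (N - k)) j0 = cc g * grad f j0 \<and> (\<forall>i<3. cross (s k) (t (N - k)) i = cc g * grad f i)" if k: "k \<le> N" for k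
 proof -
  obtain g where g: "\<forall>i<3. cross (s k) (t (N - k)) i = g * grad f i"
   using cross_grad[of "s k" "t (N - k)"] sD[of k] tD[of "N - k"] unfolding D_def by blast
  have "homogeneous (int k + int (N - k)) (g * grad f j0)" unfolding g[rule_format, OF j0(1), symmetric]
   by (rule homogeneous_cross) (use sD[of k] tD[of "N - k"] D_subset in blast)+
  from homogeneous_divide[OF this hom_grad j0(2)] have "homogeneous 0 g" using k N by simp
  then obtain g' where "g = cc g'" using homogeneous_const by blast
  thus ?thesis using g j0(1) by blast
 qed
 then obtain g where g: "\<And>k. k \<le> N ==> \<forall>i<3. cross (s k) (t (N - k)) i = cc (g k) * grad f i" by metis
 have "cc gm * grad f j0 = hc (int N) (cross (v 0) (v 1) j0)"
  unfolding c[OF j0(1)] gm using hc_id[of "int N" "cc gm * grad f j0"] homogeneous_mult[OF homogeneous_gens(1) hom_grad, of gm j0] N by simp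
 also have "\<dots> = (\<Sum>k\<le>N. cross (s k) (t (N - k)) j0)"
  unfolding hc_cross_sum by (intro sum.cong refl cross_c) (simp_all add: s_def t_def)
 also have "\<dots> = (\<Sum>k\<le>N. cc (g k)) * grad f j0" unfolding sum_distrib_right using g j0(1) by (intro sum.cong) auto
 finally have "cc gm = (\<Sum>k\<le>N. cc (g k))" using j0(2) mult_right_cancel by blast
 hence "\<exists>k\<le>N. g k ~= 0" using g0 by (metis (mono_tags, lifting) atMost_iff pCons_0_0 pCons_eq_0_iff sum.neutral)
 then obtain k where "k \<le> N" "g k ~= 0" by blast
 thus ?thesis using sD[of k] tD[of "N - k"] g by blast
qed

end

lemma free_with_exponents_chern:
 assumes "free_with_exponents f a b"
 shows "curve_chern_poly f ([:- 1, a:] * [:- 1, b:])" "free_curve f"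
proof -
 obtain A where A: "graded_map [a, b] [0, 0, 0] A" and bij: "bij_betw (\<lambda>w. A *\<^sub>v w) (carrier_vec 2) (D0 f)"
  using assms unfolding free_with_exponents_def by blast
 have Ac: "A \<in> carrier_mat 3 2" using A by (simp add: graded_map_def numeral_2_eq_2 numeral_3_eq_3)
 thus "free_curve f" using bij unfolding free_curve_def by blast
 have l: "length [a, b] = 2" "length [0, 0, 0 :: int] = 3" by simp_all
 have im: "(\<lambda>w. A *\<^sub>v w) ` carrier_vec 2 = D0 f" by (rule bij_betw_imp_surj_on[OF bij])
 have A0: "A *\<^sub>v 0\<^sub>v 2 = 0\<^sub>v 3" by (rule eq_vecI) (use Ac in "auto simp: scalar_prod_def")
 have ker: "{w \<in> carrier_vec 2. A *\<^sub>v w = 0\<^sub>v 3} = {0\<^sub>v 2}"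
 proof (intro subset_antisym subsetI)
  fix w assume "w \<in> {w \<in> carrier_vec 2. A *\<^sub>v w = 0\<^sub>v 3}"
  hence "w \<in> carrier_vec 2" "A *\<^sub>v w = A *\<^sub>v 0\<^sub>v 2" using A0 by simp_all
  thus "w \<in> {0\<^sub>v 2}" using inj_onD[OF bij_betw_imp_inj_on[OF bij]] zero_carrier_vec by blast
 qed (use A0 in simp)
 have "has_chern_poly [0, 0, 0] ((\<lambda>w. A *\<^sub>v w) ` carrier_vec (length [a, b])) ([:- 1, a:] * [:- 1, b:])"
 proof (rule has_chern_poly.step[OF A])
  show "has_chern_poly [a, b] {w \<in> carrier_vec (length [a, b]). A *\<^sub>v w = 0\<^sub>v (length [0, 0, 0 :: int])} 1"
   unfolding l ker using has_chern_poly.zero[of "[a, b]"] unfolding l .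
 qed simp_all
 thus "curve_chern_poly f ([:- 1, a:] * [:- 1, b:])" unfolding l im curve_chern_poly_def .
qed

sublocale conic_curve \<subseteq> plane_curve f d
 by unfold_locales (rule f_reduced f_homogeneous)+

section \<open>Summing the Hilbert bound over one parity class\<close>

lemma telescope:
 fixes H B :: "int => int"
 assumes "\<And>n. n \<ge> l ==> H n \<le> H (n - 2) + (B n - B (n - 2))" "l \<le> l' + 2"
 shows "H (l' + 2 * int j) \<le> H l' + B (l' + 2 * int j) - B l'"
proof (induction j)
 case (Suc j)
 have "H (l' + 2 * int (Suc j)) \<le> H (l' + 2 * int (Suc j) - 2) + (B (l' + 2 * int (Suc j)) - B (l' + 2 * int (Suc j) - 2))"
  using assms(2) by (intro assms(1)) simp
 moreover have "l' + 2 * int (Suc j) - 2 = l' + 2 * int j" by simp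
 ultimately show ?case using Suc by simp
qed simp

text \<open>The sum of max 0 (y - 2) along steps of 4, vanishing for negative y. The step is 4
  because y = 2 n + 3 - k and n moves by 2.\<close>

definition gap :: "int => int" where "gap y = (if y < 0 then 0 else y\<^sup>2 div 8)"

lemma square_mod_8: "(y :: int)\<^sup>2 mod 8 = (if odd y then 1 else if y mod 4 = 2 then 4 else 0)"
proof -
 define u where "u = y div 4"
 have y: "y = 4 * u + y mod 4" by (simp add: u_def)
 have "y\<^sup>2 = (y mod 4)\<^sup>2 + 8 * (2 * u\<^sup>2 + u * (y mod 4))" by (subst y) (simp add: power2_eq_square algebra_simps)
 hence "y\<^sup>2 mod 8 = (y mod 4)\<^sup>2 mod 8" by (metis mod_mult_self2)
 moreover have "y mod 4 = 0 \<and> even y \<or> y mod 4 = 1 \<and> odd y \<or> y mod 4 = 2 \<and> even y \<or> y mod 4 = 3 \<and> odd y" by presburger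
 ultimately show ?thesis by auto
qed

text \<open>Squares are 0, 1 or 4 modulo 8, and the loss in rounding is largest for y congruent to 2
  modulo 4.\<close>

lemma gap_bounds: "gap y \<ge> 0" "8 * gap y \<le> y\<^sup>2 - (if odd y then 1 else if y mod 4 = 2 then 4 else 0)" "y \<ge> - 2 ==> y\<^sup>2 - 4 \<le> 8 * gap y"
proof -
 have e: "8 * (y\<^sup>2 div 8) = y\<^sup>2 - y\<^sup>2 mod 8" by (rule minus_mod_eq_mult_div[symmetric])
 show "gap y \<ge> 0" by (simp add: gap_def pos_imp_zdiv_nonneg_iff)
 have "y\<^sup>2 mod 8 \<le> y\<^sup>2" by (rule zmod_le_nonneg_dividend) simp
 thus "8 * gap y \<le> y\<^sup>2 - (if odd y then 1 else if y mod 4 = 2 then 4 else 0)"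
  unfolding square_mod_8[symmetric] gap_def using e by simp
 assume y: "y \<ge> - 2"
 show "y\<^sup>2 - 4 \<le> 8 * gap y"
 proof (cases "y < 0")
  case True
  hence "y = - 1 \<or> y = - 2" using y by auto
  thus ?thesis by (auto simp: gap_def)
 next
  case False
  thus ?thesis using e square_mod_8[of y] by (auto simp: gap_def)
 qed
qed

lemma gap_diff: "gap y - gap (y - 4) = max 0 (y - 2)"
proof (cases "y < 4")
 case False
 have "y\<^sup>2 = (y - 4)\<^sup>2 + 8 * (y - 2)" by (simp add: power2_eq_square algebra_simps)
 hence "y\<^sup>2 div 8 = (y - 4)\<^sup>2 div 8 + (y - 2)" by simp
 thus ?thesis using False by (simp add: gap_def)
next
 case True
 hence "y < 0 \<or> y \<in> {0, 1, 2, 3}" by auto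
 thus ?thesis by (auto simp: gap_def)
qed

section \<open>The dichotomy, the boundary cases and the tangency obstruction\<close>

locale conic_chern = conic_curve +
 fixes a b :: int
 assumes chern: "curve_chern_poly f ([:- 1, a:] * [:- 1, b:])" and a0: "a > 0" and ab: "a \<le> b"
begin

lemma ab_sum: "a + b = int d - 1"
 using hilbert_polynomial(1)[OF chern] a0 ab by simp

lemma hilbert_large: obtains N where "N \<ge> b"
 "\<And>n. n \<ge> N ==> 2 * int (hD f n) = (n - a + 1) * (n - a + 2) + (n - b + 1) * (n - b + 2)"
proof -
 obtain N where N: "\<forall>n\<ge>N. 2 * int (hD f n) = (n - a + 1) * (n - a + 2) + (n - b + 1) * (n - b + 2)"
  using hilbert_polynomial(2)[OF chern] a0 ab by auto
 show ?thesis by (rule that[of "max N b"]) (use N in auto)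
qed

lemma hilbert_sdim:
 assumes "n \<ge> b" "2 * int (hD f n) = (n - a + 1) * (n - a + 2) + (n - b + 1) * (n - b + 2)"
 shows "hD f n = sdim (n - a) + sdim (n - b)"
proof -
 have "2 * int (sdim (n - a)) = (n - a + 1) * (n - a + 2)" "2 * int (sdim (n - b)) = (n - b + 1) * (n - b + 2)"
  using assms(1) ab by (intro sdim_eq; simp)+
 thus ?thesis using assms(2) by linarith
qed

lemma hD_step:
 assumes "n \<ge> 0"
 shows "int (hD f n) \<le> int (hD f (n - 2)) + max 0 (2 * n + 3 - (2 * (a + b + 1) - k_number f q)) + max 0 (2 * n + 1 - k_number f q)"
proof -
 obtain m where m: "n = int m" using assms by (metis nonneg_int_cases)
 have "int (degree R) = 2 * (a + b + 1) - k_number f q" using degree_R ab_sum unfolding degree_K[symmetric] by simp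
 moreover have "int (x - y) = max 0 (int x - int y)" for x y :: nat by simp
 moreover have "int (hD f n) \<le> int (hD f (n - 2)) + int (2 * m + 3 - degree R) + int (2 * m + 1 - degree K)"
  unfolding m using hD_bound[of m] by linarith
 ultimately show ?thesis using degree_K by (simp add: m)
qed

lemma min_degree:
 obtains l s where "s \<in> D f l" "s ~= 0" "\<And>n. n < l ==> hD f n = 0" "hD f l > 0" "l \<ge> 0"
proof -
 obtain N where N: "N \<ge> b" "\<And>n. n \<ge> N ==> 2 * int (hD f n) = (n - a + 1) * (n - a + 2) + (n - b + 1) * (n - b + 2)" by (rule hilbert_large) (rule that)
 have "0 < (N - a + 1) * (N - a + 2)" "0 < (N - b + 1) * (N - b + 2)" using N(1) ab by simp_all
 hence "hD f N ~= 0" using N(2)[of N] by linarith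
 hence ex: "hD f (int (nat N)) ~= 0" using N(1) a0 ab by simp
 define e where "e = (LEAST n. hD f (int n) ~= 0)"
 have e: "hD f (int e) ~= 0" unfolding e_def by (rule LeastI[of "\<lambda>n. hD f (int n) ~= 0", OF ex])
 have m: "hD f n = 0" if "n < int e" for n
 proof (cases "n < 0")
  case False
  hence "nat n < e" using that by linarith
  hence "\<not> hD f (int (nat n)) ~= 0" unfolding e_def by (rule not_less_Least)
  thus ?thesis using False by simp
 qed (rule hD_neg[OF hom])
 have "D f (int e) ~= {0}" using e unfolding hD_0_iff .
 moreover have "0 \<in> D f (int e)" by (rule subspD(1)[OF subsp_D])
 ultimately have "\<not> D f (int e) \<subseteq> {0}" by auto
 then obtain s where "s \<in> D f (int e)" "s ~= 0" by auto
 thus ?thesis using that[of s "int e"] m e by simp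
qed

text \<open>The bound \<open>B\<close> and the Hilbert polynomial agree in the terms that grow with
  n. A large degree therefore compares (b - a)^2 with (k - (a + b))^2, up to the loss in rounding.
  In the boundary cases the slack is too small for the minimal degree of a derivation to differ from
  \<open>a\<close>.\<close>

lemma conic_case:
 defines "k \<equiv> k_number f q"
 shows "(b - a)\<^sup>2 + (if even k then 0 else 1) \<le> (k - (a + b))\<^sup>2"
  and "\<bar>k - (a + b)\<bar> = b - a \<or> \<bar>k - (a + b)\<bar> = b - a + 1 ==> free_with_exponents f a b"
proof -
 define H where "H n = int (hD f n)" for n
 define B where "B n = gap (2 * n + 3 - k) + gap (2 * n + 3 - (2 * (a + b) - k))" for n
 have dB: "B n - B (n - 2) = max 0 (2 * n + 1 - k) + max 0 (2 * n + 1 - (2 * (a + b) - k))" for n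
  using gap_diff[of "2 * n + 3 - k"] gap_diff[of "2 * n + 3 - (2 * (a + b) - k)"] unfolding B_def by (simp add: algebra_simps)
 have step: "H n \<le> H (n - 2) + (B n - B (n - 2))" if "n \<ge> 0" for n
  unfolding dB using hD_step[OF that] unfolding H_def k_def by simp
 note tele = telescope[of 0 H B, OF step]
 have H0: "n < 0 ==> H n = 0" for n using hD_neg[OF hom] by (simp add: H_def)
 have B0: "B n \<ge> 0" for n unfolding B_def by (intro add_nonneg_nonneg gap_bounds(1))
 have up: "H n \<le> B n" if n: "n \<ge> 0" for n
 proof -
  \<comment> \<open>The summation starts at -2 or -1, where the Hilbert function is 0 and
    \<open>B\<close> is nonnegative.\<close>
  define l where "l = (if even n then - 2 else - 1 :: int)"
  have "even (n - l)" by (simp add: l_def)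
  then obtain i where i: "n - l = 2 * i" by (rule evenE)
  have "i \<ge> 0" using i n by (simp add: l_def split: if_splits)
  hence "n = l + 2 * int (nat i)" using i by simp
  thus ?thesis using tele[of l "nat i"] B0[of l] H0[of l] by (simp add: l_def split: if_splits)
 qed
 obtain N where N: "N \<ge> b" "\<And>n. n \<ge> N ==> 2 * int (hD f n) = (n - a + 1) * (n - a + 2) + (n - b + 1) * (n - b + 2)" by (rule hilbert_large) (rule that)
 have H8: "8 * H n = 2 * (2 * n + 3 - (a + b))\<^sup>2 + 2 * (b - a)\<^sup>2 - 2" if "n \<ge> N" for n
  using N(2)[OF that] unfolding H_def by (simp add: power2_eq_square algebra_simps)
 have B8: "8 * B n \<le> 2 * (2 * n + 3 - (a + b))\<^sup>2 + 2 * (k - (a + b))\<^sup>2 - (if even k then 2 else if (2 * n + 3 - k) mod 4 = 2 then 4 else 0)" for n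
 proof -
  have "(2 * n + 3 - k)\<^sup>2 + (2 * n + 3 - (2 * (a + b) - k))\<^sup>2 = 2 * (2 * n + 3 - (a + b))\<^sup>2 + 2 * (k - (a + b))\<^sup>2"
   by (simp add: power2_eq_square algebra_simps)
  thus ?thesis using gap_bounds(2)[of "2 * n + 3 - k"] gap_bounds(2)[of "2 * n + 3 - (2 * (a + b) - k)"]
   unfolding B_def by (auto split: if_splits)
 qed
 \<comment> \<open>For odd k the degree is chosen with 2 n + 3 - k congruent to 2 modulo 4, where
   the rounding loses at least 4; this supplies the extra 1.\<close>
 define n where "n = \<bar>N\<bar> + (if even k \<or> (2 * \<bar>N\<bar> + 3 - k) mod 4 = 2 then 0 else 1)"
 have "n \<ge> N" "n \<ge> 0" by (auto simp: n_def)
 moreover have "odd k ==> (2 * M + 3 - k) mod 4 ~= 2 ==> (2 * (M + 1) + 3 - k) mod 4 = 2" for M k :: int by presburger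
 hence "even k \<or> (2 * n + 3 - k) mod 4 = 2" by (simp add: n_def)
 ultimately show "(b - a)\<^sup>2 + (if even k then 0 else 1) \<le> (k - (a + b))\<^sup>2"
  using up[of n] H8[of n] B8[of n] by auto
 define r where "r = \<bar>k - (a + b)\<bar>"
 have r2: "r\<^sup>2 = (k - (a + b))\<^sup>2" by (simp add: r_def)
 have Br: "B n = gap (2 * n + 3 - (a + b) + r) + gap (2 * n + 3 - (a + b) - r)" for n
  unfolding B_def r_def by (cases "k \<ge> a + b") (simp_all add: algebra_simps)
 assume "\<bar>k - (a + b)\<bar> = b - a \<or> \<bar>k - (a + b)\<bar> = b - a + 1"
 hence r: "r = b - a \<or> r = b - a + 1" by (simp add: r_def)
 obtain e s where e: "s \<in> D f e" "s ~= 0" "\<And>n. n < e ==> hD f n = 0" "hD f e > 0" "e \<ge> 0" by (rule min_degree) (rule that)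
 have prim: "primitive s" by (rule min_degree_primitive[OF e(1-3)])
 \<comment> \<open>Below degree \<open>a\<close> both arguments of \<open>gap\<close> are at most 2,
   so the bound is 0.\<close>
 have "e \<ge> a"
 proof (rule ccontr)
  assume "\<not> e \<ge> a"
  hence l: "2 * e + 3 - (a + b) + r \<le> 2" "2 * e + 3 - (a + b) - r \<le> 2" using r ab by auto
  have h0: "gap y = 0" if "y \<le> 2" for y using that gap_diff[of y] by (simp add: gap_def)
  have "B e = 0" unfolding Br h0[OF l(1)] h0[OF l(2)] by simp
  thus False using up[OF e(5)] e(4) by (simp add: H_def)
 qed
 moreover have "e \<le> a"
 proof (rule ccontr)
  assume ea: "\<not> e \<le> a"
  \<comment> \<open>A primitive \<open>s\<close> of degree e bounds the Hilbert function by that of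
    exponents e and a + b - e. In large degree this means (e - a)(e - b) \<ge> 0.\<close>
  define n where "n = max N (max e (a + b - e))"
  have n: "n \<ge> N" "n \<ge> e" "n \<ge> a + b - e" by (simp_all add: n_def)
  have "hD f n \<le> sdim (n - e) + sdim (n + e - (int d - 1))" by (rule hilbert_syz(1)[OF e(1) prim])
  moreover have "2 * int (sdim (n - e)) = (n - e + 1) * (n - e + 2)"
   "2 * int (sdim (n + e - (int d - 1))) = (n + e - (int d - 1) + 1) * (n + e - (int d - 1) + 2)"
   using n ab_sum by (intro sdim_eq; simp)+
  ultimately have "(n - a + 1) * (n - a + 2) + (n - b + 1) * (n - b + 2) \<le> (n - e + 1) * (n - e + 2) + (n + e - (a + b) + 1) * (n + e - (a + b) + 2)"
   using N(2)[OF n(1)] unfolding ab_sum by linarith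
  hence "(e - a) * (e - b) \<ge> 0" by (simp add: algebra_simps)
  hence eb: "e \<ge> b" using ea by (simp add: zero_le_mult_iff)
  \<comment> \<open>Now the summation can start at e - 1, where the Hilbert function is still 0 but
    \<open>B\<close> is already positive. This gain exceeds the slack left in large degree.\<close>
  define n where "n = e - 1 + 2 * int (nat \<bar>N\<bar>)"
  have "n \<ge> N" using ea a0 by (simp add: n_def)
  moreover have "H n \<le> B n - B (e - 1)" unfolding n_def using tele[of "e - 1" "nat \<bar>N\<bar>"] e(3)[of "e - 1"] e(5) by (simp add: H_def)
  ultimately have "8 * B (e - 1) \<le> 2 * r\<^sup>2 - 2 * (b - a)\<^sup>2 + 2" using H8[of n] B8[of n] unfolding r2 by (auto split: if_splits)
  moreover have "(2 * e + 1 - (a + b) + r)\<^sup>2 - 4 \<le> 8 * B (e - 1)"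
   using gap_bounds(3)[of "2 * e + 1 - (a + b) + r"] gap_bounds(1)[of "2 * e + 1 - (a + b) - r"] r ea eb unfolding Br by (auto simp: algebra_simps)
  ultimately have b: "(2 * e + 1 - (a + b) + r)\<^sup>2 - 4 \<le> 2 * r\<^sup>2 - 2 * (b - a)\<^sup>2 + 2" by linarith
  define x c where "x = e - a" and "c = b - a"
  have x: "x \<ge> 1" "x \<ge> c" using ea eb by (simp_all add: x_def c_def)
  hence xx: "1 * 1 \<le> x * x" by (intro mult_mono) simp_all
  have "(2 * x - c + 1 + r)\<^sup>2 - 4 \<le> 2 * r\<^sup>2 - 2 * c\<^sup>2 + 2" using b by (simp add: x_def c_def algebra_simps)
  thus False using r x xx unfolding c_def[symmetric] by (elim disjE) (simp_all add: power2_eq_square algebra_simps)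
 qed
 ultimately have "e = a" by simp
 show "free_with_exponents f a b"
  by (rule free_from_hilbert[OF e(1-3)[unfolded \<open>e = a\<close>] ab_sum, where N = N]) (use hilbert_sdim N in auto)
qed

text \<open>The Hilbert polynomial determines the sum and the sum of squares of the
  exponents.\<close>

lemma free_exponents:
 assumes s: "s \<in> D f (int k1)" and t: "t \<in> D f (int k2)" and c: "\<forall>i<3. cross s t i = cc c * grad f i" "c ~= 0"
 shows "int k1 = a \<and> int k2 = b \<or> int k1 = b \<and> int k2 = a"
proof -
 have "curve_chern_poly f ([:- 1, int k1:] * [:- 1, int k2:])"
  by (rule free_with_exponents_chern(1)[OF saito_free[OF s t c]])
 from curve_hilbert[OF hom this] curve_hilbert[OF hom chern] obtain x y N M where
  h: "\<And>n. n \<ge> N ==> 2 * int (hD f n) = x * (n + 1) * (n + 2) - (int k1 + int k2) * (2 * n + 3) + (int k1)\<^sup>2 + (int k2)\<^sup>2"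
   "\<And>n. n \<ge> M ==> 2 * int (hD f n) = y * (n + 1) * (n + 2) - (a + b) * (2 * n + 3) + a\<^sup>2 + b\<^sup>2" by blast
 define u v w where "u = x - y" and "v = int k1 + int k2 - (a + b)" and "w = (int k1)\<^sup>2 + (int k2)\<^sup>2 - a\<^sup>2 - b\<^sup>2"
 have z: "u * n\<^sup>2 + (3 * u - 2 * v) * n + (2 * u - 3 * v + w) = 0" if "n \<ge> max N M" for n
  using h(1)[of n] h(2)[of n] that by (simp add: u_def v_def w_def power2_eq_square algebra_simps)
 hence e: "u * n\<^sup>2 + (3 * u - 2 * v) * n + (2 * u - 3 * v + w) \<ge> 0" "- u * n\<^sup>2 + - (3 * u - 2 * v) * n + - (2 * u - 3 * v + w) \<ge> 0"
  "u * n\<^sup>2 + (3 * u - 2 * v) * n + (2 * u - 3 * v + w) = 0" if "n \<ge> max N M" for n using z[OF that] by (simp_all add: algebra_simps)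
 have u: "u = 0" using eventually_nonneg(1)[of "max N M", OF e(1)] eventually_nonneg(1)[of "max N M", OF e(2)] by simp
 hence v: "v = 0" using eventually_nonneg(2)[of "max N M", OF e(1)] eventually_nonneg(2)[of "max N M", OF e(2)] by simp
 have "w = 0" using e(3)[of "max N M"] by (simp add: u v)
 moreover have "int k2 = a + b - int k1" using v by (simp add: v_def)
 ultimately have "2 * ((int k1 - a) * (int k1 - b)) = 0" by (simp add: w_def power2_eq_square algebra_simps)
 thus ?thesis using v by (auto simp: v_def)
qed

text \<open>If all Koszul derivations were tangent, the gradients of \<open>f\<close> and
  \<open>q\<close> would be proportional along the conic. Pairing with (x, y, z), Euler's formula
  gives d f for one and 0 for the other. So f grad q = 0 on the conic, against its
  smoothness.\<close>

lemma not_all_tangent: "\<exists>j<3. E (dot (kosz j) (grad q)) ~= 0"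
proof (rule ccontr)
 assume "\<not> ?thesis"
 hence z: "E (dot (kosz 0) (grad q)) = 0" "E (dot (kosz 1) (grad q)) = 0" "E (dot (kosz 2) (grad q)) = 0" by auto
 define u where "u i = E (grad f i)" for i
 define v where "v i = E (grad q i)" for i
 have uv: "u i * v j = u j * v i" if "i < 3" "j < 3" for i j
 proof -
  have "u 2 * v 1 - u 1 * v 2 = 0" "u 0 * v 2 - u 2 * v 0 = 0" "u 1 * v 0 - u 0 * v 1 = 0"
   using z unfolding dot_def kosz_simps by (simp_all add: E.hom_minus E.hom_mult u_def v_def)
  thus ?thesis using that unfolding lt_3 by (elim disjE) (simp_all add: algebra_simps)
 qed
 have eu: "dot gen (grad F) = of_nat n * F" if "homogeneous (int n) F" for n F
  using euler[OF that] by (simp only: dot_def gen_def grad_def) simp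
 have g: "(\<Sum>j<3. E (gen j) * u j) = of_nat d * E f" "(\<Sum>j<3. E (gen j) * v j) = 0"
 proof -
  have 3: "(\<Sum>j<3. E (gen j) * E (h j)) = E (dot gen h)" for h by (simp add: dot_def E.hom_add E.hom_mult eval_nat_numeral)
  show "(\<Sum>j<3. E (gen j) * u j) = of_nat d * E f" unfolding u_def 3 eu[OF f_homogeneous] by (simp add: E.hom_mult E.hom_of_nat)
  show "(\<Sum>j<3. E (gen j) * v j) = 0" unfolding v_def 3 using eu[of 2 q] q_homogeneous E_q by (simp add: E.hom_mult)
 qed
 have v0: "v i = 0" if i: "i < 3" for i
 proof -
  have "of_nat d * E f * v i = (\<Sum>j<3. E (gen j) * (u j * v i))" unfolding g(1)[symmetric] by (simp add: sum_distrib_right mult.assoc)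
  also have "\<dots> = (\<Sum>j<3. E (gen j) * v j) * u i" unfolding sum_distrib_right using uv[OF _ i] by (intro sum.cong) (auto simp: mult_ac)
  finally show ?thesis unfolding g(2) using Ef(1) d_pos by simp
 qed
 have "eval_vec (grad q i) (pt 0) = 0" if "i < 3" for i using v0[OF that] poly_E[of "grad q i" 0] by (simp add: v_def)
 from this[of 0] this[of 1] this[of 2] have "eval_vec (dx q) (pt 0) = 0" "eval_vec (dy q) (pt 0) = 0" "eval_vec (dz q) (pt 0) = 0"
  by (simp_all add: grad_def)
 moreover have "eval_vec q (pt 0) = 0" using poly_E[of q 0] E_q by simp
 moreover have "(pt 0 0, pt 0 1, pt 0 2) ~= (0, 0, 0)" using pt_nonzero[of 0] by auto
 ultimately show False using q_smooth unfolding smooth_conic_def by blast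
qed

text \<open>For k < 2 a the degree 2 (a + b + 1) - k of \<open>R\<close> exceeds 2 b + 2, the
  largest degree of theta(q) on the conic for theta of degree at most \<open>b\<close>. So both
  members of a homogeneous basis are tangent, and with them all derivations.\<close>

theorem not_free:
 assumes k: "k_number f q < 2 * a"
 shows "\<not> free_curve f"
proof
 assume "free_curve f"
 then obtain k1 k2 s t c where st: "s \<in> D f (int k1)" "t \<in> D f (int k2)" and c: "\<forall>i<3. cross s t i = cc c * grad f i" "c ~= 0"
  using free_curve_homogeneous_basis by blast
 have n12: "int k1 \<le> b" "int k2 \<le> b" using free_exponents[OF st c] ab by auto
 have bad: False if th: "th \<in> D f (int n)" "int n \<le> b" "E (dot th (grad q)) ~= 0" for th n
 proof -
  have "degree R \<le> degree (E (dot th (grad q)))" by (rule dvd_imp_degree_le[OF R_dvd[OF th(1)] th(3)])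
  moreover have "homogeneous (int (n + 1)) (dot th (grad q))"
   unfolding of_nat_add by (rule homogeneous_dot) (use th(1) homogeneous_grad[of 2 q] q_homogeneous in "simp_all add: D_def der_vecs_iff")
  hence "degree (E (dot th (grad q))) \<le> 2 * (n + 1)" by (rule degree_E(1))
  ultimately have "int (degree R) \<le> 2 * int n + 2" by simp
  moreover have "int (degree R) + int (degree K) = 2 * int d" using degree_R by simp
  ultimately show False using degree_K k th(2) ab_sum by simp
 qed
 hence z: "E (dot s (grad q)) = 0" "E (dot t (grad q)) = 0" using st n12 by blast+
 obtain j where j: "j < 3" "E (dot (kosz j) (grad q)) ~= 0" using not_all_tangent by blast
 obtain u v where uv: "\<And>i. i < 3 ==> kosz j i = u * s i + v * t i"
  using saito_span(1)[OF _ _ c kosz_log[OF j(1)]] st unfolding D_def by blast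
 have "dot (kosz j) (grad q) = u * dot s (grad q) + v * dot t (grad q)"
  unfolding dot_def using uv[of 0] uv[of 1] uv[of 2] by (simp add: algebra_simps)
 hence "E (dot (kosz j) (grad q)) = 0" using z by (simp add: E.hom_add E.hom_mult)
 thus False using j(2) by simp
qed

end

section \<open>Application to admissible pairs\<close>

theorem admissible_conic_chern:
 assumes "admissible f q a b"
 shows "\<exists>p0 p1 e n0 n1 n2 d. conic_chern q p0 p1 e n0 n1 n2 f d a b"
proof -
 have ad: "reduced_curve f" "0 < a" "a \<le> b" "curve_chern_poly f ([:-1, a:] * [:-1, b:])" "smooth_conic q" "q \<notin> Irr f"
  using assms by (simp_all add: admissible_def)
 obtain d where d: "homogeneous (int d) f" "f ~= 0" using ad(1) by (rule reduced_curveE)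
 obtain p0 p1 e n0 n1 n2 where c: "conic q p0 p1 e n0 n1 n2" "eval_vec f p0 ~= 0" "\<not> q dvd f"
  using conic_through_general_point[OF ad(5) d ad(6)] by blast
 have "conic_chern q p0 p1 e n0 n1 n2 f d a b"
  by (intro conic_chern.intro conic_curve.intro conic_curve_axioms.intro conic_chern_axioms.intro) (use ad d c in simp_all)
 thus ?thesis by blast
qed

lemma main_even:
 assumes ad: "admissible f q a b" and k: "k_number f q = 2 * m"
 shows "(m \<le> a \<or> m \<ge> b) \<and> (m = a \<or> m = b \<longrightarrow> free_with_exponents f a b) \<and> (m < a \<longrightarrow> \<not> free_curve f)"
proof -
 obtain p0 p1 e n0 n1 n2 d where "conic_chern q p0 p1 e n0 n1 n2 f d a b" using admissible_conic_chern[OF ad] by blast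
 then interpret conic_chern q p0 p1 e n0 n1 n2 f d a b .
 have "\<bar>b - a\<bar> \<le> \<bar>2 * m - (a + b)\<bar>" unfolding abs_le_square_iff using conic_case(1) by (simp add: k)
 thus ?thesis using conic_case(2) not_free ab by (auto simp: k)
qed

lemma main_odd:
 assumes ad: "admissible f q a b" and k: "k_number f q = 2 * m + 1"
 shows "(m \<le> a \<or> m \<ge> b) \<and> (m = a \<longrightarrow> m = b \<and> free_with_exponents f a a) \<and>
  (m = b \<longrightarrow> free_with_exponents f a b) \<and> (m < a \<longrightarrow> \<not> free_curve f)"
proof -
 obtain p0 p1 e n0 n1 n2 d where "conic_chern q p0 p1 e n0 n1 n2 f d a b" using admissible_conic_chern[OF ad] by blast
 then interpret conic_chern q p0 p1 e n0 n1 n2 f d a b .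
 \<comment> \<open>The inequality is strict by the extra 1 for odd k; this also excludes m = a
   unless a = b.\<close>
 have "\<not> \<bar>2 * m + 1 - (a + b)\<bar> \<le> \<bar>b - a\<bar>" unfolding abs_le_square_iff using conic_case(1) by (simp add: k)
 hence "m < a \<or> m \<ge> b" by auto
 thus ?thesis using conic_case(2) not_free ab by (auto simp: k)
qed

section \<open>Examples\<close>

context conic_curve
begin

lemma order_simple_root:
 fixes p :: "complex poly"
 assumes "poly p t = 0" "poly (pderiv p) t ~= 0"
 shows "order t p = 1"
proof -
 have p: "pderiv p ~= 0" "p ~= 0" using assms by auto
 hence "order t p ~= 0" using assms(1) by (simp add: order_root)
 moreover have "order t (pderiv p) = 0" using assms(2) by (rule order_0I)
 ultimately show ?thesis using order_pderiv[OF p(2) assms(1)] by simp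
qed

text \<open>At a transversal point i = 1 forces r = 0, so each of the 2 d points contributes
  1.\<close>

lemma k_number_transversal:
 assumes "\<And>t. poly (E f) t = 0 ==> poly (pderiv (E f)) t ~= 0"
 shows "k_number f q = 2 * int d"
proof -
 have "rn t = 0" if "t \<in> roots" for t
  using rn[OF that] order_simple_root[of "E f" t] assms that by (simp add: local_number_def roots_def)
 thus ?thesis unfolding k_number_eq by simp
qed

text \<open>A simple tangency at a smooth point of the curve has i = 2 and r = 1, so exactly one
  unit of the intersection number 2 d is lost.\<close>

lemma k_number_tangent:
 assumes t: "poly (E f) t = 0" "poly (pderiv (E f)) t = 0" "poly (pderiv (pderiv (E f))) t ~= 0"
  and g: "i < 3" "eval_vec (grad f i) (pt t) ~= 0"
  and s: "\<And>s. poly (E f) s = 0 ==> s ~= t ==> poly (pderiv (E f)) s ~= 0"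
 shows "k_number f q = 2 * int d - 1"
proof -
 have tr: "t \<in> roots" using t(1) by (simp add: roots_def)
 have p: "pderiv (E f) ~= 0" using t(3) by auto
 have "order t (E f) ~= 0" using t(1) Ef(1) by (simp add: order_root)
 hence o: "order t (E f) = 2" using order_pderiv[OF Ef(1) t(1)] order_simple_root[OF t(2,3)] by simp
 hence "rn t = 1" using rn[OF tr] g by (auto simp: local_number_def)
 moreover have "rn s = 0" if "s \<in> roots - {t}" for s
  using rn[of s] order_simple_root[of "E f" s] s[of s] that by (simp add: local_number_def roots_def)
 hence "(\<Sum>s\<in>roots. int (rn s)) = (\<Sum>s\<in>{t}. int (rn s))" using finite_roots tr by (intro sum.mono_neutral_right) auto
 ultimately show ?thesis unfolding k_number_eq by simp
qed

end

definition vec3f :: "'a => 'a => 'a => nat => 'a" where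
 "vec3f x y z i = (if i = 0 then x else if i = 1 then y else z)"

lemma vec3f_simps: "vec3f x y z 0 = x" "vec3f x y z (Suc 0) = y" "vec3f x y z 1 = y" "vec3f x y z 2 = z"
 by (simp_all add: vec3f_def)

text \<open>The normal form itself, with parametrisation (t^2, 1, t).\<close>

definition conic0 :: poly3 where "conic0 = zz * zz - xx * yy"

abbreviation "e0 \<equiv> vec3f 1 0 (0 :: complex)"
abbreviation "e1 \<equiv> vec3f 0 1 (0 :: complex)"
abbreviation "e2 \<equiv> vec3f 0 0 (1 :: complex)"

lemma conic0: "conic conic0 e0 e1 e2 e0 e1 e2" "smooth_conic conic0"
proof -
 have h: "homogeneous 2 conic0"
  unfolding conic0_def using homogeneous_mult[OF homogeneous_gens(4,4)] homogeneous_mult[OF homogeneous_gens(2,3)] by (intro homogeneous_diff) simp_all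
 have ev: "eval3 conic0 x y z = z * z - x * y" for x y z unfolding conic0_def eval3_simps ..
 show "conic conic0 e0 e1 e2 e0 e1 e2"
  by unfold_locales (auto simp: h ev dot_def vec3f_simps lt_3 power2_eq_square)
 have "dx conic0 = - yy" "dy conic0 = - xx" "dz conic0 = zz + zz"
  unfolding conic0_def is_derivD(2,6)[OF is_deriv_d(1)] is_derivD(2,6)[OF is_deriv_d(2)] is_derivD(2,6)[OF is_deriv_d(3)] d_gens
  by simp_all
 hence "eval3 (dx conic0) x y z = - y" "eval3 (dy conic0) x y z = - x" "eval3 (dz conic0) x y z = z + z" for x y z
  by (simp_all only: eval3_simps)
 moreover have "conic0 ~= 0" using ev[of 0 0 1] by (auto simp: eval3_simps)
 ultimately show "smooth_conic conic0" using h by (auto simp: smooth_conic_def)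
qed

lemma conic0_chern:
 assumes f: "reduced_curve f" "homogeneous (int d) f" "eval3 f 1 0 0 ~= 0"
  and c: "curve_chern_poly f ([:- 1, a:] * [:- 1, b:])" "0 < a" "a \<le> b"
 shows "conic_chern conic0 e0 e1 e2 e0 e1 e2 f d a b" "admissible f conic0 a b"
proof -
 interpret conic conic0 e0 e1 e2 e0 e1 e2 by (rule conic0)
 have "eval3 conic0 1 0 0 = 0" unfolding conic0_def eval3_simps by simp
 hence nd: "\<not> conic0 dvd f" using f(3) by (auto simp: eval3_simps)
 show "conic_chern conic0 e0 e1 e2 e0 e1 e2 f d a b"
  by (intro conic_chern.intro conic_curve.intro conic_curve_axioms.intro conic_chern_axioms.intro) (use conic0 f c nd in "simp_all add: vec3f_simps")
 show "admissible f conic0 a b" using conic0 f c nd by (simp add: admissible_def Irr_def)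
qed

lemma squarefreeI:
 fixes f :: poly3
 assumes "f ~= 0" and p: "\<And>p. irreducible p ==> p dvd f ==> p dvd dx f ==> p dvd dy f ==> p dvd dz f ==> False"
 shows "squarefree f"
 unfolding squarefree_def
proof (intro allI impI)
 fix x :: poly3 assume x: "x ^ 2 dvd f"
 show "x dvd 1"
 proof (rule ccontr)
  assume nu: "\<not> x dvd 1"
  have "x ~= 0" using x assms(1) by auto
  then obtain p where "prime p" "p dvd x" using prime_divisor_exists nu by blast
  hence irr: "irreducible p" by (auto intro: prime_elem_imp_irreducible)
  have "p ^ 2 dvd f" using \<open>p dvd x\<close> x dvd_power_same dvd_trans by blast
  then obtain h where "f = p ^ 2 * h" by (rule dvdE)
  hence h: "f = p * (p * h)" by (simp add: power2_eq_square)
  have "p dvd D f" if "is_deriv D" for D unfolding h is_derivD(2)[OF that] by simp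
  thus False using p[OF irr] h is_deriv_d by (metis dvd_triv_left)
 qed
qed

lemma derivation_D:
 assumes "homogeneous n x" "homogeneous n y" "homogeneous n z" "x * dx f + y * dy f + z * dz f = 0"
 shows "(\<lambda>i. if i < 3 then vec3f x y z i else 0) \<in> D f n"
 using assms by (auto simp: D_def der_vecs_iff vec3f_def dot_def grad_def)

subsection \<open>A family of quintics\<close>

lemma homogeneous_mult': "homogeneous n F ==> homogeneous m G ==> l = n + m ==> homogeneous l (F * G)"
 using homogeneous_mult by blast

lemma homogeneous_power: "homogeneous n F ==> l = int k * n ==> homogeneous l (F ^ k)"
proof (induction k arbitrary: l)
 case (Suc k)
 show ?case unfolding power_Suc by (rule homogeneous_mult'[OF Suc.prems(1) Suc.IH[OF Suc.prems(1) refl]]) (simp add: Suc.prems algebra_simps)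
qed (use homogeneous_gens(1)[of 1] in "simp add: one_pCons")

lemma homogeneous_numeral: "homogeneous 0 (numeral w)"
 using homogeneous_gens(1)[of "numeral w"] by (simp add: numeral_poly)

lemmas homogeneous_intros = homogeneous_gens homogeneous_numeral homogeneous_add homogeneous_minus[THEN iffD2] homogeneous_mult' homogeneous_power

lemma cc_simps: "cc (c * c') = cc c * cc c'" "cc (numeral w) = numeral w"
 by (simp_all add: numeral_poly)

lemma dvd_cc_mult: "c ~= 0 ==> p dvd cc c * F ==> p dvd F"
 using dvd_mult[of p "cc c * F" "cc (inverse c)"] unfolding mult.assoc[symmetric] cc_simps(1)[symmetric] by (simp flip: one_pCons)

lemma is_deriv_quintic:
 fixes k g a x y z :: poly3
 assumes "is_deriv dd" "dd k = 0" "dd g = 0" "dd a = 0"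
 shows "dd (k * x ^ 5 + g * (x\<^sup>2 * y ^ 3) + y ^ 4 * (a * y + z)) =
  x * (5 * k * x ^ 3 + 2 * g * y ^ 3) * dd x + y\<^sup>2 * (3 * g * x\<^sup>2 + y * (5 * a * y + 4 * z)) * dd y + y ^ 4 * dd z"
 by (simp add: eval_nat_numeral is_derivD(1,2)[OF assms(1)] assms(2-)) Groebner_Basis.algebra

text \<open>On the conic \<open>F\<close> becomes ka t^10 + gm t^4 + t + al, sparse enough to
  control its multiple roots. The condition on \<open>ka\<close> keeps the point (1, 0, 0) at
  infinity off the curve.\<close>

locale quintic =
 fixes ka gm al :: complex
 assumes ka: "ka ~= 0"
begin

definition F :: poly3 where "F = cc ka * xx ^ 5 + cc gm * (xx\<^sup>2 * yy ^ 3) + yy ^ 4 * (cc al * yy + zz)"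
definition M :: poly3 where "M = cc (5 * al) * yy + cc 4 * zz"

lemma F_d: "dx F = xx * (cc (5 * ka) * xx ^ 3 + cc (2 * gm) * yy ^ 3)" "dy F = yy\<^sup>2 * (cc (3 * gm) * xx\<^sup>2 + yy * M)" "dz F = yy ^ 4"
 unfolding F_def M_def is_deriv_quintic[OF is_deriv_d(1) d_gens(1,1,1)] is_deriv_quintic[OF is_deriv_d(2) d_gens(5,5,5)] is_deriv_quintic[OF is_deriv_d(3) d_gens(9,9,9)] d_gens cc_simps
 by simp_all

lemma F_homogeneous: "homogeneous (int 5) F"
 unfolding F_def by (rule homogeneous_intros refl | simp)+

lemma F_eval: "eval3 F x y z = ka * x ^ 5 + gm * (x\<^sup>2 * y ^ 3) + y ^ 4 * (al * y + z)"
 unfolding F_def eval3_simps ..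

lemma F_reduced: "reduced_curve F"
proof -
 have "squarefree F"
 proof (rule squarefreeI)
  show "F ~= 0" using F_eval[of 1 0 0] ka by (auto simp: eval3_simps)
  fix p assume p: "irreducible p" "p dvd dx F" "p dvd dz F"
  hence y: "p dvd yy" unfolding F_d by (metis prime_elem_dvd_power irreducible_prime_elem)
  hence "p dvd cc (2 * gm) * yy ^ 3" by (simp only: dvd_mult power3_eq_cube)
  hence "p dvd xx \<or> p dvd cc (5 * ka) * xx ^ 3"
   using prime_dvd_mult3[OF p(1)] p(2) unfolding F_d by (meson dvd_add_left_iff)
  hence "p dvd xx" using dvd_cc_mult[of "5 * ka" p "xx ^ 3"] ka prime_elem_dvd_power[OF irreducible_prime_elem[OF p(1)]] by auto
  hence "xx dvd yy" using y p(1) irreducibleD'[OF irreducible_gens(1)] by (meson dvd_trans irreducible_not_unit)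
  thus False using gens_not_dvd by blast
 qed
 thus ?thesis unfolding reduced_curve_def using F_homogeneous by (intro conjI exI[of _ 5]) simp_all
qed

sublocale plane_curve F 5
 by unfold_locales (rule F_reduced F_homogeneous)+

lemma F_free:
 assumes "gm ~= 0"
 shows "free_with_exponents F 2 2"
proof -
 define x y g k m where v: "x = xx" "y = yy" "g = cc gm" "k = cc ka" "m = M"
 \<comment> \<open>The field \<open>t\<close> below comes from the common factor y^2 of
   \<open>dy F\<close> and \<open>dz F\<close>. The field \<open>s\<close> completes it: the cross
   product is 9 gm^2 times the gradient, a constant that is nonzero exactly for gm \<noteq>
   0.\<close>
 define s where "s = (\<lambda>i. if i < 3 then vec3f (9 * g\<^sup>2 * y\<^sup>2) (5 * k * (y * m) - 15 * k * g * x\<^sup>2) (- (18 * g ^ 3 * (x * y) + 5 * k * m\<^sup>2)) i else 0)"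
 define t where "t = (\<lambda>i. if i < 3 then vec3f 0 (y\<^sup>2) (- (3 * g * x\<^sup>2 + y * m)) i else 0)"
 have h: "homogeneous 1 x" "homogeneous 1 y" "homogeneous 0 g" "homogeneous 0 k" "homogeneous 1 m"
  unfolding v M_def by (rule homogeneous_intros refl | simp)+
 have d: "dx F = x * (5 * k * x ^ 3 + 2 * g * y ^ 3)" "dy F = y\<^sup>2 * (3 * g * x\<^sup>2 + y * m)" "dz F = y ^ 4"
  unfolding F_d v cc_simps by simp_all
 show ?thesis
 proof (rule saito_free)
  show "s \<in> D F 2" unfolding s_def
   by (rule derivation_D) ((rule h homogeneous_intros homogeneous_diff refl | simp)+, unfold d, Groebner_Basis.algebra)
  show "t \<in> D F 2" unfolding t_def
   by (rule derivation_D) ((rule h homogeneous_intros homogeneous_diff refl | simp)+, unfold d, Groebner_Basis.algebra)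
  have c: "cc (9 * gm\<^sup>2) = 9 * g\<^sup>2" unfolding v power2_eq_square cc_simps by simp
  show "\<forall>i<3. cross s t i = cc (9 * gm\<^sup>2) * grad F i"
   unfolding c all_lt_3 cross_simps s_def t_def grad_def by (simp add: vec3f_def d) (intro conjI; Groebner_Basis.algebra)
 qed (use assms in simp)
qed

text \<open>y and \<open>M\<close> span the linear forms in y and z, so y, \<open>M\<close> and x^4
  form a regular sequence; these consequences give the exactness of the resolution below.\<close>

lemma relations:
 defines "y \<equiv> yy" and "z \<equiv> M" and "w \<equiv> cc (5 * ka) * xx ^ 4"
 shows "w * A + z * G + y * H = 0 ==> \<exists>p r. A = y * p + z * r" "y dvd z * A ==> y dvd A" "y ^ 3 dvd w * A ==> y ^ 3 dvd A"
proof -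
 show "y dvd A" if "y dvd z * A" for A
 proof -
  have "z * A = y * (cc (5 * al) * A) + cc 4 * (zz * A)" unfolding z_def M_def y_def by simp
  hence "y dvd cc 4 * (zz * A)" using that dvd_add_right_iff[of y "y * (cc (5 * al) * A)" "cc 4 * (zz * A)"] by (simp only: dvd_triv_left)
  hence "y dvd zz * A" by (rule dvd_cc_mult[rotated]) simp
  thus ?thesis using prime_dvd_mult3[OF irreducible_gens(2)] gens_not_dvd(3) unfolding y_def by blast
 qed
 show "y ^ 3 dvd A" if "y ^ 3 dvd w * A" for A
 proof -
  have d: "y ^ 3 dvd xx ^ 4 * A" using that unfolding w_def mult.assoc by (rule dvd_cc_mult[rotated]) (simp add: ka)
  have "prime_elem y" unfolding y_def by (rule irreducible_prime_elem[OF irreducible_gens(2)])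
  hence "coprime y xx" using prime_elem_imp_coprime[of y xx] gens_not_dvd(4) unfolding y_def by blast
  hence "coprime (y ^ 3) (xx ^ 4)" by (simp only: coprime_power_left_iff coprime_power_right_iff) simp
  thus ?thesis using d by (simp only: coprime_dvd_mult_right_iff)
 qed
 show "\<exists>p r. A = y * p + z * r" if e: "w * A + z * G + y * H = 0" for A G H
 proof -
  obtain A0 A1 where A: "A = pCons A0 A1" by (cases A)
  obtain k A2 where A0: "A0 = pCons k A2" by (cases A0)
  have dec: "A = [:[:k:]:] + (yy * [:A2:] + zz * A1)" by (simp add: A A0)
  have ind: "eval3 [:[:k:]:] a b c = eval3 [:[:k:]:] a 0 0" for a b c
   by (cases "k = 0") (simp_all add: subst3_def map_poly_pCons)
  have "eval3 [:[:k:]:] a b c = 0" if "a ~= 0" for a b c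
  proof -
   have "eval3 (w * A + z * G + y * H) a 0 0 = 0" unfolding e by (simp only: eval3_simps)
   hence "eval3 A a 0 0 = 0" using that ka unfolding w_def y_def z_def M_def eval3_simps by simp
   hence "eval3 [:[:k:]:] a 0 0 = 0" unfolding dec eval3_simps by simp
   thus ?thesis using ind[of a b c] by simp
  qed
  hence "[:[:k:]:] = 0" by (intro eval3_zero)
  moreover have "zz = yy * cc (- (5 / 4) * al) + M * cc (1 / 4)" unfolding M_def by (simp add: one_pCons)
  ultimately have "A = y * ([:A2:] + cc (- (5 / 4) * al) * A1) + z * (cc (1 / 4) * A1)" using dec unfolding y_def z_def by (simp only: algebra_simps) simp
  thus ?thesis by blast
 qed
qed

end

lemma sum_upt_3: "(\<Sum>i = 0..<3. g i) = g 0 + g 1 + g (2 :: nat)" for g :: "nat => 'a::comm_monoid_add"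
 by (simp add: eval_nat_numeral)

context quintic
begin

text \<open>For gm = 0 the gradient is (w, y^3 M, y^4), where w is a multiple of x^4. The module has
  the resolution 0 -> S(-5) -> S(-1) + S(-4)^2 -> D0 -> 0, and (1 - t)(1 - 4 t)^2 = (1 - 5 t)(1 - 2
  t)^2 modulo t^3. So the Chern polynomial factors as it does for exponents (2, 2).\<close>

lemma F_chern:
 assumes gm: "gm = 0"
 shows "curve_chern_poly F ([:- 1, 2:] * [:- 1, 2:])"
proof -
 define y z w where yzw: "y = yy" "z = M" "w = cc (5 * ka) * xx ^ 4"
 note rel = relations[folded yzw]
 have y0: "y ~= 0" using yzw by auto
 have hom: "homogeneous 1 y" "homogeneous 1 z" "homogeneous 4 w" "homogeneous 4 (y ^ 4)" "homogeneous 4 (y ^ 3 * z)"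
  unfolding yzw M_def by (rule homogeneous_intros refl | simp)+
 have c0: "cc (2 * gm) = 0" "cc (3 * gm) = 0" by (simp_all add: gm)
 have "dx F = w" "dy F = y ^ 3 * z" "dz F = y ^ 4" unfolding F_d yzw c0 by (Groebner_Basis.algebra, Groebner_Basis.algebra, rule refl)
 hence grad: "grad F 0 = w" "grad F 1 = y ^ 3 * z" "grad F 2 = y ^ 4" by (simp_all add: grad_def)
 define B where "B = mat 3 3 (\<lambda>(i, j). vec3f (vec3f 0 (y ^ 4) (y ^ 3 * z)) (vec3f y 0 (- w)) (vec3f (- z) (- w) 0) i j)"
 define C where "C = mat 3 1 (\<lambda>(i, j :: nat). vec3f (- w) z (- y) i)"
 have Bv: "vec_index (B *\<^sub>v v) 0 = y ^ 4 * vec_index v 1 + y ^ 3 * z * vec_index v 2"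
  "vec_index (B *\<^sub>v v) 1 = y * vec_index v 0 - w * vec_index v 2"
  "vec_index (B *\<^sub>v v) 2 = - z * vec_index v 0 - w * vec_index v 1" if "v \<in> carrier_vec 3" for v
  using that by (simp_all add: B_def scalar_prod_def sum_upt_3 vec3f_def)
 have Cv: "vec_index (C *\<^sub>v v) 0 = - w * vec_index v 0" "vec_index (C *\<^sub>v v) 1 = z * vec_index v 0" "vec_index (C *\<^sub>v v) 2 = - y * vec_index v 0"
  if "v \<in> carrier_vec 1" for v
  using that by (simp_all add: C_def scalar_prod_def vec3f_def)
 have car: "B *\<^sub>v v \<in> carrier_vec 3" "C *\<^sub>v v \<in> carrier_vec 3" for v by (rule carrier_vecI; simp add: B_def C_def)+
 have veq: "v = v'" if "v \<in> carrier_vec 3" "v' \<in> carrier_vec 3" "vec_index v 0 = vec_index v' 0" "vec_index v 1 = vec_index v' 1" "vec_index v 2 = vec_index v' 2"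
  for v v' :: "poly3 vec"
  by (rule eq_vecI) (use that in "auto simp: lt_3")
 have gB: "graded_map [1, 4, 4] [0, 0, 0] B"
  using hom by (auto simp: B_def vec3f_def graded_map_def)
 have gC: "graded_map [5] [1, 4, 4] C"
  using hom by (auto simp: C_def vec3f_def graded_map_def)
 have kerC: "{v \<in> carrier_vec 1. C *\<^sub>v v = 0\<^sub>v 3} = {0\<^sub>v 1}"
 proof (intro subset_antisym subsetI)
  fix v assume "v \<in> {v \<in> carrier_vec 1. C *\<^sub>v v = 0\<^sub>v 3}"
  hence v: "v \<in> carrier_vec 1" "C *\<^sub>v v = 0\<^sub>v 3" by auto
  have "- y * vec_index v 0 = 0" using Cv(3)[OF v(1)] unfolding v(2) by simp
  hence "vec_index v 0 = 0" using y0 by simp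
  thus "v \<in> {0\<^sub>v 1}" using v(1) by auto
 next
  fix v :: "poly3 vec" assume "v \<in> {0\<^sub>v 1}"
  thus "v \<in> {v \<in> carrier_vec 1. C *\<^sub>v v = 0\<^sub>v 3}" using car(2)[of v] Cv[of v] by (auto intro!: veq)
 qed
 have kerB: "{v \<in> carrier_vec 3. B *\<^sub>v v = 0\<^sub>v 3} = (\<lambda>v. C *\<^sub>v v) ` carrier_vec 1"
 proof (intro subset_antisym subsetI)
  fix v assume "v \<in> {v \<in> carrier_vec 3. B *\<^sub>v v = 0\<^sub>v 3}"
  hence v: "v \<in> carrier_vec 3" "B *\<^sub>v v = 0\<^sub>v 3" by auto
  have e: "y ^ 4 * vec_index v 1 + y ^ 3 * z * vec_index v 2 = 0" "y * vec_index v 0 - w * vec_index v 2 = 0"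
   using Bv[OF v(1)] unfolding v(2) by simp_all
  have "y ^ 3 * (y * vec_index v 1 + z * vec_index v 2) = 0" using e(1) by (simp add: algebra_simps eval_nat_numeral)
  hence e1: "y * vec_index v 1 + z * vec_index v 2 = 0" using y0 by simp
  hence "z * vec_index v 2 = y * (- vec_index v 1)" by (simp add: eq_neg_iff_add_eq_0 add.commute)
  hence "y dvd z * vec_index v 2" by simp
  hence "y dvd vec_index v 2" by (rule rel(2))
  then obtain k' where k': "vec_index v 2 = y * k'" by (rule dvdE)
  define k where "k = - k'"
  have k: "vec_index v 2 = - y * k" by (simp add: k_def k')
  have "y * (vec_index v 1 - z * k) = 0" using e1 unfolding k by simp
  hence v1: "vec_index v 1 = z * k" using y0 by simp
  have "y * (vec_index v 0 + w * k) = 0" using e(2) unfolding k by (simp add: algebra_simps)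
  hence v0: "vec_index v 0 = - w * k" using y0 by (simp add: add_eq_0_iff)
  define u where "u = vec 1 (\<lambda>i :: nat. k)"
  have u: "u \<in> carrier_vec 1" "vec_index u 0 = k" by (simp_all add: u_def)
  have "v = C *\<^sub>v u" by (rule veq[OF v(1) car(2)]) (simp_all only: Cv[OF u(1)] u(2) v0 v1 k)
  thus "v \<in> (\<lambda>v. C *\<^sub>v v) ` carrier_vec 1" using u(1) by blast
 next
  fix v assume "v \<in> (\<lambda>v. C *\<^sub>v v) ` carrier_vec 1"
  then obtain u where u: "u \<in> carrier_vec 1" "v = C *\<^sub>v u" by blast
  have v: "v \<in> carrier_vec 3" unfolding u(2) by (rule car(2))
  have "vec_index (B *\<^sub>v v) 0 = 0" "vec_index (B *\<^sub>v v) 1 = 0" "vec_index (B *\<^sub>v v) 2 = 0"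
   unfolding Bv[OF v] unfolding u(2) Cv[OF u(1)] by (simp_all add: eval_nat_numeral)
  hence "B *\<^sub>v v = 0\<^sub>v 3" by (intro veq[OF car(1)]) simp_all
  thus "v \<in> {v \<in> carrier_vec 3. B *\<^sub>v v = 0\<^sub>v 3}" using v by simp
 qed
 have imB: "(\<lambda>v. B *\<^sub>v v) ` carrier_vec 3 = D0 F"
 proof (intro subset_antisym subsetI)
  fix th assume "th \<in> (\<lambda>v. B *\<^sub>v v) ` carrier_vec 3"
  then obtain v where v: "v \<in> carrier_vec 3" "th = B *\<^sub>v v" by blast
  have "vec_index th 0 * grad F 0 + vec_index th 1 * grad F 1 + vec_index th 2 * grad F 2 = 0"
   unfolding v(2) Bv[OF v(1)] grad by (simp add: algebra_simps eval_nat_numeral)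
  thus "th \<in> D0 F" using car(1) v(2) by (simp add: D0_def grad_def)
 next
  fix th assume th: "th \<in> D0 F"
  hence c: "th \<in> carrier_vec 3" and e: "vec_index th 0 * w + vec_index th 1 * (y ^ 3 * z) + vec_index th 2 * y ^ 4 = 0"
   using grad by (simp_all add: D0_def grad_def)
  define a b d where abd: "a = vec_index th 0" "b = vec_index th 1" "d = vec_index th 2"
  have "w * a = y ^ 3 * (- (z * b) - y * d)" using e unfolding abd[symmetric] by (simp add: eval_nat_numeral) Groebner_Basis.algebra
  hence "y ^ 3 dvd w * a" by simp
  hence "y ^ 3 dvd a" by (rule rel(3))
  then obtain u where u: "a = y ^ 3 * u" by (rule dvdE)
  have "y ^ 3 * (w * u + z * b + y * d) = 0" using e unfolding abd[symmetric] u by (simp add: eval_nat_numeral) Groebner_Basis.algebra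
  hence s: "w * u + z * b + y * d = 0" using y0 by simp
  obtain p r where pr: "u = y * p + z * r" using rel(1)[OF s] by blast
  have t: "z * (b + w * r) = y * (- (d + w * p))" using s unfolding pr by Groebner_Basis.algebra
  hence "y dvd z * (b + w * r)" by simp
  hence "y dvd b + w * r" by (rule rel(2))
  then obtain m where m: "b + w * r = y * m" by (rule dvdE)
  have "y * (d + w * p + z * m) = 0" using t unfolding m by Groebner_Basis.algebra
  hence d': "d = - z * m - w * p" using y0 by (simp add: add_eq_0_iff algebra_simps) Groebner_Basis.algebra?
  define v where "v = vec 3 (vec3f m p r)"
  have v: "v \<in> carrier_vec 3" "vec_index v 0 = m" "vec_index v 1 = p" "vec_index v 2 = r" by (simp_all add: v_def vec3f_def)
  have "th = B *\<^sub>v v"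
  proof (rule veq[OF c car(1)])
   show "vec_index th 0 = vec_index (B *\<^sub>v v) 0" unfolding Bv[OF v(1)] v abd[symmetric] u pr by (simp add: algebra_simps eval_nat_numeral)
   show "vec_index th 1 = vec_index (B *\<^sub>v v) 1" unfolding Bv[OF v(1)] v abd[symmetric] using m by (simp add: algebra_simps)
   show "vec_index th 2 = vec_index (B *\<^sub>v v) 2" unfolding Bv[OF v(1)] v abd[symmetric] d' ..
  qed
  thus "th \<in> (\<lambda>v. B *\<^sub>v v) ` carrier_vec 3" using v(1) by blast
 qed
 have l: "length [1, 4, 4 :: int] = 3" "length [0, 0, 0 :: int] = 3" "length [5 :: int] = 1" by simp_all
 have 1: "has_chern_poly [5] {v \<in> carrier_vec (length [5 :: int]). C *\<^sub>v v = 0\<^sub>v (length [1, 4, 4 :: int])} 1"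
  using has_chern_poly.zero[of "[5]"] unfolding l kerC .
 have "has_chern_poly [1, 4, 4] ((\<lambda>v. C *\<^sub>v v) ` carrier_vec (length [5 :: int])) [:1, - 5:]"
  by (rule has_chern_poly.step[OF gC 1]) simp_all
 hence 2: "has_chern_poly [1, 4, 4] {v \<in> carrier_vec (length [1, 4, 4 :: int]). B *\<^sub>v v = 0\<^sub>v (length [0, 0, 0 :: int])} [:1, - 5:]"
  unfolding l kerB .
 have "has_chern_poly [0, 0, 0] ((\<lambda>v. B *\<^sub>v v) ` carrier_vec (length [1, 4, 4 :: int])) ([:- 1, 2:] * [:- 1, 2:])"
 proof (rule has_chern_poly.step[OF gB 2])
  have "[:- 1, 2:] * [:- 1, 2:] * [:1, - 5:] - (\<Prod>e\<leftarrow>[1, 4, 4]. [:1, - e:]) = [:0, 0, 0, 1:] * [:- 4 :: int:]" by simp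
  thus "[:0, 0, 0, 1:] dvd [:- 1, 2:] * [:- 1, 2:] * [:1, - 5:] - (\<Prod>e\<leftarrow>[1, 4, 4]. [:1, - e :: int:])" by (rule dvdI)
 qed simp
 thus ?thesis unfolding l imB curve_chern_poly_def .
qed

lemma F_examples:
 shows "admissible F conic0 2 2" "free_curve F \<longleftrightarrow> gm ~= 0"
  and "(\<And>t. ka * t ^ 10 + gm * t ^ 4 + t + al = 0 ==> 10 * ka * t ^ 9 + 4 * gm * t ^ 3 + 1 ~= 0) ==> k_number F conic0 = 10"
  and "ka + gm + 1 + al = 0 ==> 10 * ka + 4 * gm + 1 = 0 ==> 90 * ka + 12 * gm ~= 0 ==>
   (\<And>t. ka * t ^ 10 + gm * t ^ 4 + t + al = 0 ==> 10 * ka * t ^ 9 + 4 * gm * t ^ 3 + 1 = 0 ==> t = 1) ==> k_number F conic0 = 9"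
proof -
 have chern: "curve_chern_poly F ([:- 1, 2:] * [:- 1, 2:])" using F_chern free_with_exponents_chern(1)[OF F_free] by blast
 have c: "conic_chern conic0 e0 e1 e2 e0 e1 e2 F 5 2 2" "admissible F conic0 2 2"
  by (rule conic0_chern[OF F_reduced F_homogeneous _ chern]; simp add: F_eval ka)+
 interpret C: conic_chern conic0 e0 e1 e2 e0 e1 e2 F 5 2 2 by (rule c)
 show "admissible F conic0 2 2" by (rule c)
 show "free_curve F \<longleftrightarrow> gm ~= 0"
 proof
  assume free: "free_curve F"
  show "gm ~= 0"
  proof
   assume gm: "gm = 0"
   obtain k1 k2 s t c where st: "s \<in> D F (int k1)" "t \<in> D F (int k2)" and c: "\<forall>i<3. cross s t i = cc c * grad F i" "c ~= 0"
    using free_curve_homogeneous_basis[OF free] by blast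
   have k: "int k1 = 2" "int k2 = 2" using C.free_exponents[OF st c] by auto
   \<comment> \<open>With exponents (2, 2) there is no nonzero derivation of degree 1, but (0, y,
     -M) is one.\<close>
   have "(\<lambda>i. if i < 3 then vec3f 0 yy (- M) i else 0) \<in> D F 1"
   proof (rule derivation_D)
    show "homogeneous 1 (- M)" unfolding M_def by (rule homogeneous_intros refl | simp)+
    show "0 * dx F + yy * dy F + - M * dz F = 0" unfolding F_d by (simp add: gm eval_nat_numeral)
   qed simp_all
   hence th: "\<forall>i<3. homogeneous 1 (vec3f 0 yy (- M) i)" "dot (vec3f 0 yy (- M)) (grad F) = 0"
    by (simp_all add: D_def der_vecs_iff dot_def)
   obtain u v where uv: "\<forall>i<3. vec3f 0 yy (- M) i = u * s i + v * t i"
    using saito_span(1)[OF _ _ c th(2)] st unfolding D_def by blast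
   have h: "homogeneous 2 (s 1)" "homogeneous 2 (t 1)" using st by (simp_all add: k D_def der_vecs_iff)
   have "hc 1 (s 1 * u) = 0" "hc 1 (t 1 * v) = 0" unfolding hc_mult[OF h(1)] hc_mult[OF h(2)] by (simp_all add: hc_def)
   moreover have "yy = u * s 1 + v * t 1" using uv[rule_format, of 1] by (simp add: vec3f_def)
   ultimately have "hc 1 yy = 0" by (simp only: hc_add mult.commute add_0_left)
   thus False by (simp add: hc_id)
  qed
 qed (use free_with_exponents_chern(2)[OF F_free] in blast)
 have "poly (C.E F) = poly [:al, 1, 0, 0, gm, 0, 0, 0, 0, 0, ka:]"
  by (rule ext) (simp add: C.poly_E F_eval C.P_def vec3f_def algebra_simps eval_nat_numeral)
 hence E: "C.E F = [:al, 1, 0, 0, gm, 0, 0, 0, 0, 0, ka:]" by (simp only: poly_eq_poly_eq_iff)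
 have p: "poly (C.E F) t = ka * t ^ 10 + gm * t ^ 4 + t + al" "poly (pderiv (C.E F)) t = 10 * ka * t ^ 9 + 4 * gm * t ^ 3 + 1"
  "poly (pderiv (pderiv (C.E F))) t = 90 * ka * t ^ 8 + 12 * gm * t\<^sup>2" for t
  unfolding E by (simp_all add: pderiv_pCons algebra_simps eval_nat_numeral)
 show "k_number F conic0 = 10" if "\<And>t. ka * t ^ 10 + gm * t ^ 4 + t + al = 0 ==> 10 * ka * t ^ 9 + 4 * gm * t ^ 3 + 1 ~= 0"
  using C.k_number_transversal that unfolding p by simp
 assume t: "ka + gm + 1 + al = 0" "10 * ka + 4 * gm + 1 = 0" "90 * ka + 12 * gm ~= 0"
  "\<And>t. ka * t ^ 10 + gm * t ^ 4 + t + al = 0 ==> 10 * ka * t ^ 9 + 4 * gm * t ^ 3 + 1 = 0 ==> t = 1"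
 have "k_number F conic0 = 2 * int 5 - 1"
  by (rule C.k_number_tangent[of 1 2]) (use t in "auto simp: p grad_def F_d eval3_simps C.P_def vec3f_simps")
 thus "k_number F conic0 = 9" by simp
qed

end

lemma even_examples:
 shows "\<exists>f q. admissible f q 2 2 \<and> k_number f q = 10 \<and> free_curve f" "\<exists>f q. admissible f q 2 2 \<and> k_number f q = 10 \<and> \<not> free_curve f"
proof -
 interpret A: quintic 1 1 0 by unfold_locales simp
 have "k_number A.F conic0 = 10"
 proof (rule A.F_examples(3), rule notI)
  fix t :: complex assume "1 * t ^ 10 + 1 * t ^ 4 + t + 0 = 0" and d: "10 * 1 * t ^ 9 + 4 * 1 * t ^ 3 + 1 = 0"
  \<comment> \<open>Elimination of the top power: with p the polynomial, this is (10 p - t p') /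
    3.\<close>
  hence "t * (2 * t ^ 3 + 3) = 0" by Groebner_Basis.algebra
  hence "2 * t ^ 3 + 3 = 0" using d by auto
  \<comment> \<open>At t^3 = -3/2 the derivative is -155/4, and clearing denominators gives
    310.\<close>
  hence "(310 :: complex) = 0" using d by Groebner_Basis.algebra
  thus False by simp
 qed
 thus "\<exists>f q. admissible f q 2 2 \<and> k_number f q = 10 \<and> free_curve f" using A.F_examples(1,2) by auto
 interpret B: quintic 1 0 0 by unfold_locales simp
 have "k_number B.F conic0 = 10"
 proof (rule B.F_examples(3), rule notI)
  fix t :: complex assume "1 * t ^ 10 + 0 * t ^ 4 + t + 0 = 0" and d: "10 * 1 * t ^ 9 + 4 * 0 * t ^ 3 + 1 = 0"
  hence "t = 0" by Groebner_Basis.algebra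
  thus False using d by simp
 qed
 thus "\<exists>f q. admissible f q 2 2 \<and> k_number f q = 10 \<and> \<not> free_curve f" using B.F_examples(1,2) by auto
qed

lemma odd_examples:
 shows "\<exists>f q. admissible f q 2 2 \<and> k_number f q = 9 \<and> free_curve f" "\<exists>f q. admissible f q 2 2 \<and> k_number f q = 9 \<and> \<not> free_curve f"
proof -
 \<comment> \<open>The constants make t = 1 a double root. With s = t^3 the derivative is -(s - 1)(2
   s + 1)^2, and a common zero with s = -1/2 would have t = 2, against t^3 = s.\<close>
 interpret A: quintic "- 2 / 5" "3 / 4" "- 27 / 20" by unfold_locales simp
 have "k_number A.F conic0 = 9"
 proof (rule A.F_examples(4))
  fix t :: complex assume p: "- 2 / 5 * t ^ 10 + 3 / 4 * t ^ 4 + t + - 27 / 20 = 0" and d: "10 * (- 2 / 5) * t ^ 9 + 4 * (3 / 4) * t ^ 3 + 1 = 0"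
  define s where "s = t ^ 3"
  have "(s - 1) * (2 * s + 1)\<^sup>2 = 0" using d by (simp add: s_def power2_eq_square algebra_simps)
  hence s: "s = 1 \<or> 2 * s = - 1" by (simp add: eq_neg_iff_add_eq_0)
  have "t * (- 8 * s ^ 3 + 15 * s + 20) = 27 + 20 * (- 2 / 5 * t ^ 10 + 3 / 4 * t ^ 4 + t + - 27 / 20)" by (simp add: s_def algebra_simps eval_nat_numeral)
  hence e: "t * (- 8 * s ^ 3 + 15 * s + 20) = 27" unfolding p by simp
  show "t = 1"
  proof (cases "s = 1")
   case False
   hence s: "2 * s = - 1" using s by simp
   hence "2 * t = 4" using e by Groebner_Basis.algebra
   thus ?thesis using s by (simp add: s_def)
  qed (use e in simp)
 qed simp_all
 thus "\<exists>f q. admissible f q 2 2 \<and> k_number f q = 9 \<and> free_curve f" using A.F_examples(1,2) by auto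
 \<comment> \<open>Here the derivative is 1 - t^9, and at its zeros the polynomial equals (9/10)(t -
   1).\<close>
 interpret B: quintic "- 1 / 10" 0 "- 9 / 10" by unfold_locales simp
 have "k_number B.F conic0 = 9"
 proof (rule B.F_examples(4))
  fix t :: complex assume p: "- 1 / 10 * t ^ 10 + 0 * t ^ 4 + t + - 9 / 10 = 0" and d: "10 * (- 1 / 10) * t ^ 9 + 4 * 0 * t ^ 3 + 1 = 0"
  have "t ^ 9 = 1" using d by simp
  moreover have "t ^ 10 = t * t ^ 9" by (simp add: eval_nat_numeral)
  ultimately show "t = 1" using p by simp
 qed simp_all
 thus "\<exists>f q. admissible f q 2 2 \<and> k_number f q = 9 \<and> \<not> free_curve f" using B.F_examples(1,2) by auto
qed

theorem theoremB2:
  shows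
    "(\<forall>f q a b m. admissible f q a b \<and> k_number f q = 2 * m \<longrightarrow>
        (m \<le> a \<or> m \<ge> b) \<and>
        (m = a \<or> m = b \<longrightarrow> free_with_exponents f a b) \<and>
        (m < a \<longrightarrow> \<not> free_curve f))
     \<and> (\<exists>f q a b m. admissible f q a b \<and> k_number f q = 2 * m \<and> m > b \<and> free_curve f)
     \<and> (\<exists>f q a b m. admissible f q a b \<and> k_number f q = 2 * m \<and> m > b \<and> \<not> free_curve f)
     \<and> (\<forall>f q a b m. admissible f q a b \<and> k_number f q = 2 * m + 1 \<longrightarrow>
        (m \<le> a \<or> m \<ge> b) \<and>
        (m = a \<longrightarrow> m = b \<and> free_with_exponents f a a) \<and>
        (m = b \<longrightarrow> free_with_exponents f a b) \<and>
        (m < a \<longrightarrow> \<not> free_curve f))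
     \<and> (\<exists>f q a b m. admissible f q a b \<and> k_number f q = 2 * m + 1 \<and> m > b \<and> free_curve f)
     \<and> (\<exists>f q a b m. admissible f q a b \<and> k_number f q = 2 * m + 1 \<and> m > b \<and> \<not> free_curve f)"
proof (intro conjI)
 show "\<forall>f q a b m. admissible f q a b \<and> k_number f q = 2 * m \<longrightarrow>
    (m \<le> a \<or> m \<ge> b) \<and> (m = a \<or> m = b \<longrightarrow> free_with_exponents f a b) \<and> (m < a \<longrightarrow> \<not> free_curve f)"
  using main_even by blast
 show "\<forall>f q a b m. admissible f q a b \<and> k_number f q = 2 * m + 1 \<longrightarrow>
    (m \<le> a \<or> m \<ge> b) \<and> (m = a \<longrightarrow> m = b \<and> free_with_exponents f a a) \<and>
    (m = b \<longrightarrow> free_with_exponents f a b) \<and> (m < a \<longrightarrow> \<not> free_curve f)"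
  using main_odd by blast
 have "\<exists>f q a b m. admissible f q a b \<and> k_number f q = 2 * m \<and> m > b \<and> P f" if ex: "\<exists>f q. admissible f q 2 2 \<and> k_number f q = 10 \<and> P f" for P
 proof -
  obtain f q where "admissible f q 2 2 \<and> k_number f q = 10 \<and> P f" using ex by blast
  hence "admissible f q 2 2 \<and> k_number f q = 2 * 5 \<and> 5 > (2 :: int) \<and> P f" by simp
  thus ?thesis by blast
 qed
 from this[OF even_examples(1)] this[OF even_examples(2)]
 show "\<exists>f q a b m. admissible f q a b \<and> k_number f q = 2 * m \<and> m > b \<and> free_curve f"
  "\<exists>f q a b m. admissible f q a b \<and> k_number f q = 2 * m \<and> m > b \<and> \<not> free_curve f" .
 have "\<exists>f q a b m. admissible f q a b \<and> k_number f q = 2 * m + 1 \<and> m > b \<and> P f" if ex: "\<exists>f q. admissible f q 2 2 \<and> k_number f q = 9 \<and> P f" for P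
 proof -
  obtain f q where "admissible f q 2 2 \<and> k_number f q = 9 \<and> P f" using ex by blast
  hence "admissible f q 2 2 \<and> k_number f q = 2 * 4 + 1 \<and> 4 > (2 :: int) \<and> P f" by simp
  thus ?thesis by blast
 qed
 from this[OF odd_examples(1)] this[OF odd_examples(2)]
 show "\<exists>f q a b m. admissible f q a b \<and> k_number f q = 2 * m + 1 \<and> m > b \<and> free_curve f"
  "\<exists>f q a b m. admissible f q a b \<and> k_number f q = 2 * m + 1 \<and> m > b \<and> \<not> free_curve f" .
qed

end
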